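(* Let $G=(V,E)$, $n=|V|$, maximum degree $\Delta$, proposal distributions $(\nu_v)_{v\in V}$ on $[q]$ and filters $f^v_{c,c'}:[q]^{N_v}\to[0,1]$ be given, let $T\ge 0$ and $Y_0\in[q]^V$. Let $(Y_t)_{t\in[0,T]}$ be the continuous-time Metropolis chain and let the main algorithm be as described in the context. Then: (1) (correctness) upon termination the main algorithm outputs a random $\widehat Y_T\in[q]^V$, each node $v$ outputting $\widehat Y_T(v)$, and $\widehat Y_T$ has the same distribution as $Y_T$; (2) (time complexity) with high probability the algorithm terminates within $O(\Delta T+\log n)$ time units; and if there is a constant $C>0$ such that $\mathbb{E}_{c'\sim\nu_v}[\delta_{u,a,b}f^v_{c,c'}]\le C/\Delta$ for every $\{u,v\}\in E$ and all $a,b,c\in[q]$, then with high probability it terminates within $O(T+\log n)$ time units, where $O(\cdot)$ hides (linearly) the constant $C$; (3) (message complexity) each message contains $O(\log n+\log\lceil T\rceil+\log q)$ bits.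
   Context: $N_v$ is the neighborhood of $v$ in $G$. For $\sigma,\tau\in[q]^{N_v}$, $\delta_{u,a,b}f^v_{c,c'}=\max|f^v_{c,c'}(\sigma)-f^v_{c,c'}(\tau)|$ over all $\sigma,\tau$ with $\sigma_u=a$, $\tau_u=b$, agreeing elsewhere. Continuous-time chain $(Y_t)$: each node carries an independent rate-1 Poisson clock; when the clock at $v$ rings at time $t$, with $c=Y_{t-\epsilon}(v)$ a proposal $c'\sim\nu_v$ is drawn and $Y_t(v)=c'$ with probability $f^v_{c,c'}(Y_t(N_v))$, else $Y_t(v)=c$. Model: fully-asynchronous message passing on network $G$ (adversarial adaptive finite delays, reliable FIFO channels; a time unit is the maximum message delay in the execution). Main algorithm at node $v$. Phase I: $v$ samples the ring times $0<t_v^1<\dots<t_v^{m_v}<T$ of a rate-1 Poisson clock on $[0,T]$ and i.i.d. proposals $c_v^1,\dots,c_v^{m_v}\sim\nu_v$, and sends $Y_0(v)$, the update times (truncated to bounded precision so that among neighbors they remain distinct and in the same relative order) and the proposals to all neighbors; once it has received this information from all neighbors it enters Phase II (messages arriving earlier from Phase-II neighbors are queued). Phase II: $v$ sets $\widehat Y_v^{(0)}=Y_0(v)$ and, for each neighbor $u$, $j_u=1$ and $\widehat Y_u^{(0)}=Y_0(u)$; then for $i=1,\dots,m_v$ it resolves update $i$ as follows. For neighbor $u$ and time $t$, the set of possible states is $\mathcal S_t(u)=\{\widehat Y_u^{(k-1)}\}$ where $t_u^{k-1}\le t<t_u^k$, if $t<t_u^{j_u}$, and $\mathcal S_t(u)=\{\widehat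 Y_u^{(j_u-1)}\}\cup\{c_u^k: t_u^{j_u}\le t_u^k\le t\}$ otherwise (with $t_u^0=0$). Let $c=\widehat Y_v^{(i-1)}$, $c'=c_v^i$, $\mathcal C=\prod_{u\in N_v}\mathcal S_{t_v^i}(u)$, $P_{AC}=\min_{\tau\in\mathcal C}f^v_{c,c'}(\tau)$, $P_{RE}=1-\max_{\tau\in\mathcal C}f^v_{c,c'}(\tau)$. Node $v$ samples $\beta$ uniform in $[0,1)$ once; as soon as $\beta<P_{AC}$ it sets $\widehat Y_v^{(i)}=c'$ and sends ``Accept'' to all neighbors; as soon as $\beta\ge 1-P_{RE}$ it sets $\widehat Y_v^{(i)}=c$ and sends ``Reject''. Whenever it processes ``Accept'' (resp. ``Reject'') from neighbor $u$, it sets $\widehat Y_u^{(j_u)}=c_u^{j_u}$ (resp. $\widehat Y_u^{(j_u-1)}$), increments $j_u$, and recomputes $P_{AC},P_{RE}$. After all $m_v$ updates, $v$ outputs $\widehat Y_T(v)=\widehat Y_v^{(m_v)}$.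
   Formalization: The bound in (3) is proved with high probability (almost surely with the number of truncation digits added), because update times truncated so that they stay distinct and in order among neighbors admit no deterministic bit bound. *)

theory Defs
  imports "HOL-Probability.Probability"
begin

section \<open>The Metropolis chain\<close>

text \<open>Vertices and spin states are natural numbers, with \<open>[q] = {1..q}\<close>, so that the constants hidden
  in the asymptotic bounds can be quantified before the network.\<close>

record metropolis =
  verts :: "nat set"
  edges :: "nat set set"
  spins :: nat
  proposal :: "nat \<Rightarrow> nat pmf"
  filt :: "nat \<Rightarrow> nat \<Rightarrow> nat \<Rightarrow> (nat \<Rightarrow> nat) \<Rightarrow> real"

definition nbrs :: "metropolis \<Rightarrow> nat \<Rightarrow> nat set" where
  "nbrs G v = {u. {u, v} \<in> edges G}"

definition colourings :: "metropolis \<Rightarrow> nat set \<Rightarrow> (nat \<Rightarrow> nat) set" where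
  "colourings G S = (S \<rightarrow>\<^sub>E {1..spins G})"

definition metropolis_system :: "metropolis \<Rightarrow> bool" where
  "metropolis_system G \<longleftrightarrow>
     finite (verts G) \<and> verts G \<noteq> {} \<and>
     (\<forall>e\<in>edges G. \<exists>u\<in>verts G. \<exists>v\<in>verts G. u \<noteq> v \<and> e = {u, v}) \<and>
     (\<forall>v\<in>verts G. set_pmf (proposal G v) \<subseteq> {1..spins G}) \<and>
     (\<forall>v\<in>verts G. \<forall>c\<in>{1..spins G}. \<forall>c'\<in>{1..spins G}. \<forall>\<sigma>\<in>colourings G (nbrs G v).
        filt G v c c' \<sigma> \<in> {0..1})"

definition max_degree :: "metropolis \<Rightarrow> nat" where
  "max_degree G = Max ((\<lambda>v. card (nbrs G v)) ` verts G)"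

text \<open>\<open>\<delta>\<^bsub>u,a,b\<^esub> f\<^sup>v\<^bsub>c,c'\<^esub>\<close>\<close>

definition filt_diff :: "metropolis \<Rightarrow> nat \<Rightarrow> nat \<Rightarrow> nat \<Rightarrow> nat \<Rightarrow> nat \<Rightarrow> nat \<Rightarrow> real" where
  "filt_diff G v u a b c c' =
     Max {\<bar>filt G v c c' \<sigma> - filt G v c c' \<tau>\<bar> | \<sigma> \<tau>.
            \<sigma> \<in> colourings G (nbrs G v) \<and> \<tau> \<in> colourings G (nbrs G v) \<and>
            \<sigma> u = a \<and> \<tau> u = b \<and> (\<forall>w\<in>nbrs G v - {u}. \<sigma> w = \<tau> w)}"

definition filter_lipschitz :: "metropolis \<Rightarrow> real \<Rightarrow> bool" where
  "filter_lipschitz G C \<longleftrightarrow>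
     (\<forall>u v. {u, v} \<in> edges G \<longrightarrow>
        (\<forall>a\<in>{1..spins G}. \<forall>b\<in>{1..spins G}. \<forall>c\<in>{1..spins G}.
           measure_pmf.expectation (proposal G v) (\<lambda>c'. filt_diff G v u a b c c')
             \<le> C / real (max_degree G)))"

text \<open>A tape holds, for node \<open>v\<close> and \<open>i \<ge> 1\<close>, the waiting time between rings \<open>i - 1\<close> and \<open>i\<close> of
  the clock at \<open>v\<close>, the proposal drawn at ring \<open>i\<close>, and a uniform coin; an event of probability \<open>p\<close> is
  realised as \<open>coin < p\<close>. The measure is completed because adversaries below are arbitrary
  functions, so that the output of the algorithm is only known to agree with a Borel function almost
  everywhere.\<close>

type_synonym tape = "nat \<times> nat \<Rightarrow> real \<times> nat \<times> real"

definition randomness :: "metropolis \<Rightarrow> tape measure" where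
  "randomness G = completion (\<Pi>\<^sub>M (v, i)\<in>verts G \<times> {1..}.
     density lborel (\<lambda>x. ennreal (exponential_density 1 x)) \<Otimes>\<^sub>M
       (measure_pmf (proposal G v) \<Otimes>\<^sub>M uniform_measure lborel {0..<1}))"

definition ring :: "tape \<Rightarrow> nat \<Rightarrow> nat \<Rightarrow> real" where
  "ring \<omega> v i = (\<Sum>k=1..i. fst (\<omega> (v, k)))"

definition ring_prop :: "tape \<Rightarrow> nat \<Rightarrow> nat \<Rightarrow> nat" where
  "ring_prop \<omega> v i = fst (snd (\<omega> (v, i)))"

definition ring_coin :: "tape \<Rightarrow> nat \<Rightarrow> nat \<Rightarrow> real" where
  "ring_coin \<omega> v i = snd (snd (\<omega> (v, i)))"

definition metropolis_update :: "metropolis \<Rightarrow> tape \<Rightarrow> nat \<times> nat \<Rightarrow> (nat \<Rightarrow> nat) \<Rightarrow> (nat \<Rightarrow> nat)" where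
  "metropolis_update G \<omega> = (\<lambda>(v, i) Y.
     if ring_coin \<omega> v i < filt G v (Y v) (ring_prop \<omega> v i) (restrict Y (nbrs G v))
     then Y(v := ring_prop \<omega> v i) else Y)"

text \<open>\<open>Y\<^sub>t\<close>. Almost surely finitely many clock rings occur up to \<open>t\<close>, at pairwise distinct times.\<close>

definition metropolis_chain :: "metropolis \<Rightarrow> (nat \<Rightarrow> nat) \<Rightarrow> real \<Rightarrow> tape \<Rightarrow> (nat \<Rightarrow> nat)" where
  "metropolis_chain G Y0 t \<omega> =
     fold (metropolis_update G \<omega>)
       (sorted_key_list_of_set (\<lambda>(v, i). ring \<omega> v i)
          {(v, i). v \<in> verts G \<and> 1 \<le> i \<and> ring \<omega> v i \<le> t})
       Y0"


section \<open>Messages\<close>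

text \<open>\<open>Update k p c\<close> announces an update at the dyadic time \<open>k / 2 ^ p\<close> with proposal \<open>c\<close>.
  \<open>EndPhaseI\<close> tells the receiver that the Phase I information of the sender is complete.\<close>

datatype message = Initial nat | Update nat nat nat | EndPhaseI | Accept | Reject

fun binary :: "nat \<Rightarrow> bool list" where
  "binary n = (if n = 0 then [] else odd n # binary (n div 2))"

declare binary.simps [simp del]

definition delimited :: "bool list \<Rightarrow> bool list" where
  "delimited bs = concat (map (\<lambda>b. [True, b]) bs) @ [False]"

fun encode :: "message \<Rightarrow> bool list" where
  "encode (Initial c) = [False, False] @ binary c"
| "encode (Update k p c) = [False, True] @ delimited (binary k) @ delimited (binary p) @ binary c"
| "encode EndPhaseI = [True]"
| "encode Accept = [True, False]"
| "encode Reject = [True, True]"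

definition bits :: "message \<Rightarrow> nat" where
  "bits m = length (encode m)"

lemma binary_inject: "binary m = binary n \<longleftrightarrow> m = n"
proof
  assume "binary m = binary n"
  then show "m = n"
  proof (induction m arbitrary: n rule: less_induct)
    case (less m)
    show ?case
    proof (cases "m = 0 \<or> n = 0")
      case True
      then show ?thesis
        using less.prems by (auto simp: binary.simps[of m] binary.simps[of n] split: if_splits)
    next
      case False
      then have *: "odd m = odd n" "binary (m div 2) = binary (n div 2)"
        using less.prems by (auto simp: binary.simps[of m] binary.simps[of n])
      from less.IH[OF _ *(2)] False have "m div 2 = n div 2" by simp
      with *(1) show ?thesis by (metis div_mod_decomp odd_iff_mod_2_eq_one even_iff_mod_2_eq_zero)
    qed
  qed
qed simp

lemma delimited_inject: "delimited xs @ as = delimited ys @ bs \<longleftrightarrow> xs = ys \<and> as = bs"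
proof
  assume "delimited xs @ as = delimited ys @ bs"
  then show "xs = ys \<and> as = bs"
  proof (induction xs arbitrary: ys)
    case Nil
    then show ?case by (cases ys) (auto simp: delimited_def)
  next
    case (Cons x xs)
    then show ?case by (cases ys) (auto simp: delimited_def)
  qed
qed simp

lemma inj_encode: "inj encode"
proof (rule injI)
  fix x y show "encode x = encode y \<Longrightarrow> x = y"
    by (cases x; cases y) (auto simp: binary_inject delimited_inject)
qed


section \<open>The main algorithm at a node\<close>

text \<open>In the state of node \<open>v\<close>, \<open>schedule u\<close> lists the pairs \<open>(t\<^sub>u\<^sup>k, c\<^sub>u\<^sup>k)\<close>, \<open>k = 1, 2, \<dots>\<close>, known so far
  and \<open>resolved u\<close> lists the resolved states of \<open>u\<close>, whose entry at position \<open>k\<close> is the state after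
  the \<open>k\<close>-th update (initial state for \<open>k = 0\<close>), both for \<open>u = v\<close> and for neighbours \<open>u\<close>. Thus \<open>j\<^sub>u = length (resolved u)\<close>, and the index \<open>i\<close> of the update being resolved by \<open>v\<close> is
  \<open>length (resolved v)\<close>. The coin of an update enters the state only when \<open>v\<close> starts resolving
  that update, so an adversary inspecting states does not see future coins.\<close>

record node =
  phaseII :: bool
  schedule :: "nat \<Rightarrow> (real \<times> nat) list"
  initial :: "nat \<Rightarrow> nat"
  informed :: "nat set"
  queued :: "(nat \<times> message) list"
  resolved :: "nat \<Rightarrow> nat list"
  coin :: real

definition update_time :: "node \<Rightarrow> nat \<Rightarrow> nat \<Rightarrow> ereal" where
  "update_time s u k =
     (if k = 0 then 0
      else if k \<le> length (schedule s u) then ereal (fst (schedule s u ! (k - 1)))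
      else \<infinity>)"

definition update_prop :: "node \<Rightarrow> nat \<Rightarrow> nat \<Rightarrow> nat" where
  "update_prop s u k = snd (schedule s u ! (k - 1))"

definition possible_states :: "node \<Rightarrow> nat \<Rightarrow> ereal \<Rightarrow> nat set" where
  "possible_states s u t =
     (let j = length (resolved s u) in
      if t < update_time s u j
      then {resolved s u ! (k - 1) | k. 1 \<le> k \<and> update_time s u (k - 1) \<le> t \<and> t < update_time s u k}
      else {resolved s u ! (j - 1)} \<union>
           {update_prop s u k | k. 1 \<le> k \<and> k \<le> length (schedule s u) \<and>
              update_time s u j \<le> update_time s u k \<and> update_time s u k \<le> t})"

definition possible_filter_values :: "metropolis \<Rightarrow> nat \<Rightarrow> node \<Rightarrow> real set" where
  "possible_filter_values G v s =
     (let i = length (resolved s v) in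
      filt G v (resolved s v ! (i - 1)) (update_prop s v i) `
        (\<Pi>\<^sub>E u\<in>nbrs G v. possible_states s u (update_time s v i)))"

definition P_AC :: "metropolis \<Rightarrow> nat \<Rightarrow> node \<Rightarrow> real" where
  "P_AC G v s = Min (possible_filter_values G v s)"

definition P_RE :: "metropolis \<Rightarrow> nat \<Rightarrow> node \<Rightarrow> real" where
  "P_RE G v s = 1 - Max (possible_filter_values G v s)"

definition record_decision :: "nat \<Rightarrow> message \<Rightarrow> node \<Rightarrow> node" where
  "record_decision u d s =
     (let j = length (resolved s u);
          y = (if d = Accept then update_prop s u j else resolved s u ! (j - 1))
      in s\<lparr>resolved := (resolved s)(u := resolved s u @ [y])\<rparr>)"

definition all_resolved :: "nat \<Rightarrow> node \<Rightarrow> bool" where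
  "all_resolved v s \<longleftrightarrow> length (schedule s v) < length (resolved s v)"

definition decision :: "metropolis \<Rightarrow> nat \<Rightarrow> node \<Rightarrow> message option" where
  "decision G v s =
     (if all_resolved v s then None
      else if coin s < P_AC G v s then Some Accept
      else if coin s \<ge> 1 - P_RE G v s then Some Reject
      else None)"

text \<open>Resolve updates as long as possible; \<open>\<beta> i\<close> is the coin of the \<open>i\<close>-th update of \<open>v\<close>. The number of
  iterations, which never exceeds the number of updates of \<open>v\<close>, is bounded by the first argument.
  Node functions return the new state and the list of messages broadcast to all neighbours.\<close>

fun resolve :: "nat \<Rightarrow> metropolis \<Rightarrow> nat \<Rightarrow> (nat \<Rightarrow> real) \<Rightarrow> node \<Rightarrow> node \<times> message list" where
  "resolve 0 G v \<beta> s = (s, [])"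
| "resolve (Suc k) G v \<beta> s =
     (case decision G v s of
        None \<Rightarrow> (s, [])
      | Some d \<Rightarrow>
          (let s' = record_decision v d s;
               (s'', ms) = resolve k G v \<beta> (s'\<lparr>coin := \<beta> (length (resolved s' v))\<rparr>)
           in (s'', d # ms)))"

definition advance :: "metropolis \<Rightarrow> nat \<Rightarrow> (nat \<Rightarrow> real) \<Rightarrow> node \<Rightarrow> node \<times> message list" where
  "advance G v \<beta> s = resolve (length (schedule s v)) G v \<beta> s"

definition process_decision ::
    "metropolis \<Rightarrow> nat \<Rightarrow> (nat \<Rightarrow> real) \<Rightarrow> nat \<Rightarrow> message \<Rightarrow> node \<Rightarrow> node \<times> message list" where
  "process_decision G v \<beta> u d s = advance G v \<beta> (record_decision u d s)"

fun process_queue ::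
    "metropolis \<Rightarrow> nat \<Rightarrow> (nat \<Rightarrow> real) \<Rightarrow> (nat \<times> message) list \<Rightarrow> node \<Rightarrow> node \<times> message list" where
  "process_queue G v \<beta> [] s = (s, [])"
| "process_queue G v \<beta> ((u, d) # ds) s =
     (let (s', ms) = process_decision G v \<beta> u d s;
          (s'', ms') = process_queue G v \<beta> ds s'
      in (s'', ms @ ms'))"

definition enter_phaseII :: "metropolis \<Rightarrow> nat \<Rightarrow> (nat \<Rightarrow> real) \<Rightarrow> node \<Rightarrow> node \<times> message list" where
  "enter_phaseII G v \<beta> s =
     (if nbrs G v \<subseteq> informed s then
        (let s0 = s\<lparr>phaseII := True, resolved := (\<lambda>u. [initial s u]), coin := \<beta> 1, queued := []\<rparr>;
             (s1, ms) = advance G v \<beta> s0;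
             (s2, ms') = process_queue G v \<beta> (queued s) s1
         in (s2, ms @ ms'))
      else (s, []))"

definition receive ::
    "metropolis \<Rightarrow> nat \<Rightarrow> (nat \<Rightarrow> real) \<Rightarrow> nat \<Rightarrow> message \<Rightarrow> node \<Rightarrow> node \<times> message list" where
  "receive G v \<beta> u m s =
     (if phaseII s then process_decision G v \<beta> u m s
      else enter_phaseII G v \<beta>
        (case m of
           Initial y \<Rightarrow> s\<lparr>initial := (initial s)(u := y)\<rparr>
         | Update k p c \<Rightarrow>
             s\<lparr>schedule := (schedule s)(u := schedule s u @ [(real k / 2 ^ p, c)])\<rparr>
         | EndPhaseI \<Rightarrow> s\<lparr>informed := insert u (informed s)\<rparr>
         | _ \<Rightarrow> s\<lparr>queued := queued s @ [(u, m)]\<rparr>))"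


section \<open>Phase I\<close>

definition num_updates :: "real \<Rightarrow> tape \<Rightarrow> nat \<Rightarrow> nat" where
  "num_updates T \<omega> v = card {i. 1 \<le> i \<and> ring \<omega> v i < T}"

definition trunc_num :: "nat \<Rightarrow> real \<Rightarrow> nat" where
  "trunc_num p t = nat \<lfloor>2 ^ p * t\<rfloor>"

text \<open>The number of binary digits to which update times are truncated: the least one for which the
  update times of any two adjacent nodes remain distinct and in the same relative order. It exists
  almost surely.\<close>

definition precision :: "metropolis \<Rightarrow> real \<Rightarrow> tape \<Rightarrow> nat" where
  "precision G T \<omega> =
     (LEAST p. \<forall>e\<in>edges G. \<forall>u\<in>e. \<forall>v\<in>e.
        \<forall>i\<in>{1..num_updates T \<omega> u}. \<forall>j\<in>{1..num_updates T \<omega> v}.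
          ring \<omega> u i < ring \<omega> v j \<longrightarrow> trunc_num p (ring \<omega> u i) < trunc_num p (ring \<omega> v j))"

definition phaseI_state :: "metropolis \<Rightarrow> real \<Rightarrow> (nat \<Rightarrow> nat) \<Rightarrow> tape \<Rightarrow> nat \<Rightarrow> node" where
  "phaseI_state G T Y0 \<omega> v =
     \<lparr>phaseII = False,
      schedule = (\<lambda>u. [])(v :=
        (let p = precision G T \<omega> in
         map (\<lambda>i. (real (trunc_num p (ring \<omega> v i)) / 2 ^ p, ring_prop \<omega> v i)) [1..<Suc (num_updates T \<omega> v)])),
      initial = (\<lambda>u. 0)(v := Y0 v),
      informed = {},
      queued = [],
      resolved = (\<lambda>u. []),
      coin = 0\<rparr>"

definition phaseI_messages :: "metropolis \<Rightarrow> real \<Rightarrow> (nat \<Rightarrow> nat) \<Rightarrow> tape \<Rightarrow> nat \<Rightarrow> message list" where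
  "phaseI_messages G T Y0 \<omega> v =
     (let p = precision G T \<omega> in
      Initial (Y0 v) #
      map (\<lambda>i. Update (trunc_num p (ring \<omega> v i)) p (ring_prop \<omega> v i)) [1..<Suc (num_updates T \<omega> v)] @
      [EndPhaseI])"

definition start :: "metropolis \<Rightarrow> real \<Rightarrow> (nat \<Rightarrow> nat) \<Rightarrow> tape \<Rightarrow> nat \<Rightarrow> node \<times> message list" where
  "start G T Y0 \<omega> v =
     (let (s, ms) = enter_phaseII G v (ring_coin \<omega> v) (phaseI_state G T Y0 \<omega> v)
      in (s, phaseI_messages G T Y0 \<omega> v @ ms))"


section \<open>Asynchronous executions\<close>

text \<open>\<open>channel u v\<close> holds the messages in transit from \<open>u\<close> to \<open>v\<close>, oldest first, with their sending
  times. Local computation takes no time and all nodes start at time 0. The log records each delivered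
  message with its delay.\<close>

record config =
  now :: real
  nodes :: "nat \<Rightarrow> node"
  channel :: "nat \<Rightarrow> nat \<Rightarrow> (real \<times> message) list"
  log :: "(real \<times> message) list"

definition initial_config :: "metropolis \<Rightarrow> real \<Rightarrow> (nat \<Rightarrow> nat) \<Rightarrow> tape \<Rightarrow> config" where
  "initial_config G T Y0 \<omega> =
     \<lparr>now = 0,
      nodes = (\<lambda>v. fst (start G T Y0 \<omega> v)),
      channel = (\<lambda>u v. if {u, v} \<in> edges G then map (Pair 0) (snd (start G T Y0 \<omega> u)) else []),
      log = []\<rparr>"

definition deliver :: "metropolis \<Rightarrow> tape \<Rightarrow> nat \<Rightarrow> nat \<Rightarrow> real \<Rightarrow> config \<Rightarrow> config" where
  "deliver G \<omega> u v t cfg =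
     (let (r, m) = hd (channel cfg u v);
          (s, ms) = receive G v (ring_coin \<omega> v) u m (nodes cfg v);
          ch = (channel cfg)(u := (channel cfg u)(v := tl (channel cfg u v)))
      in \<lparr>now = t,
          nodes = (nodes cfg)(v := s),
          channel = ch(v := (\<lambda>w. if {v, w} \<in> edges G then ch v w @ map (Pair t) ms else ch v w)),
          log = log cfg @ [(t - r, m)]\<rparr>)"

definition quiescent :: "config \<Rightarrow> bool" where
  "quiescent cfg \<longleftrightarrow> (\<forall>u v. channel cfg u v = [])"

text \<open>Given the history of configurations, latest first, an adversary chooses the channel that
  delivers its oldest message next and the time of delivery. As the algorithm sends finitely many
  messages, every message is delivered, i.e. all delays are finite.\<close>

type_synonym adversary = "config list \<Rightarrow> (nat \<times> nat) \<times> real"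

definition admissible :: "adversary \<Rightarrow> bool" where
  "admissible adv \<longleftrightarrow>
     (\<forall>h. h \<noteq> [] \<and> \<not> quiescent (hd h) \<longrightarrow>
        (case adv h of ((u, v), t) \<Rightarrow> channel (hd h) u v \<noteq> [] \<and> now (hd h) \<le> t))"

fun history ::
    "metropolis \<Rightarrow> real \<Rightarrow> (nat \<Rightarrow> nat) \<Rightarrow> adversary \<Rightarrow> tape \<Rightarrow> nat \<Rightarrow> config list" where
  "history G T Y0 adv \<omega> 0 = [initial_config G T Y0 \<omega>]"
| "history G T Y0 adv \<omega> (Suc k) =
     (let h = history G T Y0 adv \<omega> k in
      if quiescent (hd h) then h
      else case adv h of ((u, v), t) \<Rightarrow> deliver G \<omega> u v t (hd h) # h)"

definition execution ::
    "metropolis \<Rightarrow> real \<Rightarrow> (nat \<Rightarrow> nat) \<Rightarrow> adversary \<Rightarrow> tape \<Rightarrow> nat \<Rightarrow> config" where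
  "execution G T Y0 adv \<omega> k = hd (history G T Y0 adv \<omega> k)"

definition delivered ::
    "metropolis \<Rightarrow> real \<Rightarrow> (nat \<Rightarrow> nat) \<Rightarrow> adversary \<Rightarrow> tape \<Rightarrow> (real \<times> message) set" where
  "delivered G T Y0 adv \<omega> = (\<Union>k. set (log (execution G T Y0 adv \<omega> k)))"

text \<open>In an execution without messages the time unit is 0; the algorithm then terminates at time 0.\<close>

definition time_unit :: "metropolis \<Rightarrow> real \<Rightarrow> (nat \<Rightarrow> nat) \<Rightarrow> adversary \<Rightarrow> tape \<Rightarrow> real" where
  "time_unit G T Y0 adv \<omega> = Sup (insert 0 (fst ` delivered G T Y0 adv \<omega>))"

definition terminated :: "metropolis \<Rightarrow> config \<Rightarrow> bool" where
  "terminated G cfg \<longleftrightarrow> (\<forall>v\<in>verts G. phaseII (nodes cfg v) \<and> all_resolved v (nodes cfg v))"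

definition terminates ::
    "metropolis \<Rightarrow> real \<Rightarrow> (nat \<Rightarrow> nat) \<Rightarrow> adversary \<Rightarrow> tape \<Rightarrow> bool" where
  "terminates G T Y0 adv \<omega> \<longleftrightarrow> (\<exists>k. terminated G (execution G T Y0 adv \<omega> k))"

definition terminates_within ::
    "metropolis \<Rightarrow> real \<Rightarrow> (nat \<Rightarrow> nat) \<Rightarrow> adversary \<Rightarrow> tape \<Rightarrow> real \<Rightarrow> bool" where
  "terminates_within G T Y0 adv \<omega> L \<longleftrightarrow>
     (\<exists>k. terminated G (execution G T Y0 adv \<omega> k) \<and>
          now (execution G T Y0 adv \<omega> k) \<le> L * time_unit G T Y0 adv \<omega>)"

definition algorithm_output ::
    "metropolis \<Rightarrow> real \<Rightarrow> (nat \<Rightarrow> nat) \<Rightarrow> adversary \<Rightarrow> tape \<Rightarrow> (nat \<Rightarrow> nat)" where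
  "algorithm_output G T Y0 adv \<omega> =
     (let cfg = execution G T Y0 adv \<omega> (LEAST k. terminated G (execution G T Y0 adv \<omega> k))
      in restrict (\<lambda>v. last (resolved (nodes cfg v) v)) (verts G))"


section \<open>High probability\<close>

text \<open>An arbitrary adversary can make the event in question non-measurable; the bound is then on its
  inner probability.\<close>

definition with_high_prob :: "'a measure \<Rightarrow> nat \<Rightarrow> real \<Rightarrow> ('a \<Rightarrow> bool) \<Rightarrow> bool" where
  "with_high_prob M n d P \<longleftrightarrow>
     (\<exists>A\<in>sets M. measure M A \<ge> 1 - 1 / real n powr d \<and> (\<forall>\<omega>\<in>A. P \<omega>))"

end

theory Submission
  imports Defs
begin

text \<open>The algorithm and the chain run on the same clocks, proposals and coins. A node decides an update
  only when its coin gives the same outcome for all candidate states of the neighbours, the true ones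
  among them, so on every tape with distinct rings the output of the algorithm is the state of the chain,
  whatever the delays.

  Among the executions with a given time unit the synchronous one is the slowest, so the running time is
  bounded by the largest synchronous round in which an update is decided. The sum of \<open>2 ^ round\<close>
  over the past updates is a potential. When \<open>v\<close> rings, its new update is decided after round
  \<open>r\<close> only if its coin falls between the extreme filter values over the candidates left in round
  \<open>r\<close>. Learning one more outcome moves the filter by a single \<open>filt_diff\<close>, so every past
  update of a neighbour contributes \<open>O(C / \<Delta>)\<close> times its own weight to the expected new weight.
  Hence the potential grows at rate \<open>1 + 4 C\<close>, and by the renewal property of the clocks its mean is
  at most \<open>n * exp ((1 + 4 C) T)\<close>. The bound in terms of \<open>\<Delta> T\<close> is the case
  \<open>C = \<Delta>\<close>, since filters differ by at most 1.

  The same renewal argument bounds the probability of two rings at distance less than \<open>\<epsilon>\<close>,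
  which controls the precision to which the update times have to be sent.\<close>

section \<open>Superposed exponential clocks\<close>

text \<open>The weight is \<open>2 ^ round\<close> because an update decided in round r + 1 instead
  of r was waiting for outcomes of round exactly r: its weight is twice theirs. A second factor 2
  comes from the coin, which may fall near the smallest or near the largest filter value. Together
  they give the 4 in \<open>1 + 4 * C\<close>; the 1 pays for the node's own last update, whose
  round is a lower bound for the next. The Lipschitz hypothesis bounds the mean over the proposal
  for one fixed pair of states; a maximum over candidate pairs inside the mean would be out of its
  reach. Hence states and rounds of past updates are functions of the history, fixed before the new
  proposal is drawn. Adversaries are arbitrary functions, so nothing that depends on them is
  integrated. All probability concerns the history of the tape; executions are analysed tape by
  tape, on a set of full measure common to all adversaries. The tape lists waiting times node by
  node, whereas the potential evolves along the merged sequence of rings, so the renewal at the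
  first ring of any node has to be extracted from the product measure.\<close>

definition expo :: "real measure" where
  "expo = density lborel (\<lambda>x. ennreal (exponential_density 1 x))"

lemma sets_expo [measurable_cong, simp]: "sets expo = sets borel"
  by (simp add: expo_def)

lemma space_expo [simp]: "space expo = UNIV"
  by (simp add: expo_def)

lemma prob_space_expo: "prob_space expo"
  unfolding expo_def by (rule prob_space_exponential_density) simp

lemma nn_integral_expo:
  assumes [measurable]: "f \<in> borel_measurable borel"
  shows "(\<integral>\<^sup>+x. f x \<partial>expo) = (\<integral>\<^sup>+x. ennreal (exp (- x)) * indicator {0..} x * f x \<partial>lborel)"
  unfolding expo_def
  by (subst nn_integral_density)
     (auto intro!: nn_integral_cong simp: exponential_density_def indicator_def)

text \<open>Memorylessness: the substitution of \<open>x + y\<close> for \<open>y\<close> splits the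
  density into the survival probability \<open>exp (- x)\<close> and the density itself.\<close>

lemma nn_integral_expo_shift:
  assumes [measurable]: "f \<in> borel_measurable borel" and x: "0 \<le> x"
  shows "(\<integral>\<^sup>+y. indicator {x..} y * f (y - x) \<partial>expo) = ennreal (exp (- x)) * (\<integral>\<^sup>+y. f y \<partial>expo)"
proof -
  have "(\<integral>\<^sup>+y. indicator {x..} y * f (y - x) \<partial>expo) =
      (\<integral>\<^sup>+y. ennreal (exp (- y)) * indicator {0..} y * (indicator {x..} y * f (y - x)) \<partial>lborel)"
    by (rule nn_integral_expo) measurable
  also have "\<dots> = (\<integral>\<^sup>+y. ennreal (exp (- (x + y))) * indicator {0..} (x + y) * (indicator {x..} (x + y) * f y) \<partial>lborel)"
    by (subst nn_integral_real_affine[where c=1 and t=x]) auto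
  also have "\<dots> = (\<integral>\<^sup>+y. ennreal (exp (- x)) * (ennreal (exp (- y)) * indicator {0..} y * f y) \<partial>lborel)"
  proof (intro nn_integral_cong)
    fix y
    have "ennreal (exp (- (x + y))) = ennreal (exp (- x)) * ennreal (exp (- y))"
      by (simp flip: ennreal_mult exp_add)
    then show "ennreal (exp (- (x + y))) * indicator {0..} (x + y) * (indicator {x..} (x + y) * f y) =
        ennreal (exp (- x)) * (ennreal (exp (- y)) * indicator {0..} y * f y)"
      using x by (auto simp: indicator_def mult.assoc)
  qed
  also have "\<dots> = ennreal (exp (- x)) * (\<integral>\<^sup>+y. f y \<partial>expo)"
    by (subst nn_integral_cmult) (auto simp: nn_integral_expo)
  finally show ?thesis .
qed

lemma emeasure_expo_atLeast: "0 \<le> x \<Longrightarrow> emeasure expo {x..} = ennreal (exp (- x))"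
  using nn_integral_expo_shift[of "\<lambda>_. 1" x] prob_space.emeasure_space_1[OF prob_space_expo]
  by simp

lemma AE_expo_pos: "AE x in expo. 0 < x"
proof -
  have "AE x in lborel. x \<noteq> (0::real)" by (rule AE_lborel_singleton)
  then show ?thesis
    unfolding expo_def
    by (subst AE_density) (auto simp: exponential_density_def)
qed

lemma AE_expo_neq: "AE x in expo. x \<noteq> c"
proof -
  have "AE x in lborel. x \<noteq> (c::real)" by (rule AE_lborel_singleton)
  then show ?thesis
    unfolding expo_def
    by (subst AE_density) auto
qed

lemma sets_pair_expo: "sets (expo \<Otimes>\<^sub>M M) = sets (borel \<Otimes>\<^sub>M M)"
  by (rule sets_pair_measure_cong) auto

section \<open>Independent exponential clocks with marks, and renewal at the first ring of any of
  them\<close>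

locale clocks =
  fixes V :: "nat set" and N :: "nat \<Rightarrow> (nat \<times> real) measure"
  assumes finV: "finite V" and V_ne: "V \<noteq> {}" and prob_N: "\<And>v. prob_space (N v)"
begin

definition K :: "nat \<times> nat \<Rightarrow> (real \<times> nat \<times> real) measure" where
  "K = (\<lambda>(v, i). expo \<Otimes>\<^sub>M N v)"

abbreviation I :: "(nat \<times> nat) set" where "I \<equiv> V \<times> {1..}"

definition \<mu> :: "(nat \<times> nat \<Rightarrow> real \<times> nat \<times> real) measure" where
  "\<mu> = PiM I K"

lemma K_apply: "K (v, i) = expo \<Otimes>\<^sub>M N v"
  by (simp add: K_def)

lemma prob_K: "prob_space (K j)"
proof -
  obtain v i where j: "j = (v, i)" by (cases j)
  show ?thesis unfolding j K_apply by (intro prob_space_pair prob_space_expo prob_N)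
qed

sublocale P: product_prob_space K I
  by (intro_locales; (unfold product_prob_space_axioms_def product_sigma_finite_def)?)
     (auto intro: prob_K prob_space_imp_sigma_finite)

sublocale mu: prob_space \<mu>
  unfolding \<mu>_def by (rule prob_space_PiM) (rule prob_K)

lemma space_K_apply [simp]: "space (K (v, i)) = UNIV \<times> space (N v)"
  by (simp add: K_apply space_pair_measure)

definition wait :: "(nat \<times> nat \<Rightarrow> real \<times> nat \<times> real) \<Rightarrow> nat \<Rightarrow> real" where
  "wait \<omega> v = fst (\<omega> (v, 1))"

text \<open>The tape recorded from time \<open>x\<close> on if \<open>v\<close> rings at
  \<open>x\<close> and nobody rings before: \<open>v\<close> has used up its first entry, the others
  have already waited for \<open>x\<close>.\<close>

definition shift :: "real \<Rightarrow> nat \<Rightarrow> (nat \<times> nat \<Rightarrow> real \<times> nat \<times> real) \<Rightarrow> (nat \<times> nat \<Rightarrow> real \<times> nat \<times> real)" where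
  "shift x v \<omega> = (\<lambda>(u, i) \<in> I. if u = v then \<omega> (v, Suc i)
     else if i = 1 then (fst (\<omega> (u, 1)) - x, snd (\<omega> (u, 1))) else \<omega> (u, i))"

definition residual :: "nat \<Rightarrow> (nat \<times> nat \<Rightarrow> real \<times> nat \<times> real) \<Rightarrow> (nat \<times> nat \<Rightarrow> real \<times> nat \<times> real)" where
  "residual v \<omega> = shift (wait \<omega> v) v \<omega>"

lemma sets_K_shift:
  assumes A: "A \<in> sets (K (u, i))"
  shows "{z \<in> space (K (u, i)). x \<le> fst z \<and> (fst z - x, snd z) \<in> A} \<in> sets (K (u, i))"
proof -
  have [measurable]: "A \<in> sets (borel \<Otimes>\<^sub>M N u)" using A unfolding K_apply sets_pair_expo .
  show ?thesis unfolding K_apply by measurable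
qed

lemma emeasure_K_shift:
  assumes A: "A \<in> sets (K (u, i))" and x: "0 \<le> x"
  shows "emeasure (K (u, i)) {z \<in> space (K (u, i)). x \<le> fst z \<and> (fst z - x, snd z) \<in> A} =
    ennreal (exp (- x)) * emeasure (K (u, i)) A"
proof -
  interpret N: prob_space "N u" by (rule prob_N)
  have A1: "A \<in> sets (expo \<Otimes>\<^sub>M N u)" using A unfolding K_apply .
  then have [measurable]: "A \<in> sets (borel \<Otimes>\<^sub>M N u)" unfolding sets_pair_expo .
  have [measurable]: "(\<lambda>y. emeasure (N u) (Pair y -` A)) \<in> borel_measurable borel"
    using N.measurable_emeasure_Pair[OF A1]
    by (simp add: measurable_cong_sets[OF sets_expo refl])
  have *: "Pair y -` {z \<in> space (expo \<Otimes>\<^sub>M N u). x \<le> fst z \<and> (fst z - x, snd z) \<in> A} =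
      (if x \<le> y then Pair (y - x) -` A else {})" for y
  proof -
    have "A \<subseteq> space (expo \<Otimes>\<^sub>M N u)" by (rule sets.sets_into_space[OF A1])
    then show ?thesis by (auto simp: space_pair_measure)
  qed
  have S: "{z \<in> space (expo \<Otimes>\<^sub>M N u). x \<le> fst z \<and> (fst z - x, snd z) \<in> A} \<in> sets (expo \<Otimes>\<^sub>M N u)"
    using sets_K_shift[OF A] by (simp only: K_apply)
  have "emeasure (K (u, i)) {z \<in> space (K (u, i)). x \<le> fst z \<and> (fst z - x, snd z) \<in> A} =
      (\<integral>\<^sup>+y. indicator {x..} y * emeasure (N u) (Pair (y - x) -` A) \<partial>expo)"
    unfolding K_apply
    by (subst N.emeasure_pair_measure_alt[OF S]) (rule nn_integral_cong, unfold *, simp add: indicator_def)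
  also have "\<dots> = ennreal (exp (- x)) * (\<integral>\<^sup>+y. emeasure (N u) (Pair y -` A) \<partial>expo)"
    by (rule nn_integral_expo_shift[OF _ x]) measurable
  also have "\<dots> = ennreal (exp (- x)) * emeasure (K (u, i)) A"
    unfolding K_apply by (subst N.emeasure_pair_measure_alt[OF A1]) auto
  finally show ?thesis .
qed

lemma measurable_component_K [measurable]:
  "j \<in> I' \<Longrightarrow> (\<lambda>\<omega>. \<omega> j) \<in> PiM I' K \<rightarrow>\<^sub>M K j"
  by (rule measurable_component_singleton)

lemma measurable_wait_gen:
  "(u, i) \<in> I' \<Longrightarrow> (\<lambda>\<omega>. fst (\<omega> (u, i))) \<in> PiM I' K \<rightarrow>\<^sub>M borel"
  using measurable_compose[OF measurable_component_K[of "(u,i)" I'], of fst borel]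
  by (simp add: K_apply)

lemma measurable_shift_gen:
  assumes v: "v \<in> V" and I': "I' = I \<or> I' = I - {(v, 1)}"
    and [measurable]: "f \<in> M \<rightarrow>\<^sub>M borel" "g \<in> M \<rightarrow>\<^sub>M PiM I' K"
  shows "(\<lambda>z. shift (f z) v (g z)) \<in> M \<rightarrow>\<^sub>M \<mu>"
  unfolding shift_def \<mu>_def
proof (rule measurable_restrict)
  fix j assume "j \<in> I"
  then obtain u i where j: "j = (u, i)" "u \<in> V" "1 \<le> i" by auto
  have c: "(\<lambda>z. g z (u', i')) \<in> M \<rightarrow>\<^sub>M expo \<Otimes>\<^sub>M N u'" if "(u', i') \<in> I'" for u' i'
    using measurable_compose[OF assms(4) measurable_component_K[OF that]] by (simp add: K_apply)
  have 1: "(v, Suc i) \<in> I'" "u \<noteq> v \<Longrightarrow> (u, i) \<in> I'" "u \<noteq> v \<Longrightarrow> (u, 1) \<in> I'" using v j I' by auto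
  show "(\<lambda>z. (case j of (u, i) \<Rightarrow> if u = v then g z (v, Suc i)
      else if i = 1 then (fst (g z (u, 1)) - f z, snd (g z (u, 1))) else g z (u, i))) \<in> M \<rightarrow>\<^sub>M K j"
  proof (cases "u = v")
    case True then show ?thesis using c[OF 1(1)] by (simp add: j K_apply)
  next
    case False
    note c2 = c[OF 1(2)[OF False]] and c1 = c[OF 1(3)[OF False]]
    have f1: "(\<lambda>z. fst (g z (u, 1))) \<in> M \<rightarrow>\<^sub>M borel"
      using measurable_compose[OF c1 measurable_fst] unfolding measurable_cong_sets[OF refl sets_expo] .
    have "(\<lambda>z. fst (g z (u, 1)) - f z) \<in> M \<rightarrow>\<^sub>M borel"
      by (intro borel_measurable_diff f1 assms)
    then have f1': "(\<lambda>z. fst (g z (u, 1)) - f z) \<in> M \<rightarrow>\<^sub>M expo"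
      unfolding measurable_cong_sets[OF refl sets_expo] .
    show ?thesis
    proof (cases "i = 1")
      case True
      have "(\<lambda>z. (fst (g z (u, 1)) - f z, snd (g z (u, 1)))) \<in> M \<rightarrow>\<^sub>M expo \<Otimes>\<^sub>M N u"
        by (rule measurable_Pair[OF f1' measurable_compose[OF c1 measurable_snd]])
      then show ?thesis using False True by (simp add: j K_apply)
    next
      case F: False
      then show ?thesis using False c2 by (simp add: j K_apply)
    qed
  qed
qed

text \<open>Compared on cylinder sets. By memorylessness each of the other \<open>card V - 1\<close>
  nodes contributes a factor \<open>exp (- x)\<close> and then waits afresh; the entries of
  \<open>v\<close> are only renumbered. Coordinate \<open>(v, 1)\<close> is left out, to be
  integrated separately as the time \<open>x\<close>.\<close>

lemma distr_shift:
  assumes v: "v \<in> V" and x: "0 \<le> x"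
  defines "P' \<equiv> PiM (I - {(v, 1)}) K"
  shows "distr (density P' (\<lambda>\<omega>. indicator {\<omega>. \<forall>u\<in>V - {v}. x \<le> wait \<omega> u} \<omega>)) \<mu> (shift x v) =
    scale_measure (ennreal (exp (- real (card V - 1) * x))) \<mu>" (is "?L = ?R")
proof -
  let ?I' = "I - {(v, 1)}"
  have ms [measurable]: "shift x v \<in> P' \<rightarrow>\<^sub>M \<mu>"
    unfolding P'_def by (rule measurable_shift_gen[OF v, of ?I']) auto
  define S where "S = {\<omega> \<in> space P'. \<forall>u\<in>V - {v}. x \<le> wait \<omega> u}"
  have [measurable]: "S \<in> sets P'"
  proof -
    have "Measurable.pred P' (\<lambda>\<omega>. x \<le> fst (\<omega> (u, 1)))" if "u \<in> V - {v}" for u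
    proof -
      have [measurable]: "(\<lambda>\<omega>. fst (\<omega> (u, 1))) \<in> P' \<rightarrow>\<^sub>M borel"
        unfolding P'_def using that by (intro measurable_wait_gen) auto
      show ?thesis by measurable
    qed
    then have "Measurable.pred P' (\<lambda>\<omega>. \<forall>u\<in>V - {v}. x \<le> fst (\<omega> (u, 1)))"
      using finV by (intro pred_intros_finite) auto
    then show ?thesis unfolding S_def wait_def by measurable
  qed
  have dens: "density P' (\<lambda>\<omega>. indicator {\<omega>. \<forall>u\<in>V - {v}. x \<le> wait \<omega> u} \<omega>) = density P' (indicator S)"
    unfolding S_def density_def
    by (intro arg_cong3[where f=measure_of] refl ext nn_integral_cong) (auto simp: indicator_def)
  interpret P'': prob_space P' unfolding P'_def by (rule prob_space_PiM) (rule prob_K)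
  have fin: "finite_measure ?R" 
    by (rule finite_measureI) (simp add: space_scale_measure mu.emeasure_space_1 ennreal_mult_eq_top_iff)
  show ?thesis
  proof (rule measure_eqI_PiM_infinite[symmetric])
    show "finite_measure ?R" by fact
    show "sets ?R = sets (PiM I K)" "sets ?L = sets (PiM I K)" by (simp_all add: \<mu>_def)
    fix J A assume J: "finite J" "J \<subseteq> I" and A: "\<And>j. j \<in> J \<Longrightarrow> A j \<in> sets (K j)"
    \<comment> \<open>Survival constrains the first entry of every other node, so these coordinates
      join the cylinder even where \<open>A\<close> says nothing. Below, \<open>\<phi>\<close> gives
      the original coordinate from which a coordinate of the shifted tape is read, and
      \<open>\<psi>\<close> undoes it.\<close>
    define J2 where "J2 = J \<union> V \<times> {1}"
    define A2 where "A2 j = (if j \<in> J then A j else space (K j))" for j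
    define \<phi> where "\<phi> = (\<lambda>(u::nat, i::nat). if u = v then (u, Suc i) else (u, i))"
    define B where "B j = (if fst j \<noteq> v \<and> snd j = 1
       then {z \<in> space (K j). x \<le> fst z \<and> (fst z - x, snd z) \<in> A2 j} else A2 j)" for j
    define \<psi> where "\<psi> = (\<lambda>(u::nat, i::nat). if u = v then (u, i - 1) else (u, i))"
    have J2: "finite J2" "J2 \<subseteq> I" using J finV by (auto simp: J2_def)
    have \<psi>\<phi>: "\<psi> (\<phi> j) = j" for j by (auto simp: \<phi>_def \<psi>_def split: prod.splits)
    have inj: "inj_on \<phi> J2" by (metis inj_onI \<psi>\<phi>)
    have \<phi>I: "\<phi> ` J2 \<subseteq> ?I'" using J2 by (auto simp: \<phi>_def split: prod.splits if_splits)
    have A2: "A2 j \<in> sets (K j)" for j using A by (auto simp: A2_def)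
    have KB: "K (\<phi> j) = K j" for j by (auto simp: \<phi>_def K_def split: prod.splits)
    have Bs: "B j \<in> sets (K j)" for j
      using sets_K_shift[OF A2, of "fst j" "snd j" x] A2[of j] by (simp add: B_def)
    have eB: "emeasure (K j) (B j) = (if fst j \<noteq> v \<and> snd j = 1 then ennreal (exp (- x)) else 1) * emeasure (K j) (A2 j)" for j
      using emeasure_K_shift[OF A2 x, of "fst j" "snd j"] by (simp add: B_def)
    have emb: "prod_emb I K J (Pi\<^sub>E J A) = {\<omega> \<in> space \<mu>. \<forall>j\<in>J2. \<omega> j \<in> A2 j}"
    proof -
      have "\<omega> \<in> prod_emb I K J (Pi\<^sub>E J A) \<longleftrightarrow> \<omega> \<in> space \<mu> \<and> (\<forall>j\<in>J. \<omega> j \<in> A j)" for \<omega>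
        by (simp only: prod_emb_iff \<mu>_def space_PiM PiE_iff restrict_PiE_iff) auto
      moreover have "(\<forall>j\<in>J. \<omega> j \<in> A j) \<longleftrightarrow> (\<forall>j\<in>J2. \<omega> j \<in> A2 j)" if "\<omega> \<in> space \<mu>" for \<omega>
      proof -
        have "\<omega> j \<in> space (K j)" if "j \<in> I" for j
          using \<open>\<omega> \<in> space \<mu>\<close> that unfolding \<mu>_def space_PiM by blast
        then show ?thesis using J2 unfolding A2_def by (auto simp: J2_def simp del: space_K_apply)
      qed
      ultimately show ?thesis by blast
    qed
    have set: "shift x v -` prod_emb I K J (Pi\<^sub>E J A) \<inter> space P' \<inter> S =
       prod_emb ?I' K (\<phi> ` J2) (Pi\<^sub>E (\<phi> ` J2) (\<lambda>j. B (\<psi> j)))" (is "?l = ?r")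
    proof -
      have "\<omega> \<in> ?l \<longleftrightarrow> \<omega> \<in> ?r" if w: "\<omega> \<in> space P'" for \<omega>
      proof -
        have sp: "shift x v \<omega> \<in> space \<mu>" by (rule measurable_space[OF ms w])
        have comp: "\<omega> j \<in> space (K j)" if "j \<in> ?I'" for j
          using w that by (auto simp: P'_def space_PiM PiE_iff)
        have "\<omega> \<in> ?l \<longleftrightarrow> (\<forall>u\<in>V - {v}. x \<le> wait \<omega> u) \<and> (\<forall>j\<in>J2. shift x v \<omega> j \<in> A2 j)"
          unfolding emb S_def using w sp by auto
        also have "\<dots> \<longleftrightarrow> (\<forall>j\<in>J2. \<omega> (\<phi> j) \<in> B j)"
        proof (intro iffI ballI conjI)
          fix j assume H: "(\<forall>u\<in>V - {v}. x \<le> wait \<omega> u) \<and> (\<forall>j\<in>J2. shift x v \<omega> j \<in> A2 j)" and j: "j \<in> J2"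
          obtain u i where ui: "j = (u, i)" by (cases j)
          have "(u, i) \<in> I" using j J2 ui by auto
          then show "\<omega> (\<phi> j) \<in> B j" using H j comp[of "(u,i)"]
            by (cases "u = v"; cases "i = 1") (fastforce simp: ui B_def \<phi>_def shift_def wait_def)+
        next
          assume H: "\<forall>j\<in>J2. \<omega> (\<phi> j) \<in> B j"
          fix u assume "u \<in> V - {v}"
          then have "(u, 1) \<in> J2" "u \<noteq> v" by (auto simp: J2_def)
          then show "x \<le> wait \<omega> u" using H by (fastforce simp: B_def \<phi>_def wait_def)
        next
          assume H: "\<forall>j\<in>J2. \<omega> (\<phi> j) \<in> B j"
          fix j assume j: "j \<in> J2"
          obtain u i where ui: "j = (u, i)" by (cases j)
          have "(u, i) \<in> I" using j J2 ui by auto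
          then show "shift x v \<omega> j \<in> A2 j" using bspec[OF H j]
            by (cases "u = v"; cases "i = 1") (auto simp: ui B_def \<phi>_def shift_def wait_def)
        qed
        also have "\<dots> \<longleftrightarrow> \<omega> \<in> ?r"
          using w \<phi>I by (auto simp: prod_emb_def P'_def space_PiM PiE_iff \<psi>\<phi>)
        finally show ?thesis .
      qed
      moreover have "?l \<subseteq> space P'" by auto
      moreover have "?r \<subseteq> space P'" by (auto simp: prod_emb_def P'_def space_PiM)
      ultimately show ?thesis by blast
    qed
    have embs [measurable]: "prod_emb I K J (Pi\<^sub>E J A) \<in> sets \<mu>"
      unfolding \<mu>_def using J A by (intro sets_PiM_I) auto
    have "emeasure ?L (prod_emb I K J (Pi\<^sub>E J A)) =
        emeasure (density P' (indicator S)) (shift x v -` prod_emb I K J (Pi\<^sub>E J A) \<inter> space P')"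
      unfolding dens using ms embs by (subst emeasure_distr) (auto simp del: One_nat_def)
    also have "\<dots> = emeasure P' (S \<inter> (shift x v -` prod_emb I K J (Pi\<^sub>E J A) \<inter> space P'))"
      by (rule emeasure_restricted[OF _ measurable_sets[OF ms embs]]) measurable
    also have "S \<inter> (shift x v -` prod_emb I K J (Pi\<^sub>E J A) \<inter> space P') =
        shift x v -` prod_emb I K J (Pi\<^sub>E J A) \<inter> space P' \<inter> S"
      by blast
    also have "emeasure P' \<dots> = (\<Prod>j\<in>\<phi> ` J2. emeasure (K j) (B (\<psi> j)))"
      unfolding set unfolding P'_def
    proof (rule emeasure_PiM_emb)
      show "\<phi> ` J2 \<subseteq> I - {(v, 1)}" by fact
      show "B (\<psi> i) \<in> sets (K i)" if "i \<in> \<phi> ` J2" for i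
        using that Bs KB \<psi>\<phi> by (metis imageE)
    qed (use J2 prob_K in auto)
    also have "\<dots> = (\<Prod>j\<in>J2. emeasure (K j) (B j))"
      by (subst prod.reindex[OF inj]) (simp add: \<psi>\<phi> KB)
    also have "\<dots> = (\<Prod>j\<in>J2. (if fst j \<noteq> v \<and> snd j = 1 then ennreal (exp (- x)) else 1)) * (\<Prod>j\<in>J2. emeasure (K j) (A2 j))"
      by (simp add: eB prod.distrib)
    also have "(\<Prod>j\<in>J2. (if fst j \<noteq> v \<and> snd j = 1 then ennreal (exp (- x)) else 1)) = 
       (\<Prod>j\<in>(V - {v}) \<times> {1::nat}. ennreal (exp (- x)))"
      using J2 by (intro prod.mono_neutral_cong_right) (auto simp: J2_def)
    also have "\<dots> = ennreal (exp (- real (card V - 1) * x))"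
      using v finV by (simp add: card_cartesian_product ennreal_power exp_of_nat_mult[symmetric])
    also have "(\<Prod>j\<in>J2. emeasure (K j) (A2 j)) = emeasure \<mu> (prod_emb I K J (Pi\<^sub>E J A))"
      unfolding emb \<mu>_def using J2 A2 by (subst P.emeasure_PiM_Collect) auto
    finally show "emeasure ?R (prod_emb I K J (Pi\<^sub>E J A)) = emeasure ?L (prod_emb I K J (Pi\<^sub>E J A))"
      by simp
  qed
qed

lemma measurable_component_mu: "u \<in> V \<Longrightarrow> 1 \<le> i \<Longrightarrow> (\<lambda>\<omega>. \<omega> (u, i)) \<in> \<mu> \<rightarrow>\<^sub>M K (u, i)"
  unfolding \<mu>_def by (rule measurable_component_K) auto

lemma measurable_wait: "u \<in> V \<Longrightarrow> (\<lambda>\<omega>. wait \<omega> u) \<in> \<mu> \<rightarrow>\<^sub>M borel"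
  unfolding \<mu>_def wait_def by (rule measurable_wait_gen) auto

lemma measurable_shift:
  assumes v: "v \<in> V" and "f \<in> M \<rightarrow>\<^sub>M borel" "g \<in> M \<rightarrow>\<^sub>M \<mu>"
  shows "(\<lambda>z. shift (f z) v (g z)) \<in> M \<rightarrow>\<^sub>M \<mu>"
  using assms unfolding \<mu>_def[symmetric] by (intro measurable_shift_gen[where I'=I]) (auto simp: \<mu>_def)

lemma measurable_residual: "v \<in> V \<Longrightarrow> residual v \<in> \<mu> \<rightarrow>\<^sub>M \<mu>"
  unfolding residual_def by (intro measurable_shift measurable_wait) auto

lemma AE_K_pos: "AE z in K (v, i). 0 < fst z"
proof -
  interpret N: prob_space "N v" by (rule prob_N)
  interpret E: prob_space expo by (rule prob_space_expo)
  interpret pair_sigma_finite expo "N v" ..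
  have "AE x in expo. AE y in N v. 0 < fst (x, y)" using AE_expo_pos by simp
  moreover have "{z \<in> space (expo \<Otimes>\<^sub>M N v). 0 < fst z} \<in> sets (expo \<Otimes>\<^sub>M N v)" by measurable
  ultimately show ?thesis unfolding K_apply by (intro AE_pair_measure)
qed

lemma sets_min_wait:
  assumes [measurable]: "f \<in> \<mu> \<rightarrow>\<^sub>M borel"
  shows "{\<omega> \<in> space \<mu>. \<forall>u\<in>V. f \<omega> \<le> wait \<omega> u} \<in> sets \<mu>"
proof -
  have "Measurable.pred \<mu> (\<lambda>\<omega>. f \<omega> \<le> wait \<omega> u)" if "u \<in> V" for u
    unfolding pred_def by (rule borel_measurable_le[OF assms measurable_wait[OF that]])
  then have "Measurable.pred \<mu> (\<lambda>\<omega>. \<forall>u\<in>V. f \<omega> \<le> wait \<omega> u)"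
    using finV by (intro pred_intros_finite) auto
  then show ?thesis by measurable
qed

lemma measurable_H_residual:
  assumes v: "v \<in> V" and H: "(\<lambda>(z, \<omega>). H z \<omega>) \<in> K (v, 1) \<Otimes>\<^sub>M \<mu> \<rightarrow>\<^sub>M L"
  shows "(\<lambda>\<omega>. H (\<omega> (v, 1)) (residual v \<omega>)) \<in> \<mu> \<rightarrow>\<^sub>M L"
  using measurable_compose[OF measurable_Pair[OF measurable_component_mu[OF v, of 1] measurable_residual[OF v]] H]
  by simp

text \<open>The strong Markov property at the first ring: with the entry \<open>z\<close> of
  \<open>v\<close> fixed, \<open>distr_shift\<close> turns the event that \<open>v\<close> comes
  first into the exponential factor and makes the residual tape a fresh sample of
  \<open>\<mu>\<close>.\<close>

lemma nn_integral_first_ring: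
  assumes v: "v \<in> V" and H: "(\<lambda>(z, \<omega>). H z \<omega>) \<in> borel_measurable (K (v, 1) \<Otimes>\<^sub>M \<mu>)"
  shows "(\<integral>\<^sup>+\<omega>. indicator {\<omega>\<in>space \<mu>. \<forall>u\<in>V. wait \<omega> v \<le> wait \<omega> u} \<omega> * H (\<omega> (v, 1)) (residual v \<omega>) \<partial>\<mu>) =
    (\<integral>\<^sup>+z. ennreal (exp (- real (card V - 1) * fst z)) * (\<integral>\<^sup>+\<omega>. H z \<omega> \<partial>\<mu>) \<partial>K (v, 1))"
proof -
  define P' where "P' = PiM (I - {(v, 1)}) K"
  define D where "D = {\<omega>\<in>space \<mu>. \<forall>u\<in>V. wait \<omega> v \<le> wait \<omega> u}"
  interpret P': prob_space P' unfolding P'_def by (rule prob_space_PiM) (rule prob_K)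
  interpret Kv: prob_space "K (v, 1)" by (rule prob_K)
  have ins: "insert (v, 1) (I - {(v, 1)}) = I" using v by auto
  have upd: "(\<lambda>(z, X). X((v, 1) := z)) \<in> K (v, 1) \<Otimes>\<^sub>M P' \<rightarrow>\<^sub>M \<mu>"
    unfolding \<mu>_def P'_def using measurable_add_dim[of "(v,1)" "I - {(v, 1)}" K]
    unfolding ins by (subst measurable_pair_swap_iff) (auto simp: case_prod_beta' simp del: One_nat_def)
  have mu_eq: "\<mu> = distr (K (v, 1) \<Otimes>\<^sub>M P') \<mu> (\<lambda>(z, X). X((v, 1) := z))"
    using distr_pair_PiM_eq_PiM[of "I - {(v, 1)}" K "(v, 1)"] prob_K unfolding ins \<mu>_def P'_def by simp
  have D [measurable]: "D \<in> sets \<mu>" unfolding D_def by (intro sets_min_wait measurable_wait v)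
  let ?F = "\<lambda>\<omega>. indicator D \<omega> * H (\<omega> (v, 1)) (residual v \<omega>)"
  have F [measurable]: "?F \<in> borel_measurable \<mu>"
    using measurable_H_residual[OF v H] by measurable
  have "(\<integral>\<^sup>+\<omega>. ?F \<omega> \<partial>\<mu>) = (\<integral>\<^sup>+p. ?F ((\<lambda>(z, X). X((v, 1) := z)) p) \<partial>(K (v, 1) \<Otimes>\<^sub>M P'))"
  proof -
    have "(\<integral>\<^sup>+\<omega>. ?F \<omega> \<partial>distr (K (v, 1) \<Otimes>\<^sub>M P') \<mu> (\<lambda>(z, X). X((v, 1) := z))) =
        (\<integral>\<^sup>+p. ?F ((\<lambda>(z, X). X((v, 1) := z)) p) \<partial>(K (v, 1) \<Otimes>\<^sub>M P'))"
      by (rule nn_integral_distr[OF upd]) (use F in \<open>simp only: measurable_distr_eq1\<close>)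
    then show ?thesis unfolding mu_eq[symmetric] .
  qed
  also have "\<dots> = (\<integral>\<^sup>+z. \<integral>\<^sup>+X. ?F (X((v, 1) := z)) \<partial>P' \<partial>K (v, 1))"
    using measurable_compose[OF upd F] by (subst P'.nn_integral_fst[symmetric]) auto
  also have "\<dots> = (\<integral>\<^sup>+z. ennreal (exp (- real (card V - 1) * fst z)) * (\<integral>\<^sup>+\<omega>. H z \<omega> \<partial>\<mu>) \<partial>K (v, 1))"
  proof (rule nn_integral_cong_AE)
    have "(\<integral>\<^sup>+X. ?F (X((v, 1) := z)) \<partial>P') = ennreal (exp (- real (card V - 1) * fst z)) * (\<integral>\<^sup>+\<omega>. H z \<omega> \<partial>\<mu>)"
      if z: "0 < fst z" "z \<in> space (K (v, 1))" for z
    proof -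
      have Hz: "H z \<in> borel_measurable \<mu>" using measurable_compose[OF measurable_Pair1'[OF z(2)] H] by simp
      have sh: "shift (fst z) v \<in> P' \<rightarrow>\<^sub>M \<mu>"
        unfolding P'_def by (rule measurable_shift_gen[OF v, of "I - {(v, 1)}"]) auto
      define S where "S = {\<omega>. \<forall>u\<in>V - {v}. fst z \<le> wait \<omega> u}"
      have S: "S \<inter> space P' \<in> sets P'"
      proof -
        have "Measurable.pred P' (\<lambda>\<omega>. fst z \<le> fst (\<omega> (u, 1)))" if "u \<in> V - {v}" for u
        proof -
          have [measurable]: "(\<lambda>\<omega>. fst (\<omega> (u, 1))) \<in> P' \<rightarrow>\<^sub>M borel"
            unfolding P'_def using that by (intro measurable_wait_gen) auto
          show ?thesis by measurable
        qed
        then have "Measurable.pred P' (\<lambda>\<omega>. \<forall>u\<in>V - {v}. fst z \<le> fst (\<omega> (u, 1)))"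
          using finV by (intro pred_intros_finite) auto
        then have "{\<omega>\<in>space P'. \<forall>u\<in>V - {v}. fst z \<le> wait \<omega> u} \<in> sets P'" unfolding wait_def by measurable
        also have "{\<omega>\<in>space P'. \<forall>u\<in>V - {v}. fst z \<le> wait \<omega> u} = S \<inter> space P'" by (auto simp: S_def)
        finally show ?thesis .
      qed
      have "(\<integral>\<^sup>+X. ?F (X((v, 1) := z)) \<partial>P') = (\<integral>\<^sup>+X. indicator S X * H z (shift (fst z) v X) \<partial>P')"
      proof (rule nn_integral_cong)
        fix X assume X: "X \<in> space P'"
        have "X((v, 1) := z) \<in> space \<mu>"
          using measurable_space[OF upd, of "(z, X)"] X z by (simp add: space_pair_measure)
        moreover have "residual v (X((v, 1) := z)) = shift (fst z) v X"
          by (auto simp: residual_def shift_def wait_def fun_eq_iff restrict_def)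
        moreover have "(\<forall>u\<in>V. wait (X((v, 1) := z)) v \<le> wait (X((v, 1) := z)) u) \<longleftrightarrow> X \<in> S"
          by (auto simp: S_def wait_def)
        ultimately show "?F (X((v, 1) := z)) = indicator S X * H z (shift (fst z) v X)"
          by (simp add: D_def indicator_def)
      qed
      also have "\<dots> = (\<integral>\<^sup>+X. H z (shift (fst z) v X) \<partial>density P' (indicator S))"
        using S measurable_compose[OF sh Hz]
        by (subst nn_integral_density) (auto simp: borel_measurable_indicator_iff Int_commute)
      also have "\<dots> = (\<integral>\<^sup>+\<omega>. H z \<omega> \<partial>distr (density P' (indicator S)) \<mu> (shift (fst z) v))"
        using sh Hz by (subst nn_integral_distr) auto
      also have "distr (density P' (indicator S)) \<mu> (shift (fst z) v) = 
          scale_measure (ennreal (exp (- real (card V - 1) * fst z))) \<mu>"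
        using distr_shift[OF v, of "fst z"] z unfolding S_def P'_def by simp
      also have "(\<integral>\<^sup>+\<omega>. H z \<omega> \<partial>\<dots>) = ennreal (exp (- real (card V - 1) * fst z)) * (\<integral>\<^sup>+\<omega>. H z \<omega> \<partial>\<mu>)"
        using Hz by (rule nn_integral_scale_measure)
      finally show ?thesis .
    qed
    then show "AE z in K (v, 1). (\<integral>\<^sup>+X. ?F (X((v, 1) := z)) \<partial>P') =
        ennreal (exp (- real (card V - 1) * fst z)) * (\<integral>\<^sup>+\<omega>. H z \<omega> \<partial>\<mu>)"
      by (intro AE_mp[OF AE_K_pos AE_I2]) auto
  qed
  finally show ?thesis unfolding D_def .
qed

text \<open>Ties have probability 0; \<open>LEAST\<close> makes the choice total and keeps it
  measurable.\<close>

definition first :: "(nat \<times> nat \<Rightarrow> real \<times> nat \<times> real) \<Rightarrow> nat" where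
  "first \<omega> = (LEAST v. v \<in> V \<and> (\<forall>u\<in>V. wait \<omega> v \<le> wait \<omega> u))"

lemma first: "first \<omega> \<in> V" "u \<in> V \<Longrightarrow> wait \<omega> (first \<omega>) \<le> wait \<omega> u"
proof -
  have "Min (wait \<omega> ` V) \<in> wait \<omega> ` V" using finV V_ne by (intro Min_in) auto
  then obtain v where "v \<in> V" "wait \<omega> v = Min (wait \<omega> ` V)" by force
  then have "v \<in> V \<and> (\<forall>u\<in>V. wait \<omega> v \<le> wait \<omega> u)" using finV by simp
  from LeastI[of "\<lambda>v. v \<in> V \<and> (\<forall>u\<in>V. wait \<omega> v \<le> wait \<omega> u)", OF this]
  show "first \<omega> \<in> V" "u \<in> V \<Longrightarrow> wait \<omega> (first \<omega>) \<le> wait \<omega> u" by (auto simp: first_def)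
qed

lemma measurable_first: "first \<in> \<mu> \<rightarrow>\<^sub>M count_space V"
proof -
  have "Measurable.pred \<mu> (\<lambda>\<omega>. v \<in> V \<and> (\<forall>u\<in>V. wait \<omega> v \<le> wait \<omega> u))" for v
  proof (cases "v \<in> V")
    case True
    show ?thesis using sets_min_wait[OF measurable_wait[OF True]] True by (simp add: pred_def)
  qed simp
  then have "first \<in> \<mu> \<rightarrow>\<^sub>M count_space UNIV"
    unfolding first_def[abs_def] by (rule measurable_Least)
  then show ?thesis
    using first(1) by (auto intro!: measurable_count_space_eq2_countable[THEN iffD2] measurable_sets[of first]
       simp: countable_finite[OF finV] vimage_def)
qed

text \<open>A process that reacts to the rings of all nodes in order of time, restarted on the
  residual tape after each of them. \<open>k\<close> caps the number of rings, which makes the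
  recursion primitive; \<open>T\<close> is the time left.\<close>

primrec run :: "('s \<Rightarrow> nat \<Rightarrow> real \<times> nat \<times> real \<Rightarrow> 's) \<Rightarrow> nat \<Rightarrow> 's \<Rightarrow> real \<Rightarrow> (nat \<times> nat \<Rightarrow> real \<times> nat \<times> real) \<Rightarrow> 's" where
  "run step 0 s T \<omega> = s"
| "run step (Suc k) s T \<omega> =
    (let v = first \<omega> in
     if wait \<omega> v < T then run step k (step s v (\<omega> (v, 1))) (T - wait \<omega> v) (residual v \<omega>) else s)"

text \<open>The time left in the recursive call is random, so measurability is proved jointly in
  time and tape. Countability of the state space lets the random successor state be handled one
  value at a time.\<close>

lemma measurable_run:
  fixes step :: "'s::countable \<Rightarrow> nat \<Rightarrow> real \<times> nat \<times> real \<Rightarrow> 's"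
  assumes step: "\<And>s v. v \<in> V \<Longrightarrow> step s v \<in> K (v, 1) \<rightarrow>\<^sub>M count_space UNIV"
  shows "(\<lambda>(T, \<omega>). run step k s T \<omega>) \<in> borel \<Otimes>\<^sub>M \<mu> \<rightarrow>\<^sub>M count_space UNIV"
proof (induction k arbitrary: s)
  case 0
  show ?case by (simp add: case_prod_beta')
next
  case (Suc k)
  let ?M = "borel \<Otimes>\<^sub>M \<mu> :: (real \<times> _) measure"
  have fst: "fst \<in> ?M \<rightarrow>\<^sub>M borel" and snd: "snd \<in> ?M \<rightarrow>\<^sub>M \<mu>" by measurable
  have "(\<lambda>p. if wait (snd p) v < fst p then run step k (step s v (snd p (v, 1))) (fst p - wait (snd p) v) (residual v (snd p)) else s)
      \<in> ?M \<rightarrow>\<^sub>M count_space UNIV" if v: "v \<in> V" for v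
  proof -
    have w [measurable]: "(\<lambda>p. wait (snd p) v) \<in> ?M \<rightarrow>\<^sub>M borel"
      by (rule measurable_compose[OF snd measurable_wait[OF v]])
    have r [measurable]: "(\<lambda>p. residual v (snd p)) \<in> ?M \<rightarrow>\<^sub>M \<mu>"
      by (rule measurable_compose[OF snd measurable_residual[OF v]])
    have m: "(\<lambda>p. snd p (v, 1)) \<in> ?M \<rightarrow>\<^sub>M K (v, 1)"
      by (rule measurable_compose[OF snd measurable_component_mu[OF v]]) simp
    have "(\<lambda>p. run step k s' (fst p - wait (snd p) v) (residual v (snd p))) \<in> ?M \<rightarrow>\<^sub>M count_space UNIV" for s'
    proof -
      have "(\<lambda>p. (fst p - wait (snd p) v, residual v (snd p))) \<in> ?M \<rightarrow>\<^sub>M borel \<Otimes>\<^sub>M \<mu>"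
        by measurable
      from measurable_compose[OF this Suc.IH[of s']] show ?thesis by simp
    qed
    then have "(\<lambda>p. run step k (step s v (snd p (v, 1))) (fst p - wait (snd p) v) (residual v (snd p))) \<in> ?M \<rightarrow>\<^sub>M count_space UNIV"
      by (rule measurable_compose_countable) (rule measurable_compose[OF m step[OF v]])
    note [measurable] = this
    show ?thesis by measurable
  qed
  then have "(\<lambda>p. (\<lambda>v p. if wait (snd p) v < fst p then run step k (step s v (snd p (v, 1))) (fst p - wait (snd p) v) (residual v (snd p)) else s)
      (first (snd p)) p) \<in> ?M \<rightarrow>\<^sub>M count_space UNIV"
    by (rule measurable_compose_countable'[OF _ measurable_compose[OF snd measurable_first]])
       (auto simp: countable_finite finV)
  then show ?case by (simp add: case_prod_beta' Let_def)
qed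

lemma measurable_run_fixed:
  fixes step :: "'s::countable \<Rightarrow> nat \<Rightarrow> real \<times> nat \<times> real \<Rightarrow> 's"
  assumes step: "\<And>s v. v \<in> V \<Longrightarrow> step s v \<in> K (v, 1) \<rightarrow>\<^sub>M count_space UNIV"
  shows "run step k s T \<in> \<mu> \<rightarrow>\<^sub>M count_space UNIV"
  using measurable_compose[OF measurable_Pair1'[of T borel \<mu>] measurable_run[OF step]] by simp

lemma emeasure_no_ring:
  assumes "0 \<le> T"
  shows "emeasure \<mu> {\<omega>\<in>space \<mu>. \<forall>u\<in>V. T \<le> wait \<omega> u} = ennreal (exp (- real (card V) * T))"
proof -
  have "{\<omega>\<in>space \<mu>. \<forall>u\<in>V. T \<le> wait \<omega> u} =
      {\<omega>\<in>space (PiM I K). \<forall>j\<in>V \<times> {1}. \<omega> j \<in> {T..} \<times> space (N (fst j))}"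
    by (auto simp: \<mu>_def wait_def space_PiM PiE_iff mem_Times_iff)
  also have "emeasure \<mu> \<dots> = (\<Prod>j\<in>V \<times> {1}. emeasure (K j) ({T..} \<times> space (N (fst j))))"
    unfolding \<mu>_def using finV by (intro P.emeasure_PiM_Collect) (auto simp: K_apply)
  also have "\<dots> = (\<Prod>j\<in>V \<times> {1::nat}. ennreal (exp (- T)))"
  proof (rule prod.cong[OF refl])
    fix j assume "j \<in> V \<times> {1::nat}"
    then obtain u where j: "j = (u, 1)" by auto
    interpret N: prob_space "N u" by (rule prob_N)
    show "emeasure (K j) ({T..} \<times> space (N (fst j))) = ennreal (exp (- T))"
      using assms by (simp add: j K_apply N.emeasure_pair_measure_Times N.emeasure_space_1 emeasure_expo_atLeast)
  qed
  also have "\<dots> = ennreal (exp (- real (card V) * T))"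
    by (simp add: card_cartesian_product ennreal_power exp_of_nat_mult[symmetric])
  finally show ?thesis .
qed

text \<open>\<open>\<Psi>\<close> is a supersolution of the renewal equation satisfied by the probability that the process
  started in \<open>s\<close> is in a bad state at time \<open>T\<close>.\<close>

theorem run_bad_le:
  fixes step :: "'s::countable \<Rightarrow> nat \<Rightarrow> real \<times> nat \<times> real \<Rightarrow> 's"
  assumes step: "\<And>s v. v \<in> V \<Longrightarrow> step s v \<in> K (v, 1) \<rightarrow>\<^sub>M count_space UNIV"
    and base: "\<And>s T. 0 \<le> T \<Longrightarrow> s \<in> B \<Longrightarrow> 1 \<le> \<Psi> s T"
    and super: "\<And>s T. 0 \<le> T \<Longrightarrow>
      ennreal (exp (- real (card V) * T)) * indicator B s +
      (\<Sum>v\<in>V. \<integral>\<^sup>+z. ennreal (exp (- real (card V - 1) * fst z)) *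
         (indicator {..<T} (fst z) * \<Psi> (step s v z) (T - fst z)) \<partial>K (v, 1)) \<le> \<Psi> s T"
    and T: "0 \<le> T"
  shows "(\<integral>\<^sup>+\<omega>. indicator B (run step k s T \<omega>) \<partial>\<mu>) \<le> \<Psi> s T"
  using T
proof (induction k arbitrary: s T)
  case 0
  then show ?case using base[of T s] by (auto simp: indicator_def mu.emeasure_space_1)
next
  case (Suc k)
  let ?H = "\<lambda>v z \<omega>. indicator {..<T} (fst z) * indicator B (run step k (step s v z) (T - fst z) \<omega>) :: ennreal"
  let ?D = "\<lambda>v. {\<omega>\<in>space \<mu>. \<forall>u\<in>V. wait \<omega> v \<le> wait \<omega> u}"
  let ?S = "{\<omega>\<in>space \<mu>. \<forall>u\<in>V. T \<le> wait \<omega> u}"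
  have H: "(\<lambda>(z, \<omega>). ?H v z \<omega>) \<in> borel_measurable (K (v, 1) \<Otimes>\<^sub>M \<mu>)" if v: "v \<in> V" for v
  proof -
    let ?M = "K (v, 1) \<Otimes>\<^sub>M \<mu>"
    have "fst \<in> K (v, 1) \<rightarrow>\<^sub>M borel"
      unfolding K_apply prod.case using measurable_fst[of expo "N v"] unfolding measurable_cong_sets[OF refl sets_expo] .
    then have f [measurable]: "(\<lambda>p. fst (fst p)) \<in> ?M \<rightarrow>\<^sub>M borel"
      by (rule measurable_compose[OF measurable_fst])
    have s: "(\<lambda>p. step s v (fst p)) \<in> ?M \<rightarrow>\<^sub>M count_space UNIV"
      by (rule measurable_compose[OF measurable_fst step[OF v]])
    have "(\<lambda>p. (T - fst (fst p), snd p)) \<in> ?M \<rightarrow>\<^sub>M borel \<Otimes>\<^sub>M \<mu>"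
      by measurable
    from measurable_compose[OF this measurable_run[OF step]]
    have "(\<lambda>p. run step k s' (T - fst (fst p)) (snd p)) \<in> ?M \<rightarrow>\<^sub>M count_space UNIV" for s'
      by simp
    from measurable_compose_countable[OF this s]
    have r [measurable]: "(\<lambda>p. run step k (step s v (fst p)) (T - fst (fst p)) (snd p)) \<in> ?M \<rightarrow>\<^sub>M count_space UNIV" .
    show ?thesis unfolding case_prod_beta' by measurable
  qed
  have D: "?D v \<in> sets \<mu>" if "v \<in> V" for v by (intro sets_min_wait measurable_wait that)
  have S: "?S \<in> sets \<mu>" by (intro sets_min_wait) simp
  \<comment> \<open>Either no clock rings before \<open>T\<close> or some node is first. Under a tie
    several terms of the sum can be present, hence only an inequality.\<close>
  have "(\<integral>\<^sup>+\<omega>. indicator B (run step (Suc k) s T \<omega>) \<partial>\<mu>) \<le>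
     (\<integral>\<^sup>+\<omega>. indicator ?S \<omega> * indicator B s + (\<Sum>v\<in>V. indicator (?D v) \<omega> * ?H v (\<omega> (v, 1)) (residual v \<omega>)) \<partial>\<mu>)"
  proof (rule nn_integral_mono)
    fix \<omega> assume w: "\<omega> \<in> space \<mu>"
    let ?v = "first \<omega>"
    show "indicator B (run step (Suc k) s T \<omega>) \<le>
      indicator ?S \<omega> * indicator B s + (\<Sum>v\<in>V. indicator (?D v) \<omega> * ?H v (\<omega> (v, 1)) (residual v \<omega>))"
    proof (cases "wait \<omega> ?v < T")
      case True
      have "indicator B (run step (Suc k) s T \<omega>) = indicator (?D ?v) \<omega> * ?H ?v (\<omega> (?v, 1)) (residual ?v \<omega>)"
        using True w first by (simp add: Let_def wait_def[of \<omega> ?v, symmetric] del: One_nat_def)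
      also have "\<dots> \<le> (\<Sum>v\<in>V. indicator (?D v) \<omega> * ?H v (\<omega> (v, 1)) (residual v \<omega>))"
        using finV first(1) by (intro member_le_sum) auto
      finally show ?thesis by (simp add: add_increasing)
    next
      case False
      then have "\<omega> \<in> ?S" using w first(2)[of _ \<omega>] by (auto simp: not_less intro: order_trans)
      then show ?thesis using False by (simp add: Let_def)
    qed
  qed
  also have "\<dots> = (\<integral>\<^sup>+\<omega>. indicator ?S \<omega> * indicator B s \<partial>\<mu>) +
      (\<Sum>v\<in>V. \<integral>\<^sup>+\<omega>. indicator (?D v) \<omega> * ?H v (\<omega> (v, 1)) (residual v \<omega>) \<partial>\<mu>)"
  proof -
    have m: "(\<lambda>\<omega>. indicator (?D v) \<omega> * ?H v (\<omega> (v, 1)) (residual v \<omega>)) \<in> borel_measurable \<mu>" if "v \<in> V" for v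
      by (rule borel_measurable_times_ennreal[OF borel_measurable_indicator[OF D[OF that]]
            measurable_H_residual[OF that H[OF that]]])
    have S': "(\<lambda>\<omega>. indicator ?S \<omega> * indicator B s :: ennreal) \<in> borel_measurable \<mu>"
      using S by (intro borel_measurable_times_ennreal borel_measurable_indicator) auto
    have "(\<integral>\<^sup>+\<omega>. (\<Sum>v\<in>V. indicator (?D v) \<omega> * ?H v (\<omega> (v, 1)) (residual v \<omega>)) \<partial>\<mu>) =
        (\<Sum>v\<in>V. \<integral>\<^sup>+\<omega>. indicator (?D v) \<omega> * ?H v (\<omega> (v, 1)) (residual v \<omega>) \<partial>\<mu>)"
      by (rule nn_integral_sum) (rule m)
    then show ?thesis
      by (subst nn_integral_add[OF S']) (auto intro!: borel_measurable_sum m simp del: One_nat_def)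
  qed
  also have "(\<integral>\<^sup>+\<omega>. indicator ?S \<omega> * indicator B s \<partial>\<mu>) = ennreal (exp (- real (card V) * T)) * indicator B s"
    using S emeasure_no_ring[OF Suc.prems] by (subst nn_integral_multc) auto
  also have "(\<Sum>v\<in>V. \<integral>\<^sup>+\<omega>. indicator (?D v) \<omega> * ?H v (\<omega> (v, 1)) (residual v \<omega>) \<partial>\<mu>) =
     (\<Sum>v\<in>V. \<integral>\<^sup>+z. ennreal (exp (- real (card V - 1) * fst z)) * (\<integral>\<^sup>+\<omega>. ?H v z \<omega> \<partial>\<mu>) \<partial>K (v, 1))"
    by (intro sum.cong refl nn_integral_first_ring H)
  also have "\<dots> \<le> (\<Sum>v\<in>V. \<integral>\<^sup>+z. ennreal (exp (- real (card V - 1) * fst z)) *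
         (indicator {..<T} (fst z) * \<Psi> (step s v z) (T - fst z)) \<partial>K (v, 1))"
  proof (intro sum_mono nn_integral_mono mult_left_mono)
    fix v z assume "v \<in> V"
    show "(\<integral>\<^sup>+\<omega>. ?H v z \<omega> \<partial>\<mu>) \<le> indicator {..<T} (fst z) * \<Psi> (step s v z) (T - fst z)"
      using Suc.IH[of "T - fst z" "step s v z"] by (auto simp: indicator_def[of "{..<T}"])
  qed simp
  finally have "(\<integral>\<^sup>+\<omega>. indicator B (run step (Suc k) s T \<omega>) \<partial>\<mu>) \<le> \<Psi> s T"
    using super[OF Suc.prems] by (auto intro: order_trans add_left_mono)
  then show ?case .
qed

end

text \<open>Strict sortedness and the set of elements pin the list down. Both are easy to check for
  a list with one earlier ring in front and all other times shifted, which gives the recursion of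
  \<open>ring_list\<close>.\<close>

lemma (in linorder) sorted_key_list_of_set_eq_iff:
  assumes "inj_on f A" "finite A"
  shows "sorted_key_list_of_set f A = xs \<longleftrightarrow> sorted_wrt (<) (map f xs) \<and> set xs = A"
proof -
  interpret folding_insort_key "(\<le>)" "(<)" A f
    by unfold_locales (rule assms)
  have "card (set xs) = length xs" if "sorted_wrt (<) (map f xs)"
  proof -
    have "distinct (map f xs)" using that strict_sorted_iff by blast
    then show ?thesis by (intro distinct_card) (simp add: distinct_map)
  qed
  then show ?thesis
    using sorted_key_list_of_set_unique[of A xs] assms by auto
qed

context clocks
begin

subsection \<open>Null events\<close>

lemma mu_split:
  assumes j: "j \<in> I"
  shows "(\<lambda>(z, X). X(j := z)) \<in> K j \<Otimes>\<^sub>M PiM (I - {j}) K \<rightarrow>\<^sub>M \<mu>" (is "?m")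
    and "\<mu> = distr (K j \<Otimes>\<^sub>M PiM (I - {j}) K) \<mu> (\<lambda>(z, X). X(j := z))" (is "?d")
proof -
  have ins: "insert j (I - {j}) = I" using j by auto
  show ?m
    unfolding \<mu>_def using measurable_add_dim[of j "I - {j}" K]
    unfolding ins by (subst measurable_pair_swap_iff) (auto simp: case_prod_beta' simp del: One_nat_def)
  show ?d
    using distr_pair_PiM_eq_PiM[of "I - {j}" K j] prob_K unfolding ins \<mu>_def by simp
qed

lemma measurable_fst_mu: "j \<in> I \<Longrightarrow> (\<lambda>\<omega>. fst (\<omega> j)) \<in> \<mu> \<rightarrow>\<^sub>M borel"
  unfolding \<mu>_def by (cases j) (auto intro: measurable_wait_gen)

lemma AE_expo_component: "AE x in expo. P x \<Longrightarrow> Measurable.pred borel P \<Longrightarrow> AE z in K (v, i). P (fst z)"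
proof -
  assume AE: "AE x in expo. P x" and [measurable]: "Measurable.pred borel P"
  interpret N: prob_space "N v" by (rule prob_N)
  interpret E: prob_space expo by (rule prob_space_expo)
  interpret pair_sigma_finite expo "N v" ..
  have "AE x in expo. AE y in N v. P (fst (x, y))" using AE by simp
  moreover have "{z \<in> space (expo \<Otimes>\<^sub>M N v). P (fst z)} \<in> sets (expo \<Otimes>\<^sub>M N v)" by measurable
  ultimately show ?thesis unfolding K_apply by (intro AE_pair_measure)
qed

lemma AE_component_mu: "j \<in> I \<Longrightarrow> AE z in K j. P z \<Longrightarrow> AE \<omega> in \<mu>. P (\<omega> j)"
  unfolding \<mu>_def by (rule P.AE_component)

text \<open>Given all other coordinates, \<open>g\<close> is a constant, and the exponential law has
  no atoms; Fubini does the rest.\<close>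

lemma AE_fst_neq:
  assumes j: "j \<in> I" and g: "g \<in> \<mu> \<rightarrow>\<^sub>M borel" and inv: "\<And>\<omega> z. g (fun_upd \<omega> j z) = g \<omega>"
  shows "AE \<omega> in \<mu>. fst (\<omega> j) \<noteq> g \<omega>"
proof -
  let ?P' = "PiM (I - {j}) K"
  obtain u i where ui: "j = (u, i)" by (cases j)
  interpret P': prob_space ?P' by (rule prob_space_PiM) (rule prob_K)
  interpret Kj: prob_space "K j" by (rule prob_K)
  interpret pair_sigma_finite "K j" ?P' ..
  define Q where "Q \<omega> \<longleftrightarrow> fst (\<omega> j) \<noteq> g \<omega>" for \<omega>
  have Q: "Measurable.pred \<mu> Q"
    unfolding Q_def pred_def by (rule borel_measurable_neq[OF measurable_fst_mu[OF j] g])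
  have Qs: "{\<omega> \<in> space \<mu>. Q \<omega>} \<in> sets \<mu>" using Q by measurable
  have mQ: "{p \<in> space (K j \<Otimes>\<^sub>M ?P'). Q ((snd p)(j := fst p))} \<in> sets (K j \<Otimes>\<^sub>M ?P')"
    using measurable_compose[OF mu_split(1)[OF j] Q] by (simp add: case_prod_beta' pred_def)
  have "AE X in ?P'. AE z in K j. Q (X(j := z))"
  proof (rule AE_I2)
    fix X
    have "Q (X(j := z)) \<longleftrightarrow> fst z \<noteq> g X" for z unfolding Q_def by (simp add: inv)
    then show "AE z in K j. Q (X(j := z))"
      unfolding ui using AE_expo_component[OF AE_expo_neq[of "g X"], of u i] by simp
  qed
  then have "AE z in K j. AE X in ?P'. Q (X(j := z))"
    by (subst AE_commute) (use mQ in auto)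
  then have "AE p in K j \<Otimes>\<^sub>M ?P'. Q ((snd p)(j := fst p))"
    by (intro AE_pair_measure mQ) simp
  then have "AE \<omega> in distr (K j \<Otimes>\<^sub>M ?P') \<mu> (\<lambda>(z, X). X(j := z)). Q \<omega>"
    using Qs by (subst AE_distr_iff[OF mu_split(1)[OF j]]) (auto simp: case_prod_beta')
  then show ?thesis unfolding mu_split(2)[OF j, symmetric] Q_def .
qed

lemma measurable_ring: "v \<in> V \<Longrightarrow> (\<lambda>\<omega>. ring \<omega> v i) \<in> \<mu> \<rightarrow>\<^sub>M borel"
  unfolding ring_def by (intro borel_measurable_sum measurable_fst_mu) auto

lemma ring_Suc: "ring \<omega> v (Suc i) = ring \<omega> v i + fst (\<omega> (v, Suc i))"
  by (simp add: ring_def)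

lemma ring_0 [simp]: "ring \<omega> v 0 = 0"
  by (simp add: ring_def)

lemma ring_upd: "u \<noteq> v \<or> j < i \<Longrightarrow> ring (fun_upd \<omega> (v, i) z) u j = ring \<omega> u j"
  unfolding ring_def by (intro sum.cong) auto

lemma AE_ring_neq_const:
  assumes "v \<in> V" "1 \<le> i"
  shows "AE \<omega> in \<mu>. ring \<omega> v i \<noteq> c"
proof -
  have "AE \<omega> in \<mu>. fst (\<omega> (v, i)) \<noteq> c - ring \<omega> v (i - 1)"
    using assms by (intro AE_fst_neq borel_measurable_diff measurable_ring) (auto simp: ring_upd)
  then show ?thesis
    by eventually_elim (use assms ring_Suc[of _ v "i - 1"] in auto)
qed

lemma AE_ring_neq:
  assumes "u \<in> V" "v \<in> V" "u \<noteq> v" "1 \<le> i"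
  shows "AE \<omega> in \<mu>. ring \<omega> u i \<noteq> ring \<omega> v j"
proof -
  have "AE \<omega> in \<mu>. fst (\<omega> (u, i)) \<noteq> ring \<omega> v j - ring \<omega> u (i - 1)"
    using assms by (intro AE_fst_neq borel_measurable_diff measurable_ring) (auto simp: ring_upd)
  then show ?thesis
    by eventually_elim (use assms ring_Suc[of _ u "i - 1"] in auto)
qed

text \<open>Prevents rings from accumulating, by an elementary argument: that all waiting times of
  \<open>v\<close> stay below \<open>t\<close> has probability at most \<open>p ^ m\<close> for
  every \<open>m\<close>, where \<open>p = 1 - exp (- real t)\<close>.\<close>

lemma AE_wait_large:
  assumes v: "v \<in> V"
  shows "AE \<omega> in \<mu>. \<exists>i\<ge>1. real t \<le> fst (\<omega> (v, i))"
proof -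
  define S where "S m = {\<omega> \<in> space (PiM I K). \<forall>j\<in>{v} \<times> {1..m}. \<omega> j \<in> {..<real t} \<times> space (N v)}" for m
  define p where "p = measure expo {..<real t}"
  interpret E: prob_space expo by (rule prob_space_expo)
  interpret N: prob_space "N v" by (rule prob_N)
  have p: "p = 1 - exp (- real t)"
  proof -
    have "measure expo {real t..} = exp (- real t)"
      using emeasure_expo_atLeast[of "real t"] by (simp add: measure_def)
    moreover have "measure expo (space expo - {real t..}) = 1 - measure expo {real t..}"
      by (rule E.prob_compl) simp
    moreover have "space expo - {real t..} = {..<real t}" by auto
    ultimately show ?thesis by (simp add: p_def)
  qed
  have em: "emeasure \<mu> (S m) = ennreal (p ^ m)" for m
  proof -
    have "emeasure \<mu> (S m) = (\<Prod>j\<in>{v} \<times> {1..m}. emeasure (K j) ({..<real t} \<times> space (N v)))"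
      unfolding S_def \<mu>_def using v by (intro P.emeasure_PiM_Collect) (auto simp: K_apply)
    also have "\<dots> = (\<Prod>j\<in>{v} \<times> {1..m}. ennreal p)"
      by (intro prod.cong refl) (auto simp: K_apply N.emeasure_pair_measure_Times N.emeasure_space_1 p_def E.emeasure_eq_measure)
    also have "\<dots> = ennreal (p ^ m)" by (simp add: card_cartesian_product ennreal_power p_def)
    finally show ?thesis .
  qed
  define A where "A = (\<Inter>m. S m)"
  have Sm: "S m \<in> sets \<mu>" for m
    unfolding S_def \<mu>_def using v
    by (intro sets.sets_Collect_finite_All sets_Collect_single') (auto simp: K_apply)
  have A: "A \<in> sets \<mu>" unfolding A_def using Sm by auto
  have "emeasure \<mu> A \<le> ennreal (p ^ m)" for m
    unfolding em[symmetric] using Sm by (intro emeasure_mono) (auto simp: A_def)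
  moreover have "(\<lambda>m. ennreal (p ^ m)) \<longlonglongrightarrow> ennreal 0"
    by (intro tendsto_ennrealI LIMSEQ_power_zero) (auto simp: p abs_if)
  ultimately have "emeasure \<mu> A \<le> 0"
    by (intro LIMSEQ_le_const[of "\<lambda>m. ennreal (p ^ m)"]) auto
  then have "A \<in> null_sets \<mu>" using A by auto
  moreover have "{\<omega> \<in> space \<mu>. \<not> (\<exists>i\<ge>1. real t \<le> fst (\<omega> (v, i)))} \<subseteq> A"
  proof clarify
    fix \<omega> assume w: "\<omega> \<in> space \<mu>" and "\<not> (\<exists>i\<ge>1. real t \<le> fst (\<omega> (v, i)))"
    then have lt: "1 \<le> i \<Longrightarrow> fst (\<omega> (v, i)) < real t" for i by (meson not_le)
    then show "\<omega> \<in> A"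
      using v w by (auto simp: A_def S_def \<mu>_def space_PiM PiE_iff mem_Times_iff)
  qed
  ultimately show ?thesis by (rule AE_I')
qed

text \<open>Up to the range of the proposals, this is all that the analysis of executions asks of a
  tape. Two rings of one node differ because waiting times are positive. A ring at \<open>T\<close>
  is excluded because the chain counts rings up to and including \<open>T\<close>, the algorithm
  only those before \<open>T\<close>.\<close>

definition good :: "real \<Rightarrow> tape \<Rightarrow> bool" where
  "good T \<omega> \<longleftrightarrow> (\<forall>v\<in>V. \<forall>i\<ge>1. 0 < fst (\<omega> (v, i))) \<and>
     (\<forall>u\<in>V. \<forall>v\<in>V. \<forall>i\<ge>1. \<forall>j\<ge>1. ring \<omega> u i = ring \<omega> v j \<longrightarrow> u = v) \<and>
     (\<forall>v\<in>V. \<forall>t. \<exists>i\<ge>1. t < ring \<omega> v i) \<and>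
     (\<forall>v\<in>V. \<forall>i\<ge>1. ring \<omega> v i \<noteq> T)"

lemma strict_mono_ring:
  assumes pos: "\<And>i. 1 \<le> i \<Longrightarrow> 0 < fst (\<omega> (v, i))" and ij: "i < j"
  shows "ring \<omega> v i < ring \<omega> v j"
  using ij by (induction j) (auto simp: ring_Suc less_Suc_eq pos add_strict_increasing2 intro: add_pos_pos less_trans)

lemma AE_good: "AE \<omega> in \<mu>. good T \<omega>"
proof -
  have 1: "AE \<omega> in \<mu>. \<forall>v\<in>V. \<forall>i. 1 \<le> i \<longrightarrow> 0 < fst (\<omega> (v, i))"
    using finV by (intro AE_finite_allI AE_all_countable[THEN iffD2] allI)
      (auto intro!: AE_component_mu AE_K_pos simp: AE_impI Pi_iff not_less_eq_eq)
  have 2: "AE \<omega> in \<mu>. \<forall>u\<in>V. \<forall>v\<in>V. \<forall>i. \<forall>j. 1 \<le> i \<longrightarrow> ring \<omega> u i = ring \<omega> v j \<longrightarrow> u = v"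
  proof (intro AE_finite_allI[OF finV] AE_all_countable[THEN iffD2] allI)
    fix u v i j assume "u \<in> V" "v \<in> V"
    then show "AE \<omega> in \<mu>. 1 \<le> i \<longrightarrow> ring \<omega> u i = ring \<omega> v j \<longrightarrow> u = v"
      using AE_ring_neq[of u v i j] by (cases "u \<noteq> v \<and> 1 \<le> i") auto
  qed
  have 3: "AE \<omega> in \<mu>. \<forall>v\<in>V. \<forall>i. 1 \<le> i \<longrightarrow> ring \<omega> v i \<noteq> T"
  proof (intro AE_finite_allI[OF finV] AE_all_countable[THEN iffD2] allI)
    fix v i assume "v \<in> V"
    then show "AE \<omega> in \<mu>. 1 \<le> i \<longrightarrow> ring \<omega> v i \<noteq> T"
      using AE_ring_neq_const[of v i T] by (cases "1 \<le> i") auto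
  qed
  have 4: "AE \<omega> in \<mu>. \<forall>v\<in>V. \<forall>t. \<exists>i\<ge>1. real t \<le> fst (\<omega> (v, i))"
    by (intro AE_finite_allI[OF finV] AE_all_countable[THEN iffD2] allI AE_wait_large)
  from 1 2 3 4 show ?thesis
  proof eventually_elim
    case (elim \<omega>)
    have *: "\<exists>i\<ge>1. t < ring \<omega> v i" if v: "v \<in> V" for v t
    proof -
      obtain n :: nat where n: "t < real n" using reals_Archimedean2 by blast
      obtain i where i: "1 \<le> i" "real n \<le> fst (\<omega> (v, i))" using elim(4) v by blast
      have "0 \<le> ring \<omega> v (i - 1)"
        using elim(1) v unfolding ring_def by (intro sum_nonneg) (auto simp: less_imp_le)
      then have "t < ring \<omega> v i" using ring_Suc[of \<omega> v "i - 1"] i n by simp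
      then show ?thesis using i by blast
    qed
    show ?case unfolding good_def using * elim(1-3) by (intro conjI) blast+
  qed
qed

subsection \<open>The list of rings\<close>

definition rings :: "tape \<Rightarrow> real \<Rightarrow> (nat \<times> nat) set" where
  "rings \<omega> T = {(v, i). v \<in> V \<and> 1 \<le> i \<and> ring \<omega> v i < T}"

definition ring_list :: "tape \<Rightarrow> real \<Rightarrow> (nat \<times> nat) list" where
  "ring_list \<omega> T = sorted_key_list_of_set (\<lambda>(v, i). ring \<omega> v i) (rings \<omega> T)"

lemma goodD:
  assumes "good T \<omega>"
  shows "v \<in> V \<Longrightarrow> 1 \<le> i \<Longrightarrow> 0 < fst (\<omega> (v, i))"
    and "u \<in> V \<Longrightarrow> v \<in> V \<Longrightarrow> 1 \<le> i \<Longrightarrow> 1 \<le> j \<Longrightarrow> ring \<omega> u i = ring \<omega> v j \<Longrightarrow> u = v"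
    and "v \<in> V \<Longrightarrow> \<exists>i\<ge>1. t < ring \<omega> v i"
    and "v \<in> V \<Longrightarrow> 1 \<le> i \<Longrightarrow> ring \<omega> v i \<noteq> T"
  using assms unfolding good_def by blast+

lemma good_ring_less:
  assumes "good T \<omega>" "v \<in> V"
  shows "ring \<omega> v i < ring \<omega> v j \<longleftrightarrow> i < j"
proof -
  have "ring \<omega> v i < ring \<omega> v j" if "i < j" for i j
    using strict_mono_ring goodD(1)[OF assms] that by blast
  then show ?thesis by (metis linorder_neqE_nat order_less_asym order_less_irrefl)
qed

lemma good_ring_pos: "good T \<omega> \<Longrightarrow> v \<in> V \<Longrightarrow> 1 \<le> i \<Longrightarrow> 0 < ring \<omega> v i"
  using good_ring_less[of T \<omega> v 0 i] by simp

lemma good_inj: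
  assumes "good T \<omega>"
  shows "inj_on (\<lambda>(v, i). ring \<omega> v i) I"
proof (rule inj_onI, clarsimp)
  fix u i v j assume *: "u \<in> V" "v \<in> V" "Suc 0 \<le> i" "Suc 0 \<le> j" "ring \<omega> u i = ring \<omega> v j"
  with goodD(2)[OF assms, of u v i j] have "u = v" by simp
  with * good_ring_less[OF assms, of u] show "u = v \<and> i = j" by (metis linorder_neqE_nat order_less_irrefl)
qed

lemma finite_rings:
  assumes "good T' \<omega>"
  shows "finite (rings \<omega> T)"
proof -
  have "\<exists>n. \<forall>i\<ge>1. ring \<omega> v i < T \<longrightarrow> i \<le> n" if v: "v \<in> V" for v
  proof -
    obtain n where n: "T < ring \<omega> v n" using goodD(3)[OF assms v] by blast
    have "i \<le> n" if "ring \<omega> v i < T" for i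
    proof (rule ccontr)
      assume "\<not> i \<le> n"
      then have "ring \<omega> v n < ring \<omega> v i" using good_ring_less[OF assms v] by simp
      with n that show False by simp
    qed
    then show ?thesis by blast
  qed
  then have "\<forall>v. \<exists>n. v \<in> V \<longrightarrow> (\<forall>i\<ge>1. ring \<omega> v i < T \<longrightarrow> i \<le> n)" by blast
  from choice[OF this] obtain n where n: "\<And>v i. v \<in> V \<Longrightarrow> 1 \<le> i \<Longrightarrow> ring \<omega> v i < T \<Longrightarrow> i \<le> n v" by blast
  have "rings \<omega> T \<subseteq> (SIGMA v:V. {..n v})" using n by (auto simp: rings_def)
  then show ?thesis using finV by (auto intro: finite_subset)
qed

lemma rings_subset: "rings \<omega> T \<subseteq> I"
  by (auto simp: rings_def)

lemma ring_list_unique: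
  assumes "good T' \<omega>"
  shows "ring_list \<omega> T = xs \<longleftrightarrow> sorted_wrt (<) (map (\<lambda>(v, i). ring \<omega> v i) xs) \<and> set xs = rings \<omega> T"
  unfolding ring_list_def
  by (intro sorted_key_list_of_set_eq_iff inj_on_subset[OF good_inj[OF assms] rings_subset] finite_rings[OF assms])

lemma ring_list:
  assumes "good T' \<omega>"
  shows "sorted_wrt (<) (map (\<lambda>(v, i). ring \<omega> v i) (ring_list \<omega> T))" "set (ring_list \<omega> T) = rings \<omega> T"
  using ring_list_unique[OF assms, of T "ring_list \<omega> T"] by auto

lemma ring_residual:
  assumes "v \<in> V" "u \<in> V" "1 \<le> i"
  shows "ring (residual v \<omega>) u i = ring \<omega> u (if u = v then Suc i else i) - wait \<omega> v"
  using assms(3)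
proof (induction i rule: dec_induct)
  case base
  show ?case using assms
    by (auto simp: residual_def shift_def ring_def wait_def numeral_2_eq_2)
next
  case (step i)
  then show ?case using assms
    by (auto simp: ring_Suc residual_def shift_def)
qed

text \<open>Translates the numbering of updates on the residual tape back to the original one, where
  \<open>v\<close> has one more ring in front.\<close>

definition later :: "nat \<Rightarrow> nat \<times> nat \<Rightarrow> nat \<times> nat" where
  "later v = (\<lambda>(u, i). (u, if u = v then Suc i else i))"

lemma ring_one: "ring \<omega> v 1 = wait \<omega> v"
  by (simp add: ring_def wait_def)

text \<open>Minimality of \<open>v\<close> only makes the shortened waiting times of the others
  nonnegative; they are positive because rings of different nodes are distinct.\<close>

lemma good_residual:
  assumes g: "good T \<omega>" and v: "v = first \<omega>"
  shows "good (T - wait \<omega> v) (residual v \<omega>)"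
proof -
  have vV: "v \<in> V" and min: "\<And>u. u \<in> V \<Longrightarrow> wait \<omega> v \<le> wait \<omega> u" using first v by auto
  note rr = ring_residual[OF vV]
  have 1: "0 < fst (residual v \<omega> (u, i))" if "u \<in> V" "1 \<le> i" for u i
  proof -
    have "wait \<omega> v \<noteq> wait \<omega> u" if "u \<noteq> v"
      using goodD(2)[OF g vV \<open>u \<in> V\<close>, of 1 1] that unfolding ring_one by auto
    then have "u \<noteq> v \<Longrightarrow> wait \<omega> v < wait \<omega> u" using min[OF that(1)] by fastforce
    then show ?thesis using that goodD(1)[OF g]
      by (auto simp: residual_def shift_def wait_def)
  qed
  have 2: "u = w" if "ring (residual v \<omega>) u i = ring (residual v \<omega>) w j" "u \<in> V" "w \<in> V" "1 \<le> i" "1 \<le> j" for u w i j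
    using that goodD(2)[OF g, of u w "if u = v then Suc i else i" "if w = v then Suc j else j"]
    by (simp add: rr del: One_nat_def split: if_splits)
  have 3: "\<exists>i\<ge>1. t < ring (residual v \<omega>) u i" if uV: "u \<in> V" for u t
  proof -
    obtain i where i: "1 \<le> i" "t + wait \<omega> v < ring \<omega> u i" using goodD(3)[OF g uV] by blast
    have "ring \<omega> u i < ring \<omega> u (Suc i)" using good_ring_less[OF g uV] by simp
    then have "t < ring (residual v \<omega>) u i" using i rr[OF uV i(1)] by auto
    then show ?thesis using i by blast
  qed
  have 4: "ring (residual v \<omega>) u i \<noteq> T - wait \<omega> v" if "u \<in> V" "1 \<le> i" for u i
    using goodD(4)[OF g that(1), of "if u = v then Suc i else i"] that by (simp add: rr)
  show ?thesis unfolding good_def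
    by (intro conjI ballI allI impI) (fact 1, erule (4) 2, fact 3, fact 4)
qed

lemma rings_residual:
  assumes g: "good T \<omega>" and v: "v = first \<omega>" and T: "wait \<omega> v < T"
  shows "rings \<omega> T = insert (v, 1) (later v ` rings (residual v \<omega>) (T - wait \<omega> v))"
    (is "_ = insert _ ?R")
proof -
  have vV: "v \<in> V" using first v by auto
  note rr = ring_residual[OF vV]
  have "e \<in> rings \<omega> T \<longleftrightarrow> e \<in> insert (v, 1) ?R" for e
  proof -
    obtain u i where e: "e = (u, i)" by (cases e)
    have *: "(u, i) \<in> ?R \<longleftrightarrow> u \<in> V \<and> 1 \<le> i \<and> (u = v \<longrightarrow> 2 \<le> i) \<and> ring \<omega> u i < T"
    proof
      assume "(u, i) \<in> ?R"
      then show "u \<in> V \<and> 1 \<le> i \<and> (u = v \<longrightarrow> 2 \<le> i) \<and> ring \<omega> u i < T"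
        by (auto simp: rings_def later_def rr[simplified])
    next
      assume *: "u \<in> V \<and> 1 \<le> i \<and> (u = v \<longrightarrow> 2 \<le> i) \<and> ring \<omega> u i < T"
      let ?i = "if u = v then i - 1 else i"
      have "(u, ?i) \<in> rings (residual v \<omega>) (T - wait \<omega> v)" 
        using * by (auto simp: rings_def rr[simplified])
      moreover have "later v (u, ?i) = (u, i)" using * by (auto simp: later_def)
      ultimately show "(u, i) \<in> ?R" by (metis image_eqI)
    qed
    show ?thesis
    proof (cases "e = (v, 1)")
      case True
      then show ?thesis using T vV ring_one[of \<omega> v] by (simp add: rings_def)
    next
      case False
      then show ?thesis using * e by (auto simp: rings_def)
    qed
  qed
  then show ?thesis by blast
qed

lemma ring_list_residual:
  assumes g: "good T \<omega>" and v: "v = first \<omega>" and T: "wait \<omega> v < T"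
  shows "ring_list \<omega> T = (v, 1) # map (later v) (ring_list (residual v \<omega>) (T - wait \<omega> v))"
    (is "_ = _ # map _ ?L")
proof (subst ring_list_unique[OF g], intro conjI)
  have vV: "v \<in> V" using first v by auto
  note rr = ring_residual[OF vV]
  note g' = good_residual[OF g v]
  note L = ring_list[OF g', of "T - wait \<omega> v"]
  show "set ((v, 1) # map (later v) ?L) = rings \<omega> T"
    unfolding rings_residual[OF assms] using L by simp
  define r r' where "r = (\<lambda>(v, i). ring \<omega> v i)" and "r' = (\<lambda>(u, i). ring (residual v \<omega>) u i)"
  have eq: "r (later v e) = r' e + wait \<omega> v" if "e \<in> set ?L" for e
    using that unfolding r_def r'_def L(2) by (auto simp: rings_def later_def rr[simplified])
  have "sorted_wrt (<) (map r' ?L)" using L(1) unfolding r'_def .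
  then have "sorted_wrt (<) (map (\<lambda>e. r' e + wait \<omega> v) ?L)"
    by (simp add: sorted_wrt_map)
  also have "map (\<lambda>e. r' e + wait \<omega> v) ?L = map r (map (later v) ?L)"
    using eq by simp
  finally have "sorted_wrt (<) (map r (map (later v) ?L))" .
  moreover have "r (v, 1) < r e" if "e \<in> set (map (later v) ?L)" for e
  proof -
    obtain e' where e': "e' \<in> set ?L" "e = later v e'" using \<open>e \<in> _\<close> by auto
    then have "0 < r' e'" using good_ring_pos[OF g'] unfolding L(2) r'_def by (auto simp: rings_def)
    then show ?thesis using eq[OF e'(1)] e'(2) ring_one[of \<omega> v] by (simp add: r_def)
  qed
  ultimately have "sorted_wrt (<) (map r ((v, 1) # map (later v) ?L))" by simp
  then show "sorted_wrt (<) (map (\<lambda>(v, i). ring \<omega> v i) ((v, 1) # map (later v) ?L))"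
    unfolding r_def .
qed

lemma ring_list_Nil:
  assumes g: "good T \<omega>" and T: "\<not> wait \<omega> (first \<omega>) < T"
  shows "ring_list \<omega> T = []"
proof -
  have "rings \<omega> T = {}"
  proof -
    have False if "v \<in> V" "1 \<le> i" "ring \<omega> v i < T" for v i
    proof -
      have "ring \<omega> v 1 \<le> ring \<omega> v i" using good_ring_less[OF g that(1), of 1 i] that(2) by (cases "i = 1") auto
      then show False using that first(2)[OF that(1), of \<omega>] T unfolding ring_one by linarith
    qed
    then show ?thesis by (auto simp: rings_def)
  qed
  then show ?thesis using ring_list[OF g, of T] by simp
qed

lemma snd_residual:
  assumes "e \<in> I" "v \<in> V"
  shows "snd (residual v \<omega> e) = snd (\<omega> (later v e))"
  using assms by (auto simp: residual_def shift_def later_def split: prod.splits)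

text \<open>Residual tapes carry shortened waiting times but the original proposals and coins, so a
  step that ignores the waiting time sees the same input in both descriptions.\<close>

lemma run_eq_fold:
  assumes step: "\<And>s v x y m. step s v (x, m) = step s v (y, m)"
    and "good T \<omega>" "length (ring_list \<omega> T) \<le> k"
  shows "run step k s T \<omega> = fold (\<lambda>e s. step s (fst e) (\<omega> e)) (ring_list \<omega> T) s"
  using assms(2,3)
proof (induction k arbitrary: s T \<omega>)
  case 0
  then show ?case by simp
next
  case (Suc k)
  define v where "v = first \<omega>"
  have vV: "v \<in> V" using first v_def by auto
  show ?case
  proof (cases "wait \<omega> v < T")
    case True
    let ?L = "ring_list (residual v \<omega>) (T - wait \<omega> v)"
    note g' = good_residual[OF Suc.prems(1) v_def]
    have L: "ring_list \<omega> T = (v, 1) # map (later v) ?L"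
      by (rule ring_list_residual[OF Suc.prems(1) v_def True])
    have "run step (Suc k) s T \<omega> = run step k (step s v (\<omega> (v, 1))) (T - wait \<omega> v) (residual v \<omega>)"
      using True by (simp add: v_def Let_def)
    also have "\<dots> = fold (\<lambda>e s. step s (fst e) (residual v \<omega> e)) ?L (step s v (\<omega> (v, 1)))"
      using Suc.prems L by (intro Suc.IH g') simp
    also have "\<dots> = fold (\<lambda>e s. step s (fst (later v e)) (\<omega> (later v e))) ?L (step s v (\<omega> (v, 1)))"
    proof (intro fold_cong refl ext)
      fix e s assume "e \<in> set ?L"
      then have "e \<in> I" using ring_list(2)[OF g'] rings_subset by blast
      then have "snd (residual v \<omega> e) = snd (\<omega> (later v e))" by (intro snd_residual vV)
      moreover have "fst (later v e) = fst e" by (simp add: later_def split: prod.splits)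
      ultimately show "step s (fst e) (residual v \<omega> e) = step s (fst (later v e)) (\<omega> (later v e))"
        using step by (metis prod.collapse)
    qed
    also have "\<dots> = fold (\<lambda>e s. step s (fst e) (\<omega> e)) (ring_list \<omega> T) s"
      unfolding L by (simp add: fold_map comp_def)
    finally show ?thesis .
  next
    case False
    then show ?thesis using ring_list_Nil[OF Suc.prems(1)] by (simp add: v_def Let_def)
  qed
qed

end

text \<open>\<open>run\<close> reaches its final state after a number of steps that depends on the
  tape, so no single \<open>k\<close> will do. The events of being bad from step \<open>n\<close> on
  increase with \<open>n\<close>, and each lies in a bad event of probability at most
  \<open>p\<close>.\<close>

lemma liminf_bad_le:
  assumes f: "\<And>k. f k \<in> M \<rightarrow>\<^sub>M count_space UNIV"
    and le: "\<And>k::nat. (\<integral>\<^sup>+\<omega>. indicator B (f k \<omega>) \<partial>M) \<le> p"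
  shows "\<exists>A\<in>sets M. emeasure M A \<le> p \<and> (\<forall>\<omega>\<in>space M. (\<exists>n. \<forall>k\<ge>n. f k \<omega> \<in> B) \<longrightarrow> \<omega> \<in> A)"
proof -
  define S where "S k = f k -` B \<inter> space M" for k
  define A where "A n = (\<Inter>k\<in>{n..}. S k)" for n
  have S: "S k \<in> sets M" for k unfolding S_def by (rule measurable_sets[OF f]) simp
  have A: "A n \<in> sets M" for n unfolding A_def by (intro sets.countable_INT) (auto simp: S)
  have "incseq A" unfolding A_def by (intro monoI INF_superset_mono) auto
  then have "emeasure M (\<Union>n. A n) = (SUP n. emeasure M (A n))"
    using A by (intro SUP_emeasure_incseq[symmetric]) auto
  also have "\<dots> \<le> p"
  proof (rule SUP_least)
    fix n
    have "emeasure M (A n) \<le> emeasure M (S n)" using S by (intro emeasure_mono) (auto simp: A_def)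
    also have "\<dots> = (\<integral>\<^sup>+\<omega>. indicator (S n) \<omega> \<partial>M)" using S by simp
    also have "\<dots> = (\<integral>\<^sup>+\<omega>. indicator B (f n \<omega>) \<partial>M)"
      by (intro nn_integral_cong) (auto simp: S_def indicator_def)
    finally show "emeasure M (A n) \<le> p" using le[of n] by simp
  qed
  finally have "emeasure M (\<Union>n. A n) \<le> p" .
  moreover have "\<omega> \<in> (\<Union>n. A n)" if "\<omega> \<in> space M" "\<exists>n. \<forall>k\<ge>n. f k \<omega> \<in> B" for \<omega>
    using that by (auto simp: A_def S_def)
  ultimately show ?thesis using A by (intro bexI[of _ "\<Union>n. A n"]) auto
qed

text \<open>Provides a measurable version of the final state of \<open>run\<close>: the sequence is
  evaluated at the first index from which it is constant. Where it never becomes constant, nothing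
  is claimed about the value.\<close>

lemma eventual_value_measurable:
  fixes f :: "nat \<Rightarrow> 'a \<Rightarrow> 's::countable"
  assumes f: "\<And>k. f k \<in> M \<rightarrow>\<^sub>M count_space UNIV"
  obtains F where "F \<in> M \<rightarrow>\<^sub>M count_space UNIV"
    "\<And>\<omega> s n. \<omega> \<in> space M \<Longrightarrow> (\<And>k. n \<le> k \<Longrightarrow> f k \<omega> = s) \<Longrightarrow> F \<omega> = s"
proof -
  define L where "L \<omega> = (LEAST n. \<forall>k. n \<le> k \<longrightarrow> f k \<omega> = f n \<omega>)" for \<omega>
  have eq: "Measurable.pred M (\<lambda>\<omega>. f k \<omega> = f n \<omega>)" for k n
  proof -
    have "{\<omega>\<in>space M. f k \<omega> = f n \<omega>} = (\<Union>s. (f k -` {s} \<inter> space M) \<inter> (f n -` {s} \<inter> space M))" by auto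
    also have "\<dots> \<in> sets M"
      by (intro sets.countable_UN'' sets.Int measurable_sets[OF f]) auto
    finally show ?thesis by (simp add: pred_def)
  qed
  have "L \<in> M \<rightarrow>\<^sub>M count_space UNIV"
    unfolding L_def[abs_def]
  proof (rule measurable_Least)
    fix n
    have "Measurable.pred M (\<lambda>\<omega>. n \<le> k \<longrightarrow> f k \<omega> = f n \<omega>)" for k
      by (cases "n \<le> k") (simp_all add: eq)
    then show "Measurable.pred M (\<lambda>\<omega>. \<forall>k. n \<le> k \<longrightarrow> f k \<omega> = f n \<omega>)"
      by (rule pred_intros_countable(1))
  qed
  then have "(\<lambda>\<omega>. f (L \<omega>) \<omega>) \<in> M \<rightarrow>\<^sub>M count_space UNIV"
    by (rule measurable_compose_countable[OF f])
  moreover have "f (L \<omega>) \<omega> = s" if "\<And>k. n \<le> k \<Longrightarrow> f k \<omega> = s" for \<omega> s n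
  proof -
    have "\<forall>k. n \<le> k \<longrightarrow> f k \<omega> = f n \<omega>" using that by simp
    then have "\<forall>k. L \<omega> \<le> k \<longrightarrow> f k \<omega> = f (L \<omega>) \<omega>" unfolding L_def by (rule LeastI)
    then show ?thesis using that by (metis max.cobounded1 max.cobounded2)
  qed
  ultimately show ?thesis using that by blast
qed

section \<open>Exponential integrals behind the two supersolutions, and the resulting tail
  bounds\<close>

lemma nn_integral_expo_exp:
  fixes n :: real
  assumes "1 \<le> n" "0 \<le> \<kappa>" "0 \<le> T"
  shows "(\<integral>\<^sup>+x. ennreal (exp (- (n - 1) * x)) * (indicator {..<T} x * ennreal (exp (\<kappa> * (T - x)))) \<partial>expo) \<le>
    ennreal ((exp (\<kappa> * T) - exp (- n * T)) / (n + \<kappa>))"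
proof -
  let ?f = "\<lambda>x. exp (\<kappa> * T - (n + \<kappa>) * x)"
  let ?F = "\<lambda>x. - exp (\<kappa> * T - (n + \<kappa>) * x) / (n + \<kappa>)"
  have "(\<integral>\<^sup>+x. ennreal (exp (- (n - 1) * x)) * (indicator {..<T} x * ennreal (exp (\<kappa> * (T - x)))) \<partial>expo) \<le>
      (\<integral>\<^sup>+x. ennreal (?f x) * indicator {0..T} x \<partial>lborel)"
  proof (subst nn_integral_expo, measurable, intro nn_integral_mono)
    fix x :: real
    have e: "exp (- x) * (exp (- (n - 1) * x) * exp (\<kappa> * (T - x))) = ?f x"
      unfolding exp_add[symmetric] by (simp add: algebra_simps)
    have "ennreal (exp (- x)) * (ennreal (exp (- (n - 1) * x)) * ennreal (exp (\<kappa> * (T - x)))) = ennreal (?f x)"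
      unfolding e[symmetric] by (simp add: ennreal_mult)
    then show "ennreal (exp (- x)) * indicator {0..} x * (ennreal (exp (- (n - 1) * x)) * (indicator {..<T} x * ennreal (exp (\<kappa> * (T - x))))) \<le> ennreal (?f x) * indicator {0..T} x"
      by (auto simp: indicator_def)
  qed
  also have "\<dots> = ennreal (?F T - ?F 0)"
  proof (rule nn_integral_FTC_Icc)
    fix x
    have "- (exp (\<kappa> * T - (n + \<kappa>) * x) * (- (n + \<kappa>))) / (n + \<kappa>) = ?f x"
    proof -
      have "0 < n + \<kappa>" using assms by linarith
      then have "- (y * - (n + \<kappa>)) / (n + \<kappa>) = y" for y by (simp del: minus_add_distrib)
      then show ?thesis .
    qed
    moreover have "(?F has_real_derivative - (exp (\<kappa> * T - (n + \<kappa>) * x) * (- (n + \<kappa>))) / (n + \<kappa>)) (at x)"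
    proof -
      have "0 < n + \<kappa>" using assms by linarith
      then show ?thesis by (auto intro!: derivative_eq_intros)
    qed
    ultimately show "(?F has_real_derivative ?f x) (at x)" by (rule DERIV_cong[rotated])
  qed (use assms in auto)
  also have "?F T - ?F 0 = (exp (\<kappa> * T) - exp (- n * T)) / (n + \<kappa>)"
  proof -
    have "\<kappa> * T - (n + \<kappa>) * T = - n * T" by (simp add: algebra_simps)
    then show ?thesis by (simp add: diff_divide_distrib)
  qed
  finally show ?thesis .
qed

text \<open>The weight \<open>1 + n * (T - x)\<close> makes the integrand the derivative of
  \<open>- exp (- n * x) * (T - x)\<close>, which vanishes at \<open>T\<close>.\<close>

lemma nn_integral_expo_linear:
  fixes n :: real
  assumes "1 \<le> n" "0 \<le> T"
  shows "(\<integral>\<^sup>+x. ennreal (exp (- (n - 1) * x)) * (indicator {..<T} x * ennreal (1 + n * (T - x))) \<partial>expo) \<le> ennreal T"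
proof -
  let ?f = "\<lambda>x. exp (- n * x) * (1 + n * (T - x))"
  let ?F = "\<lambda>x. - exp (- n * x) * (T - x)"
  have "(\<integral>\<^sup>+x. ennreal (exp (- (n - 1) * x)) * (indicator {..<T} x * ennreal (1 + n * (T - x))) \<partial>expo) \<le>
      (\<integral>\<^sup>+x. ennreal (?f x) * indicator {0..T} x \<partial>lborel)"
  proof (subst nn_integral_expo, measurable, intro nn_integral_mono)
    fix x :: real
    have e: "exp (- x) * exp (- (n - 1) * x) = exp (- n * x)"
      unfolding exp_add[symmetric] by (simp add: algebra_simps)
    have "ennreal (exp (- x)) * (ennreal (exp (- (n - 1) * x)) * ennreal (1 + n * (T - x))) = ennreal (?f x)" if "x < T"
    proof -
      have "0 \<le> 1 + n * (T - x)" using that assms by simp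
      then show ?thesis unfolding e[symmetric] by (simp add: ennreal_mult mult.assoc)
    qed
    then show "ennreal (exp (- x)) * indicator {0..} x * (ennreal (exp (- (n - 1) * x)) * (indicator {..<T} x * ennreal (1 + n * (T - x)))) \<le> ennreal (?f x) * indicator {0..T} x"
      by (auto simp: indicator_def)
  qed
  also have "\<dots> = ennreal (?F T - ?F 0)"
  proof (rule nn_integral_FTC_Icc)
    fix x
    show "(?F has_real_derivative ?f x) (at x)"
      by (auto intro!: derivative_eq_intros simp: algebra_simps)
    assume "x \<in> {0..T}"
    then show "0 \<le> ?f x" using assms by (intro mult_nonneg_nonneg add_nonneg_nonneg) auto
  qed (use assms in auto)
  finally show ?thesis by simp
qed

lemma nn_integral_expo_small:
  fixes n :: real
  assumes "1 \<le> n" "0 \<le> \<epsilon>"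
  shows "(\<integral>\<^sup>+x. ennreal (exp (- (n - 1) * x)) * indicator {..<\<epsilon>} x \<partial>expo) \<le> ennreal \<epsilon>"
proof -
  have "(\<integral>\<^sup>+x. ennreal (exp (- (n - 1) * x)) * indicator {..<\<epsilon>} x \<partial>expo) \<le>
      (\<integral>\<^sup>+x. indicator {0..\<epsilon>} x \<partial>lborel)"
  proof (subst nn_integral_expo, measurable, intro nn_integral_mono)
    fix x :: real
    show "ennreal (exp (- x)) * indicator {0..} x * (ennreal (exp (- (n - 1) * x)) * indicator {..<\<epsilon>} x) \<le> indicator {0..\<epsilon>} x"
    proof (cases "0 \<le> x")
      case True
      have "exp (- x) * exp (- (n - 1) * x) \<le> 1 * 1"
      proof (intro mult_mono)
        have "0 \<le> (n - 1) * x" using True assms by simp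
        then show "exp (- (n - 1) * x) \<le> 1" unfolding exp_le_one_iff mult_minus_left by simp
      qed (use True in auto)
      then have "ennreal (exp (- x)) * ennreal (exp (- (n - 1) * x)) \<le> 1"
        by (simp flip: ennreal_mult)
      then show ?thesis by (auto simp: indicator_def)
    qed simp
  qed
  also have "\<dots> = ennreal \<epsilon>" using assms by simp
  finally show ?thesis .
qed

context clocks
begin

lemma measurable_fst_K: "fst \<in> K (v, i) \<rightarrow>\<^sub>M borel"
  unfolding K_apply using measurable_fst[of expo "N v"] unfolding measurable_cong_sets[OF refl sets_expo] .

lemma nn_integral_K_mult:
  assumes g: "g \<in> borel_measurable borel" and h: "h \<in> borel_measurable (N v)"
  shows "(\<integral>\<^sup>+z. g (fst z) * h (snd z) \<partial>K (v, i)) = (\<integral>\<^sup>+x. g x \<partial>expo) * (\<integral>\<^sup>+m. h m \<partial>N v)"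
proof -
  interpret N: prob_space "N v" by (rule prob_N)
  have g': "g \<in> borel_measurable expo" using g by (simp add: expo_def)
  have "(\<lambda>z. g (fst z) * h (snd z)) \<in> borel_measurable (expo \<Otimes>\<^sub>M N v)"
    by (intro borel_measurable_times_ennreal measurable_compose[OF measurable_fst g'] measurable_compose[OF measurable_snd h])
  then have "(\<integral>\<^sup>+z. g (fst z) * h (snd z) \<partial>K (v, i)) = (\<integral>\<^sup>+x. \<integral>\<^sup>+m. g x * h m \<partial>N v \<partial>expo)"
    unfolding K_apply by (subst N.nn_integral_fst[symmetric]) auto
  also have "\<dots> = (\<integral>\<^sup>+x. g x \<partial>expo) * (\<integral>\<^sup>+m. h m \<partial>N v)"
    using g' h by (simp add: nn_integral_cmult nn_integral_multc)
  finally show ?thesis .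
qed

lemma nn_integral_K_fst:
  assumes "g \<in> borel_measurable borel"
  shows "(\<integral>\<^sup>+z. g (fst z) \<partial>K (v, i)) = (\<integral>\<^sup>+x. g x \<partial>expo)"
  using nn_integral_K_mult[OF assms, of "\<lambda>_. 1" v i] prob_space.emeasure_space_1[OF prob_N[of v]] by simp

lemma card_V: "1 \<le> card V"
  using finV V_ne by (simp add: Suc_le_eq card_gt_0_iff)

lemma real_card_V: "real (card V - 1) = real (card V) - 1"
  using card_V by simp

text \<open>Markov's inequality for the potential at time \<open>T\<close>, phrased as a
  supersolution. Write \<open>n\<close> for \<open>card V\<close>. The factor
  \<open>n + \<kappa>\<close> of the generator cancels the denominator in
  \<open>nn_integral_expo_exp\<close>; what remains,
  \<open>exp (\<kappa> * T) - exp (- n * T)\<close>, is completed to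
  \<open>exp (\<kappa> * T)\<close> by the event without a ring.\<close>

theorem run_potential_le:
  fixes step :: "'s::countable \<Rightarrow> nat \<Rightarrow> real \<times> nat \<times> real \<Rightarrow> 's"
  assumes step: "\<And>s v. v \<in> V \<Longrightarrow> step s v \<in> K (v, 1) \<rightarrow>\<^sub>M count_space UNIV"
    and indep: "\<And>s v x y m. step s v (x, m) = step s v (y, m)"
    and base: "\<And>s. s \<in> B \<Longrightarrow> b \<le> \<Phi> s" and b: "0 < b" and nonneg: "\<And>s. 0 \<le> \<Phi> s"
    and gen: "\<And>s. (\<Sum>v\<in>V. \<integral>\<^sup>+m. ennreal (\<Phi> (step s v (0, m))) \<partial>N v) \<le> ennreal ((real (card V) + \<kappa>) * \<Phi> s)"
    and \<kappa>: "0 \<le> \<kappa>" and T: "0 \<le> T"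
  shows "(\<integral>\<^sup>+\<omega>. indicator B (run step k s T \<omega>) \<partial>\<mu>) \<le> ennreal (\<Phi> s * exp (\<kappa> * T) / b)"
proof (rule run_bad_le[OF step _ _ T, where \<Psi>="\<lambda>s T. ennreal (\<Phi> s * exp (\<kappa> * T) / b)"])
  fix s T assume T: "0 \<le> (T::real)" and "s \<in> B"
  then have "b * 1 \<le> \<Phi> s * exp (\<kappa> * T)" using base b \<kappa> nonneg by (intro mult_mono) auto
  then have "1 \<le> \<Phi> s * exp (\<kappa> * T) / b" using b by (simp add: field_simps)
  then show "1 \<le> ennreal (\<Phi> s * exp (\<kappa> * T) / b)" by (simp flip: ennreal_1 add: ennreal_leI)
next
  fix s T assume T: "0 \<le> (T::real)"
  let ?n = "real (card V)"
  have n: "1 \<le> ?n" using card_V by simp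
  have mP: "(\<lambda>m. ennreal (\<Phi> (step s v (0, m)) / b)) \<in> borel_measurable (N v)" if "v \<in> V" for v
  proof -
    have "Pair 0 \<in> N v \<rightarrow>\<^sub>M K (v, 1)" unfolding K_apply by (intro measurable_Pair1') simp
    from measurable_compose[OF measurable_compose[OF this step[OF that]], of "\<lambda>s. ennreal (\<Phi> s / b)"]
    show ?thesis by simp
  qed
  have int: "(\<integral>\<^sup>+z. ennreal (exp (- real (card V - 1) * fst z)) *
      (indicator {..<T} (fst z) * ennreal (\<Phi> (step s v z) * exp (\<kappa> * (T - fst z)) / b)) \<partial>K (v, 1)) \<le>
      ennreal ((exp (\<kappa> * T) - exp (- ?n * T)) / (?n + \<kappa>)) * (\<integral>\<^sup>+m. ennreal (\<Phi> (step s v (0, m)) / b) \<partial>N v)"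
    if v: "v \<in> V" for v
  proof -
    have "(\<integral>\<^sup>+z. ennreal (exp (- real (card V - 1) * fst z)) *
      (indicator {..<T} (fst z) * ennreal (\<Phi> (step s v z) * exp (\<kappa> * (T - fst z)) / b)) \<partial>K (v, 1)) =
      (\<integral>\<^sup>+z. (ennreal (exp (- (?n - 1) * fst z)) * (indicator {..<T} (fst z) * ennreal (exp (\<kappa> * (T - fst z))))) *
        ennreal (\<Phi> (step s v (0, snd z)) / b) \<partial>K (v, 1))"
      unfolding real_card_V
    proof (intro nn_integral_cong)
      fix z :: "real \<times> nat \<times> real"
      have "step s v z = step s v (0, snd z)" using indep by (metis prod.collapse)
      moreover have "ennreal (\<Phi> s' * exp (\<kappa> * (T - fst z)) / b) = ennreal (exp (\<kappa> * (T - fst z))) * ennreal (\<Phi> s' / b)" for s'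
        using nonneg b by (subst ennreal_mult[symmetric]) (auto simp: less_imp_le mult.commute)
      ultimately show "ennreal (exp (- (?n - 1) * fst z)) *
          (indicator {..<T} (fst z) * ennreal (\<Phi> (step s v z) * exp (\<kappa> * (T - fst z)) / b)) =
          (ennreal (exp (- (?n - 1) * fst z)) * (indicator {..<T} (fst z) * ennreal (exp (\<kappa> * (T - fst z))))) *
        ennreal (\<Phi> (step s v (0, snd z)) / b)"
        by (simp only: mult.assoc)
    qed
    also have "\<dots> = (\<integral>\<^sup>+x. ennreal (exp (- (?n - 1) * x)) * (indicator {..<T} x * ennreal (exp (\<kappa> * (T - x)))) \<partial>expo) *
       (\<integral>\<^sup>+m. ennreal (\<Phi> (step s v (0, m)) / b) \<partial>N v)"
      by (rule nn_integral_K_mult[OF _ mP[OF v]]) measurable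
    also have "\<dots> \<le> ennreal ((exp (\<kappa> * T) - exp (- ?n * T)) / (?n + \<kappa>)) * (\<integral>\<^sup>+m. ennreal (\<Phi> (step s v (0, m)) / b) \<partial>N v)"
      by (intro mult_right_mono nn_integral_expo_exp n \<kappa> T) simp
    finally show ?thesis .
  qed
  have pos: "0 \<le> exp (\<kappa> * T) - exp (- ?n * T)"
  proof -
    have "- ?n * T \<le> 0" "0 \<le> \<kappa> * T" using T \<kappa> by auto
    then show ?thesis by simp
  qed
  have "(\<Sum>v\<in>V. \<integral>\<^sup>+m. ennreal (\<Phi> (step s v (0, m)) / b) \<partial>N v) = ennreal (1 / b) * (\<Sum>v\<in>V. \<integral>\<^sup>+m. ennreal (\<Phi> (step s v (0, m))) \<partial>N v)"
    unfolding sum_distrib_left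
  proof (rule sum.cong[OF refl])
    fix v assume v: "v \<in> V"
    have "(\<lambda>m. ennreal (\<Phi> (step s v (0, m)))) \<in> borel_measurable (N v)"
    proof -
      have "Pair 0 \<in> N v \<rightarrow>\<^sub>M K (v, 1)" unfolding K_apply by (intro measurable_Pair1') simp
      from measurable_compose[OF measurable_compose[OF this step[OF v]], of "\<lambda>s. ennreal (\<Phi> s)"]
      show ?thesis by simp
    qed
    then show "(\<integral>\<^sup>+m. ennreal (\<Phi> (step s v (0, m)) / b) \<partial>N v) = ennreal (1 / b) * (\<integral>\<^sup>+m. ennreal (\<Phi> (step s v (0, m))) \<partial>N v)"
      using b nonneg by (subst nn_integral_cmult[symmetric]) (auto simp: ennreal_mult[symmetric])
  qed
  also have "\<dots> \<le> ennreal (1 / b) * ennreal ((?n + \<kappa>) * \<Phi> s)"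
    by (intro mult_left_mono gen) simp
  also have "\<dots> = ennreal ((?n + \<kappa>) * \<Phi> s / b)"
    using b nonneg n \<kappa> by (subst ennreal_mult[symmetric]) auto
  finally have sum: "(\<Sum>v\<in>V. \<integral>\<^sup>+m. ennreal (\<Phi> (step s v (0, m)) / b) \<partial>N v) \<le> ennreal ((?n + \<kappa>) * \<Phi> s / b)" .
  have "(\<Sum>v\<in>V. \<integral>\<^sup>+z. ennreal (exp (- real (card V - 1) * fst z)) *
      (indicator {..<T} (fst z) * ennreal (\<Phi> (step s v z) * exp (\<kappa> * (T - fst z)) / b)) \<partial>K (v, 1)) \<le>
      (\<Sum>v\<in>V. ennreal ((exp (\<kappa> * T) - exp (- ?n * T)) / (?n + \<kappa>)) * (\<integral>\<^sup>+m. ennreal (\<Phi> (step s v (0, m)) / b) \<partial>N v))"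
    by (intro sum_mono int)
  also have "\<dots> \<le> ennreal ((exp (\<kappa> * T) - exp (- ?n * T)) / (?n + \<kappa>)) * ennreal ((?n + \<kappa>) * \<Phi> s / b)"
    unfolding sum_distrib_left[symmetric] by (intro mult_left_mono sum) simp
  also have "\<dots> = ennreal ((exp (\<kappa> * T) - exp (- ?n * T)) * (\<Phi> s / b))"
    using n \<kappa> pos nonneg b by (subst ennreal_mult[symmetric]) (auto simp: divide_simps)
  finally have 1: "(\<Sum>v\<in>V. \<integral>\<^sup>+z. ennreal (exp (- real (card V - 1) * fst z)) *
      (indicator {..<T} (fst z) * ennreal (\<Phi> (step s v z) * exp (\<kappa> * (T - fst z)) / b)) \<partial>K (v, 1)) \<le>
      ennreal ((exp (\<kappa> * T) - exp (- ?n * T)) * (\<Phi> s / b))" .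
  have "indicator B s \<le> \<Phi> s / b" using base[of s] b nonneg[of s] by (auto simp: indicator_def)
  then have "exp (- ?n * T) * indicator B s \<le> exp (- ?n * T) * (\<Phi> s / b)" by (intro mult_left_mono) auto
  then have 2: "ennreal (exp (- ?n * T)) * indicator B s \<le> ennreal (exp (- ?n * T) * (\<Phi> s / b))"
    by (auto simp: indicator_def intro: ennreal_leI)
  have "ennreal (exp (- ?n * T)) * indicator B s + (\<Sum>v\<in>V. \<integral>\<^sup>+z. ennreal (exp (- real (card V - 1) * fst z)) *
      (indicator {..<T} (fst z) * ennreal (\<Phi> (step s v z) * exp (\<kappa> * (T - fst z)) / b)) \<partial>K (v, 1)) \<le>
     ennreal (exp (- ?n * T) * (\<Phi> s / b)) + ennreal ((exp (\<kappa> * T) - exp (- ?n * T)) * (\<Phi> s / b))"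
    by (intro add_mono 1 2)
  also have "\<dots> = ennreal (\<Phi> s * exp (\<kappa> * T) / b)"
  proof (subst ennreal_plus[symmetric])
    have "0 \<le> \<Phi> s / b" using nonneg b by simp
    then show "0 \<le> exp (- ?n * T) * (\<Phi> s / b)" "0 \<le> (exp (\<kappa> * T) - exp (- ?n * T)) * (\<Phi> s / b)"
      using pos by (intro mult_nonneg_nonneg; simp)+
  qed (simp add: algebra_simps)
  finally show "ennreal (exp (- ?n * T)) * indicator B s + (\<Sum>v\<in>V. \<integral>\<^sup>+z. ennreal (exp (- real (card V - 1) * fst z)) *
      (indicator {..<T} (fst z) * ennreal (\<Phi> (step s v z) * exp (\<kappa> * (T - fst z)) / b)) \<partial>K (v, 1)) \<le> ennreal (\<Phi> s * exp (\<kappa> * T) / b)" .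
qed

subsection \<open>Gaps between rings\<close>

text \<open>Along \<open>run\<close>, \<open>fst z\<close> is the time since the previous ring of
  any node, and at the start since time 0; the state remembers whether a short gap has
  occurred.\<close>

definition gap_step :: "real \<Rightarrow> bool \<Rightarrow> nat \<Rightarrow> real \<times> nat \<times> real \<Rightarrow> bool" where
  "gap_step \<epsilon> s v z \<longleftrightarrow> s \<or> fst z < \<epsilon>"

text \<open>Shaped like a union bound: with \<open>n\<close> for \<open>card V\<close>, a gap is
  short with probability at most \<open>n * \<epsilon>\<close>, and \<open>n * T\<close> rings are
  expected. By \<open>nn_integral_expo_linear\<close> the affine bound reproduces itself under the
  renewal step; after a short gap the bound is simply 1.\<close>

lemma run_gap_le:
  assumes \<epsilon>: "0 \<le> \<epsilon>" and T: "0 \<le> T"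
  shows "(\<integral>\<^sup>+\<omega>. indicator {True} (run (gap_step \<epsilon>) k False T \<omega>) \<partial>\<mu>) \<le> 
    ennreal (real (card V) * \<epsilon> * (1 + real (card V) * T))"
proof -
  let ?n = "real (card V)"
  have n: "1 \<le> ?n" using card_V by simp
  define \<Psi> where "\<Psi> s T = (if s then 1 else ennreal (?n * \<epsilon> * (1 + ?n * T)))" for s and T :: real
  have "(\<integral>\<^sup>+\<omega>. indicator {True} (run (gap_step \<epsilon>) k False T \<omega>) \<partial>\<mu>) \<le> \<Psi> False T"
  proof (rule run_bad_le[OF _ _ _ T])
    fix s v assume "v \<in> V"
    note [measurable] = measurable_fst_K[of v 1]
    show "gap_step \<epsilon> s v \<in> K (v, 1) \<rightarrow>\<^sub>M count_space UNIV"
      unfolding gap_step_def[abs_def] by measurable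
  next
    fix s T assume "s \<in> {True}"
    then show "1 \<le> \<Psi> s T" by (simp add: \<Psi>_def)
  next
    fix s T assume T: "0 \<le> (T::real)"
    let ?g1 = "\<lambda>x. ennreal (exp (- (?n - 1) * x)) * (indicator {..<T} x * ennreal (exp (0 * (T - x))))"
    let ?g2 = "\<lambda>x. ennreal (exp (- (?n - 1) * x)) * (indicator {..<T} x * ennreal (1 + ?n * (T - x)))"
    let ?g3 = "\<lambda>x. ennreal (exp (- (?n - 1) * x)) * indicator {..<\<epsilon>} x"
    let ?J = "\<lambda>v. \<integral>\<^sup>+z. ennreal (exp (- real (card V - 1) * fst z)) *
         (indicator {..<T} (fst z) * \<Psi> (gap_step \<epsilon> s v z) (T - fst z)) \<partial>K (v, 1)"
    show "ennreal (exp (- ?n * T)) * indicator {True} s + (\<Sum>v\<in>V. ?J v) \<le> \<Psi> s T"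
    proof (cases s)
      case True
      have "?J v = (\<integral>\<^sup>+z. ?g1 (fst z) \<partial>K (v, 1))" for v
        unfolding real_card_V using True by (intro nn_integral_cong) (simp add: \<Psi>_def gap_step_def)
      also have "\<dots> v = (\<integral>\<^sup>+x. ?g1 x \<partial>expo)" for v
        by (rule nn_integral_K_fst) measurable
      finally have J: "?J v = (\<integral>\<^sup>+x. ?g1 x \<partial>expo)" for v .
      have "?J v \<le> ennreal ((1 - exp (- ?n * T)) / ?n)" for v
        unfolding J using nn_integral_expo_exp[OF n, of 0 T] T by simp
      then have "(\<Sum>v\<in>V. ?J v) \<le> (\<Sum>v\<in>V. ennreal ((1 - exp (- ?n * T)) / ?n))" by (intro sum_mono)
      also have "\<dots> = ennreal (?n * ((1 - exp (- ?n * T)) / ?n))"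
        using T n by (subst ennreal_mult) (auto simp: ennreal_of_nat_eq_real_of_nat)
      also have "?n * ((1 - exp (- ?n * T)) / ?n) = 1 - exp (- ?n * T)" using n by simp
      finally have "(\<Sum>v\<in>V. ?J v) \<le> ennreal (1 - exp (- ?n * T))" .
      then have "ennreal (exp (- ?n * T)) * indicator {True} s + (\<Sum>v\<in>V. ?J v) \<le> 
          ennreal (exp (- ?n * T)) + ennreal (1 - exp (- ?n * T))"
        using True by (intro add_mono) auto
      also have "\<dots> = 1" using T n by (subst ennreal_plus[symmetric]) auto
      finally show ?thesis using True by (simp add: \<Psi>_def)
    next
      case False
      have "?J v \<le> (\<integral>\<^sup>+z. ?g3 (fst z) + ennreal (?n * \<epsilon>) * ?g2 (fst z) \<partial>K (v, 1))" for v
        unfolding real_card_V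
      proof (intro nn_integral_mono)
        fix z :: "real \<times> nat \<times> real"
        have "ennreal (?n * \<epsilon> * (1 + ?n * (T - fst z))) = ennreal (?n * \<epsilon>) * ennreal (1 + ?n * (T - fst z))" if "fst z < T"
          using that \<epsilon> n by (intro ennreal_mult) auto
        then show "ennreal (exp (- (?n - 1) * fst z)) *
         (indicator {..<T} (fst z) * \<Psi> (gap_step \<epsilon> s v z) (T - fst z)) \<le> ?g3 (fst z) + ennreal (?n * \<epsilon>) * ?g2 (fst z)"
          using False
          by (cases "fst z < \<epsilon>"; cases "fst z < T") (simp_all add: \<Psi>_def gap_step_def mult.left_commute add_increasing2)
      qed
      also have "\<dots> v = (\<integral>\<^sup>+x. ?g3 x + ennreal (?n * \<epsilon>) * ?g2 x \<partial>expo)" for v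
        by (rule nn_integral_K_fst[where g="\<lambda>x. ?g3 x + ennreal (?n * \<epsilon>) * ?g2 x"]) measurable
      also have "\<dots> = (\<integral>\<^sup>+x. ?g3 x \<partial>expo) + ennreal (?n * \<epsilon>) * (\<integral>\<^sup>+x. ?g2 x \<partial>expo)"
        by (subst nn_integral_add) (auto simp: nn_integral_cmult)
      also have "\<dots> \<le> ennreal \<epsilon> + ennreal (?n * \<epsilon>) * ennreal T"
        by (intro add_mono mult_left_mono nn_integral_expo_small nn_integral_expo_linear n \<epsilon> T) simp
      also have "\<dots> = ennreal (\<epsilon> + ?n * \<epsilon> * T)"
        using n \<epsilon> T by (simp add: ennreal_mult)
      finally have J: "?J v \<le> ennreal (\<epsilon> + ?n * \<epsilon> * T)" for v .
      have "(\<Sum>v\<in>V. ?J v) \<le> (\<Sum>v\<in>V. ennreal (\<epsilon> + ?n * \<epsilon> * T))" by (intro sum_mono J)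
      also have "\<dots> = ennreal (?n * \<epsilon> * (1 + ?n * T))"
        using n \<epsilon> T by (simp add: ennreal_of_nat_eq_real_of_nat ennreal_mult[symmetric] algebra_simps)
      finally show ?thesis using False by (simp add: \<Psi>_def)
    qed
  qed
  then show ?thesis by (simp add: \<Psi>_def)
qed

lemma run_gap_mono: "s \<Longrightarrow> run (gap_step \<epsilon>) k s T \<omega>"
  by (induction k arbitrary: s T \<omega>) (auto simp: Let_def gap_step_def)

text \<open>Peeling off the first ring keeps differences of ring times and turns the distance of a
  later ring from the first one into its own ring time on the residual tape. This is why the
  induction also claims \<open>\<epsilon> \<le> ring \<omega> u i\<close>.\<close>

lemma gap_separated:
  assumes "good T \<omega>" "length (ring_list \<omega> T) \<le> k" "\<not> run (gap_step \<epsilon>) k False T \<omega>" 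
  shows "\<forall>(u, i)\<in>rings \<omega> T. \<epsilon> \<le> ring \<omega> u i \<and>
    (\<forall>(v, j)\<in>rings \<omega> T. (u, i) \<noteq> (v, j) \<longrightarrow> \<epsilon> \<le> \<bar>ring \<omega> u i - ring \<omega> v j\<bar>)"
  using assms
proof (induction k arbitrary: T \<omega>)
  case 0
  then show ?case using ring_list(2)[OF 0(1), of T] by auto
next
  case (Suc k)
  define v where "v = first \<omega>"
  have vV: "v \<in> V" using first v_def by auto
  show ?case
  proof (cases "wait \<omega> v < T")
    case True
    let ?T = "T - wait \<omega> v" and ?\<omega> = "residual v \<omega>"
    note g' = good_residual[OF Suc.prems(1) v_def]
    have L: "ring_list \<omega> T = (v, 1) # map (later v) (ring_list ?\<omega> ?T)"
      by (rule ring_list_residual[OF Suc.prems(1) v_def True])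
    have w: "\<not> fst (\<omega> (v, 1)) < \<epsilon>" and r: "\<not> run (gap_step \<epsilon>) k False ?T ?\<omega>"
    proof -
      have "run (gap_step \<epsilon>) (Suc k) False T \<omega> =
          run (gap_step \<epsilon>) k (gap_step \<epsilon> False v (\<omega> (v, 1))) ?T ?\<omega>"
        using True by (simp add: Let_def v_def)
      with Suc.prems(3) have *: "\<not> run (gap_step \<epsilon>) k (gap_step \<epsilon> False v (\<omega> (v, 1))) ?T ?\<omega>" by simp
      then have g: "\<not> gap_step \<epsilon> False v (\<omega> (v, 1))" using run_gap_mono by blast
      then show "\<not> fst (\<omega> (v, 1)) < \<epsilon>" by (simp add: gap_step_def)
      show "\<not> run (gap_step \<epsilon>) k False ?T ?\<omega>" using * g by simp
    qed
    have IH: "\<forall>(u, i)\<in>rings ?\<omega> ?T. \<epsilon> \<le> ring ?\<omega> u i \<and>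
      (\<forall>(v, j)\<in>rings ?\<omega> ?T. (u, i) \<noteq> (v, j) \<longrightarrow> \<epsilon> \<le> \<bar>ring ?\<omega> u i - ring ?\<omega> v j\<bar>)"
      by (rule Suc.IH[OF g' _ r]) (use Suc.prems L in simp)
    define \<rho> where "\<rho> = (\<lambda>(u, i). ring \<omega> u i)"
    define \<rho>' where "\<rho>' = (\<lambda>(u, i). ring ?\<omega> u i)"
    have eq: "\<rho> (later v e) = \<rho>' e + wait \<omega> v" if "e \<in> rings ?\<omega> ?T" for e
      using that ring_residual[OF vV] unfolding \<rho>_def \<rho>'_def by (auto simp: rings_def later_def)
    have v1: "\<rho> (v, 1) = wait \<omega> v" unfolding \<rho>_def by (simp add: ring_one[simplified])
    have IH1: "\<epsilon> \<le> \<rho>' e" if "e \<in> rings ?\<omega> ?T" for e using IH that by (auto simp: \<rho>'_def)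
    have IH2: "\<epsilon> \<le> \<bar>\<rho>' e - \<rho>' e'\<bar>" if "e \<in> rings ?\<omega> ?T" "e' \<in> rings ?\<omega> ?T" "e \<noteq> e'" for e e'
      using IH that by (fastforce simp: \<rho>'_def)
    have we: "\<epsilon> \<le> wait \<omega> v" using w by (simp add: wait_def)
    have w0: "0 < wait \<omega> v" using goodD(1)[OF Suc.prems(1) vV, of 1] by (simp add: wait_def)
    have R: "e \<in> rings \<omega> T \<Longrightarrow> e = (v, 1) \<or> (\<exists>e'\<in>rings ?\<omega> ?T. e = later v e')" for e
      unfolding rings_residual[OF Suc.prems(1) v_def True] by auto
    have pos: "0 < \<rho>' e" if "e \<in> rings ?\<omega> ?T" for e
      using that good_ring_pos[OF g'] by (auto simp: rings_def \<rho>'_def)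
    have 1: "\<epsilon> \<le> \<rho> e" if "e \<in> rings \<omega> T" for e
      using R[OF that] eq v1 we IH1 w0 by force
    have 2: "\<epsilon> \<le> \<bar>\<rho> e - \<rho> e'\<bar>" if e: "e \<in> rings \<omega> T" "e' \<in> rings \<omega> T" "e \<noteq> e'" for e e'
    proof -
      consider "e = (v, 1)" "e' = (v, 1)" 
        | e1 where "e = (v, 1)" "e1 \<in> rings ?\<omega> ?T" "e' = later v e1"
        | e1 where "e' = (v, 1)" "e1 \<in> rings ?\<omega> ?T" "e = later v e1"
        | e1 e2 where "e1 \<in> rings ?\<omega> ?T" "e = later v e1" "e2 \<in> rings ?\<omega> ?T" "e' = later v e2"
        using R[OF e(1)] R[OF e(2)] by blast
      then show ?thesis
      proof cases
        case 1 then show ?thesis using e by simp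
      next
        case 2 then show ?thesis using eq[of e1] v1 IH1[of e1] by auto
      next
        case 3 then show ?thesis using eq[of e1] v1 IH1[of e1] by auto
      next
        case 4 then show ?thesis using eq[of e1] eq[of e2] IH2[of e1 e2] e by auto
      qed
    qed
    show ?thesis using 1 2 unfolding \<rho>_def by fastforce
  next
    case False
    then have "rings \<omega> T = {}"
      using ring_list_Nil[OF Suc.prems(1)] ring_list(2)[OF Suc.prems(1), of T] by (simp add: v_def)
    then show ?thesis by simp
  qed
qed

end

section \<open>Decisions with partial knowledge of the neighbours\<close>

text \<open>\<open>y u k\<close> and \<open>c u k\<close> are the state of \<open>u\<close> after its \<open>k\<close>-th update and the proposal of that update,
  \<open>n u\<close> is the number of updates of \<open>u\<close> that precede the update of \<open>v\<close> in question, and \<open>K u\<close> is the number of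
  updates of \<open>u\<close> whose outcome is known.\<close>

definition box :: "metropolis \<Rightarrow> nat \<Rightarrow> (nat \<Rightarrow> nat \<Rightarrow> nat) \<Rightarrow> (nat \<Rightarrow> nat \<Rightarrow> nat) \<Rightarrow> (nat \<Rightarrow> nat) \<Rightarrow> (nat \<Rightarrow> nat) \<Rightarrow> (nat \<Rightarrow> nat) set" where
  "box G v y c n K = (\<Pi>\<^sub>E u\<in>nbrs G v. insert (y u (min (K u) (n u))) (c u ` {K u<..n u}))"

text \<open>The tests against \<open>P_AC\<close> and \<open>P_RE\<close> in a form without
  \<open>Min\<close> and \<open>Max\<close>, which visibly survives shrinking \<open>A\<close>;
  \<open>decision_eq\<close> makes the link.\<close>

definition decided :: "metropolis \<Rightarrow> nat \<Rightarrow> nat \<Rightarrow> nat \<Rightarrow> real \<Rightarrow> (nat \<Rightarrow> nat) set \<Rightarrow> bool" where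
  "decided G v a b \<beta> A \<longleftrightarrow> (\<forall>\<sigma>\<in>A. \<forall>\<tau>\<in>A. (\<beta> < filt G v a b \<sigma>) = (\<beta> < filt G v a b \<tau>))"

lemma nbrs_subset:
  assumes "metropolis_system G" "u \<in> nbrs G v"
  shows "u \<in> verts G" "v \<in> verts G" "u \<noteq> v"
proof -
  have "{u, v} \<in> edges G" using assms(2) by (simp add: nbrs_def)
  moreover have "\<forall>e\<in>edges G. \<exists>a\<in>verts G. \<exists>b\<in>verts G. a \<noteq> b \<and> e = {a, b}"
    using assms(1) by (simp add: metropolis_system_def)
  ultimately obtain a b where "a \<in> verts G" "b \<in> verts G" "a \<noteq> b" "{u, v} = {a, b}" by blast
  then show "u \<in> verts G" "v \<in> verts G" "u \<noteq> v" by (auto simp: doubleton_eq_iff)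
qed

lemma nbrs_sym: "u \<in> nbrs G v \<longleftrightarrow> v \<in> nbrs G u"
  by (simp add: nbrs_def insert_commute)

lemma finite_nbrs: "metropolis_system G \<Longrightarrow> finite (nbrs G v)"
proof -
  assume sys: "metropolis_system G"
  then have "nbrs G v \<subseteq> verts G" using nbrs_subset(1) by blast
  then show ?thesis using sys by (auto simp: metropolis_system_def intro: finite_subset)
qed

lemma finite_colourings: "metropolis_system G \<Longrightarrow> finite (colourings G (nbrs G v))"
  unfolding colourings_def by (intro finite_PiE finite_nbrs) auto

lemma filt_range:
  assumes "metropolis_system G" "v \<in> verts G" "a \<in> {1..spins G}" "b \<in> {1..spins G}" "\<sigma> \<in> colourings G (nbrs G v)"
  shows "0 \<le> filt G v a b \<sigma>" "filt G v a b \<sigma> \<le> 1"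
  using assms unfolding metropolis_system_def by auto

lemma filt_diff_ge:
  assumes "metropolis_system G" "\<sigma> \<in> colourings G (nbrs G v)" "\<tau> \<in> colourings G (nbrs G v)"
    "\<And>w. w \<in> nbrs G v - {u} \<Longrightarrow> \<sigma> w = \<tau> w"
  shows "\<bar>filt G v a b \<sigma> - filt G v a b \<tau>\<bar> \<le> filt_diff G v u (\<sigma> u) (\<tau> u) a b"
  unfolding filt_diff_def
proof (rule Max_ge)
  let ?S = "colourings G (nbrs G v)"
  have "finite ((\<lambda>(\<sigma>, \<tau>). \<bar>filt G v a b \<sigma> - filt G v a b \<tau>\<bar>) ` (?S \<times> ?S))"
    using finite_colourings[OF assms(1)] by auto
  then show "finite {\<bar>filt G v a b \<sigma>' - filt G v a b \<tau>'\<bar> |\<sigma>' \<tau>'. \<sigma>' \<in> ?S \<and> \<tau>' \<in> ?S \<and>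
      \<sigma>' u = \<sigma> u \<and> \<tau>' u = \<tau> u \<and> (\<forall>w\<in>nbrs G v - {u}. \<sigma>' w = \<tau>' w)}"
    by (rule rev_finite_subset) auto
qed (use assms in blast)

lemma filt_diff_bounds:
  assumes sys: "metropolis_system G" and u: "u \<in> nbrs G v" and b: "b \<in> {1..spins G}" "b' \<in> {1..spins G}"
    and c: "c \<in> {1..spins G}" "c' \<in> {1..spins G}"
  shows "0 \<le> filt_diff G v u b b' c c'" "filt_diff G v u b b' c c' \<le> 1"
proof -
  let ?S = "colourings G (nbrs G v)"
  let ?X = "{\<bar>filt G v c c' \<sigma> - filt G v c c' \<tau>\<bar> |\<sigma> \<tau>. \<sigma> \<in> ?S \<and> \<tau> \<in> ?S \<and>
      \<sigma> u = b \<and> \<tau> u = b' \<and> (\<forall>w\<in>nbrs G v - {u}. \<sigma> w = \<tau> w)}"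
  have v: "v \<in> verts G" using nbrs_subset[OF sys u] by simp
  have fin: "finite ?X"
  proof -
    have "finite ((\<lambda>(\<sigma>, \<tau>). \<bar>filt G v c c' \<sigma> - filt G v c c' \<tau>\<bar>) ` (?S \<times> ?S))"
      using finite_colourings[OF sys] by auto
    then show ?thesis by (rule rev_finite_subset) auto
  qed
  \<comment> \<open>A constant colouring, to be changed at \<open>u\<close> alone: it witnesses that
    the set under \<open>Max\<close> is not empty.\<close>
  define \<sigma> where "\<sigma> = (\<lambda>w\<in>nbrs G v. if w = u then b else b)"
  have s: "\<sigma> \<in> ?S" "fun_upd \<sigma> u b' \<in> ?S" "\<sigma> u = b" using u b by (auto simp: \<sigma>_def colourings_def)
  have "\<bar>filt G v c c' \<sigma> - filt G v c c' (fun_upd \<sigma> u b')\<bar> \<le> filt_diff G v u (\<sigma> u) ((fun_upd \<sigma> u b') u) c c'"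
    by (rule filt_diff_ge[OF sys s(1,2)]) auto
  then show "0 \<le> filt_diff G v u b b' c c'" using s(3) by simp
  have "\<bar>filt G v c c' \<sigma> - filt G v c c' (fun_upd \<sigma> u b')\<bar> \<in> ?X"
    using s by (intro CollectI exI[of _ \<sigma>] exI[of _ "fun_upd \<sigma> u b'"]) auto
  then have ne: "?X \<noteq> {}" by blast
  have "x \<le> 1" if x: "x \<in> ?X" for x
  proof -
    obtain \<sigma> \<tau> where *: "x = \<bar>filt G v c c' \<sigma> - filt G v c c' \<tau>\<bar>" "\<sigma> \<in> ?S" "\<tau> \<in> ?S" using x by blast
    then show ?thesis using filt_range[OF sys v c *(2)] filt_range[OF sys v c *(3)] by simp
  qed
  then show "filt_diff G v u b b' c c' \<le> 1"
    unfolding filt_diff_def using fin ne by (subst Max_le_iff) auto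
qed

section \<open>Shrinking candidate sets, and the coins that they leave undecided\<close>

locale nbhd =
  fixes G v and y c :: "nat \<Rightarrow> nat \<Rightarrow> nat" and n :: "nat \<Rightarrow> nat"
  assumes sys: "metropolis_system G" and vV: "v \<in> verts G"
    and y_range: "u \<in> nbrs G v \<Longrightarrow> k \<le> n u \<Longrightarrow> y u k \<in> {1..spins G}"
    and c_range: "u \<in> nbrs G v \<Longrightarrow> 1 \<le> k \<Longrightarrow> k \<le> n u \<Longrightarrow> c u k \<in> {1..spins G}"
    and y_Suc: "u \<in> nbrs G v \<Longrightarrow> k < n u \<Longrightarrow> y u (Suc k) = y u k \<or> y u (Suc k) = c u (Suc k)"
begin

abbreviation bx where "bx \<equiv> box G v y c n"

definition entry :: "(nat \<Rightarrow> nat) \<Rightarrow> nat \<Rightarrow> nat set" where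
  "entry K u = insert (y u (min (K u) (n u))) (c u ` {K u<..n u})"

lemma bx_eq: "bx K = (\<Pi>\<^sub>E u\<in>nbrs G v. entry K u)"
  by (simp add: box_def entry_def)

lemma entry_range: "u \<in> nbrs G v \<Longrightarrow> entry K u \<subseteq> {1..spins G}"
  using y_range[of u "min (K u) (n u)"] c_range by (auto simp: entry_def)

lemma bx_colourings: "bx K \<subseteq> colourings G (nbrs G v)"
  unfolding bx_eq colourings_def using entry_range by (intro PiE_mono) auto

lemma finite_bx: "finite (bx K)"
  using bx_colourings finite_colourings[OF sys] by (rule finite_subset)

lemma bx_ne: "bx K \<noteq> {}"
  unfolding bx_eq by (auto simp: PiE_eq_empty_iff entry_def)

lemma y_reach:
  assumes "u \<in> nbrs G v" "k \<le> k'" "k' \<le> n u"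
  shows "y u k' \<in> insert (y u k) (c u ` {k<..n u})"
  using assms(2,3)
proof (induction k' rule: dec_induct)
  case (step m)
  then have "m < n u" by simp
  then show ?case using y_Suc[OF assms(1), of m] step by auto
qed simp

text \<open>The known state of \<open>u\<close> moves on when outcomes are learned, but by
  \<open>y_reach\<close> the new one is the old one or a proposal that was still pending.\<close>

lemma entry_antimono:
  assumes "u \<in> nbrs G v" "K u \<le> K' u"
  shows "entry K' u \<subseteq> entry K u"
proof (cases "K u \<le> n u")
  case True
  then have "y u (min (K' u) (n u)) \<in> entry K u"
    using y_reach[OF assms(1), of "K u" "min (K' u) (n u)"] assms(2) by (auto simp: entry_def)
  then show ?thesis using assms(2) by (auto simp: entry_def)
next
  case False
  then show ?thesis using assms(2) by (auto simp: entry_def)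
qed

lemma bx_antimono: "(\<And>u. u \<in> nbrs G v \<Longrightarrow> K u \<le> K' u) \<Longrightarrow> bx K' \<subseteq> bx K"
  unfolding bx_eq using entry_antimono by (intro PiE_mono) auto

lemma bx_full:
  assumes "\<And>u. u \<in> nbrs G v \<Longrightarrow> n u \<le> K u"
  shows "bx K = {\<lambda>u\<in>nbrs G v. y u (n u)}"
proof -
  have "bx K = (\<Pi>\<^sub>E u\<in>nbrs G v. {y u (n u)})"
    unfolding bx_eq using assms by (intro PiE_cong) (auto simp: entry_def min.absorb2)
  then show ?thesis by (simp add: PiE_singleton restrict_def fun_eq_iff) (auto simp: PiE_iff extensional_def fun_eq_iff)
qed

text \<open>Full knowledge leaves exactly the true configuration, and candidate sets only shrink, so
  the truth belongs to every one of them.\<close>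

lemma truth_in_bx: "(\<lambda>u\<in>nbrs G v. y u (n u)) \<in> bx K"
proof -
  have "bx (\<lambda>u. max (K u) (n u)) \<subseteq> bx K" by (rule bx_antimono) simp
  moreover have "bx (\<lambda>u. max (K u) (n u)) = {\<lambda>u\<in>nbrs G v. y u (n u)}" by (rule bx_full) simp
  ultimately show ?thesis by simp
qed

lemma decided_full: "(\<And>u. u \<in> nbrs G v \<Longrightarrow> n u \<le> K u) \<Longrightarrow> decided G v a b \<beta> (bx K)"
  by (simp add: bx_full decided_def)

lemma decided_mono: "decided G v a b \<beta> (bx K) \<Longrightarrow> (\<And>u. u \<in> nbrs G v \<Longrightarrow> K u \<le> K' u) \<Longrightarrow> decided G v a b \<beta> (bx K')"
  using bx_antimono[of K K'] unfolding decided_def by blast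

text \<open>Learning one more outcome of \<open>u\<close> removes one of the two candidates \<open>y u k\<close> and \<open>c u (Suc k)\<close>, so the
  filter moves by a single \<open>filt_diff\<close> rather than by a maximum over all candidates.\<close>

lemma approx_step:
  assumes u: "u \<in> nbrs G v" and K: "K u < n u" and \<tau>: "\<tau> \<in> bx K"
    and a: "a \<in> {1..spins G}" and b: "b \<in> {1..spins G}"
  shows "\<exists>\<tau>'\<in>bx (fun_upd K u (Suc (K u))). \<bar>filt G v a b \<tau> - filt G v a b \<tau>'\<bar> \<le>
    filt_diff G v u (y u (K u)) (c u (Suc (K u))) a b"
proof -
  let ?K = "fun_upd K u (Suc (K u))" and ?\<delta> = "filt_diff G v u (y u (K u)) (c u (Suc (K u))) a b"
  have yc: "y u (K u) \<in> {1..spins G}" "c u (Suc (K u)) \<in> {1..spins G}"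
    using y_range[OF u, of "K u"] c_range[OF u, of "Suc (K u)"] K by auto
  have \<delta>: "0 \<le> ?\<delta>" by (rule filt_diff_bounds(1)[OF sys u yc a b])
  have e1: "entry K u = insert (y u (K u)) (insert (c u (Suc (K u))) (c u ` {Suc (K u)<..n u}))"
  proof -
    have "{K u<..n u} = insert (Suc (K u)) {Suc (K u)<..n u}" using K by auto
    then show ?thesis using K by (simp add: entry_def)
  qed
  have e2: "entry ?K u = insert (y u (Suc (K u))) (c u ` {Suc (K u)<..n u})"
    using K by (simp add: entry_def min_def)
  have e3: "entry ?K w = entry K w" if "w \<noteq> u" for w using that by (simp add: entry_def)
  show ?thesis
  proof (cases "\<tau> u \<in> entry ?K u")
    case True
    have "\<tau> \<in> bx ?K"
      using \<tau> True e3 unfolding bx_eq PiE_iff by (metis fun_upd_other)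
    then show ?thesis using \<delta> by (intro bexI[of _ \<tau>]) auto
  next
    case False
    have \<tau>u: "\<tau> u \<in> entry K u" using \<tau> u unfolding bx_eq by auto
    let ?\<tau> = "fun_upd \<tau> u (y u (Suc (K u)))"
    have t': "?\<tau> \<in> bx ?K"
      using \<tau> u e2 e3 unfolding bx_eq PiE_iff extensional_def by auto
    have col: "\<tau> \<in> colourings G (nbrs G v)" "?\<tau> \<in> colourings G (nbrs G v)"
      using \<tau> t' bx_colourings by blast+
    \<comment> \<open>The outcome keeps one of the two candidates \<open>y u (K u)\<close> and
      \<open>c u (Suc (K u))\<close>. As \<open>\<tau> u\<close> has dropped out, it is one of them,
      and the resolved state, which replaces it, is the other.\<close>
    have "(\<tau> u = y u (K u) \<and> ?\<tau> u = c u (Suc (K u))) \<or> (\<tau> u = c u (Suc (K u)) \<and> ?\<tau> u = y u (K u))"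
      using y_Suc[OF u K] False \<tau>u unfolding e1 e2 by auto
    then have "\<bar>filt G v a b \<tau> - filt G v a b ?\<tau>\<bar> \<le> ?\<delta>"
    proof
      assume "\<tau> u = y u (K u) \<and> ?\<tau> u = c u (Suc (K u))"
      then show ?thesis using filt_diff_ge[OF sys col, of u a b] by auto
    next
      assume "\<tau> u = c u (Suc (K u)) \<and> ?\<tau> u = y u (K u)"
      then show ?thesis using filt_diff_ge[OF sys col(2,1), of u a b] by (auto simp: abs_minus_commute)
    qed
    then show ?thesis using t' by blast
  qed
qed

text \<open>The cost of passing from knowledge \<open>K\<close> to \<open>K'\<close> one outcome at
  a time. Every term has a fixed pair of states, so its mean over \<open>b\<close> is within reach
  of the Lipschitz hypothesis.\<close>

definition moved :: "nat \<Rightarrow> (nat \<Rightarrow> nat) \<Rightarrow> (nat \<Rightarrow> nat) \<Rightarrow> nat \<Rightarrow> real" where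
  "moved a K K' b = (\<Sum>u\<in>nbrs G v. \<Sum>k\<in>{K u..<K' u}. filt_diff G v u (y u k) (c u (Suc k)) a b)"

text \<open>Outcomes are learned one by one in any order: the cost of an outcome of \<open>u\<close>
  depends only on \<open>u\<close> and its index, not on what is known about other
  neighbours.\<close>

lemma approx:
  assumes "\<And>u. u \<in> nbrs G v \<Longrightarrow> K u \<le> K' u" "\<And>u. u \<in> nbrs G v \<Longrightarrow> K' u \<le> n u" "\<tau> \<in> bx K"
    and a: "a \<in> {1..spins G}" and b: "b \<in> {1..spins G}"
  shows "\<exists>\<tau>'\<in>bx K'. \<bar>filt G v a b \<tau> - filt G v a b \<tau>'\<bar> \<le> moved a K K' b"
  using assms(1-3)
proof (induction "\<Sum>u\<in>nbrs G v. K' u - K u" arbitrary: K \<tau>)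
  case 0
  have "K u = K' u" if "u \<in> nbrs G v" for u
    using 0(1)[symmetric] 0(2)[OF that] that finite_nbrs[OF sys] by (force simp: sum_eq_0_iff)
  then have *: "bx K = bx K'" "moved a K K' b = 0" unfolding bx_eq moved_def
    by (auto simp: entry_def intro!: PiE_cong)
  from 0(4) have "\<tau> \<in> bx K'" unfolding *(1) .
  then show ?case by (rule bexI[rotated]) (simp only: *(2) diff_self abs_zero order_refl)
next
  case (Suc m)
  note fin = finite_nbrs[OF sys, of v]
  have "\<exists>u\<in>nbrs G v. K' u - K u \<noteq> 0" 
  proof (rule ccontr)
    assume "\<not> ?thesis"
    then have "(\<Sum>u\<in>nbrs G v. K' u - K u) = 0" by (intro sum.neutral) auto
    with Suc(2) show False by simp
  qed
  then obtain u where u: "u \<in> nbrs G v" "K u < K' u" by auto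
  let ?K = "fun_upd K u (Suc (K u))"
  have "K u < n u" using Suc(4)[OF u(1)] u by simp
  from approx_step[OF u(1) this Suc(5) a b] obtain \<tau>1 where
    t1: "\<tau>1 \<in> bx ?K" "\<bar>filt G v a b \<tau> - filt G v a b \<tau>1\<bar> \<le> filt_diff G v u (y u (K u)) (c u (Suc (K u))) a b"
    by blast
  have s: "(\<Sum>w\<in>nbrs G v. K' w - ?K w) = m"
  proof -
    have "(\<Sum>w\<in>nbrs G v. K' w - K w) = (K' u - K u) + (\<Sum>w\<in>nbrs G v - {u}. K' w - K w)"
      using fin u by (simp add: sum.remove)
    moreover have "(\<Sum>w\<in>nbrs G v. K' w - ?K w) = (K' u - Suc (K u)) + (\<Sum>w\<in>nbrs G v - {u}. K' w - ?K w)"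
      using fin u by (simp add: sum.remove)
    moreover have "(\<Sum>w\<in>nbrs G v - {u}. K' w - ?K w) = (\<Sum>w\<in>nbrs G v - {u}. K' w - K w)"
      by (intro sum.cong) auto
    ultimately show ?thesis using Suc(2) u by simp
  qed
  have "\<exists>\<tau>'\<in>bx K'. \<bar>filt G v a b \<tau>1 - filt G v a b \<tau>'\<bar> \<le> moved a ?K K' b"
    using s Suc(3,4) u t1 by (intro Suc(1)) auto
  then obtain \<tau>' where t': "\<tau>' \<in> bx K'" "\<bar>filt G v a b \<tau>1 - filt G v a b \<tau>'\<bar> \<le> moved a ?K K' b" by blast
  have "moved a K K' b = filt_diff G v u (y u (K u)) (c u (Suc (K u))) a b + moved a ?K K' b"
  proof -
    let ?d = "\<lambda>w k. filt_diff G v w (y w k) (c w (Suc k)) a b"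
    have "moved a K K' b = (\<Sum>k\<in>{K u..<K' u}. ?d u k) + (\<Sum>w\<in>nbrs G v - {u}. \<Sum>k\<in>{K w..<K' w}. ?d w k)"
      unfolding moved_def using fin u by (simp add: sum.remove)
    moreover have "moved a ?K K' b = (\<Sum>k\<in>{Suc (K u)..<K' u}. ?d u k) + (\<Sum>w\<in>nbrs G v - {u}. \<Sum>k\<in>{K w..<K' w}. ?d w k)"
      unfolding moved_def using fin u by (simp add: sum.remove)
    moreover have "(\<Sum>k\<in>{K u..<K' u}. ?d u k) = ?d u (K u) + (\<Sum>k\<in>{Suc (K u)..<K' u}. ?d u k)"
      using u by (simp add: sum.atLeast_Suc_lessThan)
    ultimately show ?thesis by simp
  qed
  then have "\<bar>filt G v a b \<tau> - filt G v a b \<tau>'\<bar> \<le> moved a K K' b" using t'(2) t1(2) by linarith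
  then show ?case using t'(1) by (rule bexI)
qed

lemma moved_nonneg:
  assumes "\<And>u. u \<in> nbrs G v \<Longrightarrow> K' u \<le> n u" "a \<in> {1..spins G}" "b \<in> {1..spins G}"
  shows "0 \<le> moved a K K' b"
  unfolding moved_def
proof (intro sum_nonneg)
  fix u k assume "u \<in> nbrs G v" "k \<in> {K u..<K' u}"
  then show "0 \<le> filt_diff G v u (y u k) (c u (Suc k)) a b"
    using assms by (intro filt_diff_bounds(1)[OF sys] y_range c_range) force+
qed

text \<open>A coin undecided at \<open>K\<close> lies between the extreme filter values there;
  decided at \<open>K'\<close>, it lies outside those for \<open>K'\<close>. So it falls between the
  two minima or between the two maxima, and by \<open>approx\<close> each of these intervals has
  length at most \<open>moved\<close>. Hence the factor 2.\<close>

lemma decision_event: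
  assumes K: "\<And>u. u \<in> nbrs G v \<Longrightarrow> K u \<le> K' u" "\<And>u. u \<in> nbrs G v \<Longrightarrow> K' u \<le> n u"
    and a: "a \<in> {1..spins G}" and b: "b \<in> {1..spins G}"
  shows "emeasure (uniform_measure lborel {0..<1}) {\<beta>. \<not> decided G v a b \<beta> (bx K) \<and> decided G v a b \<beta> (bx K')} \<le>
    ennreal (2 * moved a K K' b)"
proof -
  let ?F = "\<lambda>K. filt G v a b ` bx K"
  define mx mn where "mx K = Max (?F K)" and "mn K = Min (?F K)" for K
  let ?S = "{\<beta>. \<not> decided G v a b \<beta> (bx K) \<and> decided G v a b \<beta> (bx K')}"
  have F: "finite (?F K)" "?F K \<noteq> {}" for K using finite_bx bx_ne by auto
  have mx: "mx K \<le> mx K' + moved a K K' b"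
  proof -
    have "mx K \<in> ?F K" unfolding mx_def by (rule Max_in[OF F])
    then obtain \<tau> where "\<tau> \<in> bx K" "mx K = filt G v a b \<tau>" by auto
    moreover obtain \<tau>' where "\<tau>' \<in> bx K'" "\<bar>filt G v a b \<tau> - filt G v a b \<tau>'\<bar> \<le> moved a K K' b"
      using approx[of K K', OF K \<open>\<tau> \<in> bx K\<close> a b] by blast
    moreover have "filt G v a b \<tau>' \<le> mx K'" unfolding mx_def using F calculation by (intro Max_ge) auto
    ultimately show ?thesis by linarith
  qed
  have mn: "mn K' \<le> mn K + moved a K K' b"
  proof -
    have "mn K \<in> ?F K" unfolding mn_def by (rule Min_in[OF F])
    then obtain \<tau> where "\<tau> \<in> bx K" "mn K = filt G v a b \<tau>" by auto
    moreover obtain \<tau>' where "\<tau>' \<in> bx K'" "\<bar>filt G v a b \<tau> - filt G v a b \<tau>'\<bar> \<le> moved a K K' b"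
      using approx[of K K', OF K \<open>\<tau> \<in> bx K\<close> a b] by blast
    moreover have "mn K' \<le> filt G v a b \<tau>'" unfolding mn_def using F calculation by (intro Min_le) auto
    ultimately show ?thesis by linarith
  qed
  have sub: "?S \<subseteq> {mn K..mn K'} \<union> {mx K'..mx K}"
  proof
    fix \<beta> assume "\<beta> \<in> ?S"
    then have nd: "\<not> decided G v a b \<beta> (bx K)" and d: "decided G v a b \<beta> (bx K')" by auto
    obtain \<sigma> \<tau> where "\<sigma> \<in> bx K" "\<tau> \<in> bx K" "\<not> \<beta> < filt G v a b \<sigma>" "\<beta> < filt G v a b \<tau>"
      using nd unfolding decided_def by blast
    moreover have "mn K \<le> filt G v a b \<sigma>" "filt G v a b \<tau> \<le> mx K"
      unfolding mn_def mx_def using F calculation by (auto intro!: Min_le Max_ge)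
    ultimately have 1: "mn K \<le> \<beta>" "\<beta> \<le> mx K" by linarith+
    have "mx K' \<in> ?F K'" "mn K' \<in> ?F K'" unfolding mx_def mn_def by (intro Max_in Min_in F)+
    then obtain \<sigma>' \<tau>' where "\<sigma>' \<in> bx K'" "mx K' = filt G v a b \<sigma>'" "\<tau>' \<in> bx K'" "mn K' = filt G v a b \<tau>'" by blast
    then have "\<beta> < mn K' \<or> mx K' \<le> \<beta>" using d unfolding decided_def by (metis not_le)
    then show "\<beta> \<in> {mn K..mn K'} \<union> {mx K'..mx K}" using 1 by auto
  qed
  have nn: "0 \<le> moved a K K' b" by (rule moved_nonneg[OF K(2) a b])
  have U: "emeasure (uniform_measure lborel {0..<1::real}) X \<le> emeasure lborel X" if "X \<in> sets lborel" for X
    using that by (simp add: emeasure_uniform_measure divide_ennreal_def) (auto intro!: emeasure_mono)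
  have "emeasure (uniform_measure lborel {0..<1}) ?S \<le> emeasure (uniform_measure lborel {0..<1}) ({mn K..mn K'} \<union> {mx K'..mx K})"
    using sub by (intro emeasure_mono) auto
  also have "\<dots> \<le> emeasure lborel ({mn K..mn K'} \<union> {mx K'..mx K})" by (rule U) auto
  also have "\<dots> \<le> emeasure lborel {mn K..mn K'} + emeasure lborel {mx K'..mx K}"
    by (rule emeasure_subadditive) auto
  also have "\<dots> \<le> ennreal (moved a K K' b) + ennreal (moved a K K' b)"
    using mx mn nn by (intro add_mono) (auto simp: emeasure_lborel_Icc_eq intro!: ennreal_leI)
  also have "\<dots> = ennreal (2 * moved a K K' b)" using nn by (simp flip: ennreal_plus)
  finally show ?thesis .
qed

end

abbreviation unif :: "real measure" where "unif \<equiv> uniform_measure lborel {0..<1}"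

lemma prob_space_unif: "prob_space unif"
  by (rule prob_space_uniform_measure) auto

text \<open>The set of outcomes known in round \<open>r\<close> is that of the updates whose own round is below \<open>r\<close>.\<close>

definition known :: "(nat \<Rightarrow> nat \<Rightarrow> nat) \<Rightarrow> (nat \<Rightarrow> nat) \<Rightarrow> nat \<Rightarrow> nat \<Rightarrow> nat" where
  "known R n r u = card {k\<in>{1..n u}. R u k < r}"

text \<open>\<open>s\<close> is the round of the preceding update of \<open>v\<close>: a node
  resolves its own updates in order, so no update is decided in a smaller round than its
  predecessor.\<close>

definition round_of :: "metropolis \<Rightarrow> nat \<Rightarrow> (nat \<Rightarrow> nat \<Rightarrow> nat) \<Rightarrow> (nat \<Rightarrow> nat \<Rightarrow> nat) \<Rightarrow> (nat \<Rightarrow> nat \<Rightarrow> nat) \<Rightarrow>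
    (nat \<Rightarrow> nat) \<Rightarrow> nat \<Rightarrow> nat \<Rightarrow> nat \<Rightarrow> real \<Rightarrow> nat" where
  "round_of G v y c R n s a b \<beta> = (LEAST r. s \<le> r \<and> decided G v a b \<beta> (box G v y c n (known R n r)))"

lemma known_le: "known R n r u \<le> n u"
proof -
  have "card {k\<in>{1..n u}. R u k < r} \<le> card {1..n u}" by (intro card_mono) auto
  then show ?thesis by (simp add: known_def)
qed

lemma known_mono: "r \<le> r' \<Longrightarrow> known R n r u \<le> known R n r' u"
  unfolding known_def by (intro card_mono) auto

lemma known_Suc: "known R n (Suc r) u = known R n r u + card {k\<in>{1..n u}. R u k = r}"
proof -
  have "{k\<in>{1..n u}. R u k < Suc r} = {k\<in>{1..n u}. R u k < r} \<union> {k\<in>{1..n u}. R u k = r}" by auto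
  moreover have "card (\<dots>) = card {k\<in>{1..n u}. R u k < r} + card {k\<in>{1..n u}. R u k = r}"
    by (intro card_Un_disjoint) auto
  ultimately show ?thesis by (simp add: known_def)
qed

lemma known_full: "(\<And>k. 1 \<le> k \<Longrightarrow> k \<le> n u \<Longrightarrow> R u k < r) \<Longrightarrow> known R n r u = n u"
proof -
  assume "\<And>k. 1 \<le> k \<Longrightarrow> k \<le> n u \<Longrightarrow> R u k < r"
  then have "{k\<in>{1..n u}. R u k < r} = {1..n u}" by auto
  then show ?thesis by (simp add: known_def)
qed

lemma known_bound: "(\<And>k. 1 \<le> k \<Longrightarrow> k \<le> n u \<Longrightarrow> R u k < r \<Longrightarrow> k \<le> K) \<Longrightarrow> known R n r u \<le> K"
proof -
  assume "\<And>k. 1 \<le> k \<Longrightarrow> k \<le> n u \<Longrightarrow> R u k < r \<Longrightarrow> k \<le> K"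
  then have "card {k\<in>{1..n u}. R u k < r} \<le> card {1..K}" by (intro card_mono) auto
  then show ?thesis by (simp add: known_def)
qed

lemma sets_decided: "finite A \<Longrightarrow> {\<beta>. decided G v a b \<beta> A} \<in> sets borel"
  unfolding decided_def
proof -
  assume A: "finite A"
  have "Measurable.pred borel (\<lambda>\<beta>. (\<beta> < filt G v a b \<sigma>) = (\<beta> < filt G v a b \<tau>))" for \<sigma> \<tau>
    by measurable
  then have "Measurable.pred borel (\<lambda>\<beta>. \<forall>\<sigma>\<in>A. \<forall>\<tau>\<in>A. (\<beta> < filt G v a b \<sigma>) = (\<beta> < filt G v a b \<tau>))"
    using A by (intro pred_intros_finite) auto
  then show "{\<beta>. \<forall>\<sigma>\<in>A. \<forall>\<tau>\<in>A. (\<beta> < filt G v a b \<sigma>) = (\<beta> < filt G v a b \<tau>)} \<in> sets borel"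
    by (simp add: pred_def)
qed

context nbhd
begin

text \<open>A crude round by which all relevant outcomes are known. It makes the
  \<open>LEAST\<close> in \<open>round_of\<close> exist and keeps the sums over rounds
  finite.\<close>

definition top_round :: "(nat \<Rightarrow> nat \<Rightarrow> nat) \<Rightarrow> nat" where
  "top_round R = Suc (\<Sum>u\<in>nbrs G v. \<Sum>k=1..n u. R u k)"

lemma top_round: 
  assumes "u \<in> nbrs G v" "1 \<le> k" "k \<le> n u"
  shows "R u k < top_round R"
proof -
  have "R u k \<le> (\<Sum>k=1..n u. R u k)" using assms by (intro member_le_sum) auto
  also have "\<dots> \<le> (\<Sum>u\<in>nbrs G v. \<Sum>k=1..n u. R u k)"
    using assms finite_nbrs[OF sys] by (intro member_le_sum[of u "nbrs G v" "\<lambda>u. \<Sum>k=1..n u. R u k"]) auto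
  finally show ?thesis by (simp add: top_round_def)
qed

lemma decided_top: "top_round R \<le> r \<Longrightarrow> decided G v a b \<beta> (bx (known R n r))"
proof (rule decided_full)
  fix u assume r: "top_round R \<le> r" and u: "u \<in> nbrs G v"
  have "known R n r u = n u"
    using top_round[OF u] r by (intro known_full) (blast intro: less_le_trans)
  then show "n u \<le> known R n r u" by simp
qed

lemma round_of:
  shows "s \<le> round_of G v y c R n s a b \<beta>"
    and "decided G v a b \<beta> (bx (known R n (round_of G v y c R n s a b \<beta>)))"
proof -
  have "s \<le> max s (top_round R) \<and> decided G v a b \<beta> (bx (known R n (max s (top_round R))))"
    using decided_top by simp
  from LeastI[of "\<lambda>r. s \<le> r \<and> decided G v a b \<beta> (bx (known R n r))", OF this]
  show "s \<le> round_of G v y c R n s a b \<beta>" "decided G v a b \<beta> (bx (known R n (round_of G v y c R n s a b \<beta>)))"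
    unfolding round_of_def by auto
qed

lemma measurable_round_of [measurable]: "round_of G v y c R n s a b \<in> borel \<rightarrow>\<^sub>M count_space UNIV"
proof -
  have "Measurable.pred borel (\<lambda>\<beta>. s \<le> r \<and> decided G v a b \<beta> (bx (known R n r)))" for r
    using sets_decided[OF finite_bx] by (cases "s \<le> r") (auto simp: pred_def)
  then show ?thesis unfolding round_of_def by (rule measurable_Least)
qed

text \<open>Unless the round is \<open>s\<close> itself, the coin lies in \<open>E r\<close> for the
  last undecided round \<open>r\<close>, and the term of that index in the sum is exactly
  \<open>2 ^ Suc r\<close>.\<close>

lemma round_of_le:
  fixes \<beta> :: real
  assumes E_def: "\<And>r. E r = {\<beta>. \<not> decided G v a b \<beta> (bx (known R n r)) \<and> decided G v a b \<beta> (bx (known R n (Suc r)))}"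
  shows "2 ^ round_of G v y c R n s a b \<beta> \<le> (2 ^ s + (\<Sum>r<top_round R. 2 ^ Suc r * indicator (E r) \<beta>) :: real)"
proof (cases "round_of G v y c R n s a b \<beta> = s")
  case True
  then show ?thesis by (simp add: sum_nonneg)
next
  case False
  let ?r = "round_of G v y c R n s a b \<beta> - 1"
  have r: "round_of G v y c R n s a b \<beta> = Suc ?r" "s \<le> ?r" using False round_of(1)[where R=R and s=s and a=a and b=b and \<beta>=\<beta>] by auto
  have nd: "\<not> decided G v a b \<beta> (bx (known R n ?r))"
  proof
    assume "decided G v a b \<beta> (bx (known R n ?r))"
    then have "round_of G v y c R n s a b \<beta> \<le> ?r" unfolding round_of_def[of G v y c R n s a b \<beta>]
      using r by (intro Least_le) (simp add: round_of_def)
    then show False using r by simp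
  qed
  have E: "\<beta> \<in> E ?r" using nd round_of(2)[where R=R and s=s and a=a and b=b and \<beta>=\<beta>] r by (simp add: E_def)
  have "?r < top_round R" using nd decided_top not_le by blast
  then have "(2::real) ^ Suc ?r * indicator (E ?r) \<beta> \<le> (\<Sum>r<top_round R. 2 ^ Suc r * indicator (E r) \<beta>)"
    by (intro member_le_sum[where f="\<lambda>r. 2 ^ Suc r * indicator (E r) \<beta>"]) auto
  then show ?thesis using E r(1) by (simp add: add_increasing)
qed

lemma nn_integral_round_coin:
  assumes a: "a \<in> {1..spins G}" and b: "b \<in> {1..spins G}"
  shows "(\<integral>\<^sup>+\<beta>. ennreal (2 ^ round_of G v y c R n s a b \<beta>) \<partial>unif) \<le>
    ennreal (2 ^ s + (\<Sum>r<top_round R. 2 ^ Suc r * (2 * moved a (known R n r) (known R n (Suc r)) b)))"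
proof -
  interpret U: prob_space unif by (rule prob_space_unif)
  define E where "E r = {\<beta>. \<not> decided G v a b \<beta> (bx (known R n r)) \<and> decided G v a b \<beta> (bx (known R n (Suc r)))}" for r
  let ?m = "\<lambda>r. moved a (known R n r) (known R n (Suc r)) b"
  have E [measurable]: "E r \<in> sets borel" for r
  proof -
    have "E r = (UNIV - {\<beta>. decided G v a b \<beta> (bx (known R n r))}) \<inter> {\<beta>. decided G v a b \<beta> (bx (known R n (Suc r)))}"
      by (auto simp: E_def)
    then show ?thesis by (simp only:) (intro sets.Int sets.Diff sets_decided finite_bx; simp)
  qed
  have m: "0 \<le> ?m r" for r using known_le a b by (intro moved_nonneg) auto
  have "(\<integral>\<^sup>+\<beta>. ennreal (2 ^ round_of G v y c R n s a b \<beta>) \<partial>unif) \<le>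
      (\<integral>\<^sup>+\<beta>. ennreal (2 ^ s) + (\<Sum>r<top_round R. ennreal (2 ^ Suc r) * indicator (E r) \<beta>) \<partial>unif)"
  proof (rule nn_integral_mono)
    fix \<beta>
    have "ennreal (2 ^ round_of G v y c R n s a b \<beta>) \<le> ennreal (2 ^ s + (\<Sum>r<top_round R. 2 ^ Suc r * indicator (E r) \<beta>))"
      by (intro ennreal_leI round_of_le E_def)
    also have "\<dots> = ennreal (2 ^ s) + (\<Sum>r<top_round R. ennreal (2 ^ Suc r * indicator (E r) \<beta>))"
      by (subst ennreal_plus) (auto intro!: sum_nonneg simp: sum_ennreal)
    also have "(\<Sum>r<top_round R. ennreal (2 ^ Suc r * indicator (E r) \<beta>)) = (\<Sum>r<top_round R. ennreal (2 ^ Suc r) * indicator (E r) \<beta>)"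
      by (intro sum.cong refl) (auto simp: indicator_def)
    finally show "ennreal (2 ^ round_of G v y c R n s a b \<beta>) \<le> ennreal (2 ^ s) + (\<Sum>r<top_round R. ennreal (2 ^ Suc r) * indicator (E r) \<beta>)" .
  qed
  also have "\<dots> = ennreal (2 ^ s) + (\<Sum>r<top_round R. ennreal (2 ^ Suc r) * emeasure unif (E r))"
  proof -
    have m: "(\<lambda>\<beta>. ennreal (2 ^ Suc r) * indicator (E r) \<beta>) \<in> borel_measurable unif" for r
      by measurable
    have i: "(\<integral>\<^sup>+\<beta>. ennreal (2 ^ Suc r) * indicator (E r) \<beta> \<partial>unif) = ennreal (2 ^ Suc r) * emeasure unif (E r)" for r
      by (rule nn_integral_cmult_indicator) simp
    show ?thesis
      by (rule trans[OF nn_integral_add])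
         (simp_all only: nn_integral_sum[OF m] i nn_integral_const U.emeasure_space_1 mult_1_right
           borel_measurable_const borel_measurable_sum[OF m])
  qed
  also have "\<dots> \<le> ennreal (2 ^ s) + (\<Sum>r<top_round R. ennreal (2 ^ Suc r) * ennreal (2 * ?m r))"
    unfolding E_def using a b by (intro add_left_mono sum_mono mult_left_mono decision_event known_mono known_le) auto
  also have "\<dots> = ennreal (2 ^ s + (\<Sum>r<top_round R. 2 ^ Suc r * (2 * ?m r)))"
  proof -
    have e: "ennreal (2 ^ Suc r) * ennreal (2 * ?m r) = ennreal (2 ^ Suc r * (2 * ?m r))" for r
      using m[of r] by (intro ennreal_mult[symmetric]) auto
    have p: "0 \<le> 2 ^ Suc r * (2 * ?m r)" for r using m[of r] by (intro mult_nonneg_nonneg) auto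
    show ?thesis
      unfolding e sum_ennreal[OF p] by (rule ennreal_plus[symmetric]) (auto intro: sum_nonneg p simp del: power_Suc)
  qed
  finally show ?thesis .
qed

text \<open>The states and proposals of the neighbours are fixed here and only \<open>c'\<close> is
  random, so the hypothesis applies to each term separately.\<close>

lemma expectation_moved:
  assumes a: "a \<in> {1..spins G}"
    and lip: "\<And>u b b'. u \<in> nbrs G v \<Longrightarrow> b \<in> {1..spins G} \<Longrightarrow> b' \<in> {1..spins G} \<Longrightarrow>
      measure_pmf.expectation (proposal G v) (\<lambda>c'. filt_diff G v u b b' a c') \<le> \<gamma>"
    and K: "\<And>u. u \<in> nbrs G v \<Longrightarrow> K' u \<le> n u"
  shows "measure_pmf.expectation (proposal G v) (\<lambda>c'. moved a K K' c') \<le> \<gamma> * (\<Sum>u\<in>nbrs G v. real (K' u - K u))"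
proof -
  have sp: "set_pmf (proposal G v) \<subseteq> {1..spins G}" using sys vV by (simp add: metropolis_system_def)
  have int: "integrable (measure_pmf (proposal G v)) f" for f :: "nat \<Rightarrow> real"
    by (rule integrable_measure_pmf_finite) (rule finite_subset[OF sp], simp)
  have "measure_pmf.expectation (proposal G v) (\<lambda>c'. moved a K K' c') =
      (\<Sum>u\<in>nbrs G v. \<Sum>k\<in>{K u..<K' u}. measure_pmf.expectation (proposal G v) (\<lambda>c'. filt_diff G v u (y u k) (c u (Suc k)) a c'))"
    unfolding moved_def using int by (simp add: Bochner_Integration.integral_sum)
  also have "\<dots> \<le> (\<Sum>u\<in>nbrs G v. \<Sum>k\<in>{K u..<K' u}. \<gamma>)"
    using K by (intro sum_mono lip y_range c_range) force+
  also have "\<dots> = \<gamma> * (\<Sum>u\<in>nbrs G v. real (K' u - K u))"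
    by (simp add: sum_distrib_left mult.commute)
  finally show ?thesis .
qed

text \<open>Round \<open>r + 1\<close> costs \<open>2 ^ Suc r\<close> and is entered undecided with
  mean probability at most \<open>2 * \<gamma>\<close> times the number of neighbouring outcomes of
  round \<open>r\<close>. Regrouped by outcomes, each pays \<open>4 * \<gamma>\<close> times its own
  weight.\<close>

theorem nn_integral_round_of:
  assumes a: "a \<in> {1..spins G}" and \<gamma>: "0 \<le> \<gamma>"
    and lip: "\<And>u b b'. u \<in> nbrs G v \<Longrightarrow> b \<in> {1..spins G} \<Longrightarrow> b' \<in> {1..spins G} \<Longrightarrow>
      measure_pmf.expectation (proposal G v) (\<lambda>c'. filt_diff G v u b b' a c') \<le> \<gamma>"
  shows "(\<integral>\<^sup>+b. \<integral>\<^sup>+\<beta>. ennreal (2 ^ round_of G v y c R n s a b \<beta>) \<partial>unif \<partial>measure_pmf (proposal G v)) \<le>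
    ennreal (2 ^ s + 4 * \<gamma> * (\<Sum>u\<in>nbrs G v. \<Sum>k=1..n u. 2 ^ R u k))"
proof -
  have sp: "set_pmf (proposal G v) \<subseteq> {1..spins G}" using sys vV by (simp add: metropolis_system_def)
  have int: "integrable (measure_pmf (proposal G v)) f" for f :: "nat \<Rightarrow> real"
    by (rule integrable_measure_pmf_finite) (rule finite_subset[OF sp], simp)
  let ?m = "\<lambda>r b. moved a (known R n r) (known R n (Suc r)) b"
  let ?g = "\<lambda>b. 2 ^ s + (\<Sum>r<top_round R. 2 ^ Suc r * (2 * ?m r b))"
  have m: "b \<in> {1..spins G} \<Longrightarrow> 0 \<le> ?m r b" for r b using known_le a by (intro moved_nonneg) auto
  have "(\<integral>\<^sup>+b. \<integral>\<^sup>+\<beta>. ennreal (2 ^ round_of G v y c R n s a b \<beta>) \<partial>unif \<partial>measure_pmf (proposal G v)) \<le>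
      (\<integral>\<^sup>+b. ennreal (?g b) \<partial>measure_pmf (proposal G v))"
  proof (intro nn_integral_mono_AE AE_pmfI)
    fix b assume "b \<in> set_pmf (proposal G v)"
    then have "b \<in> {1..spins G}" using sp by blast
    then show "(\<integral>\<^sup>+\<beta>. ennreal (2 ^ round_of G v y c R n s a b \<beta>) \<partial>unif) \<le> ennreal (?g b)"
      by (rule nn_integral_round_coin[OF a])
  qed
  also have "\<dots> = ennreal (measure_pmf.expectation (proposal G v) ?g)"
    using sp m by (intro nn_integral_eq_integral int) (auto simp: AE_measure_pmf_iff intro!: add_nonneg_nonneg sum_nonneg mult_nonneg_nonneg)
  also have "measure_pmf.expectation (proposal G v) ?g =
      2 ^ s + (\<Sum>r<top_round R. 2 ^ Suc r * (2 * measure_pmf.expectation (proposal G v) (?m r)))"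
    using int by (simp add: Bochner_Integration.integral_sum Bochner_Integration.integral_add)
  also have "\<dots> \<le> 2 ^ s + (\<Sum>r<top_round R. 2 ^ Suc r * (2 * (\<gamma> * (\<Sum>u\<in>nbrs G v. real (known R n (Suc r) u - known R n r u)))))"
    by (intro add_left_mono sum_mono mult_left_mono expectation_moved a lip known_le) auto
  also have "\<dots> = 2 ^ s + 4 * \<gamma> * (\<Sum>u\<in>nbrs G v. \<Sum>r<top_round R. 2 ^ r * real (card {k\<in>{1..n u}. R u k = r}))"
    by (simp add: known_Suc sum_distrib_left sum.swap[of _ "nbrs G v"] mult_ac)
  also have "(\<Sum>u\<in>nbrs G v. \<Sum>r<top_round R. 2 ^ r * real (card {k\<in>{1..n u}. R u k = r})) = (\<Sum>u\<in>nbrs G v. \<Sum>k=1..n u. 2 ^ R u k :: real)"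
  proof (rule sum.cong[OF refl])
    fix u assume u: "u \<in> nbrs G v"
    have "(\<Sum>k=1..n u. 2 ^ R u k :: real) = (\<Sum>r<top_round R. \<Sum>k\<in>{k\<in>{1..n u}. R u k = r}. 2 ^ R u k)"
      using top_round[OF u] by (intro sum.group[symmetric]) auto
    also have "\<dots> = (\<Sum>r<top_round R. 2 ^ r * real (card {k\<in>{1..n u}. R u k = r}))"
      by (intro sum.cong refl) (simp add: mult.commute)
    finally show "(\<Sum>r<top_round R. 2 ^ r * real (card {k\<in>{1..n u}. R u k = r})) = (\<Sum>k=1..n u. 2 ^ R u k :: real)" ..
  qed
  finally show ?thesis by (simp add: ennreal_leI)
qed

end

section \<open>Histories\<close>

text \<open>A history lists, latest first, the updates made so far: the node, its proposal, its new state and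
  the round in which a synchronous execution decides the update.\<close>

type_synonym history = "(nat \<times> nat \<times> nat \<times> nat) list"

text \<open>Histories grow at the front; after reversal the \<open>k\<close>-th update of
  \<open>u\<close> sits at position \<open>k - 1\<close> for good, whatever is added later.\<close>

definition updates_of :: "history \<Rightarrow> nat \<Rightarrow> (nat \<times> nat \<times> nat) list" where
  "updates_of h u = map snd (filter (\<lambda>e. fst e = u) (rev h))"

definition count_of :: "history \<Rightarrow> nat \<Rightarrow> nat" where
  "count_of h u = length (updates_of h u)"

definition prop_of :: "history \<Rightarrow> nat \<Rightarrow> nat \<Rightarrow> nat" where
  "prop_of h u k = fst (updates_of h u ! (k - 1))"

definition state_of :: "(nat \<Rightarrow> nat) \<Rightarrow> history \<Rightarrow> nat \<Rightarrow> nat \<Rightarrow> nat" where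
  "state_of Y0 h u k = (if k = 0 then Y0 u else fst (snd (updates_of h u ! (k - 1))))"

definition rnd_of :: "history \<Rightarrow> nat \<Rightarrow> nat \<Rightarrow> nat" where
  "rnd_of h u k = (if k = 0 then 0 else snd (snd (updates_of h u ! (k - 1))))"

lemma updates_of_Nil [simp]: "updates_of [] u = []"
  by (simp add: updates_of_def)

lemma updates_of_Cons [simp]: "updates_of ((v, e) # h) u = (if u = v then updates_of h u @ [e] else updates_of h u)"
  by (simp add: updates_of_def)

lemma count_of_Cons [simp]: "count_of ((v, e) # h) u = (if u = v then Suc (count_of h u) else count_of h u)"
  by (simp add: count_of_def)

lemma count_of_Nil [simp]: "count_of [] u = 0"
  by (simp add: count_of_def)

lemma Cons_old:
  assumes "k \<le> count_of h u"
  shows "state_of Y0 ((v, e) # h) u k = state_of Y0 h u k" "rnd_of ((v, e) # h) u k = rnd_of h u k"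
    "1 \<le> k \<Longrightarrow> prop_of ((v, e) # h) u k = prop_of h u k"
  using assms by (auto simp: state_of_def rnd_of_def prop_of_def count_of_def nth_append)

lemma Cons_new:
  shows "state_of Y0 ((v, b, y, r) # h) v (Suc (count_of h v)) = y"
    "rnd_of ((v, b, y, r) # h) v (Suc (count_of h v)) = r"
    "prop_of ((v, b, y, r) # h) v (Suc (count_of h v)) = b"
  by (auto simp: state_of_def rnd_of_def prop_of_def count_of_def nth_append)

definition valid_history :: "metropolis \<Rightarrow> (nat \<Rightarrow> nat) \<Rightarrow> history \<Rightarrow> bool" where
  "valid_history G Y0 h \<longleftrightarrow> (\<forall>u\<in>verts G.
     (\<forall>k\<le>count_of h u. state_of Y0 h u k \<in> {1..spins G}) \<and>
     (\<forall>k\<in>{1..count_of h u}. prop_of h u k \<in> {1..spins G}) \<and>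
     (\<forall>k<count_of h u. state_of Y0 h u (Suc k) = state_of Y0 h u k \<or> state_of Y0 h u (Suc k) = prop_of h u (Suc k)))"

definition current :: "(nat \<Rightarrow> nat) \<Rightarrow> history \<Rightarrow> nat \<Rightarrow> nat" where
  "current Y0 h u = state_of Y0 h u (count_of h u)"

definition new_state :: "metropolis \<Rightarrow> (nat \<Rightarrow> nat) \<Rightarrow> history \<Rightarrow> nat \<Rightarrow> nat \<Rightarrow> real \<Rightarrow> nat" where
  "new_state G Y0 h v b \<beta> =
     (if \<beta> < filt G v (current Y0 h v) b (\<lambda>u\<in>nbrs G v. current Y0 h u) then b else current Y0 h v)"

definition new_round :: "metropolis \<Rightarrow> (nat \<Rightarrow> nat) \<Rightarrow> history \<Rightarrow> nat \<Rightarrow> nat \<Rightarrow> real \<Rightarrow> nat" where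
  "new_round G Y0 h v b \<beta> =
     round_of G v (state_of Y0 h) (prop_of h) (rnd_of h) (count_of h) (rnd_of h v (count_of h v)) (current Y0 h v) b \<beta>"

text \<open>Invalid histories, which arise with probability 0, are frozen, so that the bounds below hold for
  all histories.\<close>

definition extend_history :: "metropolis \<Rightarrow> (nat \<Rightarrow> nat) \<Rightarrow> history \<Rightarrow> nat \<Rightarrow> real \<times> nat \<times> real \<Rightarrow> history" where
  "extend_history G Y0 h v z = (case z of (x, b, \<beta>) \<Rightarrow>
     if valid_history G Y0 h then (v, b, new_state G Y0 h v b \<beta>, new_round G Y0 h v b \<beta>) # h else h)"

text \<open>The index \<open>k = 0\<close> gives every node an initial weight \<open>2 ^ 0\<close>.
  It pays for a first update, for which the lower bound on the round is 0.\<close>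

definition potential :: "metropolis \<Rightarrow> history \<Rightarrow> real" where
  "potential G h = (\<Sum>v\<in>verts G. \<Sum>k\<le>count_of h v. 2 ^ rnd_of h v k)"

lemma valid_nbhd:
  assumes "metropolis_system G" "valid_history G Y0 h" "v \<in> verts G"
  shows "nbhd G v (state_of Y0 h) (prop_of h) (count_of h)"
proof
  fix u k assume u: "u \<in> nbrs G v"
  have uV: "u \<in> verts G" using nbrs_subset[OF assms(1) u] by simp
  show "k \<le> count_of h u \<Longrightarrow> state_of Y0 h u k \<in> {1..spins G}"
    "1 \<le> k \<Longrightarrow> k \<le> count_of h u \<Longrightarrow> prop_of h u k \<in> {1..spins G}"
    "k < count_of h u \<Longrightarrow> state_of Y0 h u (Suc k) = state_of Y0 h u k \<or> state_of Y0 h u (Suc k) = prop_of h u (Suc k)"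
    using assms(2) uV by (auto simp: valid_history_def)
qed (use assms in auto)

lemma potential_nonneg: "0 \<le> potential G h"
  unfolding potential_def by (intro sum_nonneg) auto

lemma potential_extend:
  assumes "metropolis_system G" "v \<in> verts G"
  shows "potential G ((v, b, y, r) # h) = potential G h + 2 ^ r"
proof -
  let ?h = "(v, b, y, r) # h"
  have fin: "finite (verts G)" using assms by (simp add: metropolis_system_def)
  have "(\<Sum>k\<le>count_of ?h u. 2 ^ rnd_of ?h u k :: real) = (\<Sum>k\<le>count_of h u. 2 ^ rnd_of h u k) + (if u = v then 2 ^ r else 0)" for u
    by (auto simp: Cons_old Cons_new)
  then show ?thesis unfolding potential_def using assms(2) fin by (simp add: sum.distrib)
qed

lemma card_nbrs_le:
  assumes "metropolis_system G" "v \<in> verts G"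
  shows "card (nbrs G v) \<le> max_degree G"
  unfolding max_degree_def using assms by (intro Max_ge) (auto simp: metropolis_system_def)

definition marks :: "metropolis \<Rightarrow> nat \<Rightarrow> (nat \<times> real) measure" where
  "marks G v = measure_pmf (proposal G v) \<Otimes>\<^sub>M unif"

lemma prob_space_marks: "prob_space (marks G v)"
  unfolding marks_def by (intro prob_space_pair prob_space_unif prob_space_measure_pmf)

lemma measurable_extend:
  assumes "metropolis_system G" "v \<in> verts G"
  shows "extend_history G Y0 h v \<in> expo \<Otimes>\<^sub>M marks G v \<rightarrow>\<^sub>M count_space UNIV"
proof (cases "valid_history G Y0 h")
  case False
  then have "extend_history G Y0 h v = (\<lambda>_. h)" by (auto simp: extend_history_def fun_eq_iff)
  then show ?thesis by simp
next
  case True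
  interpret nbhd G v "state_of Y0 h" "prop_of h" "count_of h" by (rule valid_nbhd[OF assms(1) True assms(2)])
  let ?M = "expo \<Otimes>\<^sub>M marks G v"
  have b: "(\<lambda>z. fst (snd z)) \<in> ?M \<rightarrow>\<^sub>M count_space UNIV"
    using measurable_compose[OF measurable_snd measurable_fst, of expo "measure_pmf (proposal G v)" unif]
    by (simp add: marks_def)
  have c [measurable]: "(\<lambda>z. snd (snd z)) \<in> ?M \<rightarrow>\<^sub>M borel"
    using measurable_compose[OF measurable_snd measurable_snd, of expo "measure_pmf (proposal G v)" unif]
    by (simp add: marks_def)
  have "(\<lambda>z. (v, b, new_state G Y0 h v b (snd (snd z)), new_round G Y0 h v b (snd (snd z))) # h) \<in> ?M \<rightarrow>\<^sub>M count_space UNIV" for b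
  proof -
    have "new_state G Y0 h v b \<in> borel \<rightarrow>\<^sub>M count_space UNIV"
      unfolding new_state_def[abs_def] by (intro measurable_If measurable_const) auto
    then have ns: "(\<lambda>z. new_state G Y0 h v b (snd (snd z))) \<in> ?M \<rightarrow>\<^sub>M count_space UNIV"
      by (rule measurable_compose[OF c])
    have nr: "(\<lambda>z. new_round G Y0 h v b (snd (snd z))) \<in> ?M \<rightarrow>\<^sub>M count_space UNIV"
      unfolding new_round_def by (rule measurable_compose[OF c measurable_round_of])
    have "(\<lambda>z. (v, b, s, new_round G Y0 h v b (snd (snd z))) # h) \<in> ?M \<rightarrow>\<^sub>M count_space UNIV" for s
      by (rule measurable_compose[OF nr, where g="\<lambda>r. (v, b, s, r) # h"]) simp
    then show ?thesis
      by (rule measurable_compose_countable[where f="\<lambda>s z. (v, b, s, new_round G Y0 h v b (snd (snd z))) # h"]) (rule ns)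
  qed
  then have "(\<lambda>z. (v, fst (snd z), new_state G Y0 h v (fst (snd z)) (snd (snd z)), new_round G Y0 h v (fst (snd z)) (snd (snd z))) # h)
      \<in> ?M \<rightarrow>\<^sub>M count_space UNIV"
    by (rule measurable_compose_countable[where g="\<lambda>z. fst (snd z)" and
          f="\<lambda>b z. (v, b, new_state G Y0 h v b (snd (snd z)), new_round G Y0 h v b (snd (snd z))) # h"]) (rule b)
  moreover have "extend_history G Y0 h v = (\<lambda>z. (v, fst (snd z), new_state G Y0 h v (fst (snd z)) (snd (snd z)),
      new_round G Y0 h v (fst (snd z)) (snd (snd z))) # h)"
  proof
    fix z show "extend_history G Y0 h v z = (v, fst (snd z), new_state G Y0 h v (fst (snd z)) (snd (snd z)),
      new_round G Y0 h v (fst (snd z)) (snd (snd z))) # h"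
      unfolding extend_history_def by (cases z) (simp only: True if_True prod.case fst_conv snd_conv)
  qed
  ultimately show ?thesis by (simp only:)
qed

text \<open>The lower bounds \<open>2 ^ rnd_of h v (count_of h v)\<close> sum to at most the
  potential. Exchanging the order of summation, a past update of \<open>u\<close> is charged once by
  each neighbour of \<open>u\<close>, and \<open>card (nbrs G u) \<le> max_degree G\<close> cancels
  the denominator in \<open>C / \<Delta>\<close>.\<close>

theorem potential_generator:
  assumes sys: "metropolis_system G" and C: "0 \<le> C" and lip: "filter_lipschitz G C"
  shows "(\<Sum>v\<in>verts G. \<integral>\<^sup>+m. ennreal (potential G (extend_history G Y0 h v (0, m))) \<partial>marks G v) \<le>
    ennreal ((real (card (verts G)) + (1 + 4 * C)) * potential G h)"
proof (cases "valid_history G Y0 h")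
  case False
  have "(\<Sum>v\<in>verts G. \<integral>\<^sup>+m. ennreal (potential G (extend_history G Y0 h v (0, m))) \<partial>marks G v) =
      (\<Sum>v\<in>verts G. ennreal (potential G h))"
    using False prob_space.emeasure_space_1[OF prob_space_marks] by (simp add: extend_history_def case_prod_beta')
  also have "\<dots> = ennreal (real (card (verts G)) * potential G h)"
    using potential_nonneg[of G h] by (simp add: ennreal_mult ennreal_of_nat_eq_real_of_nat)
  also have "\<dots> \<le> ennreal ((real (card (verts G)) + (1 + 4 * C)) * potential G h)"
    using potential_nonneg[of G h] C by (intro ennreal_leI mult_right_mono) auto
  finally show ?thesis .
next
  case True
  define \<Delta> where "\<Delta> = max_degree G"
  let ?R = "rnd_of h" and ?n = "count_of h"
  let ?S = "\<lambda>u. \<Sum>k=1..?n u. 2 ^ ?R u k :: real"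
  have fin: "finite (verts G)" using sys by (simp add: metropolis_system_def)
  have S: "0 \<le> ?S u" for u by (intro sum_nonneg) auto
  have nn: "0 \<le> 2 ^ ?R v (?n v) + 4 * (C / \<Delta>) * (\<Sum>u\<in>nbrs G v. ?S u)" for v
    using C by (intro add_nonneg_nonneg mult_nonneg_nonneg sum_nonneg S) auto
  have one: "(\<integral>\<^sup>+m. ennreal (potential G (extend_history G Y0 h v (0, m))) \<partial>marks G v) \<le>
      ennreal (potential G h + (2 ^ ?R v (?n v) + 4 * (C / \<Delta>) * (\<Sum>u\<in>nbrs G v. ?S u)))"
    if v: "v \<in> verts G" for v
  proof -
    interpret nbhd G v "state_of Y0 h" "prop_of h" "count_of h" by (rule valid_nbhd[OF sys True v])
    interpret U: prob_space unif by (rule prob_space_unif)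
    have a: "current Y0 h v \<in> {1..spins G}" using True v by (auto simp: valid_history_def current_def)
    let ?r = "new_round G Y0 h v"
    have r: "?r b \<in> borel \<rightarrow>\<^sub>M count_space UNIV" for b
      unfolding new_round_def by (rule measurable_round_of)
    have mr: "(\<lambda>m. ?r (fst m) (snd m)) \<in> marks G v \<rightarrow>\<^sub>M count_space UNIV"
      unfolding marks_def
    proof (rule measurable_compose_countable[where g=fst and f="\<lambda>b m. ?r b (snd m)"])
      show "(\<lambda>m. ?r b (snd m)) \<in> measure_pmf (proposal G v) \<Otimes>\<^sub>M unif \<rightarrow>\<^sub>M count_space UNIV" for b
        using measurable_compose[OF measurable_snd, of "?r b" unif "count_space UNIV" "measure_pmf (proposal G v)"] r[of b] by simp
      show "fst \<in> measure_pmf (proposal G v) \<Otimes>\<^sub>M unif \<rightarrow>\<^sub>M count_space UNIV"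
        using measurable_fst[of "measure_pmf (proposal G v)" unif] by simp
    qed
    have mf: "(\<lambda>m. ennreal (2 ^ ?r (fst m) (snd m))) \<in> borel_measurable (marks G v)"
      by (rule measurable_compose[OF mr]) simp
    have "(\<integral>\<^sup>+m. ennreal (potential G (extend_history G Y0 h v (0, m))) \<partial>marks G v) =
        (\<integral>\<^sup>+m. ennreal (potential G h) + ennreal (2 ^ ?r (fst m) (snd m)) \<partial>marks G v)"
      using True potential_nonneg[of G h]
      by (intro nn_integral_cong) (simp add: extend_history_def case_prod_beta' potential_extend[OF sys v])
    also have "\<dots> = ennreal (potential G h) + (\<integral>\<^sup>+m. ennreal (2 ^ ?r (fst m) (snd m)) \<partial>marks G v)"
      by (subst nn_integral_add[OF _ mf]) (auto simp: prob_space.emeasure_space_1[OF prob_space_marks])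
    also have "(\<integral>\<^sup>+m. ennreal (2 ^ ?r (fst m) (snd m)) \<partial>marks G v) =
        (\<integral>\<^sup>+b. \<integral>\<^sup>+\<beta>. ennreal (2 ^ ?r b \<beta>) \<partial>unif \<partial>measure_pmf (proposal G v))"
      using mf unfolding marks_def by (subst U.nn_integral_fst[symmetric]) (auto simp: case_prod_beta')
    also have "\<dots> \<le> ennreal (2 ^ ?R v (?n v) + 4 * (C / \<Delta>) * (\<Sum>u\<in>nbrs G v. ?S u))"
      unfolding new_round_def
    proof (rule nn_integral_round_of[OF a])
      show "0 \<le> C / \<Delta>" using C by simp
      fix u b b' assume "u \<in> nbrs G v" "b \<in> {1..spins G}" "b' \<in> {1..spins G}"
      then show "measure_pmf.expectation (proposal G v) (filt_diff G v u b b' (current Y0 h v)) \<le> C / \<Delta>"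
        using lip a unfolding filter_lipschitz_def \<Delta>_def nbrs_def by blast
    qed
    also have "ennreal (potential G h) + \<dots> = ennreal (potential G h + (2 ^ ?R v (?n v) + 4 * (C / \<Delta>) * (\<Sum>u\<in>nbrs G v. ?S u)))"
      using C by (intro ennreal_plus[symmetric] potential_nonneg nn)
    finally show ?thesis by (simp add: add_left_mono)
  qed
  have "(\<Sum>v\<in>verts G. \<Sum>u\<in>nbrs G v. ?S u) = (\<Sum>v\<in>verts G. \<Sum>u\<in>verts G. if u \<in> nbrs G v then ?S u else 0)"
  proof (rule sum.cong[OF refl])
    fix v
    have "verts G \<inter> nbrs G v = nbrs G v" using nbrs_subset(1)[OF sys] by blast
    then show "(\<Sum>u\<in>nbrs G v. ?S u) = (\<Sum>u\<in>verts G. if u \<in> nbrs G v then ?S u else 0)"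
      using sum.inter_restrict[OF fin, of ?S "nbrs G v"] by simp
  qed
  also have "\<dots> = (\<Sum>u\<in>verts G. \<Sum>v\<in>verts G. if u \<in> nbrs G v then ?S u else 0)" by (rule sum.swap)
  also have "\<dots> = (\<Sum>u\<in>verts G. real (card (nbrs G u)) * ?S u)"
  proof (rule sum.cong[OF refl])
    fix u
    have "(\<Sum>v\<in>verts G. if u \<in> nbrs G v then ?S u else 0) = (\<Sum>v\<in>nbrs G u. ?S u)"
    proof -
      have "verts G \<inter> {v. u \<in> nbrs G v} = nbrs G u" using nbrs_subset(1)[OF sys] nbrs_sym[of u G] by blast
      then show ?thesis using sum.inter_restrict[OF fin, of "\<lambda>_. ?S u" "{v. u \<in> nbrs G v}"] by simp
    qed
    then show "(\<Sum>v\<in>verts G. if u \<in> nbrs G v then ?S u else 0) = real (card (nbrs G u)) * ?S u" by simp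
  qed
  finally have swap: "(\<Sum>v\<in>verts G. \<Sum>u\<in>nbrs G v. ?S u) = (\<Sum>u\<in>verts G. real (card (nbrs G u)) * ?S u)" .
  \<comment> \<open>Without edges the denominator is 0, and division by zero makes the left side
    0.\<close>
  have deg: "C / \<Delta> * (real (card (nbrs G u)) * ?S u) \<le> C * ?S u" if "u \<in> verts G" for u
  proof (cases "\<Delta> = 0")
    case True
    then show ?thesis using C S by simp
  next
    case False
    have "real (card (nbrs G u)) \<le> real \<Delta>" using card_nbrs_le[OF sys that] by (simp add: \<Delta>_def)
    then have "C / \<Delta> * real (card (nbrs G u)) \<le> C / \<Delta> * real \<Delta>" using C by (intro mult_left_mono) auto
    also have "\<dots> = C" using False by simp
    finally show ?thesis using S[of u] by (simp only: mult.assoc[symmetric] mult_right_mono)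
  qed
  have pot: "potential G h = (\<Sum>v\<in>verts G. 1 + ?S v)"
  proof -
    have "(\<Sum>k\<le>?n v. 2 ^ ?R v k :: real) = 1 + ?S v" for v
    proof -
      have "{..?n v} = insert 0 {1..?n v}" by auto
      then show ?thesis by (simp add: rnd_of_def)
    qed
    then show ?thesis by (simp add: potential_def)
  qed
  have last: "2 ^ ?R v (?n v) \<le> 1 + ?S v" for v
  proof (cases "?n v = 0")
    case True then show ?thesis by (simp add: rnd_of_def)
  next
    case False
    then have "(2::real) ^ ?R v (?n v) \<le> ?S v" by (intro member_le_sum) auto
    then show ?thesis by simp
  qed
  have "(\<Sum>v\<in>verts G. \<integral>\<^sup>+m. ennreal (potential G (extend_history G Y0 h v (0, m))) \<partial>marks G v) \<le>
      (\<Sum>v\<in>verts G. ennreal (potential G h + (2 ^ ?R v (?n v) + 4 * (C / \<Delta>) * (\<Sum>u\<in>nbrs G v. ?S u))))"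
    by (intro sum_mono one)
  also have "\<dots> = ennreal (\<Sum>v\<in>verts G. potential G h + (2 ^ ?R v (?n v) + 4 * (C / \<Delta>) * (\<Sum>u\<in>nbrs G v. ?S u)))"
    by (intro sum_ennreal add_nonneg_nonneg potential_nonneg nn)
  also have "\<dots> \<le> ennreal ((real (card (verts G)) + (1 + 4 * C)) * potential G h)"
  proof (rule ennreal_leI)
    have "(\<Sum>v\<in>verts G. potential G h + (2 ^ ?R v (?n v) + 4 * (C / \<Delta>) * (\<Sum>u\<in>nbrs G v. ?S u))) =
        real (card (verts G)) * potential G h + (\<Sum>v\<in>verts G. 2 ^ ?R v (?n v)) +
        4 * (\<Sum>u\<in>verts G. C / \<Delta> * (real (card (nbrs G u)) * ?S u))"
      by (simp only: sum.distrib sum_constant sum_distrib_left[symmetric] swap mult.assoc add.assoc)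
    also have "\<dots> \<le> real (card (verts G)) * potential G h + potential G h + 4 * (\<Sum>u\<in>verts G. C * ?S u)"
      unfolding pot by (intro add_mono mult_left_mono sum_mono last deg order_refl) auto
    also have "(\<Sum>u\<in>verts G. C * ?S u) \<le> C * potential G h"
      unfolding pot sum_distrib_left[symmetric] using C by (intro mult_left_mono sum_mono) auto
    finally show "(\<Sum>v\<in>verts G. potential G h + (2 ^ ?R v (?n v) + 4 * (C / \<Delta>) * (\<Sum>u\<in>nbrs G v. ?S u))) \<le>
        (real (card (verts G)) + (1 + 4 * C)) * potential G h"
      by (simp add: algebra_simps)
  qed
  finally show ?thesis .
qed

section \<open>The algorithm at a node\<close>

declare upt_Suc [simp del]

text \<open>\<open>y v i\<close> is the state of \<open>v\<close> in the Metropolis chain after its \<open>i\<close>-th update and \<open>R v i\<close> the round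
  in which a synchronous execution decides that update.\<close>

definition trunc_time :: "metropolis \<Rightarrow> real \<Rightarrow> tape \<Rightarrow> nat \<Rightarrow> nat \<Rightarrow> real" where
  "trunc_time G T \<omega> v i = real (trunc_num (precision G T \<omega>) (ring \<omega> v i)) / 2 ^ precision G T \<omega>"

definition earlier :: "real \<Rightarrow> tape \<Rightarrow> nat \<Rightarrow> nat \<Rightarrow> nat \<Rightarrow> nat" where
  "earlier T \<omega> v i u = card {j\<in>{1..num_updates T \<omega> u}. ring \<omega> u j < ring \<omega> v i}"

text \<open>What the analysis of executions takes from the tape. Rounds enter through two
  properties: they do not decrease along a node, and the outcomes of smaller rounds suffice for a
  decision.\<close>

locale coupled_run =
  fixes G :: metropolis and T :: real and Y0 :: "nat \<Rightarrow> nat" and \<omega> :: tape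
    and y R :: "nat \<Rightarrow> nat \<Rightarrow> nat"
  assumes sys: "metropolis_system G"
    and Y0: "Y0 \<in> colourings G (verts G)"
    and ring_mono: "v \<in> verts G \<Longrightarrow> i < j \<Longrightarrow> ring \<omega> v i < ring \<omega> v j"
    and ring_neq: "u \<in> verts G \<Longrightarrow> v \<in> verts G \<Longrightarrow> u \<noteq> v \<Longrightarrow> 1 \<le> i \<Longrightarrow> 1 \<le> j \<Longrightarrow> ring \<omega> u i \<noteq> ring \<omega> v j"
    and trunc_less: "u \<in> nbrs G v \<Longrightarrow> a \<in> {u, v} \<Longrightarrow> b \<in> {u, v} \<Longrightarrow>
       1 \<le> i \<Longrightarrow> i \<le> num_updates T \<omega> a \<Longrightarrow> 1 \<le> j \<Longrightarrow> j \<le> num_updates T \<omega> b \<Longrightarrow>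
       ring \<omega> a i < ring \<omega> b j \<Longrightarrow> trunc_time G T \<omega> a i < trunc_time G T \<omega> b j"
    and y_0: "y v 0 = Y0 v"
    and y_rec: "v \<in> verts G \<Longrightarrow> 1 \<le> i \<Longrightarrow> i \<le> num_updates T \<omega> v \<Longrightarrow> y v i =
       (if ring_coin \<omega> v i < filt G v (y v (i - 1)) (ring_prop \<omega> v i) (\<lambda>u\<in>nbrs G v. y u (earlier T \<omega> v i u))
        then ring_prop \<omega> v i else y v (i - 1))"
    and c_spins: "v \<in> verts G \<Longrightarrow> 1 \<le> i \<Longrightarrow> i \<le> num_updates T \<omega> v \<Longrightarrow> ring_prop \<omega> v i \<in> {1..spins G}"
    and R_mono: "v \<in> verts G \<Longrightarrow> 1 \<le> i \<Longrightarrow> i \<le> num_updates T \<omega> v \<Longrightarrow> R v (i - 1) \<le> R v i"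
    and R_decided: "v \<in> verts G \<Longrightarrow> 1 \<le> i \<Longrightarrow> i \<le> num_updates T \<omega> v \<Longrightarrow>
       decided G v (y v (i - 1)) (ring_prop \<omega> v i) (ring_coin \<omega> v i)
         (box G v y (ring_prop \<omega>) (earlier T \<omega> v i) (known R (earlier T \<omega> v i) (R v i)))"
begin

abbreviation "m \<equiv> num_updates T \<omega>"
abbreviation "tm \<equiv> trunc_time G T \<omega>"
abbreviation "c \<equiv> ring_prop \<omega>"
abbreviation "\<beta> \<equiv> ring_coin \<omega>"
abbreviation "cn \<equiv> earlier T \<omega>"

definition det :: "nat \<Rightarrow> nat \<Rightarrow> (nat \<Rightarrow> nat) \<Rightarrow> bool" where
  "det v i K \<longleftrightarrow> decided G v (y v (i - 1)) (c v i) (\<beta> v i) (box G v y c (cn v i) K)"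

text \<open>The decision that the chain prescribes. All decisions sent in an execution turn out to
  be of this form, whatever the delays.\<close>

definition dec :: "nat \<Rightarrow> nat \<Rightarrow> message" where
  "dec v i = (if \<beta> v i < filt G v (y v (i - 1)) (c v i) (\<lambda>u\<in>nbrs G v. y u (cn v i u)) then Accept else Reject)"

definition sched :: "nat \<Rightarrow> (real \<times> nat) list" where
  "sched u = map (\<lambda>i. (tm u i, c u i)) [1..<Suc (m u)]"

lemma length_sched [simp]: "length (sched u) = m u"
  by (simp add: sched_def)

lemma sched_nth: "1 \<le> k \<Longrightarrow> k \<le> m u \<Longrightarrow> sched u ! (k - 1) = (tm u k, c u k)"
proof -
  assume k: "1 \<le> k" "k \<le> m u"
  then have "[1..<Suc (m u)] ! (k - 1) = k" by (subst nth_upt) auto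
  then show ?thesis using k by (simp add: sched_def)
qed

lemma y_spins: "v \<in> verts G \<Longrightarrow> i \<le> m v \<Longrightarrow> y v i \<in> {1..spins G}"
proof (induction i)
  case 0
  then show ?case using Y0 by (auto simp: y_0 colourings_def)
next
  case (Suc i)
  then show ?case using y_rec[of v "Suc i"] c_spins[of v "Suc i"] by auto
qed

lemma cn_le: "cn v i u \<le> m u"
proof -
  have "cn v i u \<le> card {1..m u}" unfolding earlier_def by (intro card_mono) auto
  then show ?thesis by simp
qed

text \<open>The rings of \<open>u\<close> increase, so those before \<open>ring \<omega> v i\<close>
  form an initial segment and \<open>earlier\<close> is its length.\<close>

lemma cn_iff:
  assumes u: "u \<in> verts G" and k: "1 \<le> k" "k \<le> m u"
  shows "k \<le> cn v i u \<longleftrightarrow> ring \<omega> u k < ring \<omega> v i"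
proof -
  let ?S = "{j\<in>{1..m u}. ring \<omega> u j < ring \<omega> v i}"
  have mono: "j \<le> k \<Longrightarrow> ring \<omega> u j \<le> ring \<omega> u k" for j k
    using ring_mono[OF u, of j k] by (cases "j = k") auto
  have card: "cn v i u = card ?S" by (simp add: earlier_def)
  show ?thesis
  proof
    assume "ring \<omega> u k < ring \<omega> v i"
    then have "{1..k} \<subseteq> ?S"
      using k by (auto intro: le_less_trans[OF mono])
    then have "card {1..k} \<le> card ?S" by (intro card_mono) auto
    then show "k \<le> cn v i u" using card by simp
  next
    assume le: "k \<le> cn v i u"
    show "ring \<omega> u k < ring \<omega> v i"
    proof (rule ccontr)
      assume "\<not> ring \<omega> u k < ring \<omega> v i"
      then have "\<not> k \<le> j" if "ring \<omega> u j < ring \<omega> v i" for j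
        using mono[of k j] that by linarith
      then have "?S \<subseteq> {1..k - 1}" by fastforce
      then have "card ?S \<le> card {1..k - 1}" by (intro card_mono) auto
      then show False using le card k by simp
    qed
  qed
qed

lemma nbhd_cn: "v \<in> verts G \<Longrightarrow> nbhd G v y c (cn v i)"
proof
  fix u k assume u: "u \<in> nbrs G v"
  have uV: "u \<in> verts G" using nbrs_subset[OF sys u] by simp
  show "k \<le> cn v i u \<Longrightarrow> y u k \<in> {1..spins G}" using y_spins[OF uV, of k] cn_le[of v i u] by simp
  show "1 \<le> k \<Longrightarrow> k \<le> cn v i u \<Longrightarrow> c u k \<in> {1..spins G}" using c_spins[OF uV, of k] cn_le[of v i u] by simp
  show "k < cn v i u \<Longrightarrow> y u (Suc k) = y u k \<or> y u (Suc k) = c u (Suc k)"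
    using y_rec[OF uV, of "Suc k"] cn_le[of v i u] by auto
qed (rule sys)

text \<open>Nodes only see truncated times, but the precision keeps the order between neighbours
  strict; since ties are excluded, comparing truncated times is comparing true ones.\<close>

lemma tm_iff:
  assumes u: "u \<in> nbrs G v" and i: "1 \<le> i" "i \<le> m v" and k: "1 \<le> k" "k \<le> m u"
  shows "tm u k \<le> tm v i \<longleftrightarrow> k \<le> cn v i u"
proof -
  have uv: "u \<in> verts G" "v \<in> verts G" "u \<noteq> v" using nbrs_subset[OF sys u] by auto
  have "ring \<omega> u k \<noteq> ring \<omega> v i" using ring_neq[OF uv, of k i] i k by simp
  then consider "ring \<omega> u k < ring \<omega> v i" | "ring \<omega> v i < ring \<omega> u k" by linarith
  then show ?thesis
  proof cases
    case 1
    then have "tm u k < tm v i" using trunc_less[OF u, of u v k i] i k by simp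
    then show ?thesis using 1 cn_iff[OF uv(1) k, of v i] by simp
  next
    case 2
    then have "tm v i < tm u k" using trunc_less[OF u, of v u i k] i k by simp
    then show ?thesis using 2 cn_iff[OF uv(1) k, of v i] by simp
  qed
qed

lemma tm_mono:
  assumes u: "u \<in> nbrs G v" and k: "1 \<le> k" "k \<le> m u" "1 \<le> j" "j \<le> m u"
  shows "tm u j \<le> tm u k \<longleftrightarrow> j \<le> k"
proof -
  have uV: "u \<in> verts G" using nbrs_subset[OF sys u] by auto
  have "tm u j < tm u k" if "j < k" "1 \<le> j" "k \<le> m u" for j k
    using trunc_less[OF u, of u u j k] ring_mono[OF uV, of j k] that by simp
  then show ?thesis using k by (metis linorder_not_less nle_le order_less_imp_le)
qed

lemma tm_nonneg: "0 \<le> tm v i"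
  by (simp add: trunc_time_def)

definition inPhaseII :: "nat \<Rightarrow> (nat \<Rightarrow> nat) \<Rightarrow> node \<Rightarrow> bool" where
  "inPhaseII v K s \<longleftrightarrow> phaseII s \<and>
     (\<forall>u\<in>insert v (nbrs G v). schedule s u = sched u \<and> resolved s u = map (y u) [0..<Suc (K u)] \<and> K u \<le> m u) \<and>
     coin s = \<beta> v (Suc (K v))"

lemma inPhaseII_D:
  assumes "inPhaseII v K s" "u \<in> insert v (nbrs G v)"
  shows "schedule s u = sched u" "resolved s u = map (y u) [0..<Suc (K u)]" "K u \<le> m u"
    "length (resolved s u) = Suc (K u)" "k \<le> K u \<Longrightarrow> resolved s u ! k = y u k"
    "update_time s u k = (if k = 0 then 0 else if k \<le> m u then ereal (tm u k) else \<infinity>)"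
    "1 \<le> k \<Longrightarrow> k \<le> m u \<Longrightarrow> update_prop s u k = c u k"
proof -
  show 1: "schedule s u = sched u" "resolved s u = map (y u) [0..<Suc (K u)]" "K u \<le> m u"
    using assms by (auto simp: inPhaseII_def)
  show "length (resolved s u) = Suc (K u)" "k \<le> K u \<Longrightarrow> resolved s u ! k = y u k"
    by (simp_all add: 1 del: upt_Suc)
  show "update_time s u k = (if k = 0 then 0 else if k \<le> m u then ereal (tm u k) else \<infinity>)"
    using sched_nth[of k u] by (simp add: update_time_def 1)
  show "1 \<le> k \<Longrightarrow> k \<le> m u \<Longrightarrow> update_prop s u k = c u k"
    using sched_nth[of k u] by (simp add: update_prop_def 1)
qed

text \<open>Here \<open>j\<close> is \<open>Suc (K u)\<close>. The test
  \<open>t < update_time s u j\<close> succeeds exactly when all \<open>cn v i u\<close> outcomes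
  that matter are known, and then picks the one state after them; otherwise the last known state and
  the pending proposals up to the ring of \<open>v\<close> remain.\<close>

lemma possible_states_eq:
  assumes s: "inPhaseII v K s" and u: "u \<in> nbrs G v" and i: "1 \<le> i" "i \<le> m v"
  shows "possible_states s u (ereal (tm v i)) = insert (y u (min (K u) (cn v i u))) (c u ` {K u<..cn v i u})"
proof -
  let ?n = "cn v i u" and ?t = "ereal (tm v i)"
  note D = inPhaseII_D[OF s insertI2[OF u]]
  note ut = D(6)
  have le: "update_time s u k \<le> ?t \<longleftrightarrow> k \<le> ?n" for k
    using tm_iff[OF u i, of k] cn_le[of v i u] tm_nonneg[of v i] by (auto simp: ut)
  have less: "?t < update_time s u k \<longleftrightarrow> ?n < k" for k
    using le[of k] by (metis linorder_not_less)
  show ?thesis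
  proof (cases "?n \<le> K u")
    case True
    have "possible_states s u ?t = {resolved s u ! (k - 1) |k. 1 \<le> k \<and> k - 1 \<le> ?n \<and> ?n < k}"
      using True by (simp add: possible_states_def D(4) le less)
    also have "\<dots> = {resolved s u ! ?n}"
    proof -
      have "1 \<le> k \<and> k - 1 \<le> ?n \<and> ?n < k \<longleftrightarrow> k = Suc ?n" for k by auto
      then show ?thesis by simp
    qed
    finally show ?thesis using True D(5)[of ?n] by simp
  next
    case False
    have "possible_states s u ?t = {resolved s u ! K u} \<union> {update_prop s u k |k. 1 \<le> k \<and> k \<le> m u \<and>
        update_time s u (Suc (K u)) \<le> update_time s u k \<and> k \<le> ?n}"
      using False by (simp add: possible_states_def D(1,4) le less)
    also have "{update_prop s u k |k. 1 \<le> k \<and> k \<le> m u \<and>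
        update_time s u (Suc (K u)) \<le> update_time s u k \<and> k \<le> ?n} = c u ` {K u<..?n}" (is "?A = ?B")
    proof -
      have *: "1 \<le> k \<and> k \<le> m u \<and> update_time s u (Suc (K u)) \<le> update_time s u k \<and> k \<le> ?n \<longleftrightarrow> K u < k \<and> k \<le> ?n" for k
        using tm_mono[OF u, of k "Suc (K u)"] cn_le[of v i u] False by (auto simp: ut)
      show ?thesis
      proof (intro set_eqI iffI)
        fix x assume "x \<in> ?A"
        then obtain k where k: "x = update_prop s u k" "K u < k" "k \<le> ?n" unfolding * by blast
        then show "x \<in> ?B" using D(7)[of k] cn_le[of v i u] by auto
      next
        fix x assume "x \<in> ?B"
        then obtain k where k: "x = c u k" "K u < k" "k \<le> ?n" by auto
        then have "x = update_prop s u k" using D(7)[of k] cn_le[of v i u] by auto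
        then show "x \<in> ?A" using k unfolding * by blast
      qed
    qed
    finally show ?thesis using False D(5)[of "K u"] by (simp add: min_def)
  qed
qed

text \<open>The coin passes the \<open>P_AC\<close> test iff all candidates accept, and the
  \<open>P_RE\<close> test iff all reject. The truth is among the candidates, so a unanimous verdict
  is the one of the chain, and both tests cannot succeed.\<close>

lemma decision_eq:
  assumes s: "inPhaseII v K s" and v: "v \<in> verts G"
  shows "decision G v s = (if K v < m v \<and> det v (Suc (K v)) K then Some (dec v (Suc (K v))) else None)"
proof (cases "K v < m v")
  case False
  then show ?thesis using inPhaseII_D(1,4)[OF s insertI1] by (simp add: decision_def all_resolved_def)
next
  case True
  let ?i = "Suc (K v)"
  interpret nbhd G v y c "cn v ?i" by (rule nbhd_cn[OF v])
  note D = inPhaseII_D[OF s insertI1]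
  let ?f = "filt G v (y v (K v)) (c v ?i)" and ?b = "\<beta> v ?i"
  have vals: "possible_filter_values G v s = ?f ` box G v y c (cn v ?i) K"
  proof -
    have "(\<Pi>\<^sub>E u\<in>nbrs G v. possible_states s u (update_time s v ?i)) = box G v y c (cn v ?i) K"
      unfolding box_def using possible_states_eq[OF s, of _ ?i] True by (intro PiE_cong) (simp add: D(6))
    then show ?thesis using True D(5)[of "K v"] D(7)[of ?i] by (simp add: possible_filter_values_def D(4))
  qed
  have fin: "finite (?f ` box G v y c (cn v ?i) K)" "?f ` box G v y c (cn v ?i) K \<noteq> {}" using finite_bx bx_ne by auto
  have ac: "?b < P_AC G v s \<longleftrightarrow> (\<forall>\<sigma>\<in>box G v y c (cn v ?i) K. ?b < ?f \<sigma>)"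
    unfolding P_AC_def vals using fin by (subst Min_gr_iff) auto
  have re: "1 - P_RE G v s \<le> ?b \<longleftrightarrow> (\<forall>\<sigma>\<in>box G v y c (cn v ?i) K. \<not> ?b < ?f \<sigma>)"
    unfolding P_RE_def vals using fin by (simp add: not_less)
  have ar: "\<not> all_resolved v s" using True D(1,4) by (simp add: all_resolved_def)
  have co: "coin s = ?b" using s by (simp add: inPhaseII_def)
  have truth: "(\<lambda>u\<in>nbrs G v. y u (cn v ?i u)) \<in> box G v y c (cn v ?i) K" by (rule truth_in_bx)
  define A where "A \<longleftrightarrow> (\<forall>\<sigma>\<in>box G v y c (cn v ?i) K. ?b < ?f \<sigma>)"
  define B where "B \<longleftrightarrow> (\<forall>\<sigma>\<in>box G v y c (cn v ?i) K. \<not> ?b < ?f \<sigma>)"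
  have dn: "decision G v s = (if A then Some Accept else if B then Some Reject else None)"
    unfolding decision_def co ac re A_def[symmetric] B_def[symmetric] by (simp only: ar if_False)
  have dt: "det v ?i K \<longleftrightarrow> A \<or> B"
    unfolding det_def decided_def diff_Suc_1 A_def B_def using truth by blast
  have A: "A \<Longrightarrow> dec v ?i = Accept" and B: "B \<Longrightarrow> dec v ?i = Reject"
    using truth unfolding dec_def diff_Suc_1 A_def B_def by auto
  have AB: "\<not> (A \<and> B)" using truth unfolding A_def B_def by blast
  show ?thesis unfolding dn dt using True A B AB by auto
qed

lemma record_decision_eq:
  assumes s: "inPhaseII v K s" and u: "u \<in> insert v (nbrs G v)" and K: "K u < m u" and v: "v \<in> verts G"
  shows "record_decision u (dec u (Suc (K u))) s = s\<lparr>resolved := (resolved s)(u := map (y u) [0..<Suc (Suc (K u))])\<rparr>"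
proof -
  have uV: "u \<in> verts G" using u v nbrs_subset(1)[OF sys] by auto
  note D = inPhaseII_D[OF s u]
  have "record_decision u (dec u (Suc (K u))) s = s\<lparr>resolved := (resolved s)(u := resolved s u @
      [if dec u (Suc (K u)) = Accept then update_prop s u (Suc (K u)) else resolved s u ! K u])\<rparr>"
    unfolding record_decision_def Let_def D(4) diff_Suc_1 ..
  also have "(if dec u (Suc (K u)) = Accept then update_prop s u (Suc (K u)) else resolved s u ! K u) = y u (Suc (K u))"
    using y_rec[OF uV, of "Suc (K u)"] K D(5)[of "K u"] D(7)[of "Suc (K u)"] by (simp add: dec_def)
  also have "resolved s u @ [y u (Suc (K u))] = map (y u) [0..<Suc (Suc (K u))]"
    unfolding D(2) by (simp add: upt_Suc)
  finally show ?thesis .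
qed

definition stuck :: "nat \<Rightarrow> (nat \<Rightarrow> nat) \<Rightarrow> bool" where
  "stuck v K \<longleftrightarrow> K v < m v \<longrightarrow> \<not> det v (Suc (K v)) K"

text \<open>The loop ends early only at an update that is not yet determined. \<open>advance\<close>
  runs it with \<open>m v\<close> iterations, which covers the \<open>m v - K v\<close> updates that
  are left.\<close>

lemma resolve_spec:
  assumes "inPhaseII v K s" "v \<in> verts G" "resolve k G v (\<beta> v) s = (s', ms)"
  shows "\<exists>n. K v \<le> n \<and> inPhaseII v (K(v := n)) s' \<and> ms = map (dec v) [Suc (K v)..<Suc n] \<and>
    (m v - K v \<le> k \<longrightarrow> stuck v (K(v := n)))"
  using assms(1,3)
proof (induction k arbitrary: K s s' ms)
  case 0
  then show ?case using inPhaseII_D(3)[OF 0(1) insertI1] by (intro exI[of _ "K v"]) (auto simp: stuck_def)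
next
  case (Suc k)
  show ?case
  proof (cases "K v < m v \<and> det v (Suc (K v)) K")
    case False
    then have "decision G v s = None" using decision_eq[OF Suc(2) assms(2)] by simp
    then show ?thesis using Suc(2,3) False by (intro exI[of _ "K v"]) (auto simp: stuck_def)
  next
    case True
    let ?K = "fun_upd K v (Suc (K v))"
    let ?s = "s\<lparr>resolved := (resolved s)(v := map (y v) [0..<Suc (Suc (K v))]), coin := \<beta> v (Suc (Suc (K v)))\<rparr>"
    have d: "decision G v s = Some (dec v (Suc (K v)))" using decision_eq[OF Suc(2) assms(2)] True by simp
    have vn: "v \<notin> nbrs G v" using nbrs_subset(3)[OF sys] by blast
    have P: "inPhaseII v ?K ?s"
      using Suc(2) True vn unfolding inPhaseII_def by auto
    obtain s1 ms1 where r: "resolve k G v (\<beta> v) ?s = (s1, ms1)" by fastforce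
    have "s' = s1" "ms = dec v (Suc (K v)) # ms1"
      using Suc(3) d record_decision_eq[OF Suc(2) insertI1 _ assms(2)] True r by (simp_all add: Let_def)
    moreover obtain n where n: "?K v \<le> n" "inPhaseII v (?K(v := n)) s1" "ms1 = map (dec v) [Suc (?K v)..<Suc n]"
      "m v - ?K v \<le> k \<longrightarrow> stuck v (?K(v := n))" using Suc(1)[OF P r] by blast
    moreover have "[Suc (K v)..<Suc n] = Suc (K v) # [Suc (Suc (K v))..<Suc n]" using n(1) by (simp add: upt_rec)
    moreover have "?K(v := n) = K(v := n)" by simp
    ultimately show ?thesis by (intro exI[of _ n]) (auto simp del: fun_upd_apply simp: fun_upd_same)
  qed
qed

lemma advance_spec:
  assumes "inPhaseII v K s" "v \<in> verts G" "advance G v (\<beta> v) s = (s', ms)"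
  shows "\<exists>n. K v \<le> n \<and> inPhaseII v (K(v := n)) s' \<and> ms = map (dec v) [Suc (K v)..<Suc n] \<and> stuck v (K(v := n))"
  using resolve_spec[OF assms(1,2)] assms(3) inPhaseII_D(1)[OF assms(1) insertI1]
  unfolding advance_def by fastforce

lemma process_decision_spec:
  assumes s: "inPhaseII v K s" and v: "v \<in> verts G" and u: "u \<in> nbrs G v" and K: "K u < m u"
    and p: "process_decision G v (\<beta> v) u (dec u (Suc (K u))) s = (s', ms)"
  shows "\<exists>n. K v \<le> n \<and> inPhaseII v (K(u := Suc (K u), v := n)) s' \<and> ms = map (dec v) [Suc (K v)..<Suc n] \<and>
    stuck v (K(u := Suc (K u), v := n))"
proof -
  let ?s = "s\<lparr>resolved := (resolved s)(u := map (y u) [0..<Suc (Suc (K u))])\<rparr>"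
  have uv: "u \<noteq> v" using nbrs_subset(3)[OF sys u] .
  have "inPhaseII v (K(u := Suc (K u))) ?s"
    using s uv K unfolding inPhaseII_def by auto
  moreover have "advance G v (\<beta> v) ?s = (s', ms)"
    using p record_decision_eq[OF s insertI2[OF u] K v] by (simp add: process_decision_def)
  ultimately show ?thesis using advance_spec[of v "K(u := Suc (K u))" ?s s' ms] v uv by (auto simp: fun_upd_twist)
qed

text \<open>Messages of different neighbours may be interleaved arbitrarily; FIFO channels only
  guarantee that those of one neighbour form the consecutive outcomes from \<open>K u\<close> to
  \<open>K' u\<close>.\<close>

lemma process_queue_spec:
  assumes "inPhaseII v K s" "v \<in> verts G" "stuck v K" "fst ` set q \<subseteq> nbrs G v"
    "\<And>u. u \<in> nbrs G v \<Longrightarrow> map snd (filter (\<lambda>x. fst x = u) q) = map (dec u) [Suc (K u)..<Suc (K' u)]"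
    "\<And>u. u \<in> nbrs G v \<Longrightarrow> K u \<le> K' u" "\<And>u. u \<in> nbrs G v \<Longrightarrow> K' u \<le> m u"
    "process_queue G v (\<beta> v) q s = (s', ms)"
  shows "\<exists>n. K v \<le> n \<and> inPhaseII v (K'(v := n)) s' \<and> ms = map (dec v) [Suc (K v)..<Suc n] \<and> stuck v (K'(v := n))"
  using assms
proof (induction q arbitrary: K s s' ms)
  case Nil
  have "K u = K' u" if "u \<in> nbrs G v" for u using Nil(5,6)[OF that] by simp
  then have *: "inPhaseII v (K'(v := K v)) s" "stuck v (K'(v := K v))"
  proof -
    assume *: "\<And>u. u \<in> nbrs G v \<Longrightarrow> K u = K' u"
    have vn: "v \<notin> nbrs G v" using nbrs_subset(3)[OF sys] by blast
    show "inPhaseII v (K'(v := K v)) s" using Nil(1) * vn unfolding inPhaseII_def by auto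
    have "box G v y c n (K'(v := K v)) = box G v y c n K" for n
      unfolding box_def using * vn by (intro PiE_cong) auto
    then show "stuck v (K'(v := K v))" using Nil(3) by (simp add: stuck_def det_def)
  qed
  have "s = s'" "ms = map (dec v) [Suc (K v)..<Suc (K v)]" using Nil(8) by simp_all
  with * show ?case by (blast intro: le_refl)
next
  case (Cons x q)
  obtain u d where x: "x = (u, d)" by (cases x)
  have u: "u \<in> nbrs G v" using Cons(5) x by auto
  have uv: "u \<noteq> v" using nbrs_subset(3)[OF sys u] .
  have "d # map snd (filter (\<lambda>x. fst x = u) q) = map (dec u) [Suc (K u)..<Suc (K' u)]"
    using Cons(6)[OF u] x by simp
  then have Ku: "K u < K' u" and d: "d = dec u (Suc (K u))" and
    rest: "map snd (filter (\<lambda>x. fst x = u) q) = map (dec u) [Suc (Suc (K u))..<Suc (K' u)]"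
    by (auto simp: upt_rec[of "Suc (K u)"] split: if_splits)
  have Km: "K u < m u" using Ku Cons(8)[OF u] by simp
  obtain s1 ms1 where p: "process_decision G v (\<beta> v) u d s = (s1, ms1)" by fastforce
  obtain s2 ms2 where q: "process_queue G v (\<beta> v) q s1 = (s2, ms2)" by fastforce
  have s': "s' = s2" "ms = ms1 @ ms2" using Cons(9) p q x by auto
  obtain n where n: "K v \<le> n" "inPhaseII v (K(u := Suc (K u), v := n)) s1" "ms1 = map (dec v) [Suc (K v)..<Suc n]"
    "stuck v (K(u := Suc (K u), v := n))"
    using process_decision_spec[OF Cons(2,3) u Km] p d by blast
  let ?K = "K(u := Suc (K u), v := n)"
  have vn: "w \<noteq> v" if "w \<in> nbrs G v" for w using nbrs_subset(3)[OF sys that] .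
  have "\<exists>n'. ?K v \<le> n' \<and> inPhaseII v (K'(v := n')) s2 \<and> ms2 = map (dec v) [Suc (?K v)..<Suc n'] \<and> stuck v (K'(v := n'))"
  proof (rule Cons(1)[OF n(2) Cons(3) n(4) _ _ _ _ q])
    show "fst ` set q \<subseteq> nbrs G v" using Cons(5) by auto
    fix w assume w: "w \<in> nbrs G v"
    show "map snd (filter (\<lambda>x. fst x = w) q) = map (dec w) [Suc (?K w)..<Suc (K' w)]"
      using rest Cons(6)[OF w] x vn[OF w] by (cases "w = u") auto
    show "?K w \<le> K' w" using Ku Cons(7)[OF w] vn[OF w] by auto
    show "K' w \<le> m w" by (rule Cons(8)[OF w])
  qed
  then obtain n' where n': "n \<le> n'" "inPhaseII v (K'(v := n')) s2" "ms2 = map (dec v) [Suc n..<Suc n']" "stuck v (K'(v := n'))"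
    by auto
  have "[Suc (K v)..<Suc n'] = [Suc (K v)..<Suc n] @ [Suc n..<Suc n']"
    using n(1) n'(1) upt_add_eq_append[of "Suc (K v)" "Suc n" "n' - n"] by simp
  then have "ms = map (dec v) [Suc (K v)..<Suc n']" using n(3) n'(3) s'(2) by simp
  moreover have "K v \<le> n'" using n(1) n'(1) by simp
  ultimately show ?case using n'(2,4) s'(1) by blast
qed

end

text \<open>The list starts with the initial state, which is not a decision. In Phase I it is empty,
  and truncated subtraction gives 0.\<close>

abbreviation nres :: "node \<Rightarrow> nat \<Rightarrow> nat" where
  "nres s v \<equiv> length (resolved s v) - 1"

context coupled_run
begin

text \<open>The whole stream that \<open>u\<close> sends in the course of an execution. It depends
  on the tape only; the adversary merely decides how far the stream has been sent and received at a
  given moment.\<close>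

definition full :: "nat \<Rightarrow> message list" where
  "full u = phaseI_messages G T Y0 \<omega> u @ map (dec u) [1..<Suc (m u)]"

text \<open>One \<open>Initial\<close>, one \<open>Update\<close> for each ring, one
  \<open>EndPhaseI\<close>.\<close>

abbreviation "nI u \<equiv> m u + 2"

lemma length_phaseI: "length (phaseI_messages G T Y0 \<omega> u) = nI u"
  by (simp add: phaseI_messages_def Let_def)

lemma length_full [simp]: "length (full u) = nI u + m u"
  by (simp add: full_def length_phaseI)

lemma full_nth:
  shows "full u ! 0 = Initial (Y0 u)"
    and "1 \<le> k \<Longrightarrow> k \<le> m u \<Longrightarrow> full u ! k = Update (trunc_num (precision G T \<omega>) (ring \<omega> u k)) (precision G T \<omega>) (c u k)"
    and "full u ! Suc (m u) = EndPhaseI"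
    and "j < m u \<Longrightarrow> full u ! (nI u + j) = dec u (Suc j)"
proof -
  show "full u ! 0 = Initial (Y0 u)" by (simp add: full_def phaseI_messages_def Let_def)
  show "full u ! Suc (m u) = EndPhaseI"
    by (simp add: full_def phaseI_messages_def Let_def nth_append)
  show "j < m u \<Longrightarrow> full u ! (nI u + j) = dec u (Suc j)"
    by (simp add: full_def nth_append length_phaseI del: add_2_eq_Suc')
  assume k: "1 \<le> k" "k \<le> m u"
  then have "[1..<Suc (m u)] ! (k - 1) = k" by (subst nth_upt) auto
  then show "full u ! k = Update (trunc_num (precision G T \<omega>) (ring \<omega> u k)) (precision G T \<omega>) (c u k)"
    using k by (cases k) (auto simp: full_def phaseI_messages_def Let_def nth_append)
qed

lemma drop_take_full:
  "map (dec u) [Suc a..<Suc b] = drop (nI u + a) (take (nI u + b) (full u))" if "b \<le> m u"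
proof -
  have "take (nI u + b) (full u) = phaseI_messages G T Y0 \<omega> u @ map (dec u) [1..<Suc b]"
    using that by (simp add: full_def length_phaseI take_map take_upt del: add_2_eq_Suc')
  then show ?thesis by (simp add: length_phaseI drop_map drop_upt del: add_2_eq_Suc')
qed

text \<open>After \<open>r u\<close> messages of \<open>u\<close> the node holds
  \<open>r u - 1\<close> update times, message 0 being \<open>Initial\<close>; \<open>take\<close>
  saturates once decisions arrive, and these are queued.\<close>

definition phaseI_info :: "nat \<Rightarrow> (nat \<Rightarrow> nat) \<Rightarrow> node \<Rightarrow> bool" where
  "phaseI_info v r s \<longleftrightarrow> schedule s v = sched v \<and> initial s v = Y0 v \<and> resolved s = (\<lambda>u. []) \<and>
     \<not> phaseII s \<and> fst ` set (queued s) \<subseteq> nbrs G v \<and>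
     (\<forall>u\<in>nbrs G v. schedule s u = take (r u - 1) (sched u) \<and> (1 \<le> r u \<longrightarrow> initial s u = Y0 u) \<and>
        (u \<in> informed s \<longleftrightarrow> nI u \<le> r u) \<and>
        map snd (filter (\<lambda>x. fst x = u) (queued s)) = map (dec u) [1..<Suc (r u - nI u)])"

text \<open>The invariant includes eagerness: in Phase I some neighbour has not yet delivered all
  its information, and in Phase II the next update cannot be decided with what has been
  received.\<close>

definition node_inv :: "nat \<Rightarrow> (nat \<Rightarrow> nat) \<Rightarrow> node \<Rightarrow> bool" where
  "node_inv v r s \<longleftrightarrow> (\<forall>u\<in>nbrs G v. r u \<le> nI u + m u) \<and>
     (if phaseII s then (\<forall>u\<in>nbrs G v. nI u \<le> r u) \<and> inPhaseII v ((\<lambda>u. r u - nI u)(v := nres s v)) s \<and>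
        stuck v ((\<lambda>u. r u - nI u)(v := nres s v))
      else phaseI_info v r s \<and> (\<exists>u\<in>nbrs G v. r u < nI u))"

lemma enter_spec:
  assumes s: "phaseI_info v r s" and v: "v \<in> verts G" and r: "\<And>u. u \<in> nbrs G v \<Longrightarrow> r u \<le> nI u + m u"
    and e: "enter_phaseII G v (\<beta> v) s = (s', ms)"
  shows "node_inv v r s' \<and> ms = map (dec v) [1..<Suc (nres s' v)]"
proof (cases "nbrs G v \<subseteq> informed s")
  case False
  then have "s' = s" "ms = []" using e by (simp_all add: enter_phaseII_def)
  moreover obtain u where "u \<in> nbrs G v" "u \<notin> informed s" using False by blast
  then have "\<exists>u\<in>nbrs G v. r u < nI u" using s unfolding phaseI_info_def by (metis not_le)
  moreover have "\<not> phaseII s" "resolved s = (\<lambda>u. [])" using s by (simp_all add: phaseI_info_def)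
  ultimately show ?thesis using s r by (simp add: node_inv_def)
next
  case True
  have vn: "v \<notin> nbrs G v" using nbrs_subset(3)[OF sys] by blast
  have rI: "nI u \<le> r u" if "u \<in> nbrs G v" for u using s True that unfolding phaseI_info_def by blast
  let ?s = "s\<lparr>phaseII := True, resolved := (\<lambda>u. [initial s u]), coin := \<beta> v 1, queued := []\<rparr>"
  have sch: "schedule s u = sched u \<and> initial s u = Y0 u" if u: "u \<in> insert v (nbrs G v)" for u
  proof (cases "u = v")
    case True then show ?thesis using s by (simp add: phaseI_info_def)
  next
    case False
    then have "u \<in> nbrs G v" using u by simp
    then show ?thesis using s rI[of u] by (auto simp: phaseI_info_def)
  qed
  have P: "inPhaseII v (\<lambda>_. 0) ?s" using sch by (simp add: inPhaseII_def y_0 upt_Suc)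
  obtain s1 ms1 where a: "advance G v (\<beta> v) ?s = (s1, ms1)" by fastforce
  obtain s2 ms2 where q: "process_queue G v (\<beta> v) (queued s) s1 = (s2, ms2)" by fastforce
  have s': "s' = s2" "ms = ms1 @ ms2" using e True a q by (simp_all add: enter_phaseII_def)
  obtain n where n: "inPhaseII v ((\<lambda>_. 0)(v := n)) s1" "ms1 = map (dec v) [Suc 0..<Suc n]" "stuck v ((\<lambda>_. 0)(v := n))"
    using advance_spec[OF P v a] by blast
  have "\<exists>n'. ((\<lambda>_. 0)(v := n)) v \<le> n' \<and> inPhaseII v ((\<lambda>u. r u - nI u)(v := n')) s2 \<and>
     ms2 = map (dec v) [Suc (((\<lambda>_. 0)(v := n)) v)..<Suc n'] \<and> stuck v ((\<lambda>u. r u - nI u)(v := n'))"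
  proof (rule process_queue_spec[OF n(1) v n(3) _ _ _ _ q])
    show "fst ` set (queued s) \<subseteq> nbrs G v" using s by (simp add: phaseI_info_def)
    fix u assume u: "u \<in> nbrs G v"
    have uv: "u \<noteq> v" using u vn by blast
    show "map snd (filter (\<lambda>x. fst x = u) (queued s)) = map (dec u) [Suc (((\<lambda>_. 0)(v := n)) u)..<Suc (r u - nI u)]"
      using s u uv by (simp add: phaseI_info_def)
    show "((\<lambda>_. 0)(v := n)) u \<le> r u - nI u" using uv by simp
    show "r u - nI u \<le> m u" using r[OF u] by simp
  qed
  then obtain n' where n': "n \<le> n'" "inPhaseII v ((\<lambda>u. r u - nI u)(v := n')) s2"
     "ms2 = map (dec v) [Suc n..<Suc n']" "stuck v ((\<lambda>u. r u - nI u)(v := n'))" by auto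
  have nr: "nres s2 v = n'" using inPhaseII_D(4)[OF n'(2) insertI1] by simp
  have "[1..<Suc n'] = [Suc 0..<Suc n] @ [Suc n..<Suc n']"
    using n'(1) upt_add_eq_append[of "Suc 0" "Suc n" "n' - n"] by simp
  moreover have "phaseII s2" using n'(2) by (simp add: inPhaseII_def)
  ultimately show ?thesis unfolding node_inv_def s' nr using r rI n n' by simp
qed

lemma nres_le: "node_inv v r s \<Longrightarrow> nres s v \<le> m v"
  using inPhaseII_D(3)[of v _ s v] by (fastforce simp: node_inv_def phaseI_info_def split: if_splits)

lemma receive_spec:
  assumes s: "node_inv v r s" and v: "v \<in> verts G" and u: "u \<in> nbrs G v" and ru: "r u < nI u + m u"
    and e: "receive G v (\<beta> v) u (full u ! r u) s = (s', ms)"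
  shows "node_inv v (r(u := Suc (r u))) s' \<and> nres s v \<le> nres s' v \<and> ms = map (dec v) [Suc (nres s v)..<Suc (nres s' v)]"
proof (cases "phaseII s")
  case True
  let ?K = "(\<lambda>u. r u - nI u)(v := nres s v)"
  have uv: "u \<noteq> v" using nbrs_subset(3)[OF sys u] .
  have r: "\<And>w. w \<in> nbrs G v \<Longrightarrow> r w \<le> nI w + m w" "\<And>w. w \<in> nbrs G v \<Longrightarrow> nI w \<le> r w" and P: "inPhaseII v ?K s"
    using s True by (auto simp: node_inv_def)
  have Ku: "?K u = r u - nI u" using uv by simp
  have "r u - nI u < m u" using r(2)[OF u] ru by linarith
  from full_nth(4)[OF this] have "full u ! r u = dec u (Suc (?K u))"
    unfolding le_add_diff_inverse[OF r(2)[OF u]] Ku .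
  then have pd: "process_decision G v (\<beta> v) u (dec u (Suc (?K u))) s = (s', ms)" using e True by (simp add: receive_def)
  have lt: "?K u < m u" using ru r(2)[OF u] uv by simp
  obtain n where n: "nres s v \<le> n" "inPhaseII v (?K(u := Suc (?K u), v := n)) s'" "ms = map (dec v) [Suc (nres s v)..<Suc n]"
    "stuck v (?K(u := Suc (?K u), v := n))"
    using process_decision_spec[OF P v u lt pd] unfolding fun_upd_same by blast
  have K: "?K(u := Suc (?K u), v := n) = (\<lambda>w. (r(u := Suc (r u))) w - nI w)(v := n)"
    using uv r(2)[OF u] by (auto simp: fun_eq_iff)
  have nr: "nres s' v = n" using inPhaseII_D(4)[OF n(2) insertI1] by simp
  have "phaseII s'" using n(2) by (simp add: inPhaseII_def)
  moreover have "\<forall>w\<in>nbrs G v. (r(u := Suc (r u))) w \<le> nI w + m w \<and> nI w \<le> (r(u := Suc (r u))) w"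
  proof
    fix w assume w: "w \<in> nbrs G v"
    show "(r(u := Suc (r u))) w \<le> nI w + m w \<and> nI w \<le> (r(u := Suc (r u))) w"
      using r(1)[OF w] r(2)[OF w] ru by auto
  qed
  ultimately show ?thesis unfolding node_inv_def nr using n(1,3) n(2,4)[unfolded K] by simp
next
  case False
  let ?r = "r(u := Suc (r u))" and ?d = "full u ! r u"
  have I: "phaseI_info v r s" and r: "\<And>w. w \<in> nbrs G v \<Longrightarrow> r w \<le> nI w + m w" using s False by (auto simp: node_inv_def)
  have uv: "u \<noteq> v" using nbrs_subset(3)[OF sys u] .
  have nr: "nres s v = 0" using I by (simp add: phaseI_info_def)
  define s1 where "s1 = (case ?d of
           Initial b \<Rightarrow> s\<lparr>initial := (initial s)(u := b)\<rparr>
         | Update k p b \<Rightarrow>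
             s\<lparr>schedule := (schedule s)(u := schedule s u @ [(real k / 2 ^ p, b)])\<rparr>
         | EndPhaseI \<Rightarrow> s\<lparr>informed := insert u (informed s)\<rparr>
         | _ \<Rightarrow> s\<lparr>queued := queued s @ [(u, ?d)]\<rparr>)"
  have e1: "enter_phaseII G v (\<beta> v) s1 = (s', ms)" using e False by (simp add: receive_def s1_def)
  have "phaseI_info v ?r s1"
  proof -
    \<comment> \<open>The position in the stream determines the kind of the next message:
      \<open>Initial\<close>, \<open>Update\<close>, \<open>EndPhaseI\<close>, or a decision of a
      neighbour already in Phase II.\<close>
    consider "r u = 0" | "1 \<le> r u" "r u \<le> m u" | "r u = Suc (m u)" | "nI u \<le> r u" by linarith
    then show ?thesis
    proof cases
      case 1
      then have s1: "s1 = s\<lparr>initial := (initial s)(u := Y0 u)\<rparr>" by (simp add: s1_def full_nth(1))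
      show ?thesis using I u uv 1 unfolding s1 phaseI_info_def by auto
    next
      case 2
      then have s1: "s1 = s\<lparr>schedule := (schedule s)(u := schedule s u @ [(tm u (r u), c u (r u))])\<rparr>"
        by (simp add: s1_def full_nth(2) trunc_time_def)
      have "take (r u) (sched u) = take (r u - 1) (sched u) @ [sched u ! (r u - 1)]"
        using 2 take_Suc_conv_app_nth[of "r u - 1" "sched u"] by simp
      then have "take (r u) (sched u) = take (r u - 1) (sched u) @ [(tm u (r u), c u (r u))]"
        using sched_nth[of "r u" u] 2 by simp
      then show ?thesis using I u uv 2 unfolding s1 phaseI_info_def by auto
    next
      case 3
      then have s1: "s1 = s\<lparr>informed := insert u (informed s)\<rparr>" by (simp add: s1_def full_nth(3))
      show ?thesis using I u uv 3 unfolding s1 phaseI_info_def by auto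
    next
      case 4
      then obtain a where a: "r u = nI u + a" using le_Suc_ex by blast
      have "a < m u" using a ru by linarith
      from full_nth(4)[OF this] have d: "?d = dec u (Suc a)" unfolding a .
      then have s1: "s1 = s\<lparr>queued := queued s @ [(u, dec u (Suc a))]\<rparr>"
        by (simp add: s1_def dec_def)
      have "[1..<Suc (Suc a)] = [1..<Suc a] @ [Suc a]"
        by (simp add: upt_Suc_append)
      then show ?thesis using I u uv a unfolding s1 phaseI_info_def by auto
    qed
  qed
  moreover have "\<And>w. w \<in> nbrs G v \<Longrightarrow> ?r w \<le> nI w + m w" using r ru by auto
  ultimately show ?thesis using enter_spec[OF _ v _ e1, of ?r] nr by simp
qed

lemma start_spec:
  assumes v: "v \<in> verts G" and e: "start G T Y0 \<omega> v = (s, ms)"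
  shows "node_inv v (\<lambda>_. 0) s \<and> ms = take (nI v + nres s v) (full v)"
proof -
  obtain s' ms' where e': "enter_phaseII G v (\<beta> v) (phaseI_state G T Y0 \<omega> v) = (s', ms')" by fastforce
  have vn: "v \<notin> nbrs G v" using nbrs_subset(3)[OF sys] by blast
  have "phaseI_info v (\<lambda>_. 0) (phaseI_state G T Y0 \<omega> v)"
    using vn unfolding phaseI_info_def phaseI_state_def by (auto simp: sched_def trunc_time_def Let_def)
  then have n: "node_inv v (\<lambda>_. 0) s' \<and> ms' = map (dec v) [1..<Suc (nres s' v)]"
    by (rule enter_spec[OF _ v _ e']) simp
  have s: "s = s'" "ms = phaseI_messages G T Y0 \<omega> v @ ms'" using e e' by (simp_all add: start_def)
  have "nres s' v \<le> m v" using n nres_le by blast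
  then have "ms = take (nI v + nres s v) (full v)"
    using n by (simp add: s full_def length_phaseI take_map take_upt del: add_2_eq_Suc')
  then show ?thesis using n s by simp
qed

section \<open>Asynchronous executions\<close>

text \<open>\<open>r v u\<close> counts the messages of \<open>u\<close> that \<open>v\<close> has received.\<close>

definition sent :: "config \<Rightarrow> nat \<Rightarrow> nat" where
  "sent cfg u = nI u + nres (nodes cfg u) u"

text \<open>Channels have no content of their own: each is the slice of the sender's stream between
  what is received and what is sent, so counters describe the configuration up to sending
  times.\<close>

definition config_inv :: "config \<Rightarrow> (nat \<Rightarrow> nat \<Rightarrow> nat) \<Rightarrow> bool" where
  "config_inv cfg r \<longleftrightarrow> (\<forall>v\<in>verts G. node_inv v (r v) (nodes cfg v)) \<and>
     (\<forall>v. \<forall>u\<in>nbrs G v. map snd (channel cfg u v) = drop (r v u) (take (sent cfg u) (full u)) \<and> r v u \<le> sent cfg u) \<and>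
     (\<forall>u v. u \<notin> nbrs G v \<longrightarrow> channel cfg u v = []) \<and>
     (\<forall>(d, x)\<in>set (log cfg). \<exists>u\<in>verts G. nbrs G u \<noteq> {} \<and> x \<in> set (full u))"

lemma config_inv_initial: "config_inv (initial_config G T Y0 \<omega>) (\<lambda>_ _. 0)"
  unfolding config_inv_def
proof (intro conjI ballI allI impI)
  fix v assume v: "v \<in> verts G"
  show "node_inv v (\<lambda>_. 0) (nodes (initial_config G T Y0 \<omega>) v)"
    using start_spec[OF v prod.collapse[symmetric]] by (simp add: initial_config_def)
next
  fix v u assume u: "u \<in> nbrs G v"
  have uV: "u \<in> verts G" using nbrs_subset[OF sys u] by simp
  show "map snd (channel (initial_config G T Y0 \<omega>) u v) = drop 0 (take (sent (initial_config G T Y0 \<omega>) u) (full u))"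
    using start_spec[OF uV prod.collapse[symmetric]] u by (simp add: initial_config_def nbrs_def sent_def comp_def)
qed (auto simp: initial_config_def nbrs_def)

lemma sent_le: "config_inv cfg r \<Longrightarrow> u \<in> verts G \<Longrightarrow> sent cfg u \<le> nI u + m u"
  using nres_le by (fastforce simp: config_inv_def sent_def)

lemma deliver_spec:
  assumes inv: "config_inv cfg r" and ne: "channel cfg u v \<noteq> []"
    and cfg'_def: "cfg' = deliver G \<omega> u v t cfg" and r'_def: "r' = r(v := (r v)(u := Suc (r v u)))"
  shows "u \<in> nbrs G v" "config_inv cfg' r'" "now cfg' = t"
    "log cfg' = log cfg @ [(t - fst (hd (channel cfg u v)), snd (hd (channel cfg u v)))]"
    "channel cfg' a b = (if a = v \<and> b \<in> nbrs G v then channel cfg v b @ map (Pair t) (drop (sent cfg v) (take (sent cfg' v) (full v)))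
       else if a = u \<and> b = v then tl (channel cfg u v) else channel cfg a b)"
    "w \<in> verts G \<Longrightarrow> nres (nodes cfg w) w \<le> nres (nodes cfg' w) w"
    "w \<noteq> v \<Longrightarrow> nodes cfg' w = nodes cfg w"
proof -
  show u: "u \<in> nbrs G v" using inv ne unfolding config_inv_def by blast
  have uv: "u \<noteq> v" and V: "u \<in> verts G" "v \<in> verts G" using nbrs_subset[OF sys u] by auto
  have ch: "map snd (channel cfg u v) = drop (r v u) (take (sent cfg u) (full u))" "r v u \<le> sent cfg u"
    using inv u unfolding config_inv_def by auto
  obtain rt msg where hd: "hd (channel cfg u v) = (rt, msg)" by (cases "hd (channel cfg u v)")
  have lt: "r v u < sent cfg u" using ch ne by (metis drop_all le_neq_implies_less length_take map_is_Nil_conv min.cobounded2 order_refl)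
  have sl: "sent cfg u \<le> nI u + m u" by (rule sent_le[OF inv V(1)])
  have dr: "drop (r v u) (take (sent cfg u) (full u)) = full u ! r v u # drop (Suc (r v u)) (take (sent cfg u) (full u))"
    using lt sl Cons_nth_drop_Suc[of "r v u" "take (sent cfg u) (full u)"] by simp
  have msg: "msg = full u ! r v u"
    using ch(1) dr ne hd by (cases "channel cfg u v") auto
  have tl: "map snd (tl (channel cfg u v)) = drop (Suc (r v u)) (take (sent cfg u) (full u))"
    using ch(1) dr by (metis list.sel(3) map_tl)
  obtain s' ms where rec: "receive G v (\<beta> v) u (full u ! r v u) (nodes cfg v) = (s', ms)" by fastforce
  have ni: "node_inv v (r v) (nodes cfg v)" using inv V by (simp add: config_inv_def)
  note RS = receive_spec[OF ni V(2) u _ rec]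
  have ni': "node_inv v (r' v) s'" and mono: "nres (nodes cfg v) v \<le> nres s' v"
    and ms: "ms = map (dec v) [Suc (nres (nodes cfg v) v)..<Suc (nres s' v)]"
    using RS lt sl by (auto simp: r'_def)
  have cfg': "cfg' = \<lparr>now = t, nodes = (nodes cfg)(v := s'),
          channel = ((channel cfg)(u := (channel cfg u)(v := tl (channel cfg u v))))(v := (\<lambda>w. if {v, w} \<in> edges G then
             ((channel cfg)(u := (channel cfg u)(v := tl (channel cfg u v)))) v w @ map (Pair t) ms
             else ((channel cfg)(u := (channel cfg u)(v := tl (channel cfg u v)))) v w)),
          log = log cfg @ [(t - rt, msg)]\<rparr>"
    unfolding cfg'_def deliver_def hd using rec msg by (simp add: Let_def)
  show now: "now cfg' = t" by (simp add: cfg')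
  show lg: "log cfg' = log cfg @ [(t - fst (hd (channel cfg u v)), snd (hd (channel cfg u v)))]" by (simp add: cfg' hd)
  have nodes: "nodes cfg' = (nodes cfg)(v := s')" by (simp add: cfg')
  show "w \<noteq> v \<Longrightarrow> nodes cfg' w = nodes cfg w" by (simp add: nodes)
  show "w \<in> verts G \<Longrightarrow> nres (nodes cfg w) w \<le> nres (nodes cfg' w) w" using mono by (cases "w = v") (simp_all add: nodes)
  have ms': "ms = drop (sent cfg v) (take (sent cfg' v) (full v))"
    using drop_take_full[OF nres_le[OF ni'], of "nres (nodes cfg v) v"] ms by (simp add: sent_def nodes)
  show chan: "channel cfg' a b = (if a = v \<and> b \<in> nbrs G v then channel cfg v b @ map (Pair t) (drop (sent cfg v) (take (sent cfg' v) (full v)))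
       else if a = u \<and> b = v then tl (channel cfg u v) else channel cfg a b)" for a b
  proof -
    have "{v, b} \<in> edges G \<longleftrightarrow> b \<in> nbrs G v" by (simp add: nbrs_def insert_commute)
    then have "channel cfg' a b = (if a = v \<and> b \<in> nbrs G v then channel cfg v b @ map (Pair t) ms
       else if a = u \<and> b = v then tl (channel cfg u v) else channel cfg a b)"
      using uv by (simp add: cfg')
    then show ?thesis unfolding ms' .
  qed
  have sent': "sent cfg' a = sent cfg a" if "a \<noteq> v" for a using that by (simp add: sent_def nodes)
  have sentv: "sent cfg v \<le> sent cfg' v" using mono by (simp add: sent_def nodes)
  show "config_inv cfg' r'"
    unfolding config_inv_def
  proof (intro conjI ballI allI impI)
    fix w assume w: "w \<in> verts G"
    show "node_inv w (r' w) (nodes cfg' w)"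
      using ni' inv w by (cases "w = v") (auto simp: nodes r'_def config_inv_def)
  next
    fix b a assume a: "a \<in> nbrs G b"
    have old: "map snd (channel cfg a b) = drop (r b a) (take (sent cfg a) (full a))" "r b a \<le> sent cfg a"
      using inv a unfolding config_inv_def by auto
    show "map snd (channel cfg' a b) = drop (r' b a) (take (sent cfg' a) (full a))"
    proof (cases "a = v")
      case True
      then have b: "b \<in> nbrs G v" using a nbrs_sym by blast
      have rb: "r' b a = r b a" using a True nbrs_subset(3)[OF sys a] by (simp add: r'_def)
      have "take (sent cfg' v) (full v) = take (sent cfg v) (full v) @ drop (sent cfg v) (take (sent cfg' v) (full v))"
        using sentv by (metis append_take_drop_id min.absorb1 take_take)
      moreover have "sent cfg v \<le> nI v + m v" by (rule sent_le[OF inv V(2)])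
      ultimately have "drop (r b v) (take (sent cfg' v) (full v)) =
          drop (r b v) (take (sent cfg v) (full v)) @ drop (sent cfg v) (take (sent cfg' v) (full v))"
        using old(2) True by (metis (no_types, lifting) append_Nil diff_is_0_eq drop0 drop_append length_full length_take min.absorb2)
      then show ?thesis using True b old(1) rb by (simp add: chan comp_def)
    next
      case False
      then show ?thesis using old tl sent'[OF False] by (auto simp: chan r'_def)
    qed
    show "r' b a \<le> sent cfg' a"
      using old(2) lt sentv sent'[of a] uv by (cases "a = v") (auto simp: r'_def)
  next
    fix a b assume "a \<notin> nbrs G b"
    then show "channel cfg' a b = []" using inv u nbrs_sym[of a G b] unfolding chan config_inv_def by auto
  next
    fix x assume x: "x \<in> set (log cfg')"
    have "nbrs G u \<noteq> {}" using u nbrs_sym by blast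
    moreover have "msg \<in> set (full u)" unfolding msg using lt sl by (intro nth_mem) simp
    moreover have "\<forall>(d, x)\<in>set (log cfg). \<exists>u\<in>verts G. nbrs G u \<noteq> {} \<and> x \<in> set (full u)"
      using inv by (simp add: config_inv_def)
    ultimately show "case x of (d, x) \<Rightarrow> \<exists>u\<in>verts G. nbrs G u \<noteq> {} \<and> x \<in> set (full u)"
      using x V(1) unfolding lg hd by auto
  qed
qed

end

lemma execution_0: "execution G T Y0 adv \<omega> 0 = initial_config G T Y0 \<omega>"
  by (simp add: execution_def)

lemma history_ne: "history G T Y0 adv \<omega> k \<noteq> []"
  by (induction k) (auto simp: Let_def split: prod.splits)

lemma execution_Suc:
  assumes "admissible adv" "\<not> quiescent (execution G T Y0 adv \<omega> k)"
  obtains u v t where "channel (execution G T Y0 adv \<omega> k) u v \<noteq> []" "now (execution G T Y0 adv \<omega> k) \<le> t"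
    "execution G T Y0 adv \<omega> (Suc k) = deliver G \<omega> u v t (execution G T Y0 adv \<omega> k)"
proof -
  let ?h = "history G T Y0 adv \<omega> k"
  obtain u v t where a: "adv ?h = ((u, v), t)" by (metis prod.collapse)
  have "channel (hd ?h) u v \<noteq> [] \<and> now (hd ?h) \<le> t"
    using assms history_ne[of G T Y0 adv \<omega> k] a unfolding admissible_def execution_def by fastforce
  moreover have "execution G T Y0 adv \<omega> (Suc k) = deliver G \<omega> u v t (hd ?h)"
    using assms(2) a by (simp add: execution_def Let_def)
  ultimately show ?thesis using that by (auto simp: execution_def)
qed

lemma execution_quiescent:
  "quiescent (execution G T Y0 adv \<omega> k) \<Longrightarrow> execution G T Y0 adv \<omega> (Suc k) = execution G T Y0 adv \<omega> k"
  by (simp add: execution_def Let_def)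

section \<open>Termination and running time under an arbitrary admissible adversary\<close>

locale adversarial_run = coupled_run +
  fixes adv :: adversary
  assumes adm: "admissible adv"
begin

abbreviation "ex \<equiv> execution G T Y0 adv \<omega>"

lemma ex_step:
  assumes "\<not> quiescent (ex k)"
  obtains u v t where "channel (ex k) u v \<noteq> []" "now (ex k) \<le> t" "ex (Suc k) = deliver G \<omega> u v t (ex k)"
  using execution_Suc[OF adm assms] by blast

text \<open>The sending time of the message number \<open>i\<close> of \<open>u\<close> at step \<open>k\<close>: it was sent initially or by a step before
  which it had not been sent.\<close>

definition timely :: "nat \<Rightarrow> nat \<Rightarrow> nat \<Rightarrow> real \<Rightarrow> bool" where
  "timely k u i s \<longleftrightarrow> s = 0 \<or> (\<exists>l<k. s = now (ex (Suc l)) \<and> sent (ex l) u \<le> i)"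

definition run_inv :: "nat \<Rightarrow> (nat \<Rightarrow> nat \<Rightarrow> nat) \<Rightarrow> bool" where
  "run_inv k r \<longleftrightarrow> config_inv (ex k) r \<and>
     (\<forall>v. \<forall>u\<in>nbrs G v. \<forall>j<length (channel (ex k) u v). timely k u (r v u + j) (fst (channel (ex k) u v ! j)))"

abbreviation total :: "(nat \<Rightarrow> nat \<Rightarrow> nat) \<Rightarrow> nat" where
  "total r \<equiv> \<Sum>v\<in>verts G. \<Sum>u\<in>nbrs G v. r v u"

lemma fin: "finite (verts G)"
  using sys by (simp add: metropolis_system_def)

lemma length_channel:
  assumes "config_inv cfg r" "u \<in> nbrs G v"
  shows "length (channel cfg u v) = sent cfg u - r v u"
proof -
  have "u \<in> verts G" using nbrs_subset[OF sys assms(2)] by simp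
  have "map snd (channel cfg u v) = drop (r v u) (take (sent cfg u) (full u))"
    using assms by (simp add: config_inv_def)
  then have "length (channel cfg u v) = length (drop (r v u) (take (sent cfg u) (full u)))"
    by (metis length_map)
  then show ?thesis using sent_le[OF assms(1) \<open>u \<in> verts G\<close>] by simp
qed

lemma run_inv_0: "run_inv 0 (\<lambda>_ _. 0)"
proof -
  have "fst (channel (initial_config G T Y0 \<omega>) u v ! j) = 0" if "j < length (channel (initial_config G T Y0 \<omega>) u v)" for u v j
    using that by (auto simp: initial_config_def split: if_splits)
  then show ?thesis using config_inv_initial by (simp add: run_inv_def execution_0 timely_def)
qed

lemma run_inv_Suc:
  assumes inv: "run_inv k r" and nq: "\<not> quiescent (ex k)"
  shows "\<exists>r'. run_inv (Suc k) r' \<and> total r' = Suc (total r)"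
proof -
  obtain u v t where d: "channel (ex k) u v \<noteq> []" "now (ex k) \<le> t" "ex (Suc k) = deliver G \<omega> u v t (ex k)"
    by (rule ex_step[OF nq])
  let ?r = "r(v := (r v)(u := Suc (r v u)))"
  have ci: "config_inv (ex k) r" using inv by (simp add: run_inv_def)
  note D = deliver_spec[OF ci d(1) d(3) refl]
  have V: "u \<in> verts G" "v \<in> verts G" "u \<noteq> v" using nbrs_subset[OF sys D(1)] by auto
  have "timely (Suc k) a (?r b a + j) (fst (channel (ex (Suc k)) a b ! j))"
    if a: "a \<in> nbrs G b" and j: "j < length (channel (ex (Suc k)) a b)" for a b j
  proof -
    have old: "timely (Suc k) a (r b a + i) (fst (channel (ex k) a b ! i))" if "i < length (channel (ex k) a b)" for i
      using inv a that unfolding run_inv_def timely_def by (meson less_SucI)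
    consider "a = v" | "a = u" "b = v" "a \<noteq> v" | "a \<noteq> v" "\<not> (a = u \<and> b = v)" by blast
    then show ?thesis
    proof cases
      case 1
      then have b: "b \<in> nbrs G v" using a nbrs_sym by blast
      have rb: "?r b a = r b a" using 1 nbrs_subset(3)[OF sys a] by simp
      let ?n = "drop (sent (ex k) v) (take (sent (ex (Suc k)) v) (full v))"
      have ch: "channel (ex (Suc k)) a b = channel (ex k) a b @ map (Pair t) ?n" using D(5)[of a b] 1 b by simp
      show ?thesis
      proof (cases "j < length (channel (ex k) a b)")
        case True
        then show ?thesis using old rb by (simp add: ch nth_append)
      next
        case False
        then have "fst (channel (ex (Suc k)) a b ! j) = t" using j by (simp add: ch nth_append)
        moreover have "sent (ex k) a \<le> r b a + j" using False length_channel[OF ci a] by simp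
        ultimately show ?thesis using rb D(3) unfolding timely_def by auto
      qed
    next
      case 2
      have ch: "channel (ex (Suc k)) a b = tl (channel (ex k) a b)" using D(5)[of a b] 2 by simp
      then show ?thesis using old[of "Suc j"] j 2 by (simp add: nth_tl)
    next
      case 3
      have ch: "channel (ex (Suc k)) a b = channel (ex k) a b" using D(5)[of a b] 3 by auto
      have "?r b a = r b a" using 3 by auto
      then show ?thesis using old[of j] j by (simp add: ch)
    qed
  qed
  then have "run_inv (Suc k) ?r" using D(2) by (simp add: run_inv_def)
  moreover have "total ?r = Suc (total r)"
  proof -
    have "(\<Sum>w\<in>nbrs G v. (?r v) w) = Suc (\<Sum>w\<in>nbrs G v. r v w)"
      using D(1) finite_nbrs[OF sys] by (simp add: sum.remove[where x=u])
    then show ?thesis using V(2) fin by (simp add: sum.remove[where x=v])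
  qed
  ultimately show ?thesis by blast
qed

lemma run_inv_ex: "\<exists>r. run_inv k r \<and> ((\<exists>l<k. quiescent (ex l)) \<or> total r = k)"
proof (induction k)
  case 0
  then show ?case using run_inv_0 by (intro exI[of _ "\<lambda>_ _. 0"]) simp
next
  case (Suc k)
  then obtain r where r: "run_inv k r" "(\<exists>l<k. quiescent (ex l)) \<or> total r = k" by blast
  show ?case
  proof (cases "quiescent (ex k)")
    case True
    then have eq: "ex (Suc k) = ex k" by (rule execution_quiescent)
    have "run_inv (Suc k) r" using r(1) unfolding run_inv_def eq timely_def by (meson less_SucI)
    then show ?thesis using True by blast
  next
    case False
    then obtain r' where "run_inv (Suc k) r'" "total r' = Suc (total r)" using run_inv_Suc[OF r(1)] by blast
    then show ?thesis using r(2) less_SucI by (metis (no_types, lifting))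
  qed
qed

lemma run_inv_le: "run_inv k r \<Longrightarrow> v \<in> verts G \<Longrightarrow> u \<in> nbrs G v \<Longrightarrow> r v u \<le> nI u + m u"
  unfolding run_inv_def config_inv_def node_inv_def by blast

text \<open>Every delivery raises the number of received messages by one, and the finite streams
  bound that number.\<close>

lemma quiescent_ex: "\<exists>k. quiescent (ex k)"
proof (rule ccontr)
  assume nq: "\<nexists>k. quiescent (ex k)"
  define B where "B = (\<Sum>v\<in>verts G. \<Sum>u\<in>nbrs G v. nI u + m u)"
  obtain r where r: "run_inv (Suc B) r" "total r = Suc B" using run_inv_ex[of "Suc B"] nq by blast
  have "total r \<le> B" unfolding B_def using run_inv_le[OF r(1)] by (intro sum_mono) auto
  then show False using r(2) by simp
qed

lemma node_inv_ex: "run_inv k r \<Longrightarrow> v \<in> verts G \<Longrightarrow> node_inv v (r v) (nodes (ex k) v)"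
  by (simp add: run_inv_def config_inv_def)

lemma now_mono: "k \<le> l \<Longrightarrow> now (ex k) \<le> now (ex l)"
proof (induction l rule: dec_induct)
  case (step l)
  show ?case
  proof (cases "quiescent (ex l)")
    case True
    then show ?thesis using step execution_quiescent[OF True] by simp
  next
    case False
    obtain r where r: "run_inv l r" using run_inv_ex by blast
    obtain u v t where d: "channel (ex l) u v \<noteq> []" "now (ex l) \<le> t" "ex (Suc l) = deliver G \<omega> u v t (ex l)"
      by (rule ex_step[OF False])
    then show ?thesis using step deliver_spec(3)[OF _ d(1) d(3) refl, of r] r by (simp add: run_inv_def)
  qed
qed simp

lemma delivered_later:
  assumes "quiescent (ex (k + n))" "x \<in> set (channel (ex k) u v)"
  shows "\<exists>l>k. now (ex l) - fst x \<in> fst ` set (log (ex l))"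
  using assms
proof (induction n arbitrary: k)
  case 0
  then show ?case by (simp add: quiescent_def)
next
  case (Suc n)
  have nq: "\<not> quiescent (ex k)" using Suc(3) unfolding quiescent_def by (metis empty_iff empty_set)
  obtain r where r: "run_inv k r" using run_inv_ex by blast
  obtain a b t where d: "channel (ex k) a b \<noteq> []" "now (ex k) \<le> t" "ex (Suc k) = deliver G \<omega> a b t (ex k)"
    by (rule ex_step[OF nq])
  have ci: "config_inv (ex k) r" using r by (simp add: run_inv_def)
  note D = deliver_spec[OF ci d(1) d(3) refl]
  show ?case
  proof (cases "u = a \<and> v = b \<and> x = hd (channel (ex k) a b)")
    case True
    then have "now (ex (Suc k)) - fst x \<in> fst ` set (log (ex (Suc k)))" by (auto simp: D(3,4))
    then show ?thesis by blast
  next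
    case False
    then have "x \<in> set (channel (ex (Suc k)) u v)"
      using Suc(3) D(5)[of u v] d(1) by (cases "channel (ex k) a b") (auto split: if_splits)
    moreover have "quiescent (ex (Suc k + n))" using Suc(2) by simp
    ultimately obtain l where "l > Suc k" "now (ex l) - fst x \<in> fst ` set (log (ex l))" using Suc(1) by blast
    then show ?thesis by (intro exI[of _ l]) auto
  qed
qed

abbreviation "unit \<equiv> time_unit G T Y0 adv \<omega>"

lemma ex_stable:
  assumes "quiescent (ex Q)" "Q \<le> k"
  shows "ex k = ex Q"
  using assms(2)
proof (induction k rule: dec_induct)
  case (step k)
  then show ?case using assms(1) execution_quiescent[of G T Y0 adv \<omega> k] by simp
qed simp

lemma log_subset: "k \<le> l \<Longrightarrow> set (log (ex k)) \<subseteq> set (log (ex l))"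
proof (induction l rule: dec_induct)
  case (step l)
  have "set (log (ex l)) \<subseteq> set (log (ex (Suc l)))"
  proof (cases "quiescent (ex l)")
    case True
    then show ?thesis using execution_quiescent[OF True] by simp
  next
    case False
    obtain r where r: "run_inv l r" using run_inv_ex by blast
    obtain a b t where d: "channel (ex l) a b \<noteq> []" "now (ex l) \<le> t" "ex (Suc l) = deliver G \<omega> a b t (ex l)"
      by (rule ex_step[OF False])
    then show ?thesis using deliver_spec(4)[OF _ d(1) d(3) refl, of r] r by (auto simp: run_inv_def)
  qed
  then show ?case using step by blast
qed simp

lemma finite_delivered: "finite (delivered G T Y0 adv \<omega>)"
proof -
  obtain Q where Q: "quiescent (ex Q)" using quiescent_ex by blast
  have "set (log (ex k)) \<subseteq> set (log (ex Q))" for k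
    using log_subset[of k Q] ex_stable[OF Q, of k] by (cases "k \<le> Q") auto
  then have "delivered G T Y0 adv \<omega> \<subseteq> set (log (ex Q))" unfolding delivered_def by blast
  then show ?thesis by (rule finite_subset) simp
qed

lemma delay_le_unit: "d \<in> fst ` set (log (ex k)) \<Longrightarrow> d \<le> unit"
proof -
  assume "d \<in> fst ` set (log (ex k))"
  then have "d \<in> insert 0 (fst ` delivered G T Y0 adv \<omega>)" unfolding delivered_def by blast
  then show ?thesis unfolding time_unit_def using finite_delivered by (intro cSup_upper) auto
qed

lemma unit_nonneg: "0 \<le> unit"
  unfolding time_unit_def using finite_delivered by (intro cSup_upper) auto

text \<open>A message still in its channel at step \<open>k\<close> is delivered at step
  \<open>Suc k\<close> or later with a delay of at most one unit, so even the next configuration is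
  at most one unit after the sending time.\<close>

lemma in_transit:
  assumes "x \<in> set (channel (ex k) u v)"
  shows "now (ex (Suc k)) \<le> fst x + unit"
proof -
  obtain Q where Q: "quiescent (ex Q)" using quiescent_ex by blast
  have "k \<le> Q"
  proof (rule ccontr)
    assume "\<not> k \<le> Q"
    then have "quiescent (ex k)" using ex_stable[OF Q, of k] Q by simp
    then show False using assms by (simp add: quiescent_def)
  qed
  then obtain n where "Q = k + n" using le_Suc_ex by blast
  then obtain l where l: "l > k" "now (ex l) - fst x \<in> fst ` set (log (ex l))" using delivered_later assms Q by blast
  then have "now (ex l) - fst x \<le> unit" using delay_le_unit by blast
  moreover have "now (ex (Suc k)) \<le> now (ex l)" using l by (intro now_mono) simp
  ultimately show ?thesis by simp
qed

lemma delivered_messages: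
  "(d, x) \<in> delivered G T Y0 adv \<omega> \<Longrightarrow> \<exists>u\<in>verts G. nbrs G u \<noteq> {} \<and> x \<in> set (full u)"
proof -
  assume "(d, x) \<in> delivered G T Y0 adv \<omega>"
  then obtain k where k: "(d, x) \<in> set (log (ex k))" unfolding delivered_def by blast
  obtain r where "config_inv (ex k) r" using run_inv_ex[of k] unfolding run_inv_def by blast
  then show ?thesis using k unfolding config_inv_def by blast
qed

text \<open>If all outcomes of smaller rounds had arrived, \<open>R_decided\<close> and monotonicity
  would determine the update, against \<open>stuck\<close>. Decision \<open>j\<close> of
  \<open>u\<close> has index \<open>Suc (m u) + j\<close> in the stream, so the bound on
  \<open>r v u\<close> says that it has not arrived.\<close>

lemma blocked:
  assumes r: "run_inv k r" and v: "v \<in> verts G" and II: "phaseII (nodes (ex k) v)"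
    and i: "i = Suc (nres (nodes (ex k) v) v)" "i \<le> m v"
  shows "\<exists>u\<in>nbrs G v. \<exists>j. 1 \<le> j \<and> j \<le> cn v i u \<and> R u j < R v i \<and> r v u \<le> Suc (m u) + j \<and> nI u \<le> r v u"
proof (rule ccontr)
  assume no: "\<not> ?thesis"
  let ?K = "(\<lambda>u. r v u - nI u)(v := nres (nodes (ex k) v) v)"
  have ni: "node_inv v (r v) (nodes (ex k) v)" by (rule node_inv_ex[OF r v])
  then have st: "stuck v ?K" and rI: "\<And>u. u \<in> nbrs G v \<Longrightarrow> nI u \<le> r v u" using II by (auto simp: node_inv_def)
  interpret nbhd G v y c "cn v i" by (rule nbhd_cn[OF v])
  have le: "known R (cn v i) (R v i) u \<le> ?K u" if u: "u \<in> nbrs G v" for u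
  proof -
    have uv: "u \<noteq> v" using nbrs_subset(3)[OF sys u] .
    show ?thesis
    proof (rule known_bound)
      fix j assume j: "1 \<le> j" "j \<le> cn v i u" "R u j < R v i"
      then have "\<not> r v u \<le> Suc (m u) + j" using no u rI[OF u] by blast
      then show "j \<le> ?K u" using uv by simp
    qed
  qed
  have "1 \<le> i" using i(1) by simp
  from R_decided[OF v this i(2)] have "det v i ?K"
    unfolding det_def by (rule decided_mono) (rule le)
  then show False using st i by (simp add: stuck_def)
qed

text \<open>Phase I information is sent at time 0, so the part that keeps a node in Phase I is still
  in a channel, stamped with time 0.\<close>

lemma phaseI_transit:
  assumes r: "run_inv k r" and v: "v \<in> verts G" and I: "\<not> phaseII (nodes (ex k) v)"
  obtains u x where "u \<in> nbrs G v" "x \<in> set (channel (ex k) u v)" "fst x = 0"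
proof -
  have ci: "config_inv (ex k) r" using r by (simp add: run_inv_def)
  have "\<exists>u\<in>nbrs G v. r v u < nI u" using node_inv_ex[OF r v] I by (simp add: node_inv_def)
  then obtain u where u: "u \<in> nbrs G v" "r v u < nI u" by blast
  have len: "0 < length (channel (ex k) u v)" using length_channel[OF ci u(1)] u(2) by (simp add: sent_def)
  then have "timely k u (r v u) (fst (channel (ex k) u v ! 0))" using r u(1) unfolding run_inv_def by fastforce
  then have "fst (channel (ex k) u v ! 0) = 0" using u(2) by (auto simp: timely_def sent_def)
  then show ?thesis using that u(1) len nth_mem by blast
qed

lemma all_terminated:
  assumes r: "run_inv k r" and II: "\<And>v. v \<in> verts G \<Longrightarrow> phaseII (nodes (ex k) v)"
    and m: "\<And>v. v \<in> verts G \<Longrightarrow> m v \<le> nres (nodes (ex k) v) v"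
  shows "terminated G (ex k)"
  unfolding terminated_def all_resolved_def
proof (intro ballI conjI II)
  fix v assume v: "v \<in> verts G"
  have P: "inPhaseII v ((\<lambda>u. r v u - nI u)(v := nres (nodes (ex k) v) v)) (nodes (ex k) v)"
    using node_inv_ex[OF r v] II[OF v] by (simp add: node_inv_def)
  show "length (schedule (nodes (ex k) v) v) < length (resolved (nodes (ex k) v) v)"
    using inPhaseII_D(1,4)[OF P insertI1] m[OF v] by simp
qed

text \<open>In a quiescent configuration everything sent has been received. By
  \<open>blocked\<close>, an unresolved update with the earliest ring among the next ones of all
  nodes would wait for an unresolved update with an earlier ring.\<close>

theorem terminates: "\<exists>k. terminated G (ex k)"
proof -
  obtain Q where Q: "quiescent (ex Q)" using quiescent_ex by blast
  obtain r where r: "run_inv Q r" using run_inv_ex by blast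
  have ci: "config_inv (ex Q) r" using r by (simp add: run_inv_def)
  have all: "r v u = sent (ex Q) u" if u: "u \<in> nbrs G v" for u v
  proof -
    have "sent (ex Q) u - r v u = 0" using length_channel[OF ci u] Q by (simp add: quiescent_def)
    moreover have "r v u \<le> sent (ex Q) u" using ci u by (simp add: config_inv_def)
    ultimately show ?thesis by simp
  qed
  have II: "phaseII (nodes (ex Q) v)" if "v \<in> verts G" for v
    using phaseI_transit[OF r that] Q by (metis empty_iff empty_set quiescent_def)
  have "m v \<le> nres (nodes (ex Q) v) v" if v: "v \<in> verts G" for v
  proof (rule ccontr)
    assume nv: "\<not> m v \<le> nres (nodes (ex Q) v) v"
    define U where "U = {v \<in> verts G. nres (nodes (ex Q) v) v < m v}"
    define t where "t v = ring \<omega> v (Suc (nres (nodes (ex Q) v) v))" for v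
    have "finite U" "U \<noteq> {}" using fin v nv by (auto simp: U_def)
    then obtain w where w: "w \<in> U" "\<And>u. u \<in> U \<Longrightarrow> t w \<le> t u"
      using ex_is_arg_min_if_finite[of U t] by (auto simp: is_arg_min_def not_less)
    let ?i = "Suc (nres (nodes (ex Q) w) w)"
    have wV: "w \<in> verts G" "?i \<le> m w" using w by (auto simp: U_def)
    obtain u j where u: "u \<in> nbrs G w" and j: "1 \<le> j" "j \<le> cn w ?i u" "r w u \<le> Suc (m u) + j"
      using blocked[OF r wV(1) II[OF wV(1)] refl wV(2)] by blast
    have uV: "u \<in> verts G" using nbrs_subset[OF sys u] by simp
    have lt: "nres (nodes (ex Q) u) u < j" using j(3) all[OF u] by (simp add: sent_def)
    have jm: "j \<le> m u" using j(2) cn_le[of w ?i u] by simp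
    have "ring \<omega> u j < t w" using cn_iff[OF uV j(1) jm, of w ?i] j(2) by (simp add: t_def)
    moreover have "t u \<le> ring \<omega> u j" unfolding t_def
      using ring_mono[OF uV, of "Suc (nres (nodes (ex Q) u) u)" j] lt by (cases "Suc (nres (nodes (ex Q) u) u) = j") auto
    moreover have "u \<in> U" using lt jm uV by (simp add: U_def)
    ultimately show False using w(2)[of u] by simp
  qed
  then show ?thesis using all_terminated[OF r II] by blast
qed

lemma terminated_output:
  assumes "terminated G (ex k)" "v \<in> verts G"
  shows "last (resolved (nodes (ex k) v) v) = y v (m v)"
proof -
  obtain r where r: "run_inv k r" using run_inv_ex by blast
  have II: "phaseII (nodes (ex k) v)" and ar: "all_resolved v (nodes (ex k) v)" using assms by (auto simp: terminated_def)
  have P: "inPhaseII v ((\<lambda>u. r v u - nI u)(v := nres (nodes (ex k) v) v)) (nodes (ex k) v)"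
    using node_inv_ex[OF r assms(2)] II by (simp add: node_inv_def)
  note D = inPhaseII_D[OF P insertI1]
  have n: "nres (nodes (ex k) v) v = m v" using ar D(1,3,4) by (simp add: all_resolved_def)
  show ?thesis using D(2) n by (simp add: upt_Suc)
qed

theorem output_eq: "algorithm_output G T Y0 adv \<omega> = (\<lambda>v\<in>verts G. y v (m v))"
proof -
  have "terminated G (ex (LEAST k. terminated G (ex k)))" using terminates by (metis LeastI)
  from terminated_output[OF this] show ?thesis
    by (simp add: algorithm_output_def Let_def cong: restrict_cong)
qed

text \<open>The execution with all delays equal to the time unit is the slowest one.\<close>

lemma resolved_in_time:
  assumes "v \<in> verts G" "1 \<le> i" "i \<le> m v" "unit * (1 + real (R v i)) < now (ex (Suc k))"
  shows "i \<le> nres (nodes (ex k) v) v"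
proof -
  define E where "E = (SIGMA v:verts G. {1..m v})"
  define \<rho> where "\<rho> = (\<lambda>(v, i). ring \<omega> v i)"
  have finE: "finite E" unfolding E_def by (intro finite_SigmaI fin finite_atLeastAtMost)
  \<comment> \<open>Induction on the number of updates with an earlier ring. The step index is
    quantified inside, because the hypothesis is used both now and at the moment when the awaited
    message was sent.\<close>
  have "\<forall>v i k. e = (v, i) \<longrightarrow> unit * (1 + real (R v i)) < now (ex (Suc k)) \<longrightarrow> i \<le> nres (nodes (ex k) v) v"
    if "e \<in> E" for e
    using that
  proof (induction e rule: measure_induct_rule[where f="\<lambda>e. card {e' \<in> E. \<rho> e' < \<rho> e}"])
    case (less e)
    have IH: "j \<le> nres (nodes (ex k) u) u"
      if "(u, j) \<in> E" "ring \<omega> u j < \<rho> e" "unit * (1 + real (R u j)) < now (ex (Suc k))" for u j k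
    proof -
      have "card {e' \<in> E. \<rho> e' < \<rho> (u, j)} < card {e' \<in> E. \<rho> e' < \<rho> e}"
      proof (rule psubset_card_mono)
        have lt: "\<rho> (u, j) < \<rho> e" using that(2) by (simp only: \<rho>_def prod.case)
        then have "{e' \<in> E. \<rho> e' < \<rho> (u, j)} \<subseteq> {e' \<in> E. \<rho> e' < \<rho> e}" by (auto intro: less_trans)
        moreover have "(u, j) \<in> {e' \<in> E. \<rho> e' < \<rho> e}" "(u, j) \<notin> {e' \<in> E. \<rho> e' < \<rho> (u, j)}"
          using that(1) lt by blast+
        ultimately show "{e' \<in> E. \<rho> e' < \<rho> (u, j)} \<subset> {e' \<in> E. \<rho> e' < \<rho> e}" by blast
        show "finite {e' \<in> E. \<rho> e' < \<rho> e}" by (rule finite_subset[OF _ finE]) blast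
      qed
      from less.IH[OF this that(1)] that(3) show ?thesis by blast
    qed
    show ?case
    proof (intro allI impI)
      fix v i k assume e: "e = (v, i)" and late: "unit * (1 + real (R v i)) < now (ex (Suc k))"
      have v: "v \<in> verts G" "1 \<le> i" "i \<le> m v" using less.prems e by (auto simp: E_def)
      obtain r where r: "run_inv k r" using run_inv_ex by blast
      have ci: "config_inv (ex k) r" using r by (simp add: run_inv_def)
      have II: "phaseII (nodes (ex k) v)"
      proof (rule ccontr)
        assume "\<not> phaseII (nodes (ex k) v)"
        from phaseI_transit[OF r v(1) this] obtain u x where "x \<in> set (channel (ex k) u v)" "fst x = 0" by metis
        then have "now (ex (Suc k)) \<le> unit" using in_transit by fastforce
        moreover have "unit * 1 \<le> unit * (1 + real (R v i))" using unit_nonneg by (intro mult_left_mono) auto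
        ultimately show False using late by simp
      qed
      show "i \<le> nres (nodes (ex k) v) v"
      proof (rule ccontr)
        assume n: "\<not> i \<le> nres (nodes (ex k) v) v"
        let ?i = "Suc (nres (nodes (ex k) v) v)"
        have im: "?i \<le> i" "?i \<le> m v" using n v by auto
        \<comment> \<open>The node may be stuck at an update before \<open>i\<close>; since rounds
          do not decrease along a node, that update should have been decided in time as
          well.\<close>
        have Ri: "R v ?i \<le> R v i"
          using im(1) v(3)
        proof (induction i rule: dec_induct)
          case (step j)
          then show ?case using R_mono[OF v(1), of "Suc j"] by simp
        qed simp
        obtain u j where u: "u \<in> nbrs G v" and j: "1 \<le> j" "j \<le> cn v ?i u" "R u j < R v ?i" "r v u \<le> Suc (m u) + j" "nI u \<le> r v u"
          using blocked[OF r v(1) II refl im(2)] by blast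
        have uV: "u \<in> verts G" using nbrs_subset[OF sys u] by simp
        have jm: "j \<le> m u" using j(2) cn_le[of v ?i u] by simp
        have "ring \<omega> u j < ring \<omega> v ?i" using cn_iff[OF uV j(1) jm, of v ?i] j(2) by simp
        also have "\<dots> \<le> ring \<omega> v i" using ring_mono[OF v(1), of ?i i] im(1) by (cases "?i = i") auto
        finally have less_e: "ring \<omega> u j < \<rho> e" by (simp add: \<rho>_def e)
        have uE: "(u, j) \<in> E" using uV j jm by (simp add: E_def)
        \<comment> \<open>The awaited outcome has a strictly smaller round, which leaves a full time
          unit for its message to travel.\<close>
        have "1 + real (R u j) \<le> real (R v i)" using j(3) Ri by linarith
        then have Dl: "unit * (1 + real (R u j)) \<le> unit * real (R v i)" using unit_nonneg by (rule mult_left_mono)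
        have late': "unit * real (R v i) + unit < now (ex (Suc k))" using late by (simp add: algebra_simps)
        have "unit * (1 + real (R u j)) < now (ex (Suc k))" using Dl late' unit_nonneg by linarith
        then have resolved_j: "j \<le> nres (nodes (ex k) u) u" by (rule IH[OF uE less_e])
        define a where "a = Suc (m u) + j - r v u"
        have a: "r v u + a = Suc (m u) + j" using j(4) by (simp add: a_def)
        have "Suc (m u) + j < sent (ex k) u" using resolved_j by (simp add: sent_def)
        then have al: "a < length (channel (ex k) u v)" using length_channel[OF ci u] a by simp
        let ?x = "channel (ex k) u v ! a"
        have "timely k u (Suc (m u) + j) (fst ?x)" using r u al a unfolding run_inv_def by metis
        then have "fst ?x \<le> unit * (1 + real (R u j))"
          unfolding timely_def
        proof
          assume "fst ?x = 0"
          then show ?thesis using unit_nonneg by simp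
        next
          assume "\<exists>l<k. fst ?x = now (ex (Suc l)) \<and> sent (ex l) u \<le> Suc (m u) + j"
          then obtain l where l: "fst ?x = now (ex (Suc l))" "sent (ex l) u \<le> Suc (m u) + j" by blast
          \<comment> \<open>Before the step that sent the message, decision \<open>j\<close> had not
            been made; the induction hypothesis, read backwards, bounds the time of that
            step.\<close>
          have "\<not> j \<le> nres (nodes (ex l) u) u" using l(2) by (simp add: sent_def)
          then have "\<not> unit * (1 + real (R u j)) < now (ex (Suc l))" using IH[OF uE less_e] by blast
          then show ?thesis using l(1) by simp
        qed
        moreover have "now (ex (Suc k)) \<le> fst ?x + unit" using in_transit[of ?x k u v] al by simp
        ultimately show False using Dl late' by linarith
      qed
    qed
  qed
  moreover have "(v, i) \<in> E" using assms by (simp add: E_def)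
  ultimately show ?thesis using assms(4) by blast
qed

text \<open>The time of the first terminated configuration is bounded through its predecessor, which
  still misses a decision; this is why \<open>resolved_in_time\<close> refers to the time of step
  \<open>Suc k\<close>. The summand 1 is the unit spent on Phase I.\<close>

theorem terminates_within_rounds:
  assumes "\<And>v. v \<in> verts G \<Longrightarrow> 1 \<le> m v \<Longrightarrow> real (R v (m v)) \<le> L" "0 \<le> L"
  shows "terminates_within G T Y0 adv \<omega> (1 + L)"
proof -
  define k where "k = (LEAST k. terminated G (ex k))"
  have k: "terminated G (ex k)" unfolding k_def using terminates by (metis LeastI)
  have "now (ex k) \<le> (1 + L) * unit"
  proof (cases k)
    case 0
    then show ?thesis using unit_nonneg assms(2) by (simp add: execution_0 initial_config_def)
  next
    case (Suc l)
    have nt: "\<not> terminated G (ex l)" using not_less_Least[of l "\<lambda>k. terminated G (ex k)"] Suc by (simp add: k_def)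
    show ?thesis
    proof (rule ccontr)
      assume "\<not> ?thesis"
      then have late: "unit * (1 + L) < now (ex (Suc l))" using Suc by (simp add: mult.commute)
      obtain r where r: "run_inv l r" using run_inv_ex by blast
      have "phaseII (nodes (ex l) v)" if v: "v \<in> verts G" for v
      proof (rule ccontr)
        assume "\<not> phaseII (nodes (ex l) v)"
        from phaseI_transit[OF r v this] obtain u x where "x \<in> set (channel (ex l) u v)" "fst x = 0" by metis
        then have "now (ex (Suc l)) \<le> unit" using in_transit by fastforce
        moreover have "unit * 1 \<le> unit * (1 + L)" using unit_nonneg assms(2) by (intro mult_left_mono) auto
        ultimately show False using late by simp
      qed
      moreover have "m v \<le> nres (nodes (ex l) v) v" if v: "v \<in> verts G" for v
      proof (cases "m v = 0")
        case False
        have "unit * (1 + real (R v (m v))) \<le> unit * (1 + L)"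
          using unit_nonneg assms(1)[OF v] False by (intro mult_left_mono) auto
        then show ?thesis using late False v by (intro resolved_in_time) auto
      qed simp
      ultimately show False using all_terminated[OF r] nt by blast
    qed
  qed
  then show ?thesis using k unfolding terminates_within_def by blast
qed

end

section \<open>Bit lengths\<close>

lemma binary_Suc: "n \<noteq> 0 \<Longrightarrow> length (binary n) = Suc (length (binary (n div 2)))"
  by (subst binary.simps) simp

lemma binary_0 [simp]: "binary 0 = []"
  by (subst binary.simps) simp

lemma length_binary_le: "n < 2 ^ a \<Longrightarrow> length (binary n) \<le> a"
proof (induction a arbitrary: n)
  case (Suc a)
  show ?case
  proof (cases "n = 0")
    case False
    have "n div 2 < 2 ^ a" using Suc.prems by (simp add: less_mult_imp_div_less mult.commute)
    then show ?thesis using Suc.IH[of "n div 2"] binary_Suc[OF False] by simp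
  qed simp
qed simp

lemma length_binary_ln:
  assumes "real n \<le> x" "1 \<le> x"
  shows "real (length (binary n)) \<le> 1 + ln x / ln 2"
proof (cases "n = 0")
  case True
  have "0 \<le> ln x" using assms by simp
  then show ?thesis using True by simp
next
  case False
  have pow: "2 ^ (length (binary n) - 1) \<le> n"
    using False
  proof (induction n rule: less_induct)
    case (less n)
    show ?case
    proof (cases "n = 1")
      case True
      have "length (binary 1) = 1" using binary_Suc[of 1] by simp
      then show ?thesis using True by simp
    next
      case F: False
      then have n: "n div 2 < n" "n div 2 \<noteq> 0" using less.prems by auto
      have l: "length (binary n) - 1 = Suc (length (binary (n div 2)) - 1)"
        using binary_Suc[OF less.prems] binary_Suc[OF n(2)] by simp
      have "2 ^ (length (binary n) - 1) \<le> 2 * (n div 2)" using less.IH[OF n] unfolding l by simp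
      then show ?thesis by simp
    qed
  qed
  have l1: "1 \<le> length (binary n)" using binary_Suc[OF False] by simp
  have "(2::real) ^ (length (binary n) - 1) \<le> real n" using pow by (metis of_nat_le_iff of_nat_numeral of_nat_power)
  also have "\<dots> \<le> x" by fact
  finally have "ln ((2::real) ^ (length (binary n) - 1)) \<le> ln x" using assms by simp
  then have "real (length (binary n) - 1) * ln 2 \<le> ln x" by (simp add: ln_realpow)
  then have "real (length (binary n) - 1) \<le> ln x / ln 2" by (simp add: field_simps)
  then show ?thesis using l1 by simp
qed

lemma length_delimited: "length (delimited bs) = 2 * length bs + 1"
proof -
  have "length (concat (map (\<lambda>b. [True, b]) bs)) = 2 * length bs" by (induction bs) auto
  then show ?thesis by (simp add: delimited_def)
qed

text \<open>The longest case is \<open>Update\<close>: with \<open>p\<close> for the precision and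
  binary logarithms, its time takes at most \<open>1 + p + log T\<close> bits (\<open>T\<close>
  rounded up) and its precision at most \<open>p\<close>, both doubled and closed by one bit; the
  tag has 2 bits and the proposal at most \<open>1 + log q\<close>.\<close>

lemma bits_phaseI_le:
  assumes x: "x \<in> set (phaseI_messages G T Y0 \<omega> v)"
    and Y0: "Y0 v \<le> spins G" and c: "\<And>i. 1 \<le> i \<Longrightarrow> i \<le> num_updates T \<omega> v \<Longrightarrow> ring_prop \<omega> v i \<le> spins G"
    and ring: "\<And>i. 1 \<le> i \<Longrightarrow> i \<le> num_updates T \<omega> v \<Longrightarrow> 0 < ring \<omega> v i \<and> ring \<omega> v i < T"
    and q: "1 \<le> spins G" and T: "0 \<le> T"
  shows "real (bits x) \<le> 7 + 4 * real (precision G T \<omega>) + 2 * (ln (of_int \<lceil>T\<rceil>) / ln 2) + ln (real (spins G)) / ln 2"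
proof -
  let ?p = "precision G T \<omega>" and ?LT = "ln (of_int \<lceil>T\<rceil>) / ln 2 :: real" and ?q = "ln (real (spins G)) / ln 2 :: real"
  \<comment> \<open>For \<open>T = 0\<close> the logarithm is taken at 0, where its value is
    0.\<close>
  have LT: "0 \<le> ?LT"
  proof (cases "T = 0")
    case False
    then have "1 \<le> \<lceil>T\<rceil>" using T by linarith
    then show ?thesis by simp
  qed simp
  have q0: "0 \<le> ?q" using q by simp
  have lq: "real (length (binary a)) \<le> 1 + ?q" if "a \<le> spins G" for a
    using that q by (intro length_binary_ln) auto
  consider "x = Initial (Y0 v)" | "x = EndPhaseI" |
    i where "1 \<le> i" "i \<le> num_updates T \<omega> v" "x = Update (trunc_num ?p (ring \<omega> v i)) ?p (ring_prop \<omega> v i)"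
    using x by (auto simp: phaseI_messages_def Let_def)
  then show ?thesis
  proof cases
    case 1
    then show ?thesis using lq[OF Y0] LT q0 by (simp add: bits_def)
  next
    case 2
    then show ?thesis using LT q0 by (simp add: bits_def)
  next
    case 3
    let ?k = "trunc_num ?p (ring \<omega> v i)"
    have r: "0 < ring \<omega> v i" "ring \<omega> v i < T" using ring 3 by auto
    then have T1: "1 \<le> \<lceil>T\<rceil>" by linarith
    have "real ?k \<le> 2 ^ ?p * ring \<omega> v i" using r by (simp add: trunc_num_def of_nat_nat)
    also have "\<dots> \<le> 2 ^ ?p * of_int \<lceil>T\<rceil>" using r by (intro mult_left_mono) (auto intro: less_imp_le order_trans le_of_int_ceiling)
    finally have k: "real ?k \<le> 2 ^ ?p * of_int \<lceil>T\<rceil>" .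
    have "1 \<le> (2::real) ^ ?p * of_int \<lceil>T\<rceil>" using T1 mult_mono[of 1 "(2::real) ^ ?p" 1 "of_int \<lceil>T\<rceil>"] by simp
    with k have "real (length (binary ?k)) \<le> 1 + ln (2 ^ ?p * of_int \<lceil>T\<rceil>) / ln 2" by (rule length_binary_ln)
    also have "ln ((2::real) ^ ?p * of_int \<lceil>T\<rceil>) / ln 2 = real ?p + ?LT"
    proof -
      have "ln ((2::real) ^ a * x) = real a * ln 2 + ln x" if "0 < x" for a x
        using that by (simp add: ln_mult ln_realpow)
      moreover have "0 < real_of_int \<lceil>T\<rceil>" using T1 by linarith
      ultimately have "ln ((2::real) ^ ?p * of_int \<lceil>T\<rceil>) = real ?p * ln 2 + ln (of_int \<lceil>T\<rceil>)" by blast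
      then show ?thesis by (simp add: add_divide_distrib)
    qed
    finally have bk: "real (length (binary ?k)) \<le> 1 + (real ?p + ?LT)" .
    have bp: "length (binary ?p) \<le> ?p" by (rule length_binary_le) simp
    have "real (bits x) = 2 + real (2 * length (binary ?k) + 1) + real (2 * length (binary ?p) + 1) + real (length (binary (ring_prop \<omega> v i)))"
      by (simp add: bits_def 3 length_delimited)
    then show ?thesis using bk bp lq[OF c[OF 3(1,2)]] by simp
  qed
qed

section \<open>Truncation of update times\<close>

lemma trunc_num_less:
  assumes "0 \<le> s" "s + \<epsilon> \<le> t" "1 \<le> 2 ^ p * \<epsilon>"
  shows "trunc_num p s < trunc_num p t"
proof -
  have "2 ^ p * s + 1 \<le> 2 ^ p * (s + \<epsilon>)" using assms by (simp add: algebra_simps)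
  also have "\<dots> \<le> 2 ^ p * t" using assms by (intro mult_left_mono) auto
  finally have "\<lfloor>2 ^ p * s\<rfloor> + 1 \<le> \<lfloor>2 ^ p * t\<rfloor>" by linarith
  moreover have n: "0 \<le> \<lfloor>2 ^ p * s\<rfloor>" using assms by simp
  ultimately show ?thesis unfolding trunc_num_def nat_less_eq_zless[OF n] by linarith
qed

text \<open>Times at distance \<epsilon> with \<open>1 \<le> 2 ^ p * \<epsilon>\<close> have
  different integer parts after scaling by \<open>2 ^ p\<close>. So \<open>p\<close> is admissible,
  which bounds the least admissible value and shows that this value has the property.\<close>

lemma precision_le:
  assumes gap: "\<And>u v i j. u \<in> V \<Longrightarrow> v \<in> V \<Longrightarrow> 1 \<le> i \<Longrightarrow> i \<le> num_updates T \<omega> u \<Longrightarrow> 1 \<le> j \<Longrightarrow> j \<le> num_updates T \<omega> v \<Longrightarrow>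
      ring \<omega> u i < ring \<omega> v j \<Longrightarrow> ring \<omega> u i + \<epsilon> \<le> ring \<omega> v j"
    and pos: "\<And>u i. u \<in> V \<Longrightarrow> 1 \<le> i \<Longrightarrow> i \<le> num_updates T \<omega> u \<Longrightarrow> 0 \<le> ring \<omega> u i"
    and p: "1 \<le> 2 ^ p * \<epsilon>" and V: "\<And>e. e \<in> edges G \<Longrightarrow> e \<subseteq> V"
  shows "precision G T \<omega> \<le> p"
    and "e \<in> edges G \<Longrightarrow> u \<in> e \<Longrightarrow> v \<in> e \<Longrightarrow> 1 \<le> i \<Longrightarrow> i \<le> num_updates T \<omega> u \<Longrightarrow> 1 \<le> j \<Longrightarrow> j \<le> num_updates T \<omega> v \<Longrightarrow>
      ring \<omega> u i < ring \<omega> v j \<Longrightarrow> trunc_num (precision G T \<omega>) (ring \<omega> u i) < trunc_num (precision G T \<omega>) (ring \<omega> v j)"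
proof -
  let ?P = "\<lambda>p. \<forall>e\<in>edges G. \<forall>u\<in>e. \<forall>v\<in>e. \<forall>i\<in>{1..num_updates T \<omega> u}. \<forall>j\<in>{1..num_updates T \<omega> v}.
          ring \<omega> u i < ring \<omega> v j \<longrightarrow> trunc_num p (ring \<omega> u i) < trunc_num p (ring \<omega> v j)"
  have P: "?P p"
  proof (intro ballI impI)
    fix e u v i j assume *: "e \<in> edges G" "u \<in> e" "v \<in> e" "i \<in> {1..num_updates T \<omega> u}" "j \<in> {1..num_updates T \<omega> v}"
      "ring \<omega> u i < ring \<omega> v j"
    then have "u \<in> V" "v \<in> V" using V by blast+
    then show "trunc_num p (ring \<omega> u i) < trunc_num p (ring \<omega> v j)"
      using * by (intro trunc_num_less[OF pos gap p]) auto
  qed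
  then show "precision G T \<omega> \<le> p" unfolding precision_def by (rule Least_le)
  from P have "?P (precision G T \<omega>)" unfolding precision_def by (rule LeastI)
  then show "e \<in> edges G \<Longrightarrow> u \<in> e \<Longrightarrow> v \<in> e \<Longrightarrow> 1 \<le> i \<Longrightarrow> i \<le> num_updates T \<omega> u \<Longrightarrow> 1 \<le> j \<Longrightarrow> j \<le> num_updates T \<omega> v \<Longrightarrow>
      ring \<omega> u i < ring \<omega> v j \<Longrightarrow> trunc_num (precision G T \<omega>) (ring \<omega> u i) < trunc_num (precision G T \<omega>) (ring \<omega> v j)"
    by simp
qed

section \<open>The history of a tape\<close>

locale model =
  fixes G :: metropolis and Y0 :: "nat \<Rightarrow> nat" and T :: real
  assumes sys: "metropolis_system G" and Y0: "Y0 \<in> colourings G (verts G)" and T: "0 \<le> T"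
begin

sublocale clocks "verts G" "marks G"
proof (rule clocks.intro)
  show "finite (verts G)" "verts G \<noteq> {}" using sys by (simp_all add: metropolis_system_def)
qed (rule prob_space_marks)

definition good_tape :: "tape \<Rightarrow> bool" where
  "good_tape \<omega> \<longleftrightarrow> good T \<omega> \<and> (\<forall>v\<in>verts G. \<forall>i\<ge>1. ring_prop \<omega> v i \<in> {1..spins G})"

definition step_history :: "tape \<Rightarrow> nat \<times> nat \<Rightarrow> history \<Rightarrow> history" where
  "step_history \<omega> e h = extend_history G Y0 h (fst e) (\<omega> e)"

definition hist :: "tape \<Rightarrow> nat \<Rightarrow> history" where
  "hist \<omega> n = fold (step_history \<omega>) (take n (ring_list \<omega> T)) []"

definition final_history :: "tape \<Rightarrow> history" where
  "final_history \<omega> = fold (step_history \<omega>) (ring_list \<omega> T) []"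

lemma hist_final: "hist \<omega> (length (ring_list \<omega> T)) = final_history \<omega>"
  by (simp add: hist_def final_history_def)

lemma hist_0: "hist \<omega> 0 = []"
  by (simp add: hist_def)

lemma hist_Suc: "n < length (ring_list \<omega> T) \<Longrightarrow> hist \<omega> (Suc n) = step_history \<omega> (ring_list \<omega> T ! n) (hist \<omega> n)"
  by (simp add: hist_def take_Suc_conv_app_nth)

context
  fixes \<omega> assumes good: "good_tape \<omega>"
begin

abbreviation "L \<equiv> ring_list \<omega> T"
abbreviation "h \<equiv> hist \<omega>"

lemma gd: "good T \<omega>"
  using good by (simp add: good_tape_def)

lemma num_updates_iff:
  assumes v: "v \<in> verts G" and i: "1 \<le> i"
  shows "i \<le> num_updates T \<omega> v \<longleftrightarrow> ring \<omega> v i < T"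
proof -
  let ?S = "{i. 1 \<le> i \<and> ring \<omega> v i < T}"
  obtain n where n: "T < ring \<omega> v n" using goodD(3)[OF gd v] by blast
  have mono: "a \<le> b \<Longrightarrow> ring \<omega> v a \<le> ring \<omega> v b" for a b
    using good_ring_less[OF gd v, of a b] by (cases "a = b") auto
  have "k < n" if "ring \<omega> v k < T" for k using mono[of n k] n that by (cases "n \<le> k") auto
  then have "?S \<subseteq> {..<n}" by blast
  then have fin: "finite ?S" by (rule finite_subset) simp
  show ?thesis
  proof
    assume "ring \<omega> v i < T"
    then have "{1..i} \<subseteq> ?S" by (auto intro: le_less_trans[OF mono])
    then have "card {1..i} \<le> card ?S" by (rule card_mono[OF fin])
    then show "i \<le> num_updates T \<omega> v" by (simp add: num_updates_def)
  next
    assume le: "i \<le> num_updates T \<omega> v"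
    show "ring \<omega> v i < T"
    proof (rule ccontr)
      assume c: "\<not> ring \<omega> v i < T"
      have "k < i" if "ring \<omega> v k < T" for k using mono[of i k] c that by (cases "i \<le> k") auto
      then have "?S \<subseteq> {1..i - 1}" by fastforce
      then have "card ?S \<le> card {1..i - 1}" by (intro card_mono) auto
      then show False using le i by (simp add: num_updates_def)
    qed
  qed
qed

lemma in_rings: "(v, i) \<in> set L \<longleftrightarrow> v \<in> verts G \<and> 1 \<le> i \<and> i \<le> num_updates T \<omega> v"
  using ring_list(2)[OF gd, of T] num_updates_iff by (auto simp: rings_def)

lemma take_set:
  assumes n: "n < length L" and e: "L ! n = (v, i)"
  shows "(u, j) \<in> set (take n L) \<longleftrightarrow> (u, j) \<in> set L \<and> ring \<omega> u j < ring \<omega> v i"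
proof -
  let ?r = "\<lambda>(v, i). ring \<omega> v i"
  have srt: "sorted_wrt (<) (map ?r L)" by (rule ring_list(1)[OF gd])
  have less: "?r (L ! a) < ?r (L ! b)" if "a < b" "b < length L" for a b
    using sorted_wrt_nth_less[OF srt that(1)] that by simp
  show ?thesis
  proof
    assume "(u, j) \<in> set (take n L)"
    then obtain a where a: "a < n" "L ! a = (u, j)" using n by (auto simp: in_set_conv_nth)
    then show "(u, j) \<in> set L \<and> ring \<omega> u j < ring \<omega> v i"
      using less[OF a(1) n] nth_mem[of a L] a(1) n unfolding a(2) e by simp
  next
    assume *: "(u, j) \<in> set L \<and> ring \<omega> u j < ring \<omega> v i"
    then obtain a where a: "a < length L" "L ! a = (u, j)" by (auto simp: in_set_conv_nth)
    have "a < n"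
    proof (rule ccontr)
      assume "\<not> a < n"
      then have "a = n \<or> n < a" by auto
      then show False using less[of n a] a e * by auto
    qed
    then show "(u, j) \<in> set (take n L)" using a n by (auto simp: in_set_conv_nth)
  qed
qed

lemma card_before:
  assumes n: "n < length L" and e: "L ! n = (v, i)" and u: "u \<in> verts G"
  shows "card {j. (u, j) \<in> set (take n L)} = earlier T \<omega> v i u"
proof -
  have "{j. (u, j) \<in> set (take n L)} = {j\<in>{1..num_updates T \<omega> u}. ring \<omega> u j < ring \<omega> v i}"
    using take_set[OF n e] in_rings u by auto
  then show ?thesis by (simp add: earlier_def)
qed

lemma earlier_self:
  assumes v: "v \<in> verts G" and i: "1 \<le> i" "i \<le> num_updates T \<omega> v"
  shows "earlier T \<omega> v i v = i - 1"
proof -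
  have "{j\<in>{1..num_updates T \<omega> v}. ring \<omega> v j < ring \<omega> v i} = {1..i - 1}"
    using i by (auto simp: good_ring_less[OF gd v])
  then show ?thesis by (simp add: earlier_def)
qed

lemma hist_inv:
  "n \<le> length L \<Longrightarrow> valid_history G Y0 (h n) \<and> (\<forall>u. count_of (h n) u = card {j. (u, j) \<in> set (take n L)})"
proof (induction n)
  case 0
  then show ?case using Y0 by (auto simp: hist_0 valid_history_def state_of_def colourings_def)
next
  case (Suc n)
  then have n: "n < length L" and IH: "valid_history G Y0 (h n)" "\<And>u. count_of (h n) u = card {j. (u, j) \<in> set (take n L)}" by auto
  obtain v i where e: "L ! n = (v, i)" by (cases "L ! n")
  have vi: "v \<in> verts G" "1 \<le> i" "i \<le> num_updates T \<omega> v" using in_rings[of v i] nth_mem[OF n] e by auto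
  let ?b = "ring_prop \<omega> v i" and ?\<beta> = "ring_coin \<omega> v i"
  let ?y = "new_state G Y0 (h n) v ?b ?\<beta>"
  have hS: "h (Suc n) = (v, ?b, ?y, new_round G Y0 (h n) v ?b ?\<beta>) # h n"
    using IH(1) by (simp add: hist_Suc[OF n] e step_history_def extend_history_def ring_prop_def ring_coin_def case_prod_beta')
  have b: "?b \<in> {1..spins G}" using good vi by (simp add: good_tape_def)
  have cur: "current Y0 (h n) v \<in> {1..spins G}" using IH(1) vi by (auto simp: valid_history_def current_def)
  have y: "?y \<in> {1..spins G}" "?y = current Y0 (h n) v \<or> ?y = ?b" using b cur by (auto simp: new_state_def)
  have "valid_history G Y0 (h (Suc n))"
    unfolding valid_history_def
  proof (intro ballI conjI allI impI)
    fix u assume u: "u \<in> verts G"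
    have old: "\<And>k. k \<le> count_of (h n) u \<Longrightarrow> state_of Y0 (h n) u k \<in> {1..spins G}"
      "\<And>k. 1 \<le> k \<Longrightarrow> k \<le> count_of (h n) u \<Longrightarrow> prop_of (h n) u k \<in> {1..spins G}"
      "\<And>k. k < count_of (h n) u \<Longrightarrow> state_of Y0 (h n) u (Suc k) = state_of Y0 (h n) u k \<or> state_of Y0 (h n) u (Suc k) = prop_of (h n) u (Suc k)"
      using IH(1) u by (auto simp: valid_history_def)
    show "state_of Y0 (h (Suc n)) u k \<in> {1..spins G}" if "k \<le> count_of (h (Suc n)) u" for k
    proof (cases "k \<le> count_of (h n) u")
      case True then show ?thesis using old(1)[OF True] unfolding hS by (simp add: Cons_old)
    next
      case False
      then have "u = v" "k = Suc (count_of (h n) v)" using that unfolding hS by (auto split: if_splits)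
      then show ?thesis using y(1) unfolding hS by (simp add: Cons_new)
    qed
    show "prop_of (h (Suc n)) u k \<in> {1..spins G}" if "k \<in> {1..count_of (h (Suc n)) u}" for k
    proof (cases "k \<le> count_of (h n) u")
      case True then show ?thesis using old(2)[of k] that unfolding hS by (simp add: Cons_old)
    next
      case False
      then have "u = v" "k = Suc (count_of (h n) v)" using that unfolding hS by (auto split: if_splits)
      then show ?thesis using b unfolding hS by (simp add: Cons_new)
    qed
    show "state_of Y0 (h (Suc n)) u (Suc k) = state_of Y0 (h (Suc n)) u k \<or> state_of Y0 (h (Suc n)) u (Suc k) = prop_of (h (Suc n)) u (Suc k)"
      if "k < count_of (h (Suc n)) u" for k
    proof (cases "k < count_of (h n) u")
      case True then show ?thesis using old(3)[OF True] unfolding hS by (simp add: Cons_old)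
    next
      case False
      then have "u = v" "k = count_of (h n) v" using that unfolding hS by (auto split: if_splits)
      then show ?thesis using y(2) unfolding hS by (simp add: Cons_new Cons_old current_def)
    qed
  qed
  moreover have "count_of (h (Suc n)) u = card {j. (u, j) \<in> set (take (Suc n) L)}" for u
  proof (cases "u = v")
    case False
    then have "{j. (u, j) \<in> set (take (Suc n) L)} = {j. (u, j) \<in> set (take n L)}"
      using n e by (auto simp: take_Suc_conv_app_nth)
    then show ?thesis using False IH(2) unfolding hS by simp
  next
    case True
    have S: "{j. (v, j) \<in> set (take (Suc n) L)} = insert i {j. (v, j) \<in> set (take n L)}"
      using n e by (auto simp: take_Suc_conv_app_nth)
    have "i \<notin> {j. (v, j) \<in> set (take n L)}" using take_set[OF n e, of v i] by simp
    moreover have "finite {j. (v, j) \<in> set (take n L)}"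
      by (rule finite_subset[of _ "snd ` set (take n L)"]) force+
    ultimately have "card {j. (v, j) \<in> set (take (Suc n) L)} = Suc (card {j. (v, j) \<in> set (take n L)})"
      unfolding S by simp
    then show ?thesis using True IH(2)[of v] unfolding hS by simp
  qed
  ultimately show ?case by blast
qed

lemma hist_step:
  assumes n: "n < length L" and e: "L ! n = (v, i)"
  shows "h (Suc n) = (v, ring_prop \<omega> v i, new_state G Y0 (h n) v (ring_prop \<omega> v i) (ring_coin \<omega> v i),
      new_round G Y0 (h n) v (ring_prop \<omega> v i) (ring_coin \<omega> v i)) # h n"
    and "u \<in> verts G \<Longrightarrow> count_of (h n) u = earlier T \<omega> v i u"
    and "i = Suc (count_of (h n) v)" and "v \<in> verts G"
proof -
  have vi: "v \<in> verts G" "1 \<le> i" "i \<le> num_updates T \<omega> v" using in_rings[of v i] nth_mem[OF n] e by auto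
  show c: "u \<in> verts G \<Longrightarrow> count_of (h n) u = earlier T \<omega> v i u" for u
    using hist_inv[of n] card_before[OF n e] n by simp
  show "i = Suc (count_of (h n) v)" using c[OF vi(1)] earlier_self[OF vi] vi(2) by simp
  show "v \<in> verts G" by fact
  show "h (Suc n) = (v, ring_prop \<omega> v i, new_state G Y0 (h n) v (ring_prop \<omega> v i) (ring_coin \<omega> v i),
      new_round G Y0 (h n) v (ring_prop \<omega> v i) (ring_coin \<omega> v i)) # h n"
    using hist_inv[of n] n by (simp add: hist_Suc[OF n] e step_history_def extend_history_def ring_prop_def ring_coin_def case_prod_beta')
qed

lemma hist_stable:
  assumes "n \<le> n'" "n' \<le> length L" "k \<le> count_of (h n) u"
  shows "state_of Y0 (h n') u k = state_of Y0 (h n) u k \<and> rnd_of (h n') u k = rnd_of (h n) u k \<and>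
    (1 \<le> k \<longrightarrow> prop_of (h n') u k = prop_of (h n) u k) \<and> k \<le> count_of (h n') u"
  using assms(1,2)
proof (induction n' rule: dec_induct)
  case base
  then show ?case using assms(3) by simp
next
  case (step a)
  then have a: "a < length L" by simp
  obtain v i where e: "L ! a = (v, i)" by (cases "L ! a")
  have "k \<le> count_of (h a) u" using step by simp
  then show ?case using step.IH a unfolding hist_step(1)[OF a e] by (auto simp: Cons_old)
qed

abbreviation "H \<equiv> final_history \<omega>"
abbreviation "ys \<equiv> state_of Y0 H"
abbreviation "rs \<equiv> rnd_of H"

lemma count_final: "v \<in> verts G \<Longrightarrow> count_of H v = num_updates T \<omega> v"
proof -
  assume v: "v \<in> verts G"
  have "count_of H v = card {j. (v, j) \<in> set L}"
    using hist_inv[of "length L"] by (simp add: hist_final)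
  also have "{j. (v, j) \<in> set L} = {1..num_updates T \<omega> v}" using in_rings v by auto
  finally show ?thesis by simp
qed

lemma final_at:
  assumes v: "v \<in> verts G" and i: "1 \<le> i" "i \<le> num_updates T \<omega> v"
  obtains n where "n < length L" "L ! n = (v, i)"
    "ys v i = new_state G Y0 (h n) v (ring_prop \<omega> v i) (ring_coin \<omega> v i)"
    "rs v i = new_round G Y0 (h n) v (ring_prop \<omega> v i) (ring_coin \<omega> v i)"
    "prop_of H v i = ring_prop \<omega> v i"
    "\<forall>u\<in>verts G. \<forall>k\<le>earlier T \<omega> v i u. state_of Y0 (h n) u k = ys u k \<and> rnd_of (h n) u k = rs u k \<and>
      (1 \<le> k \<longrightarrow> prop_of (h n) u k = prop_of H u k)"
    "\<forall>u\<in>verts G. count_of (h n) u = earlier T \<omega> v i u"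
proof -
  have "(v, i) \<in> set L" using in_rings v i by simp
  then obtain n where n: "n < length L" "L ! n = (v, i)" by (auto simp: in_set_conv_nth)
  note S = hist_step[OF n]
  have "i \<le> count_of (h (Suc n)) v" unfolding S(1) using S(3) by simp
  then have "ys v i = state_of Y0 (h (Suc n)) v i" "rs v i = rnd_of (h (Suc n)) v i" "prop_of H v i = prop_of (h (Suc n)) v i"
    using hist_stable[of "Suc n" "length L" i v] n i by (auto simp: hist_final)
  then have "ys v i = new_state G Y0 (h n) v (ring_prop \<omega> v i) (ring_coin \<omega> v i)"
    "rs v i = new_round G Y0 (h n) v (ring_prop \<omega> v i) (ring_coin \<omega> v i)"
    "prop_of H v i = ring_prop \<omega> v i"
    unfolding S(1) using S(3) Cons_new by metis+
  moreover have "state_of Y0 (h n) u k = ys u k \<and> rnd_of (h n) u k = rs u k \<and>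
      (1 \<le> k \<longrightarrow> prop_of (h n) u k = prop_of H u k)" if "u \<in> verts G" "k \<le> earlier T \<omega> v i u" for u k
    using hist_stable[of n "length L" k u] n S(2)[OF that(1)] that by (simp add: hist_final)
  ultimately show ?thesis by (intro that[OF n]) (use S(2) in auto)
qed

lemma prop_final: "v \<in> verts G \<Longrightarrow> 1 \<le> i \<Longrightarrow> i \<le> num_updates T \<omega> v \<Longrightarrow> prop_of H v i = ring_prop \<omega> v i"
  by (rule final_at)

lemma earlier_le: "earlier T \<omega> v i u \<le> num_updates T \<omega> u"
proof -
  have "earlier T \<omega> v i u \<le> card {1..num_updates T \<omega> u}" unfolding earlier_def by (intro card_mono) auto
  then show ?thesis by simp
qed

text \<open>Only finitely many rings precede \<open>T\<close>, so their positive differences have a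
  positive minimum. Thus some finite precision is admissible on every good tape.\<close>

lemma rings_separated:
  obtains \<epsilon> where "0 < \<epsilon>" "\<And>u v i j. u \<in> verts G \<Longrightarrow> v \<in> verts G \<Longrightarrow> 1 \<le> i \<Longrightarrow> i \<le> num_updates T \<omega> u \<Longrightarrow>
      1 \<le> j \<Longrightarrow> j \<le> num_updates T \<omega> v \<Longrightarrow> ring \<omega> u i < ring \<omega> v j \<Longrightarrow> ring \<omega> u i + \<epsilon> \<le> ring \<omega> v j"
proof -
  define S where "S = {d. 0 < d \<and> (\<exists>e\<in>set L. \<exists>e'\<in>set L. d = (case e' of (v, j) \<Rightarrow> ring \<omega> v j) - (case e of (u, i) \<Rightarrow> ring \<omega> u i))}"
  have "S \<subseteq> (\<lambda>(e, e'). (case e' of (v, j) \<Rightarrow> ring \<omega> v j) - (case e of (u, i) \<Rightarrow> ring \<omega> u i)) ` (set L \<times> set L)"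
    unfolding S_def by force
  then have fin: "finite S" by (rule finite_subset) simp
  define \<epsilon> where "\<epsilon> = Min (insert 1 S)"
  have "0 < \<epsilon>" unfolding \<epsilon>_def using fin by (subst Min_gr_iff) (auto simp: S_def)
  moreover have "ring \<omega> u i + \<epsilon> \<le> ring \<omega> v j"
    if "u \<in> verts G" "v \<in> verts G" "1 \<le> i" "i \<le> num_updates T \<omega> u" "1 \<le> j" "j \<le> num_updates T \<omega> v" "ring \<omega> u i < ring \<omega> v j" for u v i j
  proof -
    have "(u, i) \<in> set L" "(v, j) \<in> set L" using in_rings that by auto
    then have "ring \<omega> v j - ring \<omega> u i \<in> S" unfolding S_def using that(7) by force
    then have "\<epsilon> \<le> ring \<omega> v j - ring \<omega> u i" unfolding \<epsilon>_def using fin by (intro Min_le) auto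
    then show ?thesis by simp
  qed
  ultimately show ?thesis using that by blast
qed

lemma edges_verts:
  assumes "e \<in> edges G"
  shows "e \<subseteq> verts G"
proof -
  have "\<forall>e\<in>edges G. \<exists>a\<in>verts G. \<exists>b\<in>verts G. a \<noteq> b \<and> e = {a, b}"
    using sys by (simp add: metropolis_system_def)
  from bspec[OF this assms] obtain a b where "a \<in> verts G" "b \<in> verts G" "e = {a, b}" by (elim bexE conjE)
  then show ?thesis by simp
qed

text \<open>The link between probability and executions: states and rounds recorded in the final
  history have the properties assumed for \<open>y\<close> and \<open>R\<close>. At each ring the
  history then available determined both, and later rings leave those entries unchanged.\<close>

lemma coupled: "coupled_run G T Y0 \<omega> ys rs"
proof
  show "metropolis_system G" "Y0 \<in> colourings G (verts G)" by (fact sys, fact Y0)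
  show "v \<in> verts G \<Longrightarrow> i < j \<Longrightarrow> ring \<omega> v i < ring \<omega> v j" for v i j
    using good_ring_less[OF gd] by simp
  show "ring \<omega> u i \<noteq> ring \<omega> v j" if "u \<in> verts G" "v \<in> verts G" "u \<noteq> v" "1 \<le> i" "1 \<le> j" for u v i j
    using goodD(2)[OF gd] that by blast
  show "trunc_time G T \<omega> a i < trunc_time G T \<omega> b j"
    if "u \<in> nbrs G v" "a \<in> {u, v}" "b \<in> {u, v}" "1 \<le> i" "i \<le> num_updates T \<omega> a" "1 \<le> j" "j \<le> num_updates T \<omega> b"
      "ring \<omega> a i < ring \<omega> b j" for u v a b i j
  proof -
    obtain \<epsilon> where eps: "0 < \<epsilon>" "\<And>u v i j. u \<in> verts G \<Longrightarrow> v \<in> verts G \<Longrightarrow> 1 \<le> i \<Longrightarrow> i \<le> num_updates T \<omega> u \<Longrightarrow>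
      1 \<le> j \<Longrightarrow> j \<le> num_updates T \<omega> v \<Longrightarrow> ring \<omega> u i < ring \<omega> v j \<Longrightarrow> ring \<omega> u i + \<epsilon> \<le> ring \<omega> v j"
      using rings_separated by blast
    obtain p where "1 / \<epsilon> < 2 ^ p" using real_arch_pow[of 2 "1 / \<epsilon>"] by auto
    then have p: "1 \<le> 2 ^ p * \<epsilon>" using eps(1) by (simp add: field_simps)
    have e: "{u, v} \<in> edges G" using that(1) by (simp add: nbrs_def)
    have "0 \<le> ring \<omega> u i" if "u \<in> verts G" "1 \<le> i" for u i using good_ring_pos[OF gd that] by simp
    then have "trunc_num (precision G T \<omega>) (ring \<omega> a i) < trunc_num (precision G T \<omega>) (ring \<omega> b j)"
      using precision_le(2)[where V="verts G", OF eps(2) _ p edges_verts e that(2-8)] by blast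
    then show ?thesis unfolding trunc_time_def by (simp add: divide_strict_right_mono)
  qed
  show "ys v 0 = Y0 v" for v by (simp add: state_of_def)
  show "ring_prop \<omega> v i \<in> {1..spins G}" if "v \<in> verts G" "1 \<le> i" "i \<le> num_updates T \<omega> v" for v i
    using good that by (simp add: good_tape_def)
  fix v i assume v: "v \<in> verts G" and i: "1 \<le> i" "i \<le> num_updates T \<omega> v"
  obtain n where n: "n < length L" "L ! n = (v, i)"
    and y: "ys v i = new_state G Y0 (h n) v (ring_prop \<omega> v i) (ring_coin \<omega> v i)"
    and r: "rs v i = new_round G Y0 (h n) v (ring_prop \<omega> v i) (ring_coin \<omega> v i)"
    and "prop_of H v i = ring_prop \<omega> v i"
    and old': "\<forall>u\<in>verts G. \<forall>k\<le>earlier T \<omega> v i u. state_of Y0 (h n) u k = ys u k \<and> rnd_of (h n) u k = rs u k \<and>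
      (1 \<le> k \<longrightarrow> prop_of (h n) u k = prop_of H u k)"
    and cnt': "\<forall>u\<in>verts G. count_of (h n) u = earlier T \<omega> v i u"
    by (rule final_at[OF v i])
  have old: "state_of Y0 (h n) u k = ys u k \<and> rnd_of (h n) u k = rs u k \<and>
      (1 \<le> k \<longrightarrow> prop_of (h n) u k = prop_of H u k)" if "u \<in> verts G" "k \<le> earlier T \<omega> v i u" for u k
    using old' that by blast
  have cnt: "count_of (h n) u = earlier T \<omega> v i u" if "u \<in> verts G" for u
    using cnt' that by blast
  have nb: "u \<in> nbrs G v \<Longrightarrow> u \<in> verts G" for u using nbrs_subset[OF sys] by blast
  have cv: "current Y0 (h n) v = ys v (i - 1)"
    using old[OF v, of "i - 1"] cnt[OF v] earlier_self[OF v i] by (simp add: current_def)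
  have cu: "current Y0 (h n) u = ys u (earlier T \<omega> v i u)" if "u \<in> verts G" for u
    using old[OF that order_refl] cnt[OF that] by (simp add: current_def)
  have cn: "(\<lambda>u\<in>nbrs G v. current Y0 (h n) u) = (\<lambda>u\<in>nbrs G v. ys u (earlier T \<omega> v i u))"
    using cu nb by (intro restrict_ext) auto
  show "ys v i = (if ring_coin \<omega> v i < filt G v (ys v (i - 1)) (ring_prop \<omega> v i) (\<lambda>u\<in>nbrs G v. ys u (earlier T \<omega> v i u))
        then ring_prop \<omega> v i else ys v (i - 1))"
    unfolding y new_state_def cv cn ..
  interpret nbhd G v "state_of Y0 (h n)" "prop_of (h n)" "count_of (h n)"
    by (rule valid_nbhd[OF sys _ v]) (use hist_inv[of n] n in auto)
  note R = round_of[where R="rnd_of (h n)" and s="rnd_of (h n) v (count_of (h n) v)" and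
      a="current Y0 (h n) v" and b="ring_prop \<omega> v i" and \<beta>="ring_coin \<omega> v i", folded new_round_def, folded r]
  show "rs v (i - 1) \<le> rs v i"
    using R(1) old[OF v, of "i - 1"] cnt[OF v] earlier_self[OF v i] by simp
  \<comment> \<open>Both sides count only updates that precede the ring, and their rounds in the
    history at that moment are already final.\<close>
  have kn: "known (rnd_of (h n)) (count_of (h n)) (rs v i) u = known rs (earlier T \<omega> v i) (rs v i) u" if "u \<in> nbrs G v" for u
    unfolding known_def cnt[OF nb[OF that]] using old[OF nb[OF that]] by (intro arg_cong[where f=card]) auto
  have "bx (known (rnd_of (h n)) (count_of (h n)) (rs v i)) =
      box G v ys (ring_prop \<omega>) (earlier T \<omega> v i) (known rs (earlier T \<omega> v i) (rs v i))"
    unfolding box_def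
  proof (intro PiE_cong)
    fix u assume u: "u \<in> nbrs G v"
    let ?K = "known rs (earlier T \<omega> v i) (rs v i) u" and ?n = "earlier T \<omega> v i u"
    have "prop_of (h n) u ` {?K<..?n} = ring_prop \<omega> u ` {?K<..?n}"
      using old[OF nb[OF u]] prop_final[OF nb[OF u]] earlier_le[of v i u] by (intro image_cong) auto
    then show "insert (state_of Y0 (h n) u (min (known (rnd_of (h n)) (count_of (h n)) (rs v i) u) (count_of (h n) u)))
        (prop_of (h n) u ` {known (rnd_of (h n)) (count_of (h n)) (rs v i) u<..count_of (h n) u}) =
      insert (ys u (min ?K ?n)) (ring_prop \<omega> u ` {?K<..?n})"
      unfolding kn[OF u] cnt[OF nb[OF u]] using old[OF nb[OF u], of "min ?K ?n"] by simp
  qed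
  then show "decided G v (ys v (i - 1)) (ring_prop \<omega> v i) (ring_coin \<omega> v i)
         (box G v ys (ring_prop \<omega>) (earlier T \<omega> v i) (known rs (earlier T \<omega> v i) (rs v i)))"
    using R(2) unfolding cv by simp
qed

lemma chain_eq: "metropolis_chain G Y0 T \<omega> = (\<lambda>v\<in>verts G. current Y0 H v)"
proof -
  \<comment> \<open>The chain also admits rings at time \<open>T\<close> itself; on a good tape
    there are none.\<close>
  have "{(v, i). v \<in> verts G \<and> 1 \<le> i \<and> ring \<omega> v i \<le> T} = rings \<omega> T"
    using goodD(4)[OF gd] by (force simp: rings_def)
  then have "metropolis_chain G Y0 T \<omega> = fold (metropolis_update G \<omega>) L Y0"
    by (simp add: metropolis_chain_def ring_list_def)
  also have "\<dots> = (\<lambda>v\<in>verts G. current Y0 H v)"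
  proof -
    have "fold (metropolis_update G \<omega>) (take n L) Y0 = (\<lambda>v\<in>verts G. current Y0 (h n) v)" if "n \<le> length L" for n
      using that
    proof (induction n)
      case 0
      have "Y0 = restrict Y0 (verts G)" using Y0 by (simp add: colourings_def PiE_restrict)
      then show ?case by (simp add: hist_0 current_def state_of_def)
    next
      case (Suc n)
      then have n: "n < length L" by simp
      obtain v i where e: "L ! n = (v, i)" by (cases "L ! n")
      note S = hist_step[OF n e]
      let ?Y = "\<lambda>v\<in>verts G. current Y0 (h n) v"
      have vn: "verts G \<inter> nbrs G v = nbrs G v" using nbrs_subset(1)[OF sys] by blast
      have IH: "fold (metropolis_update G \<omega>) (take n L) Y0 = ?Y"
        by (rule Suc.IH) (use Suc.prems in linarith)
      have "fold (metropolis_update G \<omega>) (take (Suc n) L) Y0 = metropolis_update G \<omega> (v, i) ?Y"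
        by (simp only: take_Suc_conv_app_nth[OF n] e fold_append fold_simps comp_apply IH)
      also have "\<dots> = ?Y(v := new_state G Y0 (h n) v (ring_prop \<omega> v i) (ring_coin \<omega> v i))"
        using S(4) by (auto simp: metropolis_update_def vn new_state_def fun_eq_iff)
      also have "\<dots> = (\<lambda>w\<in>verts G. current Y0 (h (Suc n)) w)"
        using S(4) unfolding S(1) by (auto simp: fun_eq_iff current_def Cons_new Cons_old)
      finally show ?case .
    qed
    from this[of "length L"] show ?thesis by (simp add: hist_final)
  qed
  finally show ?thesis .
qed

lemma current_spins: "v \<in> verts G \<Longrightarrow> current Y0 H v \<in> {1..spins G}"
  using hist_inv[of "length L"] by (auto simp: hist_final valid_history_def current_def)

end

end

section \<open>Tail bounds\<close>

lemma AE_pair_fst: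
  assumes "prob_space M1" "prob_space M2" "AE x in M1. P x" "Measurable.pred M1 P"
  shows "AE z in M1 \<Otimes>\<^sub>M M2. P (fst z)"
proof -
  interpret M1: prob_space M1 by fact
  interpret M2: prob_space M2 by fact
  interpret pair_sigma_finite M1 M2 ..
  have "Measurable.pred (M1 \<Otimes>\<^sub>M M2) (\<lambda>z. P (fst z))"
    by (rule measurable_compose[OF measurable_fst assms(4)])
  then have "{z \<in> space (M1 \<Otimes>\<^sub>M M2). P (fst z)} \<in> sets (M1 \<Otimes>\<^sub>M M2)" by (simp only: pred_def)
  moreover have "AE x in M1. AE y in M2. P (fst (x, y))" using assms(3) by simp
  ultimately show ?thesis by (rule AE_pair_measure)
qed

lemma AE_pair_snd:
  assumes "prob_space M1" "prob_space M2" "AE x in M2. P x" "Measurable.pred M2 P"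
  shows "AE z in M1 \<Otimes>\<^sub>M M2. P (snd z)"
proof -
  interpret M1: prob_space M1 by fact
  interpret M2: prob_space M2 by fact
  interpret pair_sigma_finite M1 M2 ..
  have "Measurable.pred (M1 \<Otimes>\<^sub>M M2) (\<lambda>z. P (snd z))"
    by (rule measurable_compose[OF measurable_snd assms(4)])
  then have "{z \<in> space (M1 \<Otimes>\<^sub>M M2). P (snd z)} \<in> sets (M1 \<Otimes>\<^sub>M M2)" by (simp only: pred_def)
  moreover have "AE x in M1. AE y in M2. P (snd (x, y))" using assms(3) by simp
  ultimately show ?thesis by (rule AE_pair_measure)
qed

text \<open>An adversary can make the output non-Borel, but it agrees with a measurable function off
  a null set, and in the completed measure this is enough.\<close>

lemma completion_AE_eq:
  assumes g: "g \<in> M \<rightarrow>\<^sub>M count_space UNIV" and ae: "AE x in M. f x = g x"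
  shows "f \<in> completion M \<rightarrow>\<^sub>M count_space UNIV"
    and "distr (completion M) (count_space UNIV) f = distr (completion M) (count_space UNIV) g"
proof -
  have g': "g \<in> completion M \<rightarrow>\<^sub>M count_space UNIV" by (rule measurable_completion[OF g])
  have ae': "AE x in completion M. f x = g x" by (rule AE_completion[OF ae])
  show f: "f \<in> completion M \<rightarrow>\<^sub>M count_space UNIV"
  proof (rule measurableI)
    fix A
    show "f -` A \<inter> space (completion M) \<in> sets (completion M)"
    proof (rule completion.in_sets_AE)
      show "AE x in completion M. (x \<in> g -` A \<inter> space (completion M)) = (x \<in> f -` A \<inter> space (completion M))"
        using ae' by (rule AE_mp) (rule AE_I2, simp)
      show "g -` A \<inter> space (completion M) \<in> sets (completion M)" by (rule measurable_sets[OF g']) simp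
    qed simp
  qed simp
  show "distr (completion M) (count_space UNIV) f = distr (completion M) (count_space UNIV) g"
    by (rule distr_cong_AE[OF refl refl ae' f g'])
qed

text \<open>Measurability is asked of \<open>A\<close>, while the exceptional points of
  \<open>P\<close> outside \<open>A\<close> are covered by a null set \<open>N\<close>. The witness
  is the complement of \<open>A \<union> N\<close>.\<close>

lemma with_high_probI:
  assumes "prob_space M" and A: "A \<in> sets M" "emeasure M A \<le> ennreal p" and p: "0 \<le> p" "p \<le> 1 / real n powr d"
    and ae: "AE \<omega> in M. \<omega> \<notin> A \<longrightarrow> P \<omega>"
  shows "with_high_prob (completion M) n d P"
proof -
  interpret prob_space M by fact
  obtain N where N: "{\<omega>\<in>space M. \<not> (\<omega> \<notin> A \<longrightarrow> P \<omega>)} \<subseteq> N" "emeasure M N = 0" "N \<in> sets M"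
    using ae by (rule AE_E)
  let ?S = "space M - (A \<union> N)"
  have S: "?S \<in> sets M" using A N by auto
  have "measure M (A \<union> N) \<le> measure M A + measure M N"
    using A N by (intro measure_Un_le)
  also have "measure M N = 0" using N(2) by (simp add: measure_def)
  also have "measure M A \<le> p" using A(2) p(1) by (simp add: emeasure_eq_measure)
  finally have "1 - p \<le> measure M ?S" using A N by (subst prob_compl) auto
  moreover have "measure (completion M) ?S = measure M ?S" using S by (simp add: measure_def)
  ultimately show ?thesis
    unfolding with_high_prob_def using S N(1) p(2) by (intro bexI[of _ ?S]) auto
qed

text \<open>With a single node the required probability is \<open>1 - 1 / 1 = 0\<close>, so the
  empty event serves as witness.\<close>

lemma with_high_prob_1: "with_high_prob M 1 d P"
  unfolding with_high_prob_def by (rule bexI[of _ "{}"]) auto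

lemma terminates_within_mono:
  assumes "terminates_within G T Y0 adv \<omega> L" "L * time_unit G T Y0 adv \<omega> \<le> L' * time_unit G T Y0 adv \<omega>"
  shows "terminates_within G T Y0 adv \<omega> L'"
  using assms unfolding terminates_within_def by (meson order_trans)

context model
begin

lemma randomness_eq: "randomness G = completion \<mu>"
  unfolding randomness_def \<mu>_def K_def marks_def expo_def ..

lemma AE_good_tape: "AE \<omega> in \<mu>. good_tape \<omega>"
proof -
  have "AE \<omega> in \<mu>. \<forall>v\<in>verts G. \<forall>i. 1 \<le> i \<longrightarrow> ring_prop \<omega> v i \<in> {1..spins G}"
  proof (intro AE_finite_allI[OF finV] AE_all_countable[THEN iffD2] allI)
    fix v i assume v: "v \<in> verts G"
    show "AE \<omega> in \<mu>. 1 \<le> i \<longrightarrow> ring_prop \<omega> v i \<in> {1..spins G}"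
    proof (cases "1 \<le> i")
      case True
      have "set_pmf (proposal G v) \<subseteq> {1..spins G}" using sys v by (simp add: metropolis_system_def)
      then have "AE b in measure_pmf (proposal G v). b \<in> {1..spins G}" by (intro AE_pmfI) blast
      then have 1: "AE m in marks G v. fst m \<in> {1..spins G}"
        unfolding marks_def by (intro AE_pair_fst prob_space_measure_pmf prob_space_unif) (simp_all add: pred_def)
      have "Measurable.pred (marks G v) (\<lambda>m. fst m \<in> {1..spins G})"
        unfolding marks_def by (rule measurable_compose[OF measurable_fst]) simp
      with 1 have "AE z in K (v, i). fst (snd z) \<in> {1..spins G}"
        unfolding K_apply by (intro AE_pair_snd[where P="\<lambda>m. fst m \<in> {1..spins G}"] prob_space_expo prob_space_marks)
      then have "AE \<omega> in \<mu>. fst (snd (\<omega> (v, i))) \<in> {1..spins G}"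
        by (intro AE_component_mu[where P="\<lambda>z. fst (snd z) \<in> {1..spins G}"]) (use v True in auto)
      then show ?thesis by (simp add: ring_prop_def)
    qed simp
  qed
  then show ?thesis using AE_good[of T] unfolding good_tape_def by eventually_elim blast
qed

lemma step_measurable: "v \<in> verts G \<Longrightarrow> extend_history G Y0 hs v \<in> K (v, 1) \<rightarrow>\<^sub>M count_space UNIV"
  unfolding K_apply by (rule measurable_extend[OF sys])

lemma step_indep: "extend_history G Y0 hs v (x, z) = extend_history G Y0 hs v (x', z)"
  by (cases z) (simp add: extend_history_def)

lemma run_final:
  assumes "good_tape \<omega>" "length (ring_list \<omega> T) \<le> k"
  shows "run (extend_history G Y0) k [] T \<omega> = final_history \<omega>"
proof -
  have "good T \<omega>" using assms(1) by (simp add: good_tape_def)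
  from run_eq_fold[of "extend_history G Y0", OF step_indep this assms(2)]
  show ?thesis by (simp add: final_history_def step_history_def[abs_def])
qed

definition colouring_of :: "history \<Rightarrow> nat \<Rightarrow> nat" where
  "colouring_of hs = (\<lambda>v\<in>verts G. current Y0 hs v)"

lemma adversarial:
  assumes "good_tape \<omega>" "admissible adv"
  shows "adversarial_run G T Y0 \<omega> (state_of Y0 (final_history \<omega>)) (rnd_of (final_history \<omega>)) adv"
proof -
  interpret coupled_run G T Y0 \<omega> "state_of Y0 (final_history \<omega>)" "rnd_of (final_history \<omega>)"
    by (rule coupled[OF assms(1)])
  show ?thesis by unfold_locales (rule assms(2))
qed

lemma output_good:
  assumes "good_tape \<omega>" "admissible adv"
  shows "algorithm_output G T Y0 adv \<omega> = colouring_of (final_history \<omega>)"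
proof -
  interpret adversarial_run G T Y0 \<omega> "state_of Y0 (final_history \<omega>)" "rnd_of (final_history \<omega>)" adv
    by (rule adversarial[OF assms])
  show ?thesis
    unfolding output_eq colouring_of_def current_def using count_final[OF assms(1)] by (intro restrict_ext) simp
qed

theorem correctness:
  assumes adm: "admissible adv"
  shows "AE \<omega> in randomness G. terminates G T Y0 adv \<omega>"
    and "AE \<omega> in randomness G. algorithm_output G T Y0 adv \<omega> \<in> colourings G (verts G)"
    and "algorithm_output G T Y0 adv \<in> randomness G \<rightarrow>\<^sub>M count_space UNIV"
    and "distr (randomness G) (count_space UNIV) (algorithm_output G T Y0 adv) =
      distr (randomness G) (count_space UNIV) (metropolis_chain G Y0 T)"
proof -
  note good = AE_good_tape
  have "AE \<omega> in \<mu>. terminates G T Y0 adv \<omega>"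
    using good
  proof (rule AE_mp, intro AE_I2 impI)
    fix \<omega> assume "good_tape \<omega>"
    then interpret adversarial_run G T Y0 \<omega> "state_of Y0 (final_history \<omega>)" "rnd_of (final_history \<omega>)" adv
      by (rule adversarial[OF _ adm])
    show "terminates G T Y0 adv \<omega>" unfolding terminates_def by (rule terminates)
  qed
  then show "AE \<omega> in randomness G. terminates G T Y0 adv \<omega>" unfolding randomness_eq by (rule AE_completion)
  have "AE \<omega> in \<mu>. algorithm_output G T Y0 adv \<omega> \<in> colourings G (verts G)"
    using good
  proof (rule AE_mp, intro AE_I2 impI)
    fix \<omega> assume g: "good_tape \<omega>"
    show "algorithm_output G T Y0 adv \<omega> \<in> colourings G (verts G)"
      unfolding output_good[OF g adm] colouring_of_def colourings_def
      using current_spins[OF g] by (intro restrict_PiE_iff[THEN iffD2]) blast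
  qed
  then show "AE \<omega> in randomness G. algorithm_output G T Y0 adv \<omega> \<in> colourings G (verts G)"
    unfolding randomness_eq by (rule AE_completion)
  \<comment> \<open>\<open>F\<close> is a measurable version of \<open>final_history\<close>; output
    and chain are both compared with the colouring that it induces.\<close>
  obtain F where F: "F \<in> \<mu> \<rightarrow>\<^sub>M count_space UNIV"
    and FL: "\<And>\<omega> s n. \<omega> \<in> space \<mu> \<Longrightarrow> (\<And>k. n \<le> k \<Longrightarrow> run (extend_history G Y0) k [] T \<omega> = s) \<Longrightarrow> F \<omega> = s"
    using eventual_value_measurable[of "\<lambda>k. run (extend_history G Y0) k [] T" \<mu>, OF measurable_run_fixed[OF step_measurable]]
    by blast
  have F': "F \<omega> = final_history \<omega>" if "good_tape \<omega>" "\<omega> \<in> space \<mu>" for \<omega>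
    by (rule FL[OF that(2)]) (rule run_final[OF that(1)])
  have g: "(\<lambda>\<omega>. colouring_of (F \<omega>)) \<in> \<mu> \<rightarrow>\<^sub>M count_space UNIV"
    by (rule measurable_compose[OF F]) simp
  have out: "AE \<omega> in \<mu>. algorithm_output G T Y0 adv \<omega> = colouring_of (F \<omega>)"
    using good by (rule AE_mp) (intro AE_I2 impI, simp only: output_good[OF _ adm] F')
  have chain: "AE \<omega> in \<mu>. metropolis_chain G Y0 T \<omega> = colouring_of (F \<omega>)"
    using good by (rule AE_mp) (intro AE_I2 impI, simp only: chain_eq F' colouring_of_def)
  show "algorithm_output G T Y0 adv \<in> randomness G \<rightarrow>\<^sub>M count_space UNIV"
    unfolding randomness_eq by (rule completion_AE_eq(1)[OF g out])
  show "distr (randomness G) (count_space UNIV) (algorithm_output G T Y0 adv) =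
      distr (randomness G) (count_space UNIV) (metropolis_chain G Y0 T)"
    unfolding randomness_eq completion_AE_eq(2)[OF g out] completion_AE_eq(2)[OF g chain] ..
qed

lemma potential_Nil: "potential G [] = real (card (verts G))"
  by (simp add: potential_def rnd_of_def)

text \<open>A single update with round at least \<open>l\<close> already contributes
  \<open>2 ^ l\<close> to the potential, which starts at the number of nodes. The exceptional set is
  chosen before the adversary and serves all of them.\<close>

theorem rounds_tail:
  assumes C: "0 \<le> C" and lip: "filter_lipschitz G C"
  shows "\<exists>A\<in>sets \<mu>. emeasure \<mu> A \<le> ennreal (real (card (verts G)) * exp ((1 + 4 * C) * T) / 2 ^ l) \<and>
    (\<forall>\<omega>\<in>space \<mu>. good_tape \<omega> \<longrightarrow> \<omega> \<notin> A \<longrightarrow> (\<forall>adv. admissible adv \<longrightarrow> terminates_within G T Y0 adv \<omega> (1 + real l)))"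
proof -
  define B where "B = {h :: history. \<exists>v\<in>verts G. \<exists>k\<le>count_of h v. l \<le> rnd_of h v k}"
  let ?p = "ennreal (real (card (verts G)) * exp ((1 + 4 * C) * T) / 2 ^ l)"
  have "(\<integral>\<^sup>+\<omega>. indicator B (run (extend_history G Y0) k [] T \<omega>) \<partial>\<mu>) \<le> ?p" for k
    unfolding potential_Nil[symmetric]
  proof (rule run_potential_le[OF step_measurable step_indep])
    fix h assume "h \<in> B"
    then obtain v k where v: "v \<in> verts G" "k \<le> count_of h v" "l \<le> rnd_of h v k" unfolding B_def by blast
    have "(2::real) ^ l \<le> 2 ^ rnd_of h v k" using v(3) by simp
    also have "\<dots> \<le> (\<Sum>k\<le>count_of h v. 2 ^ rnd_of h v k)" using v(2) by (intro member_le_sum) auto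
    also have "\<dots> \<le> potential G h" unfolding potential_def
      using finV v(1) by (intro member_le_sum[of v "verts G" "\<lambda>v. \<Sum>k\<le>count_of h v. 2 ^ rnd_of h v k"] sum_nonneg) auto
    finally show "2 ^ l \<le> potential G h" .
  next
    fix h
    show "(\<Sum>v\<in>verts G. \<integral>\<^sup>+m. ennreal (potential G (extend_history G Y0 h v (0, m))) \<partial>marks G v)
          \<le> ennreal ((real (card (verts G)) + (1 + 4 * C)) * potential G h)"
      by (rule potential_generator[OF sys C lip])
  qed (use potential_nonneg C T in auto)
  from liminf_bad_le[where f="\<lambda>k. run (extend_history G Y0) k [] T", OF measurable_run_fixed[OF step_measurable] this]
  obtain A where A: "A \<in> sets \<mu>" "emeasure \<mu> A \<le> ?p"
    and bad: "\<And>\<omega>. \<omega> \<in> space \<mu> \<Longrightarrow> (\<exists>n. \<forall>k\<ge>n. run (extend_history G Y0) k [] T \<omega> \<in> B) \<Longrightarrow> \<omega> \<in> A"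
    by blast
  have "terminates_within G T Y0 adv \<omega> (1 + real l)"
    if w: "\<omega> \<in> space \<mu>" and g: "good_tape \<omega>" and n: "\<omega> \<notin> A" and adm: "admissible adv" for \<omega> adv
  proof -
    interpret adversarial_run G T Y0 \<omega> "state_of Y0 (final_history \<omega>)" "rnd_of (final_history \<omega>)" adv
      by (rule adversarial[OF g adm])
    have "final_history \<omega> \<notin> B"
      using bad[OF w] n run_final[OF g] by metis
    then have le: "rnd_of (final_history \<omega>) v k \<le> l" if "v \<in> verts G" "k \<le> count_of (final_history \<omega>) v" for v k
      using that unfolding B_def by (metis (mono_tags, lifting) mem_Collect_eq nle_le)
    show ?thesis
      by (rule terminates_within_rounds) (use le count_final[OF g] in auto)
  qed
  then show ?thesis using A by blast
qed

theorem precision_tail: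
  assumes \<epsilon>: "0 < \<epsilon>" and p: "1 \<le> 2 ^ p * \<epsilon>"
  shows "\<exists>A\<in>sets \<mu>. emeasure \<mu> A \<le> ennreal (real (card (verts G)) * \<epsilon> * (1 + real (card (verts G)) * T)) \<and>
    (\<forall>\<omega>\<in>space \<mu>. good_tape \<omega> \<longrightarrow> \<omega> \<notin> A \<longrightarrow> precision G T \<omega> \<le> p)"
proof -
  have gm: "gap_step \<epsilon> s v \<in> K (v, 1) \<rightarrow>\<^sub>M count_space UNIV" if "v \<in> verts G" for s v
  proof -
    note [measurable] = measurable_fst_K[of v 1]
    show ?thesis unfolding gap_step_def[abs_def] by measurable
  qed
  from liminf_bad_le[where f="\<lambda>k. run (gap_step \<epsilon>) k False T", OF measurable_run_fixed[OF gm] run_gap_le[OF less_imp_le[OF \<epsilon>] T]]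
  obtain A where A: "A \<in> sets \<mu>" "emeasure \<mu> A \<le> ennreal (real (card (verts G)) * \<epsilon> * (1 + real (card (verts G)) * T))"
    and bad: "\<And>\<omega>. \<omega> \<in> space \<mu> \<Longrightarrow> (\<exists>n. \<forall>k\<ge>n. run (gap_step \<epsilon>) k False T \<omega> \<in> {True}) \<Longrightarrow> \<omega> \<in> A"
    by blast
  have "precision G T \<omega> \<le> p" if w: "\<omega> \<in> space \<mu>" and g: "good_tape \<omega>" and n: "\<omega> \<notin> A" for \<omega>
  proof -
    have gd: "good T \<omega>" using g by (simp add: good_tape_def)
    have "\<not> (\<forall>k\<ge>length (ring_list \<omega> T). run (gap_step \<epsilon>) k False T \<omega> \<in> {True})"
      using bad[OF w] n by (metis (no_types))
    then obtain k where k: "length (ring_list \<omega> T) \<le> k" "\<not> run (gap_step \<epsilon>) k False T \<omega>"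
      by (auto simp only: singleton_iff simp_thms not_all not_imp)
    note gs = gap_separated[OF gd k]
    have sep: "\<epsilon> \<le> \<bar>ring \<omega> u i - ring \<omega> v j\<bar>" if "(u, i) \<in> rings \<omega> T" "(v, j) \<in> rings \<omega> T" "(u, i) \<noteq> (v, j)" for u i v j
      using bspec[OF conjunct2[OF bspec[OF gs that(1), unfolded prod.case]] that(2), unfolded prod.case] that(3) by (rule mp)
    have inr: "(v, i) \<in> rings \<omega> T" if "v \<in> verts G" "1 \<le> i" "i \<le> num_updates T \<omega> v" for v i
      using in_rings[OF g, of v i] that ring_list(2)[OF gd, of T] by simp
    show ?thesis
    proof (rule precision_le(1)[where V="verts G" and \<epsilon>=\<epsilon>])
      fix u v i j assume *: "u \<in> verts G" "v \<in> verts G" "1 \<le> i" "i \<le> num_updates T \<omega> u" "1 \<le> j" "j \<le> num_updates T \<omega> v"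
        "ring \<omega> u i < ring \<omega> v j"
      then have "\<epsilon> \<le> \<bar>ring \<omega> u i - ring \<omega> v j\<bar>" by (intro sep inr) auto
      then show "ring \<omega> u i + \<epsilon> \<le> ring \<omega> v j" using *(7) by linarith
    next
      fix u i assume "u \<in> verts G" "1 \<le> i" "i \<le> num_updates T \<omega> u"
      then show "0 \<le> ring \<omega> u i" using good_ring_pos[OF gd, of u i] by simp
    qed (use p edges_verts[OF g] in auto)
  qed
  then show ?thesis using A by blast
qed

lemma spins_pos: "1 \<le> spins G"
proof -
  obtain v where "v \<in> verts G" using V_ne by blast
  then have "Y0 v \<in> {1..spins G}" using Y0 unfolding colourings_def by auto
  then show ?thesis by simp
qed

text \<open>A delivered message needs an edge, hence two nodes. This later makes \<open>ln n\<close>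
  at least \<open>ln 2\<close>, enough to absorb additive constants.\<close>

lemma delivered_bits:
  assumes g: "good_tape \<omega>" and adm: "admissible adv" and x: "(r, x) \<in> delivered G T Y0 adv \<omega>"
  shows "2 \<le> card (verts G)" "0 < max_degree G"
    "real (bits x) \<le> 7 + 4 * real (precision G T \<omega>) + 2 * (ln (of_int \<lceil>T\<rceil>) / ln 2) + ln (real (spins G)) / ln 2"
proof -
  interpret A: adversarial_run G T Y0 \<omega> "state_of Y0 (final_history \<omega>)" "rnd_of (final_history \<omega>)" adv
    by (rule adversarial[OF g adm])
  have gd: "good T \<omega>" using g by (simp add: good_tape_def)
  obtain u where u: "u \<in> verts G" "nbrs G u \<noteq> {}" "x \<in> set (A.full u)" using A.delivered_messages[OF x] by blast
  obtain w where w: "w \<in> nbrs G u" using u(2) by blast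
  have wu: "w \<in> verts G" "w \<noteq> u" using nbrs_subset[OF sys w] by auto
  have "card {u, w} \<le> card (verts G)" using u wu finV by (intro card_mono) auto
  then show "2 \<le> card (verts G)" using wu by simp
  have "0 < card (nbrs G u)" using u(2) finite_nbrs[OF sys] by (simp add: card_gt_0_iff)
  then show "0 < max_degree G" using card_nbrs_le[OF sys u(1)] by simp
  have phI: "real (bits x) \<le> 7 + 4 * real (precision G T \<omega>) + 2 * (ln (of_int \<lceil>T\<rceil>) / ln 2) + ln (real (spins G)) / ln 2"
    if "x \<in> set (phaseI_messages G T Y0 \<omega> u)" for x
  proof (rule bits_phaseI_le[OF that _ _ _ spins_pos T])
    show "Y0 u \<le> spins G" using Y0 u(1) unfolding colourings_def by auto
    show "ring_prop \<omega> u i \<le> spins G" if "1 \<le> i" "i \<le> num_updates T \<omega> u" for i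
      using g that u(1) unfolding good_tape_def by auto
    show "0 < ring \<omega> u i \<and> ring \<omega> u i < T" if "1 \<le> i" "i \<le> num_updates T \<omega> u" for i
      using good_ring_pos[OF gd u(1) that(1)] num_updates_iff[OF g u(1) that(1)] that(2) by simp
  qed
  have "x \<in> set (phaseI_messages G T Y0 \<omega> u) \<or> x = Accept \<or> x = Reject"
    using u(3) unfolding A.full_def A.dec_def by auto
  then show "real (bits x) \<le> 7 + 4 * real (precision G T \<omega>) + 2 * (ln (of_int \<lceil>T\<rceil>) / ln 2) + ln (real (spins G)) / ln 2"
  proof (elim disjE)
    \<comment> \<open>\<open>Accept\<close> and \<open>Reject\<close> have two bits, no more than
      the tag of \<open>Initial\<close>, for which the bound is already known.\<close>
    have "EndPhaseI \<in> set (phaseI_messages G T Y0 \<omega> u)" "Initial (Y0 u) \<in> set (phaseI_messages G T Y0 \<omega> u)"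
      by (simp_all add: phaseI_messages_def Let_def)
    have "2 \<le> real (bits (Initial (Y0 u)))" by (simp add: bits_def)
    also note phI[OF \<open>Initial (Y0 u) \<in> set (phaseI_messages G T Y0 \<omega> u)\<close>]
    finally have 2: "2 \<le> 7 + 4 * real (precision G T \<omega>) + 2 * (ln (of_int \<lceil>T\<rceil>) / ln 2) + ln (real (spins G)) / ln 2" .
    show ?thesis if "x = Accept" using 2 by (simp add: that bits_def)
    show ?thesis if "x = Reject" using 2 by (simp add: that bits_def)
  qed (rule phI)
qed

text \<open>Without edges \<open>max_degree G * T\<close> vanishes and cannot absorb the growth rate
  1 of the potential. But then no message is sent, the time unit is 0, and any two bounds agree
  after multiplication by it.\<close>

lemma time_unit_no_edges:
  assumes "good_tape \<omega>" "admissible adv" "max_degree G = 0"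
  shows "time_unit G T Y0 adv \<omega> = 0"
proof -
  have "delivered G T Y0 adv \<omega> = {}" using delivered_bits(2)[OF assms(1,2)] assms(3) by fastforce
  then show ?thesis by (simp add: time_unit_def)
qed

lemma time_unit_nonneg:
  assumes "good_tape \<omega>" "admissible adv"
  shows "0 \<le> time_unit G T Y0 adv \<omega>"
proof -
  interpret A: adversarial_run G T Y0 \<omega> "state_of Y0 (final_history \<omega>)" "rnd_of (final_history \<omega>)" adv
    by (rule adversarial[OF assms])
  show ?thesis by (rule A.unit_nonneg)
qed

lemma lipschitz_max_degree: "filter_lipschitz G (real (max_degree G))"
  unfolding filter_lipschitz_def
proof (intro allI impI ballI)
  fix u v a b c assume e: "{u, v} \<in> edges G" and abc: "a \<in> {1..spins G}" "b \<in> {1..spins G}" "c \<in> {1..spins G}"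
  have u: "u \<in> nbrs G v" using e by (simp add: nbrs_def)
  have v: "v \<in> verts G" using nbrs_subset[OF sys u] by simp
  have "0 < card (nbrs G v)" using u finite_nbrs[OF sys] by (auto simp: card_gt_0_iff)
  then have \<Delta>: "0 < max_degree G" using card_nbrs_le[OF sys v] by simp
  have sp: "set_pmf (proposal G v) \<subseteq> {1..spins G}" using sys v by (simp add: metropolis_system_def)
  have "measure_pmf.expectation (proposal G v) (\<lambda>c'. filt_diff G v u a b c c') \<le> measure_pmf.expectation (proposal G v) (\<lambda>c'. 1)"
  proof (rule integral_mono_AE)
    show "integrable (measure_pmf (proposal G v)) (\<lambda>c'. filt_diff G v u a b c c')"
      by (rule integrable_measure_pmf_finite) (rule finite_subset[OF sp], simp)
    show "AE c' in measure_pmf (proposal G v). filt_diff G v u a b c c' \<le> 1"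
      using sp by (intro AE_pmfI filt_diff_bounds(2)[OF sys u abc]) blast
  qed simp
  then show "measure_pmf.expectation (proposal G v) (\<lambda>c'. filt_diff G v u a b c c') \<le> real (max_degree G) / real (max_degree G)"
    using \<Delta> by simp
qed

text \<open>\<open>bd\<close> is compared after multiplication by the time unit, so that networks
  without edges, with unit 0, are covered.\<close>

theorem time_bound:
  assumes C: "0 \<le> C" and lip: "filter_lipschitz G C" and d: "0 < d" and n: "2 \<le> card (verts G)" and adm: "admissible adv"
    and bd: "\<And>\<omega>. good_tape \<omega> \<Longrightarrow> (((1 + 4 * C) * T + (d + 3) * ln (real (card (verts G)))) / ln 2) * time_unit G T Y0 adv \<omega> \<le>
      bd * time_unit G T Y0 adv \<omega>"
  shows "with_high_prob (randomness G) (card (verts G)) d (\<lambda>\<omega>. terminates_within G T Y0 adv \<omega> bd)"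
proof -
  let ?n = "real (card (verts G))" and ?\<kappa> = "1 + 4 * C"
  \<comment> \<open>Chosen so that \<open>2 ^ l\<close> is at least
    \<open>exp (?\<kappa> * T) * ?n powr (d + 1)\<close>: one power of \<open>?n\<close> cancels the
    initial potential, the others give the failure probability.\<close>
  define x where "x = (?\<kappa> * T + (d + 1) * ln ?n) / ln 2"
  define l where "l = nat \<lceil>x\<rceil>"
  have ln2: "0 < ln (2::real)" by simp
  have lnn: "ln 2 \<le> ln ?n" using n by simp
  have lnn0: "0 \<le> ln ?n" using lnn ln2 by linarith
  have x0: "0 \<le> x" unfolding x_def using C T d lnn0 ln2 by (intro divide_nonneg_pos add_nonneg_nonneg mult_nonneg_nonneg) auto
  have l: "x \<le> real l" "real l \<le> x + 1" unfolding l_def using x0 by linarith+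
  obtain A where A: "A \<in> sets \<mu>" "emeasure \<mu> A \<le> ennreal (?n * exp (?\<kappa> * T) / 2 ^ l)"
    and ok: "\<And>\<omega>. \<omega> \<in> space \<mu> \<Longrightarrow> good_tape \<omega> \<Longrightarrow> \<omega> \<notin> A \<Longrightarrow> terminates_within G T Y0 adv \<omega> (1 + real l)"
    using rounds_tail[OF C lip, of l] adm by blast
  show ?thesis unfolding randomness_eq
  proof (rule with_high_probI[OF mu.prob_space_axioms A])
    have "exp (?\<kappa> * T + (d + 1) * ln ?n) = exp (x * ln 2)" using ln2 by (simp add: x_def)
    also have "\<dots> \<le> exp (real l * ln 2)" using l ln2 by simp
    also have "\<dots> = 2 ^ l" by (simp add: exp_of_nat_mult)
    finally have pow: "exp (?\<kappa> * T + (d + 1) * ln ?n) \<le> 2 ^ l" .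
    have e: "?n * exp (?\<kappa> * T) = exp (?\<kappa> * T + (d + 1) * ln ?n) * exp (- (d * ln ?n))"
      using n by (simp add: exp_add[symmetric] algebra_simps) (simp add: exp_add)
    have "?n * exp (?\<kappa> * T) / 2 ^ l \<le> 2 ^ l * exp (- (d * ln ?n)) / 2 ^ l"
      unfolding e using pow by (intro divide_right_mono mult_right_mono) auto
    also have "\<dots> = 1 / ?n powr d" using n by (simp add: powr_def exp_minus divide_inverse)
    finally show "?n * exp (?\<kappa> * T) / 2 ^ l \<le> 1 / ?n powr d" .
    \<comment> \<open>The unit for Phase I and the rounding of \<open>x\<close> cost 2, which is at
      most \<open>2 * ln ?n / ln 2\<close> as there are two nodes or more; this turns
      \<open>d + 1\<close> into \<open>d + 3\<close>.\<close>
    have b: "1 + real l \<le> (?\<kappa> * T + (d + 3) * ln ?n) / ln 2"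
    proof -
      have "2 \<le> 2 * ln ?n / ln 2" using lnn ln2 by (simp add: field_simps)
      moreover have "(?\<kappa> * T + (d + 3) * ln ?n) / ln 2 = x + 2 * ln ?n / ln 2"
        unfolding x_def by (simp add: add_divide_distrib[symmetric] algebra_simps)
      ultimately show ?thesis using l by linarith
    qed
    show "AE \<omega> in \<mu>. \<omega> \<notin> A \<longrightarrow> terminates_within G T Y0 adv \<omega> bd"
      using AE_good_tape
    proof (rule AE_mp, intro AE_I2 impI)
      fix \<omega> assume w: "\<omega> \<in> space \<mu>" and g: "good_tape \<omega>" and nA: "\<omega> \<notin> A"
      have "(1 + real l) * time_unit G T Y0 adv \<omega> \<le> ((?\<kappa> * T + (d + 3) * ln ?n) / ln 2) * time_unit G T Y0 adv \<omega>"
        by (rule mult_right_mono[OF b time_unit_nonneg[OF g adm]])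
      also note bd[OF g]
      finally show "terminates_within G T Y0 adv \<omega> bd" by (rule terminates_within_mono[OF ok[OF w g nA]])
    qed
  qed simp
qed

lemma ln_ceiling_nonneg: "0 \<le> ln (real_of_int \<lceil>T\<rceil>)"
proof (cases "T = 0")
  case False
  then have "1 \<le> \<lceil>T\<rceil>" using T by linarith
  then show ?thesis by simp
qed simp

text \<open>\<epsilon> is chosen as the inverse of \<open>?n powr (d + 3)\<close> times
  \<open>T\<close> rounded up (only of the power if \<open>T = 0\<close>): the gap bound is at most
  \<epsilon> times \<open>?n ^ 3\<close> times the same factor. \<open>good_tape\<close> is carried
  along because the bound on messages is known on good tapes.\<close>

theorem precision_bound:
  assumes d: "0 < d" and n: "2 \<le> card (verts G)"
  shows "with_high_prob (randomness G) (card (verts G)) d (\<lambda>\<omega>. good_tape \<omega> \<and>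
    real (precision G T \<omega>) \<le> ((d + 3) * ln (real (card (verts G))) + ln (of_int \<lceil>T\<rceil>)) / ln 2 + 1)"
proof -
  let ?n = "real (card (verts G))"
  define x where "x = (d + 3) * ln ?n + ln (of_int \<lceil>T\<rceil>)"
  define p where "p = nat \<lceil>x / ln 2\<rceil>"
  define \<epsilon> where "\<epsilon> = exp (- x)"
  have ln2: "0 < ln (2::real)" by simp
  have n2: "2 \<le> ?n" using n by simp
  have lnn: "0 \<le> ln ?n" using n by simp
  have x0: "0 \<le> x" unfolding x_def using d lnn ln_ceiling_nonneg by (intro add_nonneg_nonneg mult_nonneg_nonneg) auto
  have "0 \<le> x / ln 2" using x0 ln2 by simp
  then have p: "x / ln 2 \<le> real p" "real p \<le> x / ln 2 + 1" unfolding p_def by linarith+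
  have "x \<le> real p * ln 2" using p(1) ln2 by (simp add: field_simps)
  then have "exp x \<le> 2 ^ p" by (metis exp_le_cancel_iff exp_ln exp_of_nat_mult zero_less_numeral)
  then have "1 \<le> 2 ^ p * \<epsilon>" unfolding \<epsilon>_def by (simp add: exp_minus field_simps)
  from precision_tail[OF _ this] obtain A where A: "A \<in> sets \<mu>" "emeasure \<mu> A \<le> ennreal (?n * \<epsilon> * (1 + ?n * T))"
    and ok: "\<And>\<omega>. \<omega> \<in> space \<mu> \<Longrightarrow> good_tape \<omega> \<Longrightarrow> \<omega> \<notin> A \<Longrightarrow> precision G T \<omega> \<le> p"
    unfolding \<epsilon>_def by auto
  show ?thesis unfolding randomness_eq
  proof (rule with_high_probI[OF mu.prob_space_axioms A])
    show "0 \<le> ?n * \<epsilon> * (1 + ?n * T)" using T by (simp add: \<epsilon>_def)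
    \<comment> \<open>If \<open>T\<close> is positive, \<open>1 + ?n * T\<close> is at most twice
      \<open>?n\<close> times \<open>T\<close> rounded up, and \<open>2 \<le> ?n\<close> absorbs the
      2; with the outer \<open>?n\<close> this makes a cube. If \<open>T = 0\<close>,
      \<open>ln\<close> of 0 is 0 and the cube alone suffices.\<close>
    have key: "?n * (1 + ?n * T) \<le> exp (3 * ln ?n + ln (of_int \<lceil>T\<rceil>))"
    proof -
      have e3: "exp (3 * ln ?n) = ?n * (?n * ?n)" using n by (simp add: exp_of_nat_mult[of 3, simplified] power3_eq_cube)
      show ?thesis
      proof (cases "T = 0")
        case True
        have "1 * 1 \<le> ?n * ?n" using n2 by (intro mult_mono) auto
        then show ?thesis using True n2 by (simp add: e3)
      next
        case False
        then have "1 \<le> \<lceil>T\<rceil>" using T by linarith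
        then have T1: "1 \<le> real_of_int \<lceil>T\<rceil>" by simp
        have "1 * 1 \<le> ?n * real_of_int \<lceil>T\<rceil>" using n2 T1 by (intro mult_mono) auto
        then have "1 + ?n * T \<le> ?n * real_of_int \<lceil>T\<rceil> + ?n * real_of_int \<lceil>T\<rceil>"
          using n2 by (intro add_mono mult_left_mono) auto
        also have "\<dots> = 2 * (?n * real_of_int \<lceil>T\<rceil>)" by simp
        also have "\<dots> \<le> ?n * (?n * real_of_int \<lceil>T\<rceil>)" using n2 T1 by (intro mult_right_mono) auto
        finally have "?n * (1 + ?n * T) \<le> ?n * (?n * (?n * real_of_int \<lceil>T\<rceil>))" using n2 by (intro mult_left_mono) auto
        also have "\<dots> = exp (3 * ln ?n + ln (of_int \<lceil>T\<rceil>))" using T1 by (simp add: exp_add e3)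
        finally show ?thesis .
      qed
    qed
    have "?n * \<epsilon> * (1 + ?n * T) = (?n * (1 + ?n * T)) * \<epsilon>" by simp
    also have "\<dots> \<le> exp (3 * ln ?n + ln (of_int \<lceil>T\<rceil>)) * \<epsilon>" by (intro mult_right_mono key) (simp add: \<epsilon>_def)
    also have "\<dots> = exp (- (d * ln ?n))" unfolding \<epsilon>_def x_def exp_add[symmetric] by (simp add: algebra_simps)
    also have "\<dots> = 1 / ?n powr d" using n by (simp add: powr_def exp_minus divide_inverse)
    finally show "?n * \<epsilon> * (1 + ?n * T) \<le> 1 / ?n powr d" .
    show "AE \<omega> in \<mu>. \<omega> \<notin> A \<longrightarrow> good_tape \<omega> \<and>
      real (precision G T \<omega>) \<le> ((d + 3) * ln ?n + ln (of_int \<lceil>T\<rceil>)) / ln 2 + 1"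
      using AE_good_tape
    proof (rule AE_mp, intro AE_I2 impI)
      fix \<omega> assume "\<omega> \<in> space \<mu>" and g: "good_tape \<omega>" and "\<omega> \<notin> A"
      then have "real (precision G T \<omega>) \<le> real p" using ok by simp
      then show "good_tape \<omega> \<and> real (precision G T \<omega>) \<le> ((d + 3) * ln ?n + ln (of_int \<lceil>T\<rceil>)) / ln 2 + 1"
        using p(2) g unfolding x_def by simp
    qed
  qed
qed

end

section \<open>The final statement with explicit constants\<close>

lemma with_high_prob_mono: "with_high_prob M n d P \<Longrightarrow> (\<And>\<omega>. P \<omega> \<Longrightarrow> Q \<omega>) \<Longrightarrow> with_high_prob M n d Q"
  unfolding with_high_prob_def by blast

theorem theorem5p1:
  fixes d :: real
  assumes "d > 0"
  shows "\<exists>K::real. \<forall>(G::metropolis) (T::real) (Y0::nat \<Rightarrow> nat) (adv::adversary).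
    metropolis_system G \<longrightarrow> T \<ge> 0 \<longrightarrow> Y0 \<in> colourings G (verts G) \<longrightarrow> admissible adv \<longrightarrow>
    (let M = randomness G;
         n = card (verts G);
         \<Delta> = max_degree G;
         q = spins G;
         out = algorithm_output G T Y0 adv
     in
       ((AE \<omega> in M. terminates G T Y0 adv \<omega>) \<and>
        (AE \<omega> in M. out \<omega> \<in> colourings G (verts G)) \<and>
        out \<in> measurable M (count_space UNIV) \<and>
        distr M (count_space UNIV) out = distr M (count_space UNIV) (metropolis_chain G Y0 T)) \<and>
       (with_high_prob M n d (\<lambda>\<omega>.
          terminates_within G T Y0 adv \<omega> (K * (real \<Delta> * T + ln (real n)))) \<and>
        (\<forall>C::real. C > 0 \<longrightarrow> filter_lipschitz G C \<longrightarrow>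
          with_high_prob M n d (\<lambda>\<omega>.
            terminates_within G T Y0 adv \<omega> (K * (1 + C) * (T + ln (real n)))))) \<and>
       ((AE \<omega> in M. \<forall>(r, m)\<in>delivered G T Y0 adv \<omega>.
          real (bits m) \<le> K * (ln (real n) + ln (of_int \<lceil>T\<rceil>) + ln (real q) + real (precision G T \<omega>))) \<and>
        with_high_prob M n d (\<lambda>\<omega>. \<forall>(r, m)\<in>delivered G T Y0 adv \<omega>.
          real (bits m) \<le> K * (ln (real n) + ln (of_int \<lceil>T\<rceil>) + ln (real q)))))"
proof (intro exI allI impI)
  fix G :: metropolis and T :: real and Y0 :: "nat \<Rightarrow> nat" and adv :: adversary
  assume sys: "metropolis_system G" and T: "T \<ge> 0" and Y0: "Y0 \<in> colourings G (verts G)" and adm: "admissible adv"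
  interpret model G Y0 T using sys T Y0 by unfold_locales
  \<comment> \<open>One generous constant for all bounds; dividing by \<open>ln 2\<close> passes to
    binary logarithms. It exceeds \<open>4 * (d + 3) + 11\<close> from the message lengths,
    \<open>d + 3\<close> from the running time, and 5 from
    \<open>1 + 4 * ?\<Delta> \<le> 5 * ?\<Delta>\<close>.\<close>
  let ?K = "(10 * d + 40) / ln 2" and ?n = "real (card (verts G))" and ?\<Delta> = "real (max_degree G)"
  define a where "a = ln ?n / ln 2"
  define b where "b = ln (real_of_int \<lceil>T\<rceil>) / ln 2"
  define c where "c = ln (real (spins G)) / ln 2"
  define t where "t = T / ln 2"
  have ln2: "0 < ln (2::real)" "ln (2::real) \<le> 1" using ln_2_less_1 by auto
  have b0: "0 \<le> b" using ln_ceiling_nonneg by (simp add: b_def)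
  have c0: "0 \<le> c" using spins_pos by (simp add: c_def)
  have t0: "0 \<le> t" using T by (simp add: t_def)
  have a1: "1 \<le> a" if "2 \<le> card (verts G)" using that by (simp add: a_def)
  have AEbits: "AE \<omega> in randomness G. \<forall>(r, m)\<in>delivered G T Y0 adv \<omega>.
      real (bits m) \<le> ?K * (ln ?n + ln (of_int \<lceil>T\<rceil>) + ln (real (spins G)) + real (precision G T \<omega>))"
    unfolding randomness_eq
  proof (rule AE_completion, rule AE_mp[OF AE_good_tape], intro AE_I2 impI, clarify)
    fix \<omega> r x assume g: "good_tape \<omega>" and x: "(r, x) \<in> delivered G T Y0 adv \<omega>"
    let ?p = "real (precision G T \<omega>)"
    note D = delivered_bits[OF g adm x]
    have "?p * ln 2 \<le> ?p * 1" using ln2 by (intro mult_left_mono) auto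
    then have pp: "?p \<le> ?p / ln 2" using ln2 by (simp add: pos_le_divide_eq)
    have "real (bits x) \<le> 7 + 4 * ?p + 2 * b + c" using D(3) by (simp add: b_def c_def)
    \<comment> \<open>The additive 7 is absorbed by \<open>40 * a\<close>, as a delivered message
      implies \<open>1 \<le> a\<close>.\<close>
    also have "\<dots> \<le> 40 * (a + b + c + ?p / ln 2)" using a1[OF D(1)] b0 c0 pp by (simp add: distrib_left)
    also have "\<dots> \<le> (10 * d + 40) * (a + b + c + ?p / ln 2)"
      using a1[OF D(1)] b0 c0 assms ln2 by (intro mult_right_mono add_nonneg_nonneg divide_nonneg_pos) auto
    also have "\<dots> = ?K * (ln ?n + ln (of_int \<lceil>T\<rceil>) + ln (real (spins G)) + ?p)"
      by (simp add: a_def b_def c_def add_divide_distrib[symmetric])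
    finally show "real (bits x) \<le> ?K * (ln ?n + ln (of_int \<lceil>T\<rceil>) + ln (real (spins G)) + ?p)" .
  qed
  have whp: "with_high_prob (randomness G) (card (verts G)) d (\<lambda>\<omega>. terminates_within G T Y0 adv \<omega> (?K * (?\<Delta> * T + ln ?n))) \<and>
      (\<forall>C::real. C > 0 \<longrightarrow> filter_lipschitz G C \<longrightarrow> with_high_prob (randomness G) (card (verts G)) d
         (\<lambda>\<omega>. terminates_within G T Y0 adv \<omega> (?K * (1 + C) * (T + ln ?n)))) \<and>
      with_high_prob (randomness G) (card (verts G)) d (\<lambda>\<omega>. \<forall>(r, m)\<in>delivered G T Y0 adv \<omega>.
          real (bits m) \<le> ?K * (ln ?n + ln (of_int \<lceil>T\<rceil>) + ln (real (spins G))))"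
  proof (cases "2 \<le> card (verts G)")
    case False
    then have "card (verts G) = 1" using card_V by simp
    then show ?thesis by (simp only: with_high_prob_1 simp_thms)
  next
    case n: True
    note a1 = a1[OF n]
    have da: "0 \<le> d * a" using a1 assms by simp
    have time: "((1 + 4 * C) * T + (d + 3) * ln ?n) / ln 2 = (1 + 4 * C) * t + (d + 3) * a" for C
      by (simp add: t_def a_def add_divide_distrib)
    show ?thesis
    proof (intro conjI allI impI)
      show "with_high_prob (randomness G) (card (verts G)) d (\<lambda>\<omega>. terminates_within G T Y0 adv \<omega> (?K * (?\<Delta> * T + ln ?n)))"
      proof (rule time_bound[OF _ lipschitz_max_degree assms n adm])
        fix \<omega> assume g: "good_tape \<omega>"
        show "(((1 + 4 * ?\<Delta>) * T + (d + 3) * ln ?n) / ln 2) * time_unit G T Y0 adv \<omega> \<le>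
            ?K * (?\<Delta> * T + ln ?n) * time_unit G T Y0 adv \<omega>"
        proof (cases "max_degree G = 0")
          case True
          then show ?thesis using time_unit_no_edges[OF g adm] by simp
        next
          case False
          show ?thesis
          proof (rule mult_right_mono[OF _ time_unit_nonneg[OF g adm]])
            \<comment> \<open>With at least one edge, the summand \<open>t\<close> from the growth
              rate 1 is absorbed by \<open>?\<Delta> * t\<close>.\<close>
            have "1 * t \<le> ?\<Delta> * t" using False t0 by (intro mult_right_mono) auto
            then have "(1 + 4 * ?\<Delta>) * t + (d + 3) * a \<le> 40 * (?\<Delta> * t) + (10 * d + 40) * a"
              using t0 a1 da by (simp add: algebra_simps)
            also have "\<dots> \<le> (10 * d + 40) * (?\<Delta> * t) + (10 * d + 40) * a"
              using assms t0 by (intro add_right_mono mult_right_mono) auto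
            also have "\<dots> = ?K * (?\<Delta> * T + ln ?n)"
              by (simp add: t_def a_def add_divide_distrib[symmetric] algebra_simps)
            finally show "((1 + 4 * ?\<Delta>) * T + (d + 3) * ln ?n) / ln 2 \<le> ?K * (?\<Delta> * T + ln ?n)"
              unfolding time .
          qed
        qed
      qed simp
    next
      fix C :: real assume C: "0 < C" and lip: "filter_lipschitz G C"
      show "with_high_prob (randomness G) (card (verts G)) d (\<lambda>\<omega>. terminates_within G T Y0 adv \<omega> (?K * (1 + C) * (T + ln ?n)))"
      proof (rule time_bound[OF less_imp_le[OF C] lip assms n adm])
        fix \<omega> assume g: "good_tape \<omega>"
        show "(((1 + 4 * C) * T + (d + 3) * ln ?n) / ln 2) * time_unit G T Y0 adv \<omega> \<le>
            ?K * (1 + C) * (T + ln ?n) * time_unit G T Y0 adv \<omega>"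
        proof (rule mult_right_mono[OF _ time_unit_nonneg[OF g adm]])
          have "(1 + 4 * C) * t \<le> (40 * (1 + C)) * t" using C t0 by (intro mult_right_mono) auto
          also have "\<dots> \<le> ((10 * d + 40) * (1 + C)) * t" using C assms t0 by (intro mult_right_mono) auto
          finally have 1: "(1 + 4 * C) * t \<le> ((10 * d + 40) * (1 + C)) * t" .
          have "(10 * d + 40) * 1 \<le> (10 * d + 40) * (1 + C)" using C assms by (intro mult_left_mono) auto
          moreover have "d + 3 \<le> (10 * d + 40) * 1" using assms by simp
          ultimately have "d + 3 \<le> (10 * d + 40) * (1 + C)" by (rule order_trans[rotated])
          then have "(d + 3) * a \<le> ((10 * d + 40) * (1 + C)) * a" using a1 by (intro mult_right_mono) auto
          with 1 have "(1 + 4 * C) * t + (d + 3) * a \<le> ((10 * d + 40) * (1 + C)) * t + ((10 * d + 40) * (1 + C)) * a"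
            by (rule add_mono)
          also have "\<dots> = ?K * (1 + C) * (T + ln ?n)"
            by (simp add: t_def a_def add_divide_distrib[symmetric] algebra_simps)
          finally show "((1 + 4 * C) * T + (d + 3) * ln ?n) / ln 2 \<le> ?K * (1 + C) * (T + ln ?n)"
            unfolding time .
        qed
      qed
    next
      show "with_high_prob (randomness G) (card (verts G)) d (\<lambda>\<omega>. \<forall>(r, m)\<in>delivered G T Y0 adv \<omega>.
          real (bits m) \<le> ?K * (ln ?n + ln (of_int \<lceil>T\<rceil>) + ln (real (spins G))))"
      proof (rule with_high_prob_mono[OF precision_bound[OF assms n]], clarify)
        fix \<omega> r x assume g: "good_tape \<omega>"
          and p: "real (precision G T \<omega>) \<le> ((d + 3) * ln ?n + ln (of_int \<lceil>T\<rceil>)) / ln 2 + 1"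
          and x: "(r, x) \<in> delivered G T Y0 adv \<omega>"
        have p': "real (precision G T \<omega>) \<le> (d + 3) * a + b + 1" using p by (simp add: a_def b_def add_divide_distrib)
        have "real (bits x) \<le> 7 + 4 * real (precision G T \<omega>) + 2 * b + c"
          using delivered_bits(3)[OF g adm x] by (simp add: b_def c_def)
        also have "\<dots> \<le> 11 + 4 * ((d + 3) * a) + 6 * b + c" using p' by linarith
        also have "\<dots> \<le> (10 * d + 40) * a + 40 * (b + c)" using a1 b0 c0 da by (simp add: algebra_simps)
        also have "\<dots> \<le> (10 * d + 40) * a + (10 * d + 40) * (b + c)"
          using assms b0 c0 by (intro add_left_mono mult_right_mono) auto
        also have "\<dots> = ?K * (ln ?n + ln (of_int \<lceil>T\<rceil>) + ln (real (spins G)))"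
          by (simp add: a_def b_def c_def add_divide_distrib[symmetric] algebra_simps)
        finally show "real (bits x) \<le> ?K * (ln ?n + ln (of_int \<lceil>T\<rceil>) + ln (real (spins G)))" .
      qed
    qed
  qed
  show "let M = randomness G;
         n = card (verts G);
         \<Delta> = max_degree G;
         q = spins G;
         out = algorithm_output G T Y0 adv
     in
       ((AE \<omega> in M. terminates G T Y0 adv \<omega>) \<and>
        (AE \<omega> in M. out \<omega> \<in> colourings G (verts G)) \<and>
        out \<in> measurable M (count_space UNIV) \<and>
        distr M (count_space UNIV) out = distr M (count_space UNIV) (metropolis_chain G Y0 T)) \<and>
       (with_high_prob M n d (\<lambda>\<omega>.
          terminates_within G T Y0 adv \<omega> (?K * (real \<Delta> * T + ln (real n)))) \<and>
        (\<forall>C::real. C > 0 \<longrightarrow> filter_lipschitz G C \<longrightarrow>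
          with_high_prob M n d (\<lambda>\<omega>.
            terminates_within G T Y0 adv \<omega> (?K * (1 + C) * (T + ln (real n)))))) \<and>
       ((AE \<omega> in M. \<forall>(r, m)\<in>delivered G T Y0 adv \<omega>.
          real (bits m) \<le> ?K * (ln (real n) + ln (of_int \<lceil>T\<rceil>) + ln (real q) + real (precision G T \<omega>))) \<and>
        with_high_prob M n d (\<lambda>\<omega>. \<forall>(r, m)\<in>delivered G T Y0 adv \<omega>.
          real (bits m) \<le> ?K * (ln (real n) + ln (of_int \<lceil>T\<rceil>) + ln (real q))))"
    unfolding Let_def using correctness[OF adm] whp AEbits by (intro conjI) (elim conjE; assumption)+
qed

end
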